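(* Let $n=4$, let $a\in\mathbb{R}^4$ be a constant vector, and let $u_0\in L^1(\mathbb{R}^4)\cap L^\infty(\mathbb{R}^4)$ with $|x|^3u_0\in L^1(\mathbb{R}^4)$. Let $u$ be the solution of the initial-value problem \[ \partial_t u-\Delta u=a\cdot\nabla(u^2),\quad t>0,\ x\in\mathbb{R}^4,\qquad u(0,x)=u_0(x),\ x\in\mathbb{R}^4. \] Then, for every $1\le q\le\infty$, with $\gamma_q=2(1-\frac1q)$, \[ \begin{split} \biggl\| &u(t) - M_0 G(t) - M_1\cdot\nabla G(t) - \sum_{|\alpha| = 2} \frac{\nabla^\alpha G(t)}{\alpha!} \int_{\mathbb{R}^4} (-y)^\alpha u_0 (y)\, dy\\ &+ \nabla (a\cdot\nabla) G(t) \cdot \int_0^\infty \int_{\mathbb{R}^4} y\, u^2 (s,y)\, dy\,ds + \frac{M_0^2}{128\pi^2} \Delta (a\cdot\nabla) G(t) \log t \biggr\|_{L^q (\mathbb{R}^4)} = O(t^{-\gamma_q-\frac32}) \end{split} \] as $t\to+\infty$, where $M_0=\int_{\mathbb{R}^4}u_0(x)\,dx\in\mathbb{R}$ and $M_1=-\int_{\mathbb{R}^4}x\,u_0(x)\,dx+a\int_0^\infty\int_{\mathbb{R}^4}u^2(t,x)\,dx\,dt\in\mathbb{R}^4$.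
   Context: $G(t,x)=(4\pi t)^{-n/2}e^{-|x|^2/(4t)}$ is the $n$-dimensional heat kernel (here $n=4$), and $G(t)$ denotes the function $x\mapsto G(t,x)$; similarly $u(t)=u(t,\cdot)$. For a multi-index $\alpha=(\alpha_1,\dots,\alpha_n)$, $|\alpha|=\sum\alpha_j$, $\alpha!=\prod\alpha_j!$, $y^\alpha=\prod y_j^{\alpha_j}$, $\nabla^\alpha=\prod\partial_j^{\alpha_j}$. $a\cdot\nabla=\sum_j a_j\partial_j$. The solution $u$ is the global (mild) solution, i.e. $u(t)=G(t)*u_0+\int_0^t a\cdot\nabla G(t-s)*u^2(s)\,ds$. $f(t)=O(t^{-\mu})$ as $t\to+\infty$ means $t^{\mu}|f(t)|$ stays bounded for large $t$. *)

theory Defs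
  imports "HOL-Probability.Probability"
begin

definition heatG :: "real \<Rightarrow> real^4 \<Rightarrow> real" where
  "heatG t x = (4 * pi * t) powr (-2) * exp (- (norm x)\<^sup>2 / (4 * t))"

definition partial :: "4 \<Rightarrow> (real^4 \<Rightarrow> real) \<Rightarrow> real^4 \<Rightarrow> real" where
  "partial j f x = deriv (\<lambda>s. f (x + s *\<^sub>R axis j 1)) 0"

definition adot_grad :: "real^4 \<Rightarrow> (real^4 \<Rightarrow> real) \<Rightarrow> real^4 \<Rightarrow> real" where
  "adot_grad a f x = (\<Sum>j\<in>UNIV. a$j * partial j f x)"

definition laplace :: "(real^4 \<Rightarrow> real) \<Rightarrow> real^4 \<Rightarrow> real" where
  "laplace f x = (\<Sum>j\<in>UNIV. partial j (partial j f) x)"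

definition mpartial :: "(4 \<Rightarrow> nat) \<Rightarrow> (real^4 \<Rightarrow> real) \<Rightarrow> real^4 \<Rightarrow> real" where
  "mpartial \<alpha> f = ((partial 0 ^^ \<alpha> 0) ((partial 1 ^^ \<alpha> 1) ((partial 2 ^^ \<alpha> 2) ((partial 3 ^^ \<alpha> 3) f))))"

definition mabs :: "(4 \<Rightarrow> nat) \<Rightarrow> nat" where
  "mabs \<alpha> = (\<Sum>j\<in>UNIV. \<alpha> j)"

definition mfact :: "(4 \<Rightarrow> nat) \<Rightarrow> real" where
  "mfact \<alpha> = (\<Prod>j\<in>UNIV. fact (\<alpha> j))"

definition mpow :: "real^4 \<Rightarrow> (4 \<Rightarrow> nat) \<Rightarrow> real" where
  "mpow y \<alpha> = (\<Prod>j\<in>UNIV. (y$j) ^ (\<alpha> j))"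

definition Lq_norm :: "ereal \<Rightarrow> (real^4 \<Rightarrow> real) \<Rightarrow> ereal" where
  "Lq_norm q f =
     (if q = \<infinity> then esssup lborel (\<lambda>x. ereal \<bar>f x\<bar>)
      else (let I = (\<integral>\<^sup>+ x. ennreal (\<bar>f x\<bar> powr real_of_ereal q) \<partial>lborel)
            in if I = \<infinity> then \<infinity> else ereal (enn2real I powr (1 / real_of_ereal q))))"

definition gamma_q :: "ereal \<Rightarrow> real" where
  "gamma_q q = (if q = \<infinity> then 2 else 2 * (1 - 1 / real_of_ereal q))"

text \<open>u is a global mild solution: locally-in-time bounded in L^1 and L^infinity,
  jointly measurable, and satisfying Duhamel's formula
  u(t) = G(t) * u0 + int_0^t a.nabla G(t-s) * u^2(s) ds for every t > 0 (a.e. in x).\<close>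
definition mild_solution :: "real^4 \<Rightarrow> (real^4 \<Rightarrow> real) \<Rightarrow> (real \<Rightarrow> real^4 \<Rightarrow> real) \<Rightarrow> bool" where
  "mild_solution a u0 u \<longleftrightarrow>
     (\<lambda>p. u (fst p) (snd p)) \<in> borel_measurable (lborel \<Otimes>\<^sub>M lborel) \<and>
     (\<forall>T>0. \<exists>C. \<forall>t\<in>{0<..T}. integrable lborel (u t) \<and> (\<integral>x. \<bar>u t x\<bar> \<partial>lborel) \<le> C
                              \<and> (AE x in lborel. \<bar>u t x\<bar> \<le> C)) \<and>
     (\<forall>t>0. AE x in lborel.
        u t x = (\<integral>y. heatG t (x - y) * u0 y \<partial>lborel)
              + (LINT s:{0<..<t}|lborel. (\<integral>y. adot_grad a (heatG (t - s)) (x - y) * (u s y)^2 \<partial>lborel)))"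

end

theory Submission imports Defs begin

text \<open>Expanding \<open>G(t, x - y)\<close> in \<open>y\<close> in Duhamel's formula gives the terms containing \<open>u0\<close>.  On \<open>s < t/2\<close> the kernel
\<open>a \<cdot> \<nabla>G(t - s, x - y)\<close> is expanded parabolically, to second order in \<open>y\<close> and first order in \<open>s\<close>, against \<open>f = u\<^sup>2\<close>.
The mass and the first moment of \<open>f(s)\<close> are integrable in time, whereas \<open>s\<close> times the mass and the second
moments decay only like \<open>1/s\<close>, because \<open>f(s)\<close> is close to \<open>M0\<^sup>2 G(s)\<^sup>2\<close>; they produce the logarithm, with coefficients
\<open>- M0\<^sup>2/(64 \<pi>\<^sup>2)\<close> and \<open>M0\<^sup>2/(128 \<pi>\<^sup>2)\<close>.  The remainders are bounded in \<open>L\<^sup>1\<close> and \<open>L\<^sup>\<infinity>\<close>, which suffices by interpolation.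

This needs global bounds for data of arbitrary size.  The dissipation of the \<open>L\<^sup>2\<close> norm makes the gradient
small at some time, Hardy's inequality turns this into smallness in a scale-invariant weighted norm, and from that
time on the equation is a small perturbation of the heat equation, so mass, supremum and third moment behave
as for the heat flow.\<close>

text \<open>The map u(t,x) -> lambda u(lambda^2 t, lambda x) preserves the equation. The L^1 and L^2
  norms are not invariant under it, so boundedness of either says nothing about smallness. In
  dimension four the L^2 norm of the gradient is invariant, and so is the supremum over x0 of the
  integral of u^2/|x-x0|^2. A finite dissipation over a long time therefore makes an invariant
  quantity small at some time, whatever the size of the data.

  The solution itself is never differentiated. Gradients are taken only of
  \<open>heatS h (v t)\<close>, dissipation is the loss of the squared L^2 norm under
  \<open>heatS h\<close>, and the energy inequality is one for a time step h with error of order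
  h^(5/4). As 5/4 > 1, the errors of L/h steps together tend to zero with h.

  Regularising the Hardy weight by \<tau> and truncating the third moment serve to provide that
  finite bound.\<close>

abbreviation (input) integral_lborel :: "('a::euclidean_space \<Rightarrow> 'b::{banach, second_countable_topology}) \<Rightarrow> 'b" (binder "LI " 10)
 where "integral_lborel \<equiv> integral\<^sup>L lborel"

abbreviation (input) nn_integral_lborel :: "('a::euclidean_space \<Rightarrow> ennreal) \<Rightarrow> ennreal" (binder "NI " 10)
 where "nn_integral_lborel \<equiv> nn_integral lborel"

abbreviation (input) nT :: "real set \<Rightarrow> (real \<Rightarrow> real) \<Rightarrow> ennreal"
 where "nT A g \<equiv> \<integral>\<^sup>+s\<in>A. ennreal (g s) \<partial>lborel"

section \<open>The heat kernel and its derivatives\<close>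

lemma heatG_eq: "t > 0 \<Longrightarrow> heatG t x = exp (- (x \<bullet> x) / (4 * t)) / (4 * pi * t)\<^sup>2"
 unfolding heatG_def power2_norm_eq_inner by (simp add: powr_minus_divide)

lemma heatG_nonneg [simp]: "0 \<le> heatG t x"
 by (simp add: heatG_def)

lemma heatG_minus [simp]: "heatG t (- x) = heatG t x"
 by (simp add: heatG_def)

lemma borel_measurable_heatG [measurable (raw)]:
 assumes [measurable]: "f \<in> borel_measurable M" "g \<in> borel_measurable M"
 shows "(\<lambda>x. heatG (f x) (g x)) \<in> borel_measurable M"
 unfolding heatG_def by measurable

text \<open>One centred normal density of variance 2t per coordinate: the normalisation of the
  kernel becomes the one-dimensional Gaussian integral.\<close>

lemma heatG_eq_prod:
 assumes "t > 0"
 shows "heatG t x = (\<Prod>b\<in>Basis. normal_density 0 (sqrt (2 * t)) (x \<bullet> b))"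
proof -
 have "(\<Prod>b\<in>(Basis::(real^4) set). normal_density 0 (sqrt (2 * t)) (x \<bullet> b))
   = (1 / sqrt (4 * pi * t)) ^ 4 * exp (\<Sum>b\<in>Basis. - (x \<bullet> b)\<^sup>2 / (4 * t))"
  using assms by (simp add: normal_density_def prod_dividef prod.distrib exp_sum mult_ac power_divide)
 also have "(\<Sum>b\<in>Basis. - (x \<bullet> b)\<^sup>2 / (4 * t)) = - (x \<bullet> x) / (4 * t)"
  by (subst (2) euclidean_inner) (simp add: sum_negf sum_divide_distrib power2_eq_square)
 also have "(1 / sqrt (4 * pi * t)) ^ 4 = 1 / (4 * pi * t)\<^sup>2"
 proof -
  have "sqrt (4 * pi * t) ^ 4 = ((sqrt (4 * pi * t))\<^sup>2)\<^sup>2" by (simp flip: power_mult)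
  then show ?thesis using assms by (simp add: power_divide)
 qed
 finally show ?thesis using assms by (simp add: heatG_eq)
qed

lemma nn_integral_heatG:
 assumes t: "t > 0"
 shows "(NI x. heatG t x) = 1"
proof -
 have s: "sqrt (2 * t) > 0" using t by simp
 have 1: "(NI x. ennreal (normal_density 0 (sqrt (2 * t)) x)) = 1"
  using integral_normal_density[OF s, of 0] integrable_normal_density[OF s, of 0]
  by (subst nn_integral_eq_integral) auto
 have "(NI x. heatG t x)
   = (\<integral>\<^sup>+x. (\<Prod>b\<in>Basis. ennreal (normal_density 0 (sqrt (2 * t)) (x \<bullet> b))) \<partial>(lborel :: (real^4) measure))"
  unfolding heatG_eq_prod[OF t] by (subst prod_ennreal) auto
 also have "\<dots> = (\<Prod>b\<in>(Basis :: (real^4) set). 1)"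
  by (subst nn_integral_lborel_prod) (simp_all only: 1, auto)
 finally show ?thesis by simp
qed

lemma integrable_heatG [simp]: "t > 0 \<Longrightarrow> integrable lborel (heatG t)"
 by (rule integrableI_nonneg) (auto simp: nn_integral_heatG)

lemma integral_heatG [simp]: "t > 0 \<Longrightarrow> (LI x. heatG t x) = 1"
 by (subst integral_eq_nn_integral) (auto simp: nn_integral_heatG)

section \<open>Reflection and translation invariance of Lebesgue measure\<close>

lemma lborel_distr_reflect: "distr lborel borel (\<lambda>x. c - x) = (lborel :: (real^4) measure)"
 using lborel_affine[of "-1" c] by (simp add: density_1)

lemma nn_integral_reflect:
 fixes f :: "real^4 \<Rightarrow> ennreal"
 assumes [measurable]: "f \<in> borel_measurable borel"
 shows "(NI x. f (c - x)) = (NI x. f x)"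
 by (subst (2) lborel_distr_reflect[symmetric, of c]) (simp add: nn_integral_distr)

lemma nn_integral_shift:
 fixes f :: "real^4 \<Rightarrow> ennreal"
 assumes [measurable]: "f \<in> borel_measurable borel"
 shows "(NI x. f (x + c)) = (NI x. f x)"
 by (subst (2) lborel_distr_plus[symmetric, of c]) (simp add: nn_integral_distr add.commute)

lemma nn_integral_shift_minus:
 fixes f :: "real^4 \<Rightarrow> ennreal"
 assumes "f \<in> borel_measurable borel"
 shows "(NI x. f (x - c)) = (NI x. f x)"
 using nn_integral_shift[OF assms, of "- c"] by simp

lemma integral_reflect:
 fixes f :: "real^4 \<Rightarrow> real"
 assumes [measurable]: "f \<in> borel_measurable borel"
 shows "(LI x. f (c - x)) = (LI x. f x)"
 by (subst (2) lborel_distr_reflect[symmetric, of c]) (simp add: integral_distr)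

lemma integral_shift:
 fixes f :: "real^4 \<Rightarrow> real"
 assumes [measurable]: "f \<in> borel_measurable borel"
 shows "(LI x. f (x + c)) = (LI x. f x)"
 by (subst (2) lborel_distr_plus[symmetric, of c]) (simp add: integral_distr add.commute)

lemma integrable_shift:
 fixes f :: "real^4 \<Rightarrow> real"
 assumes [measurable]: "integrable lborel f"
 shows "integrable lborel (\<lambda>x. f (x + c))"
proof -
 have "integrable (distr lborel borel ((+) c)) f" using assms by (simp add: lborel_distr_plus)
 then show ?thesis by (subst (asm) integrable_distr_eq) (auto simp: add.commute)
qed

lemma integrable_reflect:
 fixes f :: "real^4 \<Rightarrow> real"
 assumes [measurable]: "integrable lborel f"
 shows "integrable lborel (\<lambda>x. f (c - x))"
proof -
 have "integrable (distr lborel borel (\<lambda>x. c - x)) f" using assms by (simp add: lborel_distr_reflect)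
 then show ?thesis by (subst (asm) integrable_distr_eq) auto
qed

text \<open>The constant comes from \<open>z ^ k \<le> k! exp z\<close> and \<open>z - z\<^sup>2 / 8 \<le> 2\<close>.\<close>

definition mc :: "nat \<Rightarrow> real" where "mc k = 4 * fact k * exp 2"

lemma mc_mono: "k \<le> l \<Longrightarrow> mc k \<le> mc l"
 by (simp add: mc_def fact_mono)

lemma mc_pos [simp]: "0 < mc k"
 by (simp add: mc_def)

text \<open>With z = |x|/sqrt t the exponential is the square of exp(-z^2/8). One factor absorbs
  z^k, the other is \<open>heatG (2 * t)\<close> up to its prefactor, which is the source of the 4
  in \<open>mc\<close>. Later kernel bounds carry \<open>heatG (2 * t)\<close> on the right for this
  reason.\<close>

lemma heatG_moment:
 assumes "t > 0"
 shows "norm x ^ k * heatG t x \<le> mc k * sqrt t ^ k * heatG (2 * t) x"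
proof -
 define z where "z = norm x / sqrt t"
 have z: "z \<ge> 0" "norm x = sqrt t * z" using assms by (auto simp: z_def)
 have xx: "x \<bullet> x / t = z\<^sup>2"
  using assms unfolding z_def power_divide by (simp add: dot_square_norm)
 then have xz: "x \<bullet> x = z\<^sup>2 * t" using assms by (simp add: field_simps)
 have "z ^ k / fact k \<le> exp z"
  unfolding exp_def using summable_exp[of z] z
  by (intro order_trans[OF _ sum_le_suminf[of "\<lambda>n. z ^ n /\<^sub>R fact n" "{k}"]])
    (auto simp: divide_inverse mult.commute)
 then have "z ^ k \<le> fact k * exp z" by (simp add: field_simps)
 moreover have "exp z * exp (- (z\<^sup>2 / 8)) \<le> exp 2"
 proof -
  have "0 \<le> (z - 4)\<^sup>2" by simp
  then have "z - z\<^sup>2 / 8 \<le> 2" by (simp add: power2_eq_square algebra_simps)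
  then show ?thesis by (simp flip: exp_add)
 qed
 ultimately have "z ^ k * exp (- (z\<^sup>2 / 8)) \<le> fact k * (exp z * exp (- (z\<^sup>2 / 8)))"
  "fact k * (exp z * exp (- (z\<^sup>2 / 8))) \<le> fact k * exp 2"
  by (auto simp flip: mult.assoc intro: mult_left_mono)
 then have "z ^ k * exp (- (z\<^sup>2 / 8)) \<le> fact k * exp 2" by (rule order_trans)
 then have "z ^ k * exp (- (z\<^sup>2 / 8)) * exp (- (z\<^sup>2 / 8)) \<le> fact k * exp 2 * exp (- (z\<^sup>2 / 8))"
  by (intro mult_right_mono) auto
 then have *: "z ^ k * exp (- (z\<^sup>2 / 4)) \<le> fact k * exp 2 * exp (- (z\<^sup>2 / 8))"
  by (simp add: mult.assoc flip: exp_add)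
 have g: "heatG t x = exp (- (z\<^sup>2 / 4)) / (4 * pi * t)\<^sup>2"
  "heatG (2 * t) x = exp (- (z\<^sup>2 / 8)) / (4 * (4 * pi * t)\<^sup>2)"
  using assms xz by (simp_all add: heatG_eq power_mult_distrib)
 have "norm x ^ k * heatG t x = sqrt t ^ k / (4 * pi * t)\<^sup>2 * (z ^ k * exp (- (z\<^sup>2 / 4)))"
  by (simp add: g z(2) power_mult_distrib)
 also have "\<dots> \<le> sqrt t ^ k / (4 * pi * t)\<^sup>2 * (fact k * exp 2 * exp (- (z\<^sup>2 / 8)))"
  using assms by (intro mult_left_mono *) auto
 also have "\<dots> = mc k * sqrt t ^ k * heatG (2 * t) x"
  by (simp add: g mc_def)
 finally show ?thesis .
qed

lemma heatG_le: "t > 0 \<Longrightarrow> heatG t x \<le> 1 / t\<^sup>2"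
proof -
 assume t: "t > 0"
 have "exp (- (x \<bullet> x) / (4 * t)) \<le> 1" using t by simp
 moreover have "t\<^sup>2 \<le> (4 * pi * t)\<^sup>2" using t pi_gt3 by (intro power_mono) auto
 ultimately show ?thesis using t by (simp add: heatG_eq frac_le)
qed

text \<open>The exponential increases with time and the prefactor changes by at most 2^(n/2) = 4, so
  one fixed Gaussian dominates all kernels with time between t/2 and t.\<close>

lemma heatG_half_le:
 assumes "0 < t" "t / 2 \<le> \<tau>" "\<tau> \<le> t"
 shows "heatG (2 * \<tau>) x \<le> 4 * heatG (2 * t) x"
proof -
 have "(x \<bullet> x) / (4 * (2 * t)) \<le> (x \<bullet> x) / (4 * (2 * \<tau>))"
  using assms by (intro divide_left_mono) auto
 then have e: "exp (- (x \<bullet> x) / (4 * (2 * \<tau>))) \<le> exp (- (x \<bullet> x) / (4 * (2 * t)))"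
  by simp
 have "(4 * pi * t)\<^sup>2 \<le> (4 * pi * (2 * \<tau>))\<^sup>2"
  using assms by (intro power_mono mult_left_mono) auto
 from frac_le[OF _ e _ this] have "exp (- (x \<bullet> x) / (4 * (2 * \<tau>))) / (4 * pi * (2 * \<tau>))\<^sup>2
  \<le> exp (- (x \<bullet> x) / (4 * (2 * t))) / (4 * pi * t)\<^sup>2"
  using assms by simp
 then show ?thesis using assms by (simp add: heatG_eq power_mult_distrib)
qed

text \<open>\<open>gK\<close>, \<open>hG\<close> and \<open>tG\<close> are the first, second and third directional derivatives of \<^const>\<open>heatG\<close>, \<open>qG a y\<close> is the
derivative of \<open>tG a y y\<close> in direction \<open>y\<close>, and \<open>lK a\<close> is the Laplacian of \<open>gK a\<close>, hence also its time derivative.\<close>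

definition gK :: "real^4 \<Rightarrow> real \<Rightarrow> real^4 \<Rightarrow> real" where
 "gK b t x = - (b \<bullet> x) / (2 * t) * heatG t x"

definition hG :: "real^4 \<Rightarrow> real^4 \<Rightarrow> real \<Rightarrow> real^4 \<Rightarrow> real" where
 "hG b c t x = ((b \<bullet> x) * (c \<bullet> x) / (4 * t\<^sup>2) - (b \<bullet> c) / (2 * t)) * heatG t x"

definition tG :: "real^4 \<Rightarrow> real^4 \<Rightarrow> real^4 \<Rightarrow> real \<Rightarrow> real^4 \<Rightarrow> real" where
 "tG b c d t x = (((b \<bullet> d) * (c \<bullet> x) + (b \<bullet> x) * (c \<bullet> d) + (b \<bullet> c) * (d \<bullet> x)) / (4 * t\<^sup>2)
   - (b \<bullet> x) * (c \<bullet> x) * (d \<bullet> x) / (8 * t ^ 3)) * heatG t x"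

definition qG :: "real^4 \<Rightarrow> real^4 \<Rightarrow> real \<Rightarrow> real^4 \<Rightarrow> real" where
 "qG a y t x = ((a \<bullet> x) * (y \<bullet> x) ^ 3 / (16 * t ^ 4) - 3 * (a \<bullet> y) * (y \<bullet> x)\<^sup>2 / (8 * t ^ 3)
   - 3 * (a \<bullet> x) * (y \<bullet> x) * (y \<bullet> y) / (8 * t ^ 3) + 3 * (a \<bullet> y) * (y \<bullet> y) / (4 * t\<^sup>2)) * heatG t x"

definition lK :: "real^4 \<Rightarrow> real \<Rightarrow> real^4 \<Rightarrow> real" where
 "lK a t x = - (a \<bullet> x) / (2 * t) * ((x \<bullet> x) / (4 * t\<^sup>2) - 3 / t) * heatG t x"

lemma borel_measurable_gK [measurable (raw)]:
 assumes [measurable]: "f \<in> borel_measurable M" "g \<in> borel_measurable M"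
 shows "(\<lambda>x. gK b (f x) (g x)) \<in> borel_measurable M"
 unfolding gK_def by measurable

lemma borel_measurable_hG [measurable (raw)]:
 assumes [measurable]: "f \<in> borel_measurable M" "g \<in> borel_measurable M" "c \<in> borel_measurable M"
 shows "(\<lambda>x. hG b (c x) (f x) (g x)) \<in> borel_measurable M"
 unfolding hG_def by measurable

lemma borel_measurable_tG [measurable (raw)]:
 assumes [measurable]: "f \<in> borel_measurable M" "g \<in> borel_measurable M" "c \<in> borel_measurable M" "d \<in> borel_measurable M"
 shows "(\<lambda>x. tG b (c x) (d x) (f x) (g x)) \<in> borel_measurable M"
 unfolding tG_def by measurable

lemma borel_measurable_lK [measurable (raw)]:
 assumes [measurable]: "f \<in> borel_measurable M" "g \<in> borel_measurable M"
 shows "(\<lambda>x. lK b (f x) (g x)) \<in> borel_measurable M"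
 unfolding lK_def by measurable

lemma gK_minus [simp]: "gK b t (- x) = - gK b t x"
 by (simp add: gK_def)

lemma power5_eq: "(t::real) ^ 5 = t * t * t * t * t"
 by (simp add: eval_nat_numeral)

text \<open>Written with \<open>inverse t\<close>, the identities between kernel coefficients are
  polynomial and need no cancellation of t against its inverse, so no side condition t \<noteq> 0
  arises.\<close>

lemmas ring_inv = divide_inverse power2_eq_square power3_eq_cube power4_eq_xxxx power5_eq algebra_simps inverse_mult_distrib

lemma DERIV_inner_line: "((\<lambda>\<theta>. b \<bullet> (x + \<theta> *\<^sub>R d)) has_real_derivative b \<bullet> d) (at \<theta>)"
 unfolding inner_add_right inner_scaleR_right
 by (auto intro!: derivative_eq_intros)

lemma DERIV_heatG_line:
 assumes "t > 0"
 shows "((\<lambda>\<theta>. heatG t (x + \<theta> *\<^sub>R d)) has_real_derivative gK d t (x + \<theta> *\<^sub>R d)) (at \<theta>)"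
proof -
 have *: "((\<lambda>\<theta>. - ((x + \<theta> *\<^sub>R d) \<bullet> (x + \<theta> *\<^sub>R d)) / (4 * t)) has_real_derivative
   - (2 * (d \<bullet> (x + \<theta> *\<^sub>R d))) / (4 * t)) (at \<theta>)"
 proof -
  have "(\<lambda>\<theta>. (x + \<theta> *\<^sub>R d) \<bullet> (x + \<theta> *\<^sub>R d)) = (\<lambda>\<theta>. x \<bullet> x + 2 * \<theta> * (d \<bullet> x) + \<theta>\<^sup>2 * (d \<bullet> d))"
   by (auto simp: algebra_simps inner_commute power2_eq_square)
  moreover have "((\<lambda>\<theta>. x \<bullet> x + 2 * \<theta> * (d \<bullet> x) + \<theta>\<^sup>2 * (d \<bullet> d)) has_real_derivative 2 * (d \<bullet> (x + \<theta> *\<^sub>R d))) (at \<theta>)"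
   by (auto intro!: derivative_eq_intros simp: algebra_simps)
  ultimately show ?thesis by (intro DERIV_cdivide DERIV_minus) auto
 qed
 have "((\<lambda>\<theta>. exp (- ((x + \<theta> *\<^sub>R d) \<bullet> (x + \<theta> *\<^sub>R d)) / (4 * t)) / (4 * pi * t)\<^sup>2) has_real_derivative
   exp (- ((x + \<theta> *\<^sub>R d) \<bullet> (x + \<theta> *\<^sub>R d)) / (4 * t)) * (- (2 * (d \<bullet> (x + \<theta> *\<^sub>R d))) / (4 * t)) / (4 * pi * t)\<^sup>2) (at \<theta>)"
  by (rule DERIV_cdivide DERIV_fun_exp *)+
 then show ?thesis
  by (simp add: gK_def heatG_eq[OF assms] mult.commute)
qed

lemma DERIV_gK_line:
 assumes "t > 0"
 shows "((\<lambda>\<theta>. gK b t (x + \<theta> *\<^sub>R d)) has_real_derivative hG b d t (x + \<theta> *\<^sub>R d)) (at \<theta>)"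
proof -
 have ring: "- c / (2 * t) * g + (- Y / (2 * t) * g) * (- X / (2 * t)) = (X * Y / (4 * t\<^sup>2) - c / (2 * t)) * g" for X Y c g :: real
  by (simp only: ring_inv) simp
 show ?thesis
  unfolding gK_def[of b] hG_def
  by (rule DERIV_cong[OF DERIV_mult[OF DERIV_cdivide[OF DERIV_minus[OF DERIV_inner_line]] DERIV_heatG_line[OF assms]]])
    (unfold gK_def, rule ring)
qed

lemma DERIV_hG_line:
 assumes "t > 0"
 shows "((\<lambda>\<theta>. hG b c t (x + \<theta> *\<^sub>R d)) has_real_derivative tG b c d t (x + \<theta> *\<^sub>R d)) (at \<theta>)"
proof -
 have ring: "((bd * C + cd * B) / (4 * t\<^sup>2) - 0) * g + (- D / (2 * t) * g) * (B * C / (4 * t\<^sup>2) - bc / (2 * t))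
  = ((bd * C + B * cd + bc * D) / (4 * t\<^sup>2) - B * C * D / (8 * t ^ 3)) * g" for B C D bc cd bd g :: real
  by (simp only: ring_inv) simp
 show ?thesis
  unfolding hG_def tG_def
  by (rule DERIV_cong[OF DERIV_mult[OF DERIV_diff[OF DERIV_cdivide[OF DERIV_mult[OF DERIV_inner_line DERIV_inner_line]] DERIV_const] DERIV_heatG_line[OF assms]]])
    (unfold gK_def, rule ring)
qed

lemma DERIV_tG_line:
 assumes "t > 0"
 shows "((\<lambda>\<theta>. tG a y y t (x + \<theta> *\<^sub>R y)) has_real_derivative qG a y t (x + \<theta> *\<^sub>R y)) (at \<theta>)"
proof -
 have ring: "((0 * Y + m * ay + (ay * m + 0 * X) + (0 * Y + m * ay)) / (4 * t\<^sup>2) - ((ay * Y + m * X) * Y + m * (X * Y)) / (8 * t ^ 3)) * g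
   + (- Y / (2 * t) * g) * ((ay * Y + X * m + ay * Y) / (4 * t\<^sup>2) - X * Y * Y / (8 * t ^ 3))
  = (X * Y ^ 3 / (16 * t ^ 4) - 3 * ay * Y\<^sup>2 / (8 * t ^ 3)
   - 3 * X * Y * m / (8 * t ^ 3) + 3 * ay * m / (4 * t\<^sup>2)) * g" for X Y ay m g :: real
  by (simp only: ring_inv) simp
 show ?thesis
  unfolding tG_def qG_def
  by (rule DERIV_cong[OF DERIV_mult[OF DERIV_diff[OF DERIV_cdivide[OF DERIV_add[OF DERIV_add[OF DERIV_mult[OF DERIV_const DERIV_inner_line] DERIV_mult[OF DERIV_inner_line DERIV_const]] DERIV_mult[OF DERIV_const DERIV_inner_line]]]
    DERIV_cdivide[OF DERIV_mult[OF DERIV_mult[OF DERIV_inner_line DERIV_inner_line] DERIV_inner_line]]] DERIV_heatG_line[OF assms]]])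
    (unfold gK_def, rule ring)
qed

lemma DERIV_heatG_time:
 assumes "t > 0"
 shows "((\<lambda>t. heatG t x) has_real_derivative ((x \<bullet> x) / (4 * t\<^sup>2) - 2 / t) * heatG t x) (at t)"
proof -
 define r where "r = x \<bullet> x"
 have "((\<lambda>t. - r / (4 * t)) has_real_derivative r / (4 * t\<^sup>2)) (at t)"
  using assms by (auto intro!: derivative_eq_intros simp: power2_eq_square)
 moreover have "((\<lambda>t. 1 / (4 * pi * t)\<^sup>2) has_real_derivative - 2 / t / (4 * pi * t)\<^sup>2) (at t)"
  using assms by (auto intro!: derivative_eq_intros simp: power2_eq_square divide_simps)
 ultimately have "((\<lambda>t. exp (- r / (4 * t)) * (1 / (4 * pi * t)\<^sup>2)) has_real_derivative
   exp (- r / (4 * t)) * (r / (4 * t\<^sup>2)) * (1 / (4 * pi * t)\<^sup>2) + - 2 / t / (4 * pi * t)\<^sup>2 * exp (- r / (4 * t))) (at t)"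
  by (intro DERIV_mult DERIV_fun_exp)
 moreover have "e * (r / (4 * t\<^sup>2)) * (1 / p) + - 2 / t / p * e = (r / (4 * t\<^sup>2) - 2 / t) * (e / p)" for e p
  by (simp only: ring_inv)
 ultimately have "((\<lambda>t. exp (- r / (4 * t)) * (1 / (4 * pi * t)\<^sup>2)) has_real_derivative
   (r / (4 * t\<^sup>2) - 2 / t) * heatG t x) (at t)"
  unfolding heatG_eq[OF assms] r_def by (simp only:)
 then show ?thesis
  unfolding r_def
  by (rule has_field_derivative_transform_within_open[where S = "{0<..}"]) (use assms in \<open>auto simp: heatG_eq\<close>)
qed

text \<open>The time derivatives of \<^const>\<open>lK\<close>, \<^const>\<open>hG\<close> and \<^const>\<open>tG\<close>.\<close>

definition llK :: "real^4 \<Rightarrow> real \<Rightarrow> real^4 \<Rightarrow> real" where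
 "llK a t x = - (a \<bullet> x) * ((x \<bullet> x)\<^sup>2 / (32 * t ^ 5) - (x \<bullet> x) / t ^ 4 + 6 / t ^ 3) * heatG t x"

definition lhG :: "real^4 \<Rightarrow> real^4 \<Rightarrow> real \<Rightarrow> real^4 \<Rightarrow> real" where
 "lhG b c t x = ((b \<bullet> x) * (c \<bullet> x) * (x \<bullet> x) / (16 * t ^ 4) - (b \<bullet> x) * (c \<bullet> x) / t ^ 3
   - (b \<bullet> c) * (x \<bullet> x) / (8 * t ^ 3) + 3 * (b \<bullet> c) / (2 * t\<^sup>2)) * heatG t x"

definition ltG :: "real^4 \<Rightarrow> real^4 \<Rightarrow> real \<Rightarrow> real^4 \<Rightarrow> real" where
 "ltG a y t x = ((2 * (a \<bullet> y) * (y \<bullet> x) + (a \<bullet> x) * (y \<bullet> y)) * ((x \<bullet> x) / (16 * t ^ 4) - 1 / t ^ 3)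
   - (a \<bullet> x) * (y \<bullet> x)\<^sup>2 * ((x \<bullet> x) / (32 * t ^ 5) - 5 / (8 * t ^ 4))) * heatG t x"

text \<open>Every kernel here is a function of t times \<open>heatG t x\<close>. Leaving the
  derivative \<open>h\<close> free separates the calculus from the algebra: each use reduces to an
  identity settled by \<open>ring_inv\<close>.\<close>

lemma DERIV_times_heatG_time:
 assumes "t > 0" "(f has_real_derivative f') (at t)"
  "f' * g + ((x \<bullet> x) / (4 * t\<^sup>2) - 2 / t) * g * f t = h"  "g = heatG t x"
 shows "((\<lambda>t. f t * heatG t x) has_real_derivative h) (at t)"
 using DERIV_mult[OF assms(2) DERIV_heatG_time[OF assms(1)], of x] assms(3,4) by simp

lemma DERIV_gK_time:
 assumes "t > 0"
 shows "((\<lambda>t. gK a t x) has_real_derivative lK a t x) (at t)"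
proof -
 have ring: "A / (2 * t\<^sup>2) * g + (r / (4 * t\<^sup>2) - 2 / t) * g * (- A / (2 * t)) = - A / (2 * t) * (r / (4 * t\<^sup>2) - 3 / t) * g" for A r g
  by (simp only: ring_inv) simp
 have "((\<lambda>t. - A / (2 * t)) has_real_derivative A / (2 * t\<^sup>2)) (at t)" for A
  using assms by (auto intro!: derivative_eq_intros simp: power2_eq_square)
 from DERIV_times_heatG_time[OF assms this ring refl] show ?thesis
  unfolding gK_def lK_def .
qed

lemma DERIV_lK_time:
 assumes "t > 0"
 shows "((\<lambda>t. lK a t x) has_real_derivative llK a t x) (at t)"
proof -
 have ring: "- A * (- (3 * r) / (8 * t ^ 4) + 3 / t ^ 3) * g + (r / (4 * t\<^sup>2) - 2 / t) * g * (- A / (2 * t) * (r / (4 * t\<^sup>2) - 3 / t))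
   = - A * (r\<^sup>2 / (32 * t ^ 5) - r / t ^ 4 + 6 / t ^ 3) * g" for A r g
  by (simp only: ring_inv) simp
 have "((\<lambda>t. - A / (2 * t) * (r / (4 * t\<^sup>2) - 3 / t)) has_real_derivative
   - A * (- (3 * r) / (8 * t ^ 4) + 3 / t ^ 3)) (at t)" for A r
  using assms by (auto intro!: derivative_eq_intros simp: field_simps power2_eq_square power3_eq_cube power4_eq_xxxx)
 from DERIV_times_heatG_time[OF assms this ring refl] show ?thesis
  unfolding llK_def lK_def .
qed

lemma DERIV_hG_time:
 assumes "t > 0"
 shows "((\<lambda>t. hG b c t x) has_real_derivative lhG b c t x) (at t)"
proof -
 have ring: "(- A / (2 * t ^ 3) + B / (2 * t\<^sup>2)) * g + (r / (4 * t\<^sup>2) - 2 / t) * g * (A / (4 * t\<^sup>2) - B / (2 * t))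
   = (A * r / (16 * t ^ 4) - A / t ^ 3 - B * r / (8 * t ^ 3) + 3 * B / (2 * t\<^sup>2)) * g" for A B r g
  by (simp only: ring_inv) simp
 have "((\<lambda>t. A / (4 * t\<^sup>2) - B / (2 * t)) has_real_derivative (- A / (2 * t ^ 3) + B / (2 * t\<^sup>2))) (at t)" for A B
  using assms by (auto intro!: derivative_eq_intros simp: field_simps power2_eq_square power3_eq_cube)
 from DERIV_times_heatG_time[OF assms this ring refl] show ?thesis
  unfolding hG_def lhG_def .
qed

lemma DERIV_tG_time:
 assumes "t > 0"
 shows "((\<lambda>t. tG a y y t x) has_real_derivative ltG a y t x) (at t)"
proof -
 have ring: "(- A / (2 * t ^ 3) + 3 * B / (8 * t ^ 4)) * g + (r / (4 * t\<^sup>2) - 2 / t) * g * (A / (4 * t\<^sup>2) - B / (8 * t ^ 3))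
   = (A * (r / (16 * t ^ 4) - 1 / t ^ 3) - B * (r / (32 * t ^ 5) - 5 / (8 * t ^ 4))) * g" for A B r g
  by (simp only: ring_inv) simp
 have "((\<lambda>t. A / (4 * t\<^sup>2) - B / (8 * t ^ 3)) has_real_derivative (- A / (2 * t ^ 3) + 3 * B / (8 * t ^ 4))) (at t)" for A B
  using assms by (auto intro!: derivative_eq_intros simp: field_simps power2_eq_square power3_eq_cube power4_eq_xxxx)
 from DERIV_times_heatG_time[OF assms this ring refl]
 have "((\<lambda>t. ((2 * (a \<bullet> y) * (y \<bullet> x) + (a \<bullet> x) * (y \<bullet> y)) / (4 * t\<^sup>2) - (a \<bullet> x) * (y \<bullet> x)\<^sup>2 / (8 * t ^ 3)) * heatG t x) has_real_derivative ltG a y t x) (at t)"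
  unfolding ltG_def .
 then show ?thesis
  unfolding tG_def by (simp add: power2_eq_square mult.assoc)
qed

section \<open>Pointwise Gaussian bounds on the kernels\<close>

definition kc :: real where "kc = 10 * mc 6"

lemma kc_pos [simp]: "0 < kc"
 by (simp add: kc_def)

lemma abs_inner_le: "\<bar>b \<bullet> x\<bar> \<le> norm b * norm x"
 by (rule Cauchy_Schwarz_ineq2)

text \<open>Parabolic homogeneity: a monomial of degree k in x gains t^(k/2) by
  \<open>heatG_moment\<close>, so that 2m = k + j leaves t^(-j/2). Thus j is the parabolic order of
  the kernel and is the same for all its summands.\<close>

lemma term_base:
 assumes "t > 0" "\<bar>p\<bar> \<le> B * norm x ^ k" "k \<le> 6" "2 * m = k + j" "0 \<le> B"
 shows "\<bar>p / t ^ m\<bar> * heatG t x \<le> mc 6 * B / sqrt t ^ j * heatG (2 * t) x"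
proof -
 have t: "t ^ m = sqrt t ^ k * sqrt t ^ j"
 proof -
  have "t ^ m = (sqrt t ^ 2) ^ m" using assms(1) by simp
  also have "\<dots> = sqrt t ^ k * sqrt t ^ j" by (simp only: assms(4) flip: power_mult power_add)
  finally show ?thesis .
 qed
 have tm: "t ^ m > 0" "sqrt t ^ k > 0" "sqrt t ^ j > 0" using assms(1) by auto
 have "\<bar>p / t ^ m\<bar> * heatG t x = \<bar>p\<bar> * heatG t x / t ^ m" using tm by (simp add: abs_divide)
 also have "\<dots> \<le> B * norm x ^ k * heatG t x / t ^ m"
  using tm assms by (intro divide_right_mono mult_right_mono) auto
 also have "\<dots> = B * (norm x ^ k * heatG t x) / t ^ m" by simp
 also have "\<dots> \<le> B * (mc k * sqrt t ^ k * heatG (2 * t) x) / t ^ m"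
  using tm assms by (intro divide_right_mono mult_left_mono heatG_moment) auto
 also have "\<dots> \<le> B * (mc 6 * sqrt t ^ k * heatG (2 * t) x) / t ^ m"
  using tm assms by (intro divide_right_mono mult_left_mono mult_right_mono mc_mono) auto
 also have "\<dots> = mc 6 * B / sqrt t ^ j * heatG (2 * t) x"
  using assms(1) unfolding t by simp
 finally show ?thesis .
qed

lemma term_add:
 assumes "\<bar>e\<bar> * G \<le> mc 6 * B / Q * H" "\<bar>e'\<bar> * G \<le> mc 6 * B' / Q * H" "0 \<le> G"
 shows "\<bar>e + e'\<bar> * G \<le> mc 6 * (B + B') / Q * H"
proof -
 have "\<bar>e + e'\<bar> * G \<le> \<bar>e\<bar> * G + \<bar>e'\<bar> * G"
  using assms(3) by (metis abs_triangle_ineq distrib_right mult_right_mono)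
 with assms show ?thesis by (simp add: add_divide_distrib distrib_left distrib_right)
qed

lemma term_diff:
 assumes "\<bar>e\<bar> * G \<le> mc 6 * B / Q * H" "\<bar>e'\<bar> * G \<le> mc 6 * B' / Q * H" "0 \<le> G"
 shows "\<bar>e - e'\<bar> * G \<le> mc 6 * (B + B') / Q * H"
 using term_add[of e G B Q H "- e'" B'] assms by simp

text \<open>Origin of \<open>kc\<close>: \<open>mc 6\<close> covers every power of |x| that occurs,
  and 10 exceeds the sum of the numerical coefficients of each kernel, the largest being about 7,
  for \<open>llK\<close>.\<close>

lemma term_final:
 assumes "\<bar>e\<bar> * G \<le> mc 6 * B / Q * H" "B \<le> 10 * B'" "0 \<le> G" "0 \<le> H" "0 < Q"
 shows "\<bar>e * G\<bar> \<le> kc * B' / Q * H"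
proof -
 have "mc 6 * B / Q * H \<le> mc 6 * (10 * B') / Q * H"
  using assms by (intro mult_right_mono divide_right_mono mult_left_mono) (auto simp: less_imp_le)
 with assms show ?thesis by (simp add: abs_mult kc_def mult_ac)
qed

lemma gK_bound:
 assumes t: "t > 0"
 shows "\<bar>gK b t x\<bar> \<le> kc * norm b / sqrt t * heatG (2 * t) x"
proof -
 have "\<bar>- (b \<bullet> x) / 2\<bar> \<le> norm b / 2 * norm x ^ 1"
  using abs_inner_le[of b x] by simp
 from term_base[OF t this, of 1 1]
 have "\<bar>(- (b \<bullet> x) / 2) / t ^ 1\<bar> * heatG t x \<le> mc 6 * (norm b / 2) / sqrt t ^ 1 * heatG (2 * t) x" by simp
 from term_final[OF this, of "norm b"] show ?thesis
  using t by (simp add: gK_def)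
qed

lemma hG_bound:
 assumes t: "t > 0"
 shows "\<bar>hG b c t x\<bar> \<le> kc * (norm b * norm c) / sqrt t ^ 2 * heatG (2 * t) x"
proof -
 have "\<bar>b \<bullet> x\<bar> * \<bar>c \<bullet> x\<bar> \<le> (norm b * norm x) * (norm c * norm x)"
  by (intro mult_mono abs_inner_le) auto
 then have 1: "\<bar>(b \<bullet> x) * (c \<bullet> x) / 4\<bar> \<le> norm b * norm c / 4 * norm x ^ 2"
  by (simp add: abs_mult power2_eq_square mult_ac)
 have 2: "\<bar>(b \<bullet> c) / 2\<bar> \<le> norm b * norm c / 2 * norm x ^ 0"
  using abs_inner_le[of b c] by simp
 have e: "hG b c t x = ((b \<bullet> x) * (c \<bullet> x) / 4 / t ^ 2 - (b \<bullet> c) / 2 / t ^ 1) * heatG t x"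
  by (simp add: hG_def)
 show ?thesis unfolding e
  by (rule term_final[OF term_diff[OF term_base[OF t 1, of 2 2] term_base[OF t 2, of 1 2]]])
    (use t in \<open>auto simp: algebra_simps\<close>)
qed

lemma tG_bound:
 assumes t: "t > 0"
 shows "\<bar>tG b c d t x\<bar> \<le> kc * (norm b * norm c * norm d) / sqrt t ^ 3 * heatG (2 * t) x"
proof -
 have "\<bar>b \<bullet> d\<bar> * \<bar>c \<bullet> x\<bar> \<le> (norm b * norm d) * (norm c * norm x)"
  "\<bar>b \<bullet> x\<bar> * \<bar>c \<bullet> d\<bar> \<le> (norm b * norm x) * (norm c * norm d)"
  "\<bar>b \<bullet> c\<bar> * \<bar>d \<bullet> x\<bar> \<le> (norm b * norm c) * (norm d * norm x)"
  by (intro mult_mono abs_inner_le; simp)+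
 then have 1: "\<bar>((b \<bullet> d) * (c \<bullet> x) + (b \<bullet> x) * (c \<bullet> d) + (b \<bullet> c) * (d \<bullet> x)) / 4\<bar> \<le> 3 * (norm b * norm c * norm d) / 4 * norm x ^ 1"
  unfolding abs_mult[symmetric] by (simp add: mult_ac)
 have "\<bar>b \<bullet> x\<bar> * \<bar>c \<bullet> x\<bar> * \<bar>d \<bullet> x\<bar> \<le> (norm b * norm x) * (norm c * norm x) * (norm d * norm x)"
  by (intro mult_mono abs_inner_le) auto
 then have 2: "\<bar>(b \<bullet> x) * (c \<bullet> x) * (d \<bullet> x) / 8\<bar> \<le> (norm b * norm c * norm d) / 8 * norm x ^ 3"
  by (simp add: abs_mult power3_eq_cube mult_ac)
 have e: "tG b c d t x = (((b \<bullet> d) * (c \<bullet> x) + (b \<bullet> x) * (c \<bullet> d) + (b \<bullet> c) * (d \<bullet> x)) / 4 / t ^ 2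
  - (b \<bullet> x) * (c \<bullet> x) * (d \<bullet> x) / 8 / t ^ 3) * heatG t x"
  by (simp add: tG_def)
 show ?thesis unfolding e
  by (rule term_final[OF term_diff[OF term_base[OF t 1, of 2 3] term_base[OF t 2, of 3 3]]])
    (use t in \<open>auto simp: algebra_simps\<close>)
qed

lemma qG_bound:
 assumes t: "t > 0"
 shows "\<bar>qG a y t x\<bar> \<le> kc * (norm a * norm y ^ 3) / sqrt t ^ 4 * heatG (2 * t) x"
proof -
 let ?N = "norm a * norm y ^ 3"
 have "\<bar>a \<bullet> x\<bar> * \<bar>y \<bullet> x\<bar> ^ 3 \<le> (norm a * norm x) * (norm y * norm x) ^ 3"
  by (intro mult_mono power_mono abs_inner_le) auto
 then have 1: "\<bar>(a \<bullet> x) * (y \<bullet> x) ^ 3 / 16\<bar> \<le> ?N / 16 * norm x ^ 4"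
  by (simp add: abs_mult power_abs power4_eq_xxxx power3_eq_cube mult_ac)
 have "\<bar>a \<bullet> y\<bar> * \<bar>y \<bullet> x\<bar> ^ 2 \<le> (norm a * norm y) * (norm y * norm x) ^ 2"
  by (intro mult_mono power_mono abs_inner_le) auto
 then have 2: "\<bar>3 * (a \<bullet> y) * (y \<bullet> x)\<^sup>2 / 8\<bar> \<le> 3 * ?N / 8 * norm x ^ 2"
  by (simp add: abs_mult power3_eq_cube power2_eq_square mult_ac)
 have "\<bar>a \<bullet> x\<bar> * \<bar>y \<bullet> x\<bar> * \<bar>y \<bullet> y\<bar> \<le> (norm a * norm x) * (norm y * norm x) * (norm y * norm y)"
  by (intro mult_mono power_mono abs_inner_le) auto
 then have 3: "\<bar>3 * (a \<bullet> x) * (y \<bullet> x) * (y \<bullet> y) / 8\<bar> \<le> 3 * ?N / 8 * norm x ^ 2"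
  by (simp add: abs_mult power3_eq_cube power2_eq_square mult_ac)
 have "\<bar>a \<bullet> y\<bar> * \<bar>y \<bullet> y\<bar> \<le> (norm a * norm y) * (norm y * norm y)"
  by (intro mult_mono power_mono abs_inner_le) auto
 then have 4: "\<bar>3 * (a \<bullet> y) * (y \<bullet> y) / 4\<bar> \<le> 3 * ?N / 4 * norm x ^ 0"
  by (simp add: abs_mult power3_eq_cube power2_eq_square mult_ac)
 have e: "qG a y t x = ((a \<bullet> x) * (y \<bullet> x) ^ 3 / 16 / t ^ 4 - 3 * (a \<bullet> y) * (y \<bullet> x)\<^sup>2 / 8 / t ^ 3
   - 3 * (a \<bullet> x) * (y \<bullet> x) * (y \<bullet> y) / 8 / t ^ 3 + 3 * (a \<bullet> y) * (y \<bullet> y) / 4 / t ^ 2) * heatG t x"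
  by (simp add: qG_def)
 show ?thesis unfolding e
  by (rule term_final[OF term_add[OF term_diff[OF term_diff[OF term_base[OF t 1, of 4 4] term_base[OF t 2, of 3 4]]
      term_base[OF t 3, of 3 4]] term_base[OF t 4, of 2 4]]])
    (use t in \<open>auto simp: algebra_simps\<close>)
qed

lemma lK_bound:
 assumes t: "t > 0"
 shows "\<bar>lK a t x\<bar> \<le> kc * norm a / sqrt t ^ 3 * heatG (2 * t) x"
proof -
 have "\<bar>a \<bullet> x\<bar> * \<bar>x \<bullet> x\<bar> \<le> (norm a * norm x) * (norm x * norm x)"
  by (intro mult_mono abs_inner_le) auto
 then have 1: "\<bar>3 * (a \<bullet> x) / 2\<bar> \<le> 3 * norm a / 2 * norm x ^ 1" "\<bar>(a \<bullet> x) * (x \<bullet> x) / 8\<bar> \<le> norm a / 8 * norm x ^ 3"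
  using abs_inner_le[of a x] by (simp_all add: abs_mult power3_eq_cube)
 have e: "lK a t x = (3 * (a \<bullet> x) / 2 / t ^ 2 - (a \<bullet> x) * (x \<bullet> x) / 8 / t ^ 3) * heatG t x"
  unfolding lK_def using t by (simp add: field_simps power2_eq_square power3_eq_cube)
 show ?thesis unfolding e
  by (rule term_final[OF term_diff[OF term_base[OF t 1(1), of 2 3] term_base[OF t 1(2), of 3 3]]])
    (use t in \<open>auto simp: algebra_simps\<close>)
qed

lemma llK_bound:
 assumes t: "t > 0"
 shows "\<bar>llK a t x\<bar> \<le> kc * norm a / sqrt t ^ 5 * heatG (2 * t) x"
proof -
 have "\<bar>a \<bullet> x\<bar> * \<bar>x \<bullet> x\<bar> \<le> (norm a * norm x) * (norm x * norm x)"
  "\<bar>a \<bullet> x\<bar> * \<bar>x \<bullet> x\<bar>\<^sup>2 \<le> (norm a * norm x) * (norm x * norm x)\<^sup>2"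
  by (intro mult_mono power_mono abs_inner_le; simp)+
 then have 1: "\<bar>(a \<bullet> x) * (x \<bullet> x)\<^sup>2 / 32\<bar> \<le> norm a / 32 * norm x ^ 5"
  "\<bar>(a \<bullet> x) * (x \<bullet> x)\<bar> \<le> norm a * norm x ^ 3"
  "\<bar>6 * (a \<bullet> x)\<bar> \<le> 6 * norm a * norm x ^ 1"
  using abs_inner_le[of a x] by (simp_all add: abs_mult power3_eq_cube power5_eq power2_eq_square mult_ac)
 have e: "llK a t x = - ((((a \<bullet> x) * (x \<bullet> x)\<^sup>2 / 32 / t ^ 5 - (a \<bullet> x) * (x \<bullet> x) / t ^ 4) + 6 * (a \<bullet> x) / t ^ 3) * heatG t x)"
  unfolding llK_def by (simp add: algebra_simps)
 show ?thesis unfolding e abs_minus_cancel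
  by (rule term_final[OF term_add[OF term_diff[OF term_base[OF t 1(1), of 5 5] term_base[OF t 1(2), of 4 5]] term_base[OF t 1(3), of 3 5]]])
    (use t in \<open>auto simp: algebra_simps\<close>)
qed

lemma lhG_bound:
 assumes t: "t > 0"
 shows "\<bar>lhG b c t x\<bar> \<le> kc * (norm b * norm c) / sqrt t ^ 4 * heatG (2 * t) x"
proof -
 have "\<bar>b \<bullet> x\<bar> * \<bar>c \<bullet> x\<bar> * \<bar>x \<bullet> x\<bar> \<le> (norm b * norm x) * (norm c * norm x) * (norm x * norm x)"
  "\<bar>b \<bullet> x\<bar> * \<bar>c \<bullet> x\<bar> \<le> (norm b * norm x) * (norm c * norm x)"
  "\<bar>b \<bullet> c\<bar> * \<bar>x \<bullet> x\<bar> \<le> (norm b * norm c) * (norm x * norm x)"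
  by (intro mult_mono power_mono abs_inner_le; simp)+
 then have 1: "\<bar>(b \<bullet> x) * (c \<bullet> x) * (x \<bullet> x) / 16\<bar> \<le> norm b * norm c / 16 * norm x ^ 4"
  "\<bar>(b \<bullet> x) * (c \<bullet> x)\<bar> \<le> norm b * norm c * norm x ^ 2"
  "\<bar>(b \<bullet> c) * (x \<bullet> x) / 8\<bar> \<le> norm b * norm c / 8 * norm x ^ 2"
  "\<bar>3 * (b \<bullet> c) / 2\<bar> \<le> 3 * (norm b * norm c) / 2 * norm x ^ 0"
  using abs_inner_le[of b c] by (simp_all add: abs_mult power4_eq_xxxx power2_eq_square mult_ac)
 have e: "lhG b c t x = ((((b \<bullet> x) * (c \<bullet> x) * (x \<bullet> x) / 16 / t ^ 4 - (b \<bullet> x) * (c \<bullet> x) / t ^ 3) - (b \<bullet> c) * (x \<bullet> x) / 8 / t ^ 3) + 3 * (b \<bullet> c) / 2 / t ^ 2) * heatG t x"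
  unfolding lhG_def by simp
 show ?thesis unfolding e
  by (rule term_final[OF term_add[OF term_diff[OF term_diff[OF term_base[OF t 1(1), of 4 4] term_base[OF t 1(2), of 3 4]] term_base[OF t 1(3), of 3 4]] term_base[OF t 1(4), of 2 4]]])
    (use t in \<open>auto simp: algebra_simps\<close>)
qed

lemma ltG_bound:
 assumes t: "t > 0"
 shows "\<bar>ltG a y t x\<bar> \<le> kc * (norm a * norm y ^ 2) / sqrt t ^ 5 * heatG (2 * t) x"
proof -
 define A where "A = 2 * (a \<bullet> y) * (y \<bullet> x) + (a \<bullet> x) * (y \<bullet> y)"
 define B where "B = (a \<bullet> x) * (y \<bullet> x)\<^sup>2"
 let ?N = "norm a * norm y ^ 2"
 have b: "\<bar>a \<bullet> y\<bar> * \<bar>y \<bullet> x\<bar> \<le> (norm a * norm y) * (norm y * norm x)"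
  "\<bar>a \<bullet> x\<bar> * \<bar>y \<bullet> y\<bar> \<le> (norm a * norm x) * (norm y * norm y)"
  "\<bar>a \<bullet> x\<bar> * \<bar>y \<bullet> x\<bar>\<^sup>2 \<le> (norm a * norm x) * (norm y * norm x)\<^sup>2"
  by (intro mult_mono power_mono abs_inner_le; simp)+
 have AB: "\<bar>A\<bar> \<le> 3 * ?N * norm x" "\<bar>B\<bar> \<le> ?N * norm x ^ 3"
 proof -
  have "\<bar>A\<bar> \<le> 2 * (\<bar>a \<bullet> y\<bar> * \<bar>y \<bullet> x\<bar>) + \<bar>a \<bullet> x\<bar> * \<bar>y \<bullet> y\<bar>"
   unfolding A_def by (rule order_trans[OF abs_triangle_ineq]) (simp add: abs_mult)
  with b(1,2) show "\<bar>A\<bar> \<le> 3 * ?N * norm x" by (simp only: power2_eq_square mult_ac)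
  show "\<bar>B\<bar> \<le> ?N * norm x ^ 3"
   using b(3) unfolding B_def by (simp add: abs_mult power2_eq_square power3_eq_cube mult_ac)
 qed
 have x2: "\<bar>x \<bullet> x\<bar> \<le> norm x * norm x" by (rule abs_inner_le)
 have "\<bar>A\<bar> * \<bar>x \<bullet> x\<bar> \<le> (3 * ?N * norm x) * (norm x * norm x)" "\<bar>B\<bar> * \<bar>x \<bullet> x\<bar> \<le> (?N * norm x ^ 3) * (norm x * norm x)"
  by (intro mult_mono AB x2; simp)+
 then have 1: "\<bar>A * (x \<bullet> x) / 16\<bar> \<le> 3 * ?N / 16 * norm x ^ 3" "\<bar>A\<bar> \<le> 3 * ?N * norm x ^ 1"
  "\<bar>B * (x \<bullet> x) / 32\<bar> \<le> ?N / 32 * norm x ^ 5" "\<bar>5 * B / 8\<bar> \<le> 5 * ?N / 8 * norm x ^ 3"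
  using AB by (simp_all add: abs_mult power3_eq_cube power5_eq mult_ac)
 have e: "ltG a y t x = (((A * (x \<bullet> x) / 16 / t ^ 4 - A / t ^ 3) - B * (x \<bullet> x) / 32 / t ^ 5) + 5 * B / 8 / t ^ 4) * heatG t x"
  unfolding ltG_def A_def[symmetric] B_def[symmetric] by (simp add: algebra_simps)
 show ?thesis unfolding e
  by (rule term_final[OF term_add[OF term_diff[OF term_diff[OF term_base[OF t 1(1), of 4 5] term_base[OF t 1(2), of 3 5]] term_base[OF t 1(3), of 5 5]] term_base[OF t 1(4), of 4 5]]])
    (use t in \<open>auto simp: algebra_simps\<close>)
qed

text \<open>Completing the square in y: the product is a Gaussian in x times a Gaussian in y centred
  at a multiple of x. Integrating in y then gives the semigroup identities without Fourier
  transform.\<close>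

lemma heatG_mult:
 assumes "s > 0" "t > 0"
 shows "heatG t (x - y) * heatG s y = heatG (t + s) x * heatG (t * s / (t + s)) (y - (s / (t + s)) *\<^sub>R x)"
proof -
 define X Y P where "X = x \<bullet> x" "Y = y \<bullet> y" "P = x \<bullet> y"
 have 1: "(x - y) \<bullet> (x - y) = X - 2 * P + Y"
  by (simp add: X_Y_P_def inner_diff inner_commute)
 have 2: "(y - (s / (t + s)) *\<^sub>R x) \<bullet> (y - (s / (t + s)) *\<^sub>R x) = Y - 2 * (s / (t + s)) * P + (s / (t + s))\<^sup>2 * X"
  by (simp add: X_Y_P_def inner_diff inner_commute power2_eq_square)
 have "(X - 2 * P + Y) / (4 * t) + Y / (4 * s) = X / (4 * (t + s)) + (Y - 2 * (s / (t + s)) * P + (s / (t + s))\<^sup>2 * X) / (4 * (t * s / (t + s)))"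
  using assms by (simp add: divide_simps power2_eq_square) algebra
 then have e: "exp (- ((x - y) \<bullet> (x - y)) / (4 * t)) * exp (- (y \<bullet> y) / (4 * s))
   = exp (- (x \<bullet> x) / (4 * (t + s))) * exp (- ((y - (s / (t + s)) *\<^sub>R x) \<bullet> (y - (s / (t + s)) *\<^sub>R x)) / (4 * (t * s / (t + s))))"
  unfolding 1 2 X_Y_P_def[symmetric] exp_add[symmetric] minus_divide_left[symmetric] minus_add_distrib[symmetric] by (simp only:)
 have p: "(4 * pi * t)\<^sup>2 * (4 * pi * s)\<^sup>2 = (4 * pi * (t + s))\<^sup>2 * (4 * pi * (t * s / (t + s)))\<^sup>2"
 proof -
  have "(4 * pi * t) * (4 * pi * s) = (4 * pi * (t + s)) * (4 * pi * (t * s / (t + s)))"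
   using assms by simp
  then show ?thesis by (simp only: flip: power_mult_distrib)
 qed
 have pos: "t + s > 0" "t * s / (t + s) > 0" using assms by auto
 show ?thesis
  unfolding heatG_eq[OF assms(1)] heatG_eq[OF assms(2)] heatG_eq[OF pos(1)] heatG_eq[OF pos(2)] times_divide_times_eq e p ..
qed

lemma integrable_gK [simp]:
 assumes "t > 0" shows "integrable lborel (gK b t)"
 by (rule Bochner_Integration.integrable_bound[of _ "\<lambda>x. kc * norm b / sqrt t * heatG (2 * t) x"])
  (use assms in \<open>simp, simp, unfold real_norm_def, intro AE_I2 order_trans[OF gK_bound[OF assms] abs_ge_self]\<close>)

lemma integral_gK [simp]:
 assumes "t > 0" shows "(LI x. gK b t x) = 0"
proof -
 have "(LI x. gK b t (0 - x)) = (LI x. gK b t x)"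
  by (rule integral_reflect) simp
 then show ?thesis by simp
qed

lemma heatG_conv_heatG:
 assumes "s > 0" "t > 0"
 shows "(LI y. heatG t (x - y) * heatG s y) = heatG (t + s) x"
proof -
 have "(LI y. heatG (t * s / (t + s)) (y + - ((s / (t + s)) *\<^sub>R x))) = 1"
  using assms by (subst integral_shift) auto
 then show ?thesis unfolding heatG_mult[OF assms] by simp
qed

text \<open>By \<open>heatG_mult\<close>, y is averaged against a Gaussian centred at c = (s/(t+s))
  x. The linear factor b \<bullet> y splits into b \<bullet> (y - c), which integrates to zero, and
  the constant b \<bullet> c, which yields the kernel at time t + s. Nothing is differentiated under
  the integral.\<close>

lemma heatG_conv_gK:
 assumes "s > 0" "t > 0"
 shows "(LI y. heatG t (x - y) * gK b s y) = gK b (t + s) x"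
proof -
 define r c where "r = t * s / (t + s)" "c = (s / (t + s)) *\<^sub>R x"
 have r: "r > 0" using assms by (simp add: r_c_def)
 have i: "integrable lborel (\<lambda>y. (b \<bullet> y) * heatG r y)"
 proof -
  have "integrable lborel (\<lambda>y. - (2 * r) * gK b r y)" using r by (intro integrable_mult_right) auto
  then show ?thesis using r by (simp add: gK_def)
 qed
 have z: "(LI y. (b \<bullet> y) * heatG r y) = 0"
 proof -
  have "(LI y. - (2 * r) * gK b r y) = 0" using r by simp
  then show ?thesis using r by (simp add: gK_def)
 qed
 have e: "heatG t (x - y) * gK b s y = - 1 / (2 * s) * heatG (t + s) x * ((b \<bullet> (y + - c)) * heatG r (y + - c) + (b \<bullet> c) * heatG r (y + - c))" for y
 proof -
  have "heatG t (x - y) * gK b s y = - (b \<bullet> y) / (2 * s) * (heatG t (x - y) * heatG s y)"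
   by (simp add: gK_def)
  also have "heatG t (x - y) * heatG s y = heatG (t + s) x * heatG r (y - c)"
   unfolding heatG_mult[OF assms] r_c_def ..
  finally show ?thesis by (simp add: algebra_simps)
 qed
 have "(LI y. heatG t (x - y) * gK b s y) = - 1 / (2 * s) * heatG (t + s) x *
   ((LI y. (b \<bullet> (y + - c)) * heatG r (y + - c)) + (LI y. (b \<bullet> c) * heatG r (y + - c)))"
  unfolding e integral_mult_right_zero
  using integrable_shift[OF integrable_heatG[OF r], of "- c"]
  by (subst Bochner_Integration.integral_add[OF integrable_shift[OF i]]) auto
 also have "(LI y. (b \<bullet> (y + - c)) * heatG r (y + - c)) = 0"
  using integral_shift[of "\<lambda>y. (b \<bullet> y) * heatG r y" "- c"] z by simp
 also have "(LI y. (b \<bullet> c) * heatG r (y + - c)) = b \<bullet> c"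
 proof -
  have "(LI y. heatG r (y + - c)) = 1"
   using r by (subst integral_shift) auto
  then show ?thesis by simp
 qed
 finally show ?thesis
  using assms by (simp add: gK_def r_c_def)
qed

section \<open>Integral inequalities and convolutions\<close>

text \<open>The L^1 norm is taken in \<open>ennreal\<close> so that it can be estimated before
  integrability is known; \<open>integrable_nL_le\<close> then turns a finite bound into
  integrability.\<close>

abbreviation nL :: "(real^4 \<Rightarrow> real) \<Rightarrow> ennreal" where
 "nL f \<equiv> (NI x. ennreal \<bar>f x\<bar>)"

text \<open>If f is not integrable, the Bochner integral has the default value 0 and the bound is
  trivial. This keeps integrability conditions out of the estimates built on it.\<close>

lemma ennreal_abs_integral_le:
 fixes f :: "'b \<Rightarrow> real"
 shows "ennreal \<bar>\<integral>z. f z \<partial>M\<bar> \<le> (\<integral>\<^sup>+z. ennreal \<bar>f z\<bar> \<partial>M)"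
proof (cases "integrable M f")
 case True
 then show ?thesis using integral_norm_bound_ennreal[of M f] by simp
qed (simp add: not_integrable_integral_eq)

text \<open>Triangle inequality inside, then Tonelli. The weight is 1 for L^1 norms and a truncated
  cube of |x| for third moments.\<close>

lemma minkowski_weighted:
 fixes F :: "'b \<Rightarrow> real^4 \<Rightarrow> real" and W :: "real^4 \<Rightarrow> ennreal"
 assumes "sigma_finite_measure M" and [measurable]: "case_prod F \<in> borel_measurable (M \<Otimes>\<^sub>M lborel)" "W \<in> borel_measurable borel"
 shows "(NI x. W x * ennreal \<bar>\<integral>z. F z x \<partial>M\<bar>) \<le> (\<integral>\<^sup>+z. (NI x. W x * ennreal \<bar>F z x\<bar>) \<partial>M)"
proof -
 interpret M: sigma_finite_measure M by fact
 interpret pair_sigma_finite M "lborel :: (real^4) measure" ..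
 have m[measurable]: "(\<lambda>z. F (fst z) (snd z)) \<in> borel_measurable (M \<Otimes>\<^sub>M lborel)"
  using assms(2) by (simp add: case_prod_beta')
 have "(NI x. W x * ennreal \<bar>\<integral>z. F z x \<partial>M\<bar>) \<le> (NI x. W x * (\<integral>\<^sup>+z. ennreal \<bar>F z x\<bar> \<partial>M))"
  by (intro nn_integral_mono mult_left_mono ennreal_abs_integral_le) auto
 also have "\<dots> = (NI x. (\<integral>\<^sup>+z. W x * ennreal \<bar>F z x\<bar> \<partial>M))"
 proof (intro nn_integral_cong nn_integral_cmult[symmetric])
  fix x :: "real^4"
  have "(\<lambda>z. (z, x)) \<in> M \<rightarrow>\<^sub>M M \<Otimes>\<^sub>M lborel" by simp
  from measurable_compose[OF this m] show "(\<lambda>z. ennreal \<bar>F z x\<bar>) \<in> borel_measurable M" by simp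
 qed
 also have "\<dots> = (\<integral>\<^sup>+z. (NI x. W x * ennreal \<bar>F z x\<bar>) \<partial>M)"
  by (rule Fubini') (simp add: case_prod_beta')
 finally show ?thesis .
qed

lemma minkowski_time:
 fixes F :: "real \<Rightarrow> real^4 \<Rightarrow> real" and W :: "real^4 \<Rightarrow> ennreal"
 assumes [measurable]: "case_prod F \<in> borel_measurable (lborel \<Otimes>\<^sub>M lborel)" "W \<in> borel_measurable borel" "A \<in> sets borel"
  and "\<And>s. s \<in> A \<Longrightarrow> (NI x. W x * ennreal \<bar>F s x\<bar>) \<le> \<alpha> s"
 shows "(NI x. W x * ennreal \<bar>LINT s:A|lborel. F s x\<bar>) \<le> (\<integral>\<^sup>+s\<in>A. \<alpha> s \<partial>lborel)"
proof -
 have [measurable]: "(\<lambda>z. F (fst z) (snd z)) \<in> borel_measurable (lborel \<Otimes>\<^sub>M lborel)"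
  using assms(1) by (simp add: case_prod_beta')
 have "(NI x. W x * ennreal \<bar>LINT s:A|lborel. F s x\<bar>)
   \<le> (NI s. (NI x. W x * ennreal \<bar>indicator A s *\<^sub>R F s x\<bar>))"
  unfolding set_lebesgue_integral_def
  by (rule minkowski_weighted) (auto simp: case_prod_beta' intro: lborel.sigma_finite_measure_axioms)
 also have "\<dots> \<le> (\<integral>\<^sup>+s\<in>A. \<alpha> s \<partial>lborel)"
  by (intro nn_integral_mono) (auto split: split_indicator simp: assms(4))
 finally show ?thesis .
qed

lemma abs_set_integral_le:
 fixes F :: "real \<Rightarrow> real"
 assumes "\<And>s. s \<in> A \<Longrightarrow> \<bar>F s\<bar> \<le> \<beta> s" "(nT A (\<lambda>s. \<beta> s)) \<le> ennreal C" "0 \<le> C"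
 shows "\<bar>LINT s:A|lborel. F s\<bar> \<le> C"
proof -
 have "ennreal \<bar>LINT s:A|lborel. F s\<bar> \<le> (NI s. ennreal \<bar>indicator A s *\<^sub>R F s\<bar>)"
  unfolding set_lebesgue_integral_def by (rule ennreal_abs_integral_le)
 also have "\<dots> \<le> (nT A (\<lambda>s. \<beta> s))"
  by (intro nn_integral_mono) (auto split: split_indicator intro!: ennreal_leI assms(1))
 also have "\<dots> \<le> ennreal C" by (rule assms)
 finally show ?thesis using assms(3) by simp
qed

lemma set_integrableI_bounded_by:
 fixes F :: "real \<Rightarrow> real"
 assumes [measurable]: "F \<in> borel_measurable borel" "A \<in> sets borel"
  and "\<And>s. s \<in> A \<Longrightarrow> \<bar>F s\<bar> \<le> \<beta> s" "(nT A (\<lambda>s. \<beta> s)) \<le> ennreal C"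
 shows "set_integrable lborel A F"
 unfolding set_integrable_def
proof (rule integrableI_bounded)
 have "(NI s. ennreal (norm (indicator A s *\<^sub>R F s))) \<le> (nT A (\<lambda>s. \<beta> s))"
  by (intro nn_integral_mono) (auto split: split_indicator intro!: ennreal_leI assms(3))
 also have "\<dots> < \<infinity>" using assms(4) by (auto intro: le_less_trans)
 finally show "(NI s. ennreal (norm (indicator A s *\<^sub>R F s))) < \<infinity>" .
qed simp

section \<open>Convolution estimates in L^1 and in supremum\<close>

definition conv :: "(real^4 \<Rightarrow> real) \<Rightarrow> (real^4 \<Rightarrow> real) \<Rightarrow> real^4 \<Rightarrow> real" where
 "conv k f x = (LI y. k (x - y) * f y)"

lemma borel_measurable_conv [measurable]:
 assumes [measurable]: "k \<in> borel_measurable borel" "f \<in> borel_measurable borel"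
 shows "conv k f \<in> borel_measurable borel"
 unfolding conv_def by measurable

lemma conv_weighted:
 assumes [measurable]: "k \<in> borel_measurable borel" "f \<in> borel_measurable borel" "W \<in> borel_measurable borel"
  and "\<And>y. (NI x. W x * ennreal \<bar>k (x - y)\<bar>) \<le> \<omega> y"
 shows "(NI x. W x * ennreal \<bar>conv k f x\<bar>) \<le> (NI y. \<omega> y * ennreal \<bar>f y\<bar>)"
proof -
 have "(NI x. W x * ennreal \<bar>conv k f x\<bar>)
   \<le> (NI y. (NI x. W x * ennreal \<bar>k (x - y) * f y\<bar>))"
  unfolding conv_def
  by (rule minkowski_weighted[where F = "\<lambda>y x. k (x - y) * f y"]) (auto simp: case_prod_beta' intro: lborel.sigma_finite_measure_axioms)
 also have "\<dots> = (NI y. (NI x. W x * ennreal \<bar>k (x - y)\<bar>) * ennreal \<bar>f y\<bar>)"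
  by (intro nn_integral_cong) (simp add: abs_mult ennreal_mult nn_integral_multc mult.assoc[symmetric])
 also have "\<dots> \<le> (NI y. \<omega> y * ennreal \<bar>f y\<bar>)"
  by (intro nn_integral_mono mult_right_mono assms(4)) auto
 finally show ?thesis .
qed

lemma nL_conv:
 assumes [measurable]: "k \<in> borel_measurable borel" "f \<in> borel_measurable borel"
  and "nL k \<le> ennreal A" "nL f \<le> ennreal B" "0 \<le> A" "0 \<le> B"
 shows "nL (conv k f) \<le> ennreal (A * B)"
proof -
 have "nL (conv k f) \<le> (NI y. ennreal A * ennreal \<bar>f y\<bar>)"
  using conv_weighted[of k f "\<lambda>_. 1" "\<lambda>_. ennreal A"] nn_integral_shift_minus[of "\<lambda>x. ennreal \<bar>k x\<bar>"] assms(3) by simp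
 also have "\<dots> = ennreal A * nL f" by (rule nn_integral_cmult) simp
 also have "\<dots> \<le> ennreal A * ennreal B" by (intro mult_left_mono assms) auto
 finally show ?thesis using assms by (simp add: ennreal_mult)
qed

lemma abs_conv_le_sup_kernel:
 assumes [measurable]: "f \<in> borel_measurable borel"
  and "\<And>x. \<bar>k x\<bar> \<le> A" "nL f \<le> ennreal B" "0 \<le> B"
 shows "\<bar>conv k f x\<bar> \<le> A * B"
proof -
 have A: "0 \<le> A" using assms(2)[of 0] by simp
 have "ennreal \<bar>conv k f x\<bar> \<le> (NI y. ennreal \<bar>k (x - y) * f y\<bar>)"
  unfolding conv_def by (rule ennreal_abs_integral_le)
 also have "\<dots> \<le> (NI y. ennreal A * ennreal \<bar>f y\<bar>)"
  by (intro nn_integral_mono) (auto simp: abs_mult ennreal_mult[symmetric] A intro!: ennreal_leI mult_right_mono assms)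
 also have "\<dots> = ennreal A * nL f" by (rule nn_integral_cmult) simp
 also have "\<dots> \<le> ennreal A * ennreal B" by (intro mult_left_mono assms) auto
 finally show ?thesis using assms A by (simp add: ennreal_mult[symmetric])
qed

lemma abs_conv_le_sup_data_AE:
 assumes [measurable]: "k \<in> borel_measurable borel"
  and f: "AE x in lborel. \<bar>f x\<bar> \<le> B" and "nL k \<le> ennreal A" "0 \<le> A" "0 \<le> B"
 shows "\<bar>conv k f x\<bar> \<le> A * B"
proof -
 have "ennreal \<bar>conv k f x\<bar> \<le> (NI y. ennreal \<bar>k (x - y) * f y\<bar>)"
  unfolding conv_def by (rule ennreal_abs_integral_le)
 also have "\<dots> \<le> (NI y. ennreal \<bar>k (x - y)\<bar> * ennreal B)"
  by (rule nn_integral_mono_AE, rule AE_mp[OF f])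
    (auto simp: abs_mult ennreal_mult[symmetric] assms(5) intro!: ennreal_leI mult_left_mono)
 also have "\<dots> = nL k * ennreal B"
  using nn_integral_reflect[of "\<lambda>y. ennreal \<bar>k y\<bar>" x] by (subst nn_integral_multc) auto
 also have "\<dots> \<le> ennreal A * ennreal B" by (intro mult_right_mono assms) auto
 finally show ?thesis using assms(4,5) by (simp add: ennreal_mult[symmetric])
qed

lemma abs_conv_le_sup_data:
 assumes "k \<in> borel_measurable borel" "\<And>x. \<bar>f x\<bar> \<le> B" "nL k \<le> ennreal A" "0 \<le> A"
 shows "\<bar>conv k f x\<bar> \<le> A * B"
 using assms order_trans[OF abs_ge_zero assms(2)] by (intro abs_conv_le_sup_data_AE) auto

lemma nL_kernel_bound:
 assumes "\<And>x. \<bar>\<phi> x\<bar> \<le> A * heatG t x" "t > 0" "0 \<le> A"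
 shows "nL \<phi> \<le> ennreal A"
proof -
 have "nL \<phi> \<le> (NI x. ennreal A * ennreal (heatG t x))"
  using assms by (intro nn_integral_mono) (auto simp: ennreal_mult[symmetric] intro!: ennreal_leI)
 also have "\<dots> = ennreal A" using assms by (simp add: nn_integral_cmult nn_integral_heatG)
 finally show ?thesis .
qed

lemma integrable_iff_nL: "f \<in> borel_measurable borel \<Longrightarrow> integrable lborel f \<longleftrightarrow> nL f < \<infinity>" for f :: "real^4 \<Rightarrow> real"
 by (simp add: integrable_iff_bounded)

lemma integrable_nL_le: "f \<in> borel_measurable borel \<Longrightarrow> nL f \<le> ennreal A \<Longrightarrow> integrable lborel f" for f :: "real^4 \<Rightarrow> real"
 by (auto simp: integrable_iff_nL intro: le_less_trans)

lemma nL_integral: "integrable lborel f \<Longrightarrow> nL f = ennreal (LI x. \<bar>f x\<bar>)" for f :: "real^4 \<Rightarrow> real"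
 by (rule nn_integral_eq_integral) auto

lemma abs_integral_le_nL: "nL f \<le> ennreal A \<Longrightarrow> 0 \<le> A \<Longrightarrow> \<bar>LI x. f x\<bar> \<le> A"
 using ennreal_abs_integral_le[of lborel f] by (meson ennreal_le_iff order_trans)

lemma nL_add:
 assumes [measurable]: "f \<in> borel_measurable borel" "g \<in> borel_measurable borel"
  and "nL f \<le> ennreal A" "nL g \<le> ennreal B" "0 \<le> A" "0 \<le> B"
 shows "nL (\<lambda>x. f x + g x) \<le> ennreal (A + B)"
proof -
 have "nL (\<lambda>x. f x + g x) \<le> (NI x. ennreal \<bar>f x\<bar> + ennreal \<bar>g x\<bar>)"
  by (intro nn_integral_mono) (auto simp flip: ennreal_plus intro!: ennreal_leI)
 also have "\<dots> = nL f + nL g" by (rule nn_integral_add) auto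
 also have "\<dots> \<le> ennreal A + ennreal B" by (intro add_mono assms)
 finally show ?thesis using assms by simp
qed

lemma nL_mult_bounded:
 assumes [measurable]: "f \<in> borel_measurable borel"
  and "nL f \<le> ennreal A" "\<And>x. \<bar>g x\<bar> \<le> B" "0 \<le> A"
 shows "nL (\<lambda>x. f x * g x) \<le> ennreal (A * B)"
proof -
 have B: "0 \<le> B" using assms(3)[of 0] by simp
 have "nL (\<lambda>x. f x * g x) \<le> (NI x. ennreal \<bar>f x\<bar> * ennreal B)"
  by (intro nn_integral_mono) (auto simp: abs_mult ennreal_mult[symmetric] B intro!: ennreal_leI mult_left_mono assms)
 also have "\<dots> = nL f * ennreal B" by (rule nn_integral_multc) simp
 also have "\<dots> \<le> ennreal A * ennreal B" by (intro mult_right_mono assms) auto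
 finally show ?thesis using assms B by (simp add: ennreal_mult[symmetric])
qed

section \<open>Time integrals with integrable singularities\<close>

lemma nn_integral_powr_0:
 assumes "0 < p" "p < 1" "0 < t"
 shows "(nT {0<..<t} (\<lambda>s. s powr - p)) = ennreal (t powr (1 - p) / (1 - p))"
proof -
 have "((\<lambda>s. s powr - p) has_integral (t powr (1 - p) / (1 - p))) {0..t}"
  using has_integral_powr_from_0[of "- p" t] assms by simp
 then have "((\<lambda>s. if s \<in> {0..t} then s powr - p else 0) has_integral (t powr (1 - p) / (1 - p))) UNIV"
  by (subst has_integral_restrict_UNIV)
 then have "(NI s. ennreal (if s \<in> {0..t} then s powr - p else 0)) = ennreal (t powr (1 - p) / (1 - p))"
  by (rule nn_integral_has_integral_lborel[rotated 2]) auto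
 moreover have "(nT {0<..<t} (\<lambda>s. s powr - p)) = (NI s. ennreal (if s \<in> {0..t} then s powr - p else 0))"
  by (rule nn_integral_cong_AE, rule AE_mp[OF AE_lborel_singleton[of t]], rule AE_mp[OF AE_lborel_singleton[of 0]])
    (auto split: split_indicator)
 ultimately show ?thesis by simp
qed

lemma nn_integral_interval_reflect:
 fixes t :: real
 assumes [measurable]: "f \<in> borel_measurable borel"
 shows "(\<integral>\<^sup>+s\<in>{a<..<t}. f (t - s) \<partial>lborel) = (\<integral>\<^sup>+s\<in>{0<..<t - a}. f s \<partial>lborel)"
proof -
 have "(\<integral>\<^sup>+s\<in>{0<..<t - a}. f s \<partial>lborel) = (NI s. f (t + - 1 * s) * indicator {0<..<t - a} (t + -1 * s))"
  by (subst nn_integral_real_affine[of _ "-1" t]) auto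
 also have "\<dots> = (\<integral>\<^sup>+s\<in>{a<..<t}. f (t - s) \<partial>lborel)"
  by (intro nn_integral_cong) (auto split: split_indicator)
 finally show ?thesis by simp
qed

lemma nn_integral_inverse_sqrt:
 assumes "0 < t"
 shows "(nT {0<..<t} (\<lambda>s. 1 / sqrt s)) = ennreal (2 * sqrt t)"
proof -
 have "(nT {0<..<t} (\<lambda>s. 1 / sqrt s)) = (nT {0<..<t} (\<lambda>s. s powr - (1/2)))"
  by (intro nn_integral_cong) (auto split: split_indicator simp: powr_minus_divide powr_half_sqrt)
 then show ?thesis using nn_integral_powr_0[of "1/2" t] assms by (simp add: powr_half_sqrt mult.commute)
qed

lemma nn_integral_inverse_sqrt_reflect:
 assumes "a < t"
 shows "(nT {a<..<t} (\<lambda>s. 1 / sqrt (t - s))) = ennreal (2 * sqrt (t - a))"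
 using assms nn_integral_inverse_sqrt[of "t - a"]
 by (subst nn_integral_interval_reflect[of "\<lambda>s. ennreal (1 / sqrt s)"]) auto

lemma nn_integral_inverse_34_reflect:
 assumes "0 < t"
 shows "(nT {0<..<t} (\<lambda>s. (t - s) powr - (3/4))) = ennreal (4 * t powr (1/4))"
 using assms nn_integral_powr_0[of "3/4" t]
 by (subst nn_integral_interval_reflect[of "\<lambda>s. ennreal (s powr - (3/4))"]) (auto simp: mult.commute)

lemma set_nn_integral_cmult:
 fixes f :: "real \<Rightarrow> real"
 assumes [measurable]: "f \<in> borel_measurable borel" "A \<in> sets borel" and "0 \<le> c" "(nT A (\<lambda>s. f s)) \<le> ennreal C"
 shows "(nT A (\<lambda>s. c * f s)) \<le> ennreal (c * C)"
proof -
 have "(nT A (\<lambda>s. c * f s)) = (NI s. ennreal c * (ennreal (f s) * indicator A s))"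
  by (intro nn_integral_cong) (simp add: ennreal_mult' assms mult.assoc)
 also have "\<dots> = ennreal c * (nT A (\<lambda>s. f s))" by (rule nn_integral_cmult) simp
 also have "\<dots> \<le> ennreal c * ennreal C" by (intro mult_left_mono assms) auto
 finally show ?thesis using assms(3) by (simp add: ennreal_mult')
qed

lemma set_nn_integral_add:
 fixes f :: "real \<Rightarrow> real"
 assumes [measurable]: "f \<in> borel_measurable borel" "g \<in> borel_measurable borel" "A \<in> sets borel"
  and "(nT A (\<lambda>s. f s)) \<le> ennreal B" "(nT A (\<lambda>s. g s)) \<le> ennreal C" "0 \<le> B" "0 \<le> C"
  and "\<And>s. s \<in> A \<Longrightarrow> 0 \<le> f s" "\<And>s. s \<in> A \<Longrightarrow> 0 \<le> g s"
 shows "(nT A (\<lambda>s. f s + g s)) \<le> ennreal (B + C)"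
proof -
 have "(nT A (\<lambda>s. f s + g s)) = (NI s. ennreal (f s) * indicator A s + ennreal (g s) * indicator A s)"
  using assms by (intro nn_integral_cong) (auto split: split_indicator)
 also have "\<dots> = (nT A (\<lambda>s. f s)) + (nT A (\<lambda>s. g s))"
  by (rule nn_integral_add) auto
 also have "\<dots> \<le> ennreal B + ennreal C" by (intro add_mono assms)
 finally show ?thesis using assms by simp
qed

lemma set_nn_integral_mono_le:
 fixes f :: "real \<Rightarrow> real"
 assumes "\<And>s. s \<in> A \<Longrightarrow> f s \<le> g s" "(nT A (\<lambda>s. g s)) \<le> C"
 shows "(nT A (\<lambda>s. f s)) \<le> C"
 by (rule order_trans[OF nn_integral_mono assms(2)]) (auto split: split_indicator intro: ennreal_leI assms(1))

lemma set_nn_integral_subset: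
 fixes g :: "real \<Rightarrow> real"
 assumes "A \<subseteq> B" "(nT B (\<lambda>s. g s)) \<le> C"
 shows "(nT A (\<lambda>s. g s)) \<le> C"
 by (rule order_trans[OF nn_integral_mono assms(2)]) (use assms in \<open>auto split: split_indicator\<close>)

text \<open>One of the two roots is at least sqrt (t/2), which leaves single inverse roots and the
  constant 4 sqrt 2 < 6 (the exact value is pi). That the bound does not depend on t is what allows
  |v| \<le> \<kappa>/sqrt s to be used as a smallness condition on arbitrarily long
  intervals.\<close>

lemma nn_integral_beta_half:
 assumes t: "0 < t"
 shows "(nT {0<..<t} (\<lambda>s. 1 / (sqrt (t - s) * sqrt s))) \<le> ennreal 6"
proof (rule set_nn_integral_mono_le)
 fix s assume s: "s \<in> {0<..<t}"
 define u v w where "u = sqrt (t - s)" "v = sqrt s" "w = sqrt (t / 2)"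
 have "u > 0" "v > 0" "w > 0" using s by (auto simp: u_v_w_def)
 moreover have "w \<le> u \<or> w \<le> v" using s unfolding u_v_w_def by (cases "s \<le> t / 2") auto
 ultimately have "1 / (u * v) \<le> 1 / w * (1 / u + 1 / v)"
  by (auto simp: divide_simps)
 then show "1 / (sqrt (t - s) * sqrt s) \<le> 1 / sqrt (t / 2) * (1 / sqrt (t - s) + 1 / sqrt s)"
  by (simp only: u_v_w_def)
next
 have "(nT {0<..<t} (\<lambda>s. 1 / sqrt (t / 2) * (1 / sqrt (t - s) + 1 / sqrt s))) \<le> ennreal (1 / sqrt (t / 2) * (2 * sqrt t + 2 * sqrt t))"
  by (intro set_nn_integral_cmult set_nn_integral_add) (use t nn_integral_inverse_sqrt_reflect[of 0 t] nn_integral_inverse_sqrt[of t] in auto)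
 also have "1 / sqrt (t / 2) * (2 * sqrt t + 2 * sqrt t) \<le> 6"
 proof -
  have "sqrt 2 \<le> 1.5" by (rule real_le_lsqrt) (auto simp: power2_eq_square)
  then show ?thesis using t by (simp add: real_sqrt_divide)
 qed
 finally show "(nT {0<..<t} (\<lambda>s. 1 / sqrt (t / 2) * (1 / sqrt (t - s) + 1 / sqrt s))) \<le> ennreal 6"
  by (simp add: ennreal_leI)
qed

text \<open>The difference \<phi>(x + b) - \<phi>(x) integrates to zero by translation invariance.
  It is also the integral over \<theta> in [0,1] of \<phi>'(x + \<theta> b), and by Fubini and
  translation invariance again its integral is that of \<phi>'. Integrability replaces any decay
  condition at infinity.\<close>

lemma integral_directional_derivative_zero:
 fixes \<phi> \<phi>' :: "real^4 \<Rightarrow> real"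
 assumes d: "\<And>x. ((\<lambda>\<theta>. \<phi> (x + \<theta> *\<^sub>R b)) has_real_derivative \<phi>' x) (at 0)"
  and c: "continuous_on UNIV \<phi>'" and i: "integrable lborel \<phi>" "integrable lborel \<phi>'"
 shows "(LI x. \<phi>' x) = 0"
proof -
 have [measurable]: "\<phi>' \<in> borel_measurable borel" using i by auto
 have d': "((\<lambda>\<theta>. \<phi> (x + \<theta> *\<^sub>R b)) has_real_derivative \<phi>' (x + \<theta> *\<^sub>R b)) (at \<theta>)" for x \<theta>
  using d[of "x + \<theta> *\<^sub>R b"] DERIV_shift[of "\<lambda>\<theta>. \<phi> (x + \<theta> *\<^sub>R b)" "\<phi>' (x + \<theta> *\<^sub>R b)" 0 \<theta>]
  by (simp add: scaleR_add_left add_ac)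
 have ftc: "\<phi> (x + b) - \<phi> x = (LI \<theta>. \<phi>' (x + \<theta> *\<^sub>R b) * indicator {0..1} \<theta>)" for x
 proof (subst integral_FTC_Icc_real[where F = "\<lambda>\<theta>. \<phi> (x + \<theta> *\<^sub>R b)"])
  fix \<theta> :: real
  have "continuous_on UNIV (\<lambda>\<theta>. \<phi>' (x + \<theta> *\<^sub>R b))"
   by (rule continuous_on_compose2[OF c]) (auto intro!: continuous_intros)
  then show "isCont (\<lambda>\<theta>. \<phi>' (x + \<theta> *\<^sub>R b)) \<theta>" by (simp add: continuous_on_eq_continuous_at)
 qed (auto simp: d')
 have n: "(NI x. ennreal \<bar>\<phi>' (x + \<theta> *\<^sub>R b)\<bar>) = nL \<phi>'" for \<theta>
  by (rule nn_integral_shift[of "\<lambda>x. ennreal \<bar>\<phi>' x\<bar>"]) simp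
 have I: "integrable (lborel \<Otimes>\<^sub>M lborel) (\<lambda>(x, \<theta>). \<phi>' (x + \<theta> *\<^sub>R b) * indicator {0..1::real} \<theta>)"
 proof (rule integrableI_bounded)
  have "(\<integral>\<^sup>+p. ennreal (norm (case p of (x, \<theta>) \<Rightarrow> \<phi>' (x + \<theta> *\<^sub>R b) * indicator {0..1::real} \<theta>)) \<partial>(lborel \<Otimes>\<^sub>M lborel))
   = (NI \<theta>. (NI x. ennreal \<bar>\<phi>' (x + \<theta> *\<^sub>R b)\<bar> * indicator {0..1::real} \<theta>))"
   by (subst lborel_pair.nn_integral_snd[symmetric]) (auto simp: case_prod_beta' abs_mult ennreal_mult intro!: nn_integral_cong split: split_indicator)
  also have "\<dots> = (NI \<theta>. nL \<phi>' * indicator {0..1::real} \<theta>)"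
   by (intro nn_integral_cong) (auto simp: n split: split_indicator)
  also have "\<dots> = nL \<phi>'" by (simp add: nn_integral_cmult_indicator)
  also have "\<dots> < \<infinity>" using i(2) by (simp add: integrable_iff_nL)
  finally show "(\<integral>\<^sup>+p. ennreal (norm (case p of (x, \<theta>) \<Rightarrow> \<phi>' (x + \<theta> *\<^sub>R b) * indicator {0..1::real} \<theta>)) \<partial>(lborel \<Otimes>\<^sub>M lborel)) < \<infinity>" .
 qed (simp add: case_prod_beta')
 have "0 = (LI x. \<phi> (x + b) - \<phi> x)"
  using i integral_shift[of \<phi> b] by (subst Bochner_Integration.integral_diff) (auto intro: integrable_shift)
 also have "\<dots> = (LI x. (LI \<theta>. \<phi>' (x + \<theta> *\<^sub>R b) * indicator {0..1} \<theta>))"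
  by (simp only: ftc)
 also have "\<dots> = (LI \<theta>. (LI x. \<phi>' (x + \<theta> *\<^sub>R b) * indicator {0..1} \<theta>))"
  using lborel_pair.Fubini_integral[of "\<lambda>x \<theta>. \<phi>' (x + \<theta> *\<^sub>R b) * indicator {0..1::real} \<theta>"] I by simp
 also have "\<dots> = (LI \<theta>. (LI x. \<phi>' x) * indicator {0..1::real} \<theta>)"
  using integral_shift[of \<phi>'] by simp
 also have "\<dots> = (LI x. \<phi>' x)" by simp
 finally show ?thesis by simp
qed

text \<open>Integrating the bound on the third derivative once and then applying the mean value theorem
 avoids the integral form of Taylor's remainder.\<close>

lemma taylor3_integral_bound:
 fixes \<phi> \<phi>1 \<phi>2 \<phi>3 g :: "real \<Rightarrow> real"
 assumes d: "\<And>\<theta>. (\<phi> has_real_derivative \<phi>1 \<theta>) (at \<theta>)" "\<And>\<theta>. (\<phi>1 has_real_derivative \<phi>2 \<theta>) (at \<theta>)"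
   "\<And>\<theta>. (\<phi>2 has_real_derivative \<phi>3 \<theta>) (at \<theta>)"
  and g: "\<And>\<theta>. \<bar>\<phi>3 \<theta>\<bar> \<le> g \<theta>" "continuous_on UNIV g"
 shows "ennreal \<bar>\<phi> 1 - \<phi> 0 - \<phi>1 0 - \<phi>2 0 / 2\<bar> \<le> (nT {0..1} (\<lambda>\<theta>. g \<theta>))"
proof -
 have g0: "g \<theta> \<ge> 0" for \<theta> using g(1)[of \<theta>] by linarith
 define G where "G \<theta> = integral {0..\<theta>} g" for \<theta>
 have G: "(G has_real_derivative g \<theta>) (at \<theta> within {0..1})" if "\<theta> \<in> {0..1}" for \<theta>
  unfolding G_def has_real_derivative_iff_has_vector_derivative
  by (rule integral_has_vector_derivative) (use that g(2) in \<open>auto intro: continuous_on_subset\<close>)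
 have 2: "\<bar>\<phi>2 \<theta> - \<phi>2 0\<bar> \<le> G \<theta>" if "\<theta> \<in> {0..1}" for \<theta>
 proof -
  have "(\<phi>3 has_integral (\<phi>2 \<theta> - \<phi>2 0)) {0..\<theta>}"
   using that d(3) by (intro fundamental_theorem_of_calculus)
    (auto simp: has_real_derivative_iff_has_vector_derivative[symmetric] intro: DERIV_subset)
  moreover have "g integrable_on {0..\<theta>}"
   using g(2) by (intro integrable_continuous_interval) (auto intro: continuous_on_subset)
  ultimately show ?thesis
   using integral_norm_bound_integral[of \<phi>3 "{0..\<theta>}" g] g(1) by (auto simp: G_def has_integral_iff)
 qed
 have Gm: "G \<theta> \<le> G 1" if "\<theta> \<in> {0..1}" for \<theta>
  unfolding G_def using that g0 g(2)
  by (intro integral_subset_le integrable_continuous_interval) (auto intro: continuous_on_subset)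
 have G0: "0 \<le> G 1" unfolding G_def by (rule integral_nonneg) (use g g0 in \<open>auto intro!: integrable_continuous_interval intro: continuous_on_subset\<close>)
 have 1: "\<bar>\<phi>1 \<theta> - \<phi>1 0 - \<theta> * \<phi>2 0\<bar> \<le> G 1" if "\<theta> \<in> {0..1}" for \<theta>
 proof -
  have "\<bar>(\<phi>1 \<theta> - \<theta> * \<phi>2 0) - (\<phi>1 0 - 0 * \<phi>2 0)\<bar> \<le> G 1 * \<bar>\<theta> - 0\<bar>"
  proof (rule field_differentiable_bound[where S = "{0..1}" and f' = "\<lambda>\<theta>. \<phi>2 \<theta> - \<phi>2 0", simplified real_norm_def])
   fix z :: real assume z: "z \<in> {0..1}"
   show "((\<lambda>\<theta>. \<phi>1 \<theta> - \<theta> * \<phi>2 0) has_real_derivative \<phi>2 z - \<phi>2 0) (at z within {0..1})"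
    by (rule DERIV_subset[OF _ subset_UNIV]) (auto intro!: derivative_eq_intros d)
   show "\<bar>\<phi>2 z - \<phi>2 0\<bar> \<le> G 1" using 2[OF z] Gm[OF z] by linarith
  qed (use that in auto)
  also have "\<dots> \<le> G 1" using that G0 by (simp add: mult_left_le)
  finally show ?thesis by simp
 qed
 have "\<bar>(\<phi> 1 - 1 * \<phi>1 0 - 1\<^sup>2 / 2 * \<phi>2 0) - (\<phi> 0 - 0 * \<phi>1 0 - 0\<^sup>2 / 2 * \<phi>2 0)\<bar> \<le> G 1 * \<bar>1 - 0\<bar>"
 proof (rule field_differentiable_bound[where S = "{0..1}" and f' = "\<lambda>\<theta>. \<phi>1 \<theta> - \<phi>1 0 - \<theta> * \<phi>2 0", simplified real_norm_def])
  fix z :: real assume z: "z \<in> {0..1}"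
  show "((\<lambda>\<theta>. \<phi> \<theta> - \<theta> * \<phi>1 0 - \<theta>\<^sup>2 / 2 * \<phi>2 0) has_real_derivative \<phi>1 z - \<phi>1 0 - z * \<phi>2 0) (at z within {0..1})"
   by (rule DERIV_subset[OF _ subset_UNIV]) (auto intro!: derivative_eq_intros d)
  show "\<bar>\<phi>1 z - \<phi>1 0 - z * \<phi>2 0\<bar> \<le> G 1" by (rule 1[OF z])
 qed auto
 then have "ennreal \<bar>\<phi> 1 - \<phi> 0 - \<phi>1 0 - \<phi>2 0 / 2\<bar> \<le> ennreal (G 1)"
  by (intro ennreal_leI) (simp add: algebra_simps)
 also have "ennreal (G 1) = (nT {0..1} (\<lambda>\<theta>. g \<theta>))"
 proof -
  have "(g has_integral G 1) {0..1}"
   unfolding G_def using g(2) by (intro integrable_integral integrable_continuous_interval) (auto intro: continuous_on_subset)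
  then have "((\<lambda>\<theta>. if \<theta> \<in> {0..1} then g \<theta> else 0) has_integral G 1) UNIV"
   by (subst has_integral_restrict_UNIV)
  moreover have [measurable]: "g \<in> borel_measurable borel" using g(2) by (simp add: borel_measurable_continuous_onI)
  ultimately have "(NI \<theta>. ennreal (if \<theta> \<in> {0..1} then g \<theta> else 0)) = ennreal (G 1)"
   by (intro nn_integral_has_integral_lborel) (auto simp: g0)
  then show ?thesis by (subst (asm) eq_commute) (auto intro!: nn_integral_cong split: split_indicator)
 qed
 finally show ?thesis .
qed

lemma taylor1_integral_bound:
 fixes \<phi> \<phi>1 g :: "real \<Rightarrow> real"
 assumes d: "\<And>\<theta>. (\<phi> has_real_derivative \<phi>1 \<theta>) (at \<theta>)"
  and g: "\<And>\<theta>. \<bar>\<phi>1 \<theta>\<bar> \<le> g \<theta>" "continuous_on UNIV g"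
 shows "ennreal \<bar>\<phi> 1 - \<phi> 0\<bar> \<le> (nT {0..1} (\<lambda>\<theta>. g \<theta>))"
proof -
 have g0: "g \<theta> \<ge> 0" for \<theta> using g(1)[of \<theta>] by linarith
 have i: "g integrable_on {0..1}"
  using g(2) by (intro integrable_continuous_interval) (auto intro: continuous_on_subset)
 have "(\<phi>1 has_integral (\<phi> 1 - \<phi> 0)) {0..1}"
  using d by (intro fundamental_theorem_of_calculus)
   (auto simp: has_real_derivative_iff_has_vector_derivative[symmetric] intro: DERIV_subset)
 with i have "\<bar>\<phi> 1 - \<phi> 0\<bar> \<le> integral {0..1} g"
  using integral_norm_bound_integral[of \<phi>1 "{0..1}" g] g(1) by (auto simp: has_integral_iff)
 then have "ennreal \<bar>\<phi> 1 - \<phi> 0\<bar> \<le> ennreal (integral {0..1} g)" by (rule ennreal_leI)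
 also have "\<dots> = (nT {0..1} (\<lambda>\<theta>. g \<theta>))"
 proof -
  have "((\<lambda>\<theta>. if \<theta> \<in> {0..1} then g \<theta> else 0) has_integral integral {0..1} g) UNIV"
   using i by (subst has_integral_restrict_UNIV) (rule integrable_integral)
  moreover have [measurable]: "g \<in> borel_measurable borel" using g(2) by (simp add: borel_measurable_continuous_onI)
  ultimately have "(NI \<theta>. ennreal (if \<theta> \<in> {0..1} then g \<theta> else 0)) = ennreal (integral {0..1} g)"
   by (intro nn_integral_has_integral_lborel) (auto simp: g0)
  then show ?thesis by (subst (asm) eq_commute) (auto intro!: nn_integral_cong split: split_indicator)
 qed
 finally show ?thesis .
qed

text \<open>A Taylor remainder is dominated by an average of Gaussians translated along a segment.
  Translation does not change their mass, so A survives as L^1 bound, and their common supremum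
  gives A/t^2.\<close>

lemma nL_line_bound:
 assumes t: "t > 0" "0 \<le> A" and [measurable]: "\<phi> \<in> borel_measurable borel"
  and b: "\<And>x. ennreal \<bar>\<phi> x\<bar> \<le> (nT {0..1} (\<lambda>\<theta>. A * heatG t (x + \<theta> *\<^sub>R d)))"
 shows "nL \<phi> \<le> ennreal A" "\<bar>\<phi> x\<bar> \<le> A / t\<^sup>2"
proof -
 have "nL \<phi> \<le> (NI x. (nT {0..1} (\<lambda>\<theta>. A * heatG t (x + \<theta> *\<^sub>R d))))"
  by (intro nn_integral_mono b)
 also have "\<dots> = (NI \<theta>. (NI x. ennreal (A * heatG t (x + \<theta> *\<^sub>R d)) * indicator {0..1::real} \<theta>))"
  by (rule lborel_pair.Fubini') (auto simp: case_prod_beta')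
 also have "\<dots> = (NI \<theta>. ennreal A * indicator {0..1::real} \<theta>)"
 proof (intro nn_integral_cong)
  fix \<theta> :: real
  have "(NI x. ennreal (A * heatG t (x + \<theta> *\<^sub>R d))) = ennreal A"
   using t nn_integral_shift[of "\<lambda>x. ennreal (A * heatG t x)" "\<theta> *\<^sub>R d"]
   by (simp add: ennreal_mult nn_integral_cmult nn_integral_heatG)
  then show "(NI x. ennreal (A * heatG t (x + \<theta> *\<^sub>R d)) * indicator {0..1::real} \<theta>) = ennreal A * indicator {0..1::real} \<theta>"
   by (simp add: nn_integral_multc)
 qed
 also have "\<dots> = ennreal A" by (simp add: nn_integral_cmult_indicator)
 finally show "nL \<phi> \<le> ennreal A" .
 have "ennreal \<bar>\<phi> x\<bar> \<le> (\<integral>\<^sup>+\<theta>\<in>{0..1}. ennreal (A / t\<^sup>2) \<partial>(lborel :: real measure))"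
  by (rule order_trans[OF b nn_integral_mono])
    (use t heatG_le[OF t(1)] in \<open>auto split: split_indicator intro!: ennreal_leI mult_left_mono simp: divide_inverse\<close>)
 also have "\<dots> = ennreal (A / t\<^sup>2)" by (simp add: nn_integral_cmult_indicator)
 finally show "\<bar>\<phi> x\<bar> \<le> A / t\<^sup>2" using t by simp
qed

section \<open>Mild solutions\<close>

abbreviation heatS :: "real \<Rightarrow> (real^4 \<Rightarrow> real) \<Rightarrow> real^4 \<Rightarrow> real" where
 "heatS t f \<equiv> conv (heatG t) f"

abbreviation heatP :: "real^4 \<Rightarrow> real \<Rightarrow> (real^4 \<Rightarrow> real) \<Rightarrow> real^4 \<Rightarrow> real" where
 "heatP b t f \<equiv> conv (gK b t) f"

text \<open>One bounded kernel and two integrable functions make the double integral absolutely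
  convergent; in the uses the bounded one is \<open>heatG t\<close>.\<close>

lemma conv_assoc:
 assumes k: "k \<in> borel_measurable borel" "\<And>x. \<bar>k x\<bar> \<le> C" and l: "integrable lborel l" and f: "integrable lborel f"
 shows "conv k (conv l f) x = conv (conv k l) f x"
proof -
 note [measurable] = k(1) borel_measurable_integrable[OF l] borel_measurable_integrable[OF f]
 have C: "0 \<le> C" using k(2)[of 0] by simp
 have I: "integrable (lborel \<Otimes>\<^sub>M lborel) (\<lambda>(y, z). k (x - y) * (l (y - z) * f z))"
 proof (rule integrableI_bounded)
  have "(\<integral>\<^sup>+p. ennreal (norm (case p of (y, z) \<Rightarrow> k (x - y) * (l (y - z) * f z))) \<partial>(lborel \<Otimes>\<^sub>M lborel))
   = (NI z. (NI y. ennreal \<bar>k (x - y) * (l (y - z) * f z)\<bar>))"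
   by (subst lborel_pair.nn_integral_snd[symmetric]) (auto simp: case_prod_beta')
  also have "\<dots> \<le> (NI z. (NI y. ennreal \<bar>l (y - z)\<bar> * (ennreal C * ennreal \<bar>f z\<bar>)))"
  proof (intro nn_integral_mono)
   fix y z :: "real^4"
   have "\<bar>k (x - y) * (l (y - z) * f z)\<bar> \<le> C * (\<bar>l (y - z)\<bar> * \<bar>f z\<bar>)"
    unfolding abs_mult by (intro mult_right_mono k) auto
   then show "ennreal \<bar>k (x - y) * (l (y - z) * f z)\<bar> \<le> ennreal \<bar>l (y - z)\<bar> * (ennreal C * ennreal \<bar>f z\<bar>)"
    using C by (auto simp: ennreal_mult[symmetric] mult_ac intro!: ennreal_leI)
  qed
  also have "\<dots> = (NI z. nL l * (ennreal C * ennreal \<bar>f z\<bar>))"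
   using nn_integral_shift_minus[of "\<lambda>x. ennreal \<bar>l x\<bar>"] by (simp add: nn_integral_multc)
  also have "\<dots> = nL l * (ennreal C * nL f)"
   by (simp add: nn_integral_cmult)
  also have "\<dots> < \<infinity>"
   using l f by (auto simp: integrable_iff_nL ennreal_mult_less_top)
  finally show "(\<integral>\<^sup>+p. ennreal (norm (case p of (y, z) \<Rightarrow> k (x - y) * (l (y - z) * f z))) \<partial>(lborel \<Otimes>\<^sub>M lborel)) < \<infinity>" .
 qed (simp add: case_prod_beta')
 have "conv k (conv l f) x = (LI y. (LI z. k (x - y) * (l (y - z) * f z)))"
  unfolding conv_def by (simp add: mult.assoc)
 also have "\<dots> = (LI z. (LI y. k (x - y) * (l (y - z) * f z)))"
  using lborel_pair.Fubini_integral[of "\<lambda>y z. k (x - y) * (l (y - z) * f z)"] I by simp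
 also have "\<dots> = (LI z. conv k l (x - z) * f z)"
 proof (rule Bochner_Integration.integral_cong)
  fix z
  have "(LI y. k (x - y) * (l (y - z) * f z)) = (LI y. k (x - y) * l (y - z)) * f z"
   by (simp add: mult.assoc[symmetric])
  also have "(LI y. k (x - y) * l (y - z)) = (LI y. k (x - z - y) * l y)"
   using integral_shift[of "\<lambda>y. k (x - z - y) * l y" "- z"] by simp
  finally show "(LI y. k (x - y) * (l (y - z) * f z)) = conv k l (x - z) * f z"
   by (simp add: conv_def)
 qed simp
 finally show ?thesis by (simp add: conv_def)
qed

lemma abs_heatG_le: "t > 0 \<Longrightarrow> \<bar>heatG t x\<bar> \<le> 1 / t\<^sup>2"
 using heatG_le[of t x] by simp

lemma heatS_heatS:
 assumes "t > 0" "s > 0" "integrable lborel f"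
 shows "heatS t (heatS s f) = heatS (t + s) f"
proof -
 have "conv (heatG t) (heatG s) = heatG (t + s)"
  using assms by (simp add: conv_def heatG_conv_heatG fun_eq_iff)
 moreover have "heatS t (heatS s f) = conv (conv (heatG t) (heatG s)) f"
  by (rule ext, rule conv_assoc[of _ "1 / t\<^sup>2"]) (use assms abs_heatG_le[of t] in auto)
 ultimately show ?thesis by simp
qed

lemma heatS_heatP:
 assumes "t > 0" "s > 0" "integrable lborel f"
 shows "heatS t (heatP b s f) = heatP b (t + s) f"
proof -
 have "conv (heatG t) (gK b s) = gK b (t + s)"
  using assms by (simp add: conv_def heatG_conv_gK fun_eq_iff)
 moreover have "heatS t (heatP b s f) = conv (conv (heatG t) (gK b s)) f"
  by (rule ext, rule conv_assoc[of _ "1 / t\<^sup>2"]) (use assms abs_heatG_le[of t] in auto)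
 ultimately show ?thesis by simp
qed

text \<open>Moves a space integral inside the Duhamel integral. The bounded factor \<open>k\<close>
  is a heat kernel when the equation is restarted and the smoothed solution in the energy
  inequality.\<close>

lemma Fubini_time:
 fixes F :: "real \<Rightarrow> real^4 \<Rightarrow> real"
 assumes F[measurable]: "case_prod F \<in> borel_measurable (lborel \<Otimes>\<^sub>M lborel)" "k \<in> borel_measurable borel" "A \<in> sets borel"
  and k: "\<And>x. \<bar>k x\<bar> \<le> C" and n: "(\<integral>\<^sup>+s\<in>A. nL (F s) \<partial>lborel) \<le> ennreal B"
 shows "(LI y. k y * (LINT s:A|lborel. F s y)) = (LINT s:A|lborel. (LI y. k y * F s y))"
proof -
 have C: "0 \<le> C" using k[of 0] by simp
 have [measurable]: "(\<lambda>z. F (fst z) (snd z)) \<in> borel_measurable (lborel \<Otimes>\<^sub>M lborel)"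
  using F(1) by (simp add: case_prod_beta')
 have I: "integrable (lborel \<Otimes>\<^sub>M lborel) (\<lambda>(s, y). indicator A s * (k y * F s y))"
 proof (rule integrableI_bounded)
  have "(\<integral>\<^sup>+p. ennreal (norm (case p of (s, y) \<Rightarrow> indicator A s * (k y * F s y))) \<partial>(lborel \<Otimes>\<^sub>M lborel))
   = (NI s. (NI y. ennreal \<bar>indicator A s * (k y * F s y)\<bar>))"
   by (subst lborel.nn_integral_fst[symmetric]) (auto simp: case_prod_beta')
  also have "\<dots> \<le> (NI s. ennreal C * (nL (F s) * indicator A s))"
  proof (intro nn_integral_mono)
   fix s :: real
   have [measurable]: "F s \<in> borel_measurable borel" using measurable_Pair2[OF F(1), of s] by simp
   have "(NI y. ennreal \<bar>k y * F s y\<bar>) \<le> ennreal C * nL (F s)"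
   proof -
    have "(NI y. ennreal \<bar>k y * F s y\<bar>) \<le> (NI y. ennreal C * ennreal \<bar>F s y\<bar>)"
     using C by (intro nn_integral_mono) (auto simp: ennreal_mult[symmetric] abs_mult intro!: ennreal_leI mult_right_mono k)
    also have "\<dots> = ennreal C * nL (F s)" by (rule nn_integral_cmult) simp
    finally show ?thesis .
   qed
   then show "(NI y. ennreal \<bar>indicator A s * (k y * F s y)\<bar>) \<le> ennreal C * (nL (F s) * indicator A s)"
    by (auto split: split_indicator)
  qed
  also have "\<dots> = ennreal C * (\<integral>\<^sup>+s\<in>A. nL (F s) \<partial>lborel)"
   by (rule nn_integral_cmult) simp
  also have "\<dots> < \<infinity>" using n by (auto simp: ennreal_mult_less_top intro: le_less_trans)
  finally show "(\<integral>\<^sup>+p. ennreal (norm (case p of (s, y) \<Rightarrow> indicator A s * (k y * F s y))) \<partial>(lborel \<Otimes>\<^sub>M lborel)) < \<infinity>" .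
 qed (simp add: case_prod_beta')
 have "(LI y. k y * (LINT s:A|lborel. F s y)) = (LI y. (LI s. indicator A s * (k y * F s y)))"
 proof (rule Bochner_Integration.integral_cong)
  fix y
  have "k y * (LINT s:A|lborel. F s y) = (LI s. k y * (indicator A s * F s y))"
   unfolding set_lebesgue_integral_def by (simp del: integral_mult_left_zero integral_indicator add: integral_mult_right_zero)
  then show "k y * (LINT s:A|lborel. F s y) = (LI s. indicator A s * (k y * F s y))"
   by (simp only: mult.left_commute)
 qed simp
 also have "\<dots> = (LI s. (LI y. indicator A s * (k y * F s y)))"
  using lborel_pair.Fubini_integral[of "\<lambda>s y. indicator A s * (k y * F s y)"] I by simp
 finally show ?thesis by (simp add: set_lebesgue_integral_def)
qed

lemma nL_heatG: "t > 0 \<Longrightarrow> nL (heatG t) \<le> ennreal 1"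
 by (simp add: nn_integral_heatG)

lemma nL_gK: "t > 0 \<Longrightarrow> nL (gK b t) \<le> ennreal (kc * norm b / sqrt t)"
 by (rule nL_kernel_bound[OF gK_bound]) (auto simp: less_imp_le)

lemma nL_heatP:
 assumes "t > 0" "f \<in> borel_measurable borel" "nL f \<le> ennreal B" "0 \<le> B"
 shows "nL (heatP b t f) \<le> ennreal (kc * norm b / sqrt t * B)"
 by (rule nL_conv) (use assms nL_gK[of t b] kc_pos in \<open>auto simp: less_imp_le\<close>)

lemma abs_heatP_le:
 assumes "t > 0" "\<And>x. \<bar>f x\<bar> \<le> B"
 shows "\<bar>heatP b t f x\<bar> \<le> kc * norm b / sqrt t * B"
 by (rule abs_conv_le_sup_data) (use assms nL_gK[of t b] kc_pos in \<open>auto simp: less_imp_le\<close>)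

lemma nL_heatS:
 assumes "t > 0" "f \<in> borel_measurable borel" "nL f \<le> ennreal B" "0 \<le> B"
 shows "nL (heatS t f) \<le> ennreal B"
 using nL_conv[of "heatG t" f 1 B] nL_heatG[of t] assms by auto

lemma abs_heatS_le:
 assumes "t > 0" "\<And>x. \<bar>f x\<bar> \<le> B"
 shows "\<bar>heatS t f x\<bar> \<le> B"
 using abs_conv_le_sup_data[of "heatG t" f B 1] nL_heatG[of t] assms by auto

text \<open>Duhamel's formula is required from every starting time \<tau> \<ge> 0, for every x, with
  bounds that hold everywhere. Null sets are dealt with once, in
  \<open>mild_solution_representative\<close>, and the nonlinear estimates can restart at any
  time.\<close>

locale mild =
 fixes a :: "real^4" and v :: "real \<Rightarrow> real^4 \<Rightarrow> real"
 assumes v_meas: "case_prod v \<in> borel_measurable (lborel \<Otimes>\<^sub>M lborel)"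
  and v_local: "\<And>T. T > 0 \<Longrightarrow> \<exists>C\<ge>0. \<forall>t\<in>{0..T}. nL (v t) \<le> ennreal C \<and> (\<forall>x. \<bar>v t x\<bar> \<le> C)"
  and v_mild: "\<And>\<tau> t x. 0 \<le> \<tau> \<Longrightarrow> 0 < t \<Longrightarrow>
   v (\<tau> + t) x = heatS t (v \<tau>) x + (LINT s:{0<..<t}|lborel. heatP a (t - s) (\<lambda>y. (v (\<tau> + s) y)\<^sup>2) x)"
begin

lemma borel_measurable_v [measurable (raw)]:
 assumes [measurable]: "f \<in> borel_measurable M" "g \<in> borel_measurable M"
 shows "(\<lambda>z. v (f z) (g z)) \<in> borel_measurable M"
proof -
 have "(\<lambda>z. (f z, g z)) \<in> M \<rightarrow>\<^sub>M lborel \<Otimes>\<^sub>M lborel" by simp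
 from measurable_compose[OF this v_meas] show ?thesis by simp
qed

lemma v_borel [measurable]: "v t \<in> borel_measurable borel"
 by measurable

lemma borel_measurable_heatP_v [measurable (raw)]:
 assumes [measurable]: "f \<in> borel_measurable M" "g \<in> borel_measurable M" "h \<in> borel_measurable M"
 shows "(\<lambda>z. heatP b (f z) (\<lambda>y. (v (g z) y)\<^sup>2) (h z)) \<in> borel_measurable M"
 unfolding conv_def by measurable

lemma v_square_bounds:
 assumes "nL (v t) \<le> ennreal A" "\<And>x. \<bar>v t x\<bar> \<le> B" "0 \<le> A"
 shows "nL (\<lambda>y. (v t y)\<^sup>2) \<le> ennreal (A * B)" "\<bar>(v t x)\<^sup>2\<bar> \<le> B\<^sup>2"
proof -
 show "nL (\<lambda>y. (v t y)\<^sup>2) \<le> ennreal (A * B)"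
  using nL_mult_bounded[of "v t" A "v t" B] assms by (simp only: power2_eq_square) simp
 show "\<bar>(v t x)\<^sup>2\<bar> \<le> B\<^sup>2"
  using power_mono[OF assms(2)[of x], of 2] by (simp only: power_abs abs_ge_zero)
qed

end


section \<open>From an almost everywhere solution to a pointwise one\<close>

lemma partial_heatG:
 assumes "t > 0"
 shows "partial j (heatG t) = gK (axis j 1) t"
proof
 fix x
 show "partial j (heatG t) x = gK (axis j 1) t x"
  unfolding partial_def using DERIV_heatG_line[OF assms, of x "axis j 1" 0] by (simp add: DERIV_imp_deriv)
qed

lemma gK_sum: "gK a t x = (\<Sum>j\<in>UNIV. a $ j * gK (axis j 1) t x)"
 unfolding gK_def inner_axis' by (simp add: inner_vec_def sum_distrib_left sum_distrib_right sum_divide_distrib sum_negf mult_ac)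

lemma adot_grad_heatG:
 assumes "t > 0"
 shows "adot_grad a (heatG t) = gK a t"
 unfolding adot_grad_def partial_heatG[OF assms] by (simp add: fun_eq_iff gK_sum[of a])

lemma interval_split_shift:
 fixes F :: "real \<Rightarrow> real"
 assumes "set_integrable lborel {0<..<\<tau> + t} F" "0 \<le> \<tau>" "0 < t"
 shows "(LINT s:{0<..<\<tau> + t}|lborel. F s) = (LINT s:{0<..<\<tau>}|lborel. F s) + (LINT s:{0<..<t}|lborel. F (\<tau> + s))"
proof -
 have i: "set_integrable lborel A F" if "A \<subseteq> {0<..<\<tau> + t}" "A \<in> sets borel" for A
  by (rule set_integrable_subset[OF assms(1)]) (use that in auto)
 have "(LINT s:{0<..<\<tau> + t}|lborel. F s) = (LINT s:{0<..<\<tau>} \<union> {\<tau><..<\<tau> + t}|lborel. F s)"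
  unfolding set_lebesgue_integral_def
 proof (rule integral_cong_AE)
  show "AE s in lborel. indicator {0<..<\<tau> + t} s *\<^sub>R F s = indicator ({0<..<\<tau>} \<union> {\<tau><..<\<tau> + t}) s *\<^sub>R F s"
   using AE_lborel_singleton[of \<tau>] by eventually_elim (use assms in \<open>auto split: split_indicator\<close>)
  have "set_integrable lborel ({0<..<\<tau>} \<union> {\<tau><..<\<tau> + t}) F" by (rule i) (use assms in auto)
  then show "(\<lambda>s. indicator ({0<..<\<tau>} \<union> {\<tau><..<\<tau> + t}) s *\<^sub>R F s) \<in> borel_measurable lborel"
   unfolding set_integrable_def by (rule borel_measurable_integrable)
 qed (use assms in \<open>simp add: set_integrable_def borel_measurable_integrable del: real_scaleR_def\<close>)
 also have "\<dots> = (LINT s:{0<..<\<tau>}|lborel. F s) + (LINT s:{\<tau><..<\<tau> + t}|lborel. F s)"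
  by (rule set_integral_Un) (use assms in \<open>auto intro!: i\<close>)
 also have "(LINT s:{\<tau><..<\<tau> + t}|lborel. F s) = (LINT s:{0<..<t}|lborel. F (\<tau> + s))"
  unfolding set_lebesgue_integral_def
  by (subst lborel_integral_real_affine[where c = 1 and t = \<tau>])
   (auto intro!: Bochner_Integration.integral_cong split: split_indicator)
 finally show ?thesis .
qed

lemma measurable_two_arguments:
 assumes "(\<lambda>z. f (fst z) (snd z)) \<in> borel_measurable (lborel \<Otimes>\<^sub>M lborel)"
  and [measurable]: "g \<in> borel_measurable M" "h \<in> borel_measurable M"
 shows "(\<lambda>z. f (g z) (h z)) \<in> borel_measurable M"
proof -
 have "(\<lambda>z. (g z, h z)) \<in> M \<rightarrow>\<^sub>M lborel \<Otimes>\<^sub>M lborel" by simp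
 from measurable_compose[OF this assms(1)] show ?thesis by simp
qed

lemma abs_heatP_le_AE:
 assumes "t > 0" "AE x in lborel. \<bar>f x\<bar> \<le> B" "0 \<le> B"
 shows "\<bar>heatP b t f x\<bar> \<le> kc * norm b / sqrt t * B"
 by (rule abs_conv_le_sup_data_AE) (use assms nL_gK[of t b] kc_pos in \<open>auto simp: less_imp_le\<close>)

text \<open>The part of the time integral before \<tau> is brought under \<open>heatS t\<close> by
  Fubini and the semigroup law heat(t) after gK(\<tau> - s) equals gK(\<tau> + t - s). The source
  \<open>f\<close> is arbitrary because it is applied to the square of the original
  \<open>u\<close>, whose bounds hold only almost everywhere.\<close>

lemma duhamel_restart:
 fixes v0 :: "real^4 \<Rightarrow> real" and f :: "real \<Rightarrow> real^4 \<Rightarrow> real"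
 assumes f: "(\<lambda>z. f (fst z) (snd z)) \<in> borel_measurable (lborel \<Otimes>\<^sub>M lborel)" and v0: "integrable lborel v0"
  and fL: "\<And>s. 0 < s \<Longrightarrow> s < \<tau> + t \<Longrightarrow> nL (f s) \<le> ennreal C" and fS: "\<And>s. 0 < s \<Longrightarrow> s < \<tau> + t \<Longrightarrow> AE x in lborel. \<bar>f s x\<bar> \<le> C"
  and C: "0 \<le> C" and t: "0 < \<tau>" "0 < t"
 shows "heatS (\<tau> + t) v0 x + (LINT s:{0<..<\<tau> + t}|lborel. heatP a (\<tau> + t - s) (f s) x)
  = heatS t (\<lambda>y. heatS \<tau> v0 y + (LINT s:{0<..<\<tau>}|lborel. heatP a (\<tau> - s) (f s) y)) x
   + (LINT s:{0<..<t}|lborel. heatP a (t - s) (f (\<tau> + s)) x)"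
proof -
 note [measurable (raw)] = measurable_two_arguments[OF f]
 have [measurable]: "v0 \<in> borel_measurable borel" using v0 by simp
 have fm[measurable]: "f s \<in> borel_measurable borel" for s
  using measurable_compose[of "\<lambda>y. (s, y)" lborel "lborel \<Otimes>\<^sub>M lborel" _ borel, OF _ f] by simp
 have fi: "integrable lborel (f s)" if "0 < s" "s < \<tau> + t" for s
  using fL[OF that] by (intro integrable_nL_le) auto
 have kernel: "heatP a r (f s) y = (LI z. gK a r (y - z) * f s z)" for r s y
  by (simp add: conv_def)
 have m1: "case_prod (\<lambda>s y. heatP a (r - s) (f s) y) \<in> borel_measurable (lborel \<Otimes>\<^sub>M lborel)" for r
  unfolding case_prod_beta' conv_def
 proof (rule lborel.borel_measurable_lebesgue_integral)
  have "(\<lambda>p. ((fst (fst p)), snd p)) \<in> (lborel \<Otimes>\<^sub>M lborel) \<Otimes>\<^sub>M lborel \<rightarrow>\<^sub>M (lborel :: real measure) \<Otimes>\<^sub>M (lborel :: (real^4) measure)"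
   by measurable
  from measurable_compose[OF this f]
  show "(\<lambda>(x, y). gK a (r - fst x) (snd x - y) * f (fst x) y) \<in> borel_measurable ((lborel \<Otimes>\<^sub>M lborel) \<Otimes>\<^sub>M lborel)"
   by (simp add: case_prod_beta')
 qed
 have m2[measurable]: "(\<lambda>s. heatP a (r - s) (f s) y) \<in> borel_measurable borel" for r y
  using measurable_compose[of "\<lambda>s. (s, y)" lborel "lborel \<Otimes>\<^sub>M lborel", OF _ m1[of r]] by simp
 let ?c = "\<lambda>r s. kc * norm a * C * (1 / sqrt (r - s))"
 have cb: "(nT {0<..<r} (\<lambda>s. ?c r s)) \<le> ennreal (kc * norm a * C * (2 * sqrt r))" if "0 < r" for r
  using nn_integral_inverse_sqrt_reflect[of 0 r] that C kc_pos
  by (intro set_nn_integral_cmult) (auto simp: less_imp_le)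
 have PS: "\<bar>heatP a (r - s) (f s) y\<bar> \<le> ?c r s" if "0 < s" "s < r" "r \<le> \<tau> + t" for r s y
  using abs_heatP_le_AE[of "r - s" "f s" C a y] fS[of s] that C by (simp add: mult_ac)
 have PL: "nL (heatP a (r - s) (f s)) \<le> ennreal (?c r s)" if "0 < s" "s < r" "r \<le> \<tau> + t" for r s
  using nL_heatP[of "r - s" "f s" C a] fL[of s] that C by (simp add: mult_ac)
 have int: "set_integrable lborel {0<..<\<tau> + t} (\<lambda>s. heatP a (\<tau> + t - s) (f s) x)"
  by (rule set_integrableI_bounded_by[OF _ _ PS cb]) (use t in auto)
 have nb: "(\<integral>\<^sup>+s\<in>{0<..<\<tau>}. nL (heatP a (\<tau> - s) (f s)) \<partial>lborel) \<le> ennreal (kc * norm a * C * (2 * sqrt \<tau>))"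
  by (rule order_trans[OF nn_integral_mono cb]) (use t PL in \<open>auto split: split_indicator\<close>)
 have Im[measurable]: "(\<lambda>y. LINT s:{0<..<\<tau>}|lborel. heatP a (\<tau> - s) (f s) y) \<in> borel_measurable borel"
 proof -
  have "(\<lambda>p. (snd p, fst p)) \<in> lborel \<Otimes>\<^sub>M lborel \<rightarrow>\<^sub>M (lborel :: real measure) \<Otimes>\<^sub>M (lborel :: (real^4) measure)" by measurable
  from measurable_compose[OF this m1[of \<tau>]]
  have [measurable]: "(\<lambda>p. heatP a (\<tau> - snd p) (f (snd p)) (fst p)) \<in> borel_measurable (lborel \<Otimes>\<^sub>M (lborel :: real measure))"
   by (simp add: case_prod_beta')
  have "(\<lambda>y. LINT s:{0<..<\<tau>}|lborel. heatP a (\<tau> - s) (f s) y) \<in> borel_measurable lborel"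
   unfolding set_lebesgue_integral_def
   by (rule lborel.borel_measurable_lebesgue_integral) (simp add: case_prod_beta')
  then show ?thesis by simp
 qed
 have IL: "nL (\<lambda>y. LINT s:{0<..<\<tau>}|lborel. heatP a (\<tau> - s) (f s) y) \<le> ennreal (kc * norm a * C * (2 * sqrt \<tau>))"
  using order_trans[OF minkowski_time[OF m1[of \<tau>], of "\<lambda>_. 1" "{0<..<\<tau>}" "\<lambda>s. ennreal (?c \<tau> s)"] cb[of \<tau>]] PL t by auto
 have "heatS t (\<lambda>y. heatS \<tau> v0 y + (LINT s:{0<..<\<tau>}|lborel. heatP a (\<tau> - s) (f s) y)) x
  = heatS t (heatS \<tau> v0) x + heatS t (\<lambda>y. LINT s:{0<..<\<tau>}|lborel. heatP a (\<tau> - s) (f s) y) x"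
 proof -
  have b: "\<bar>heatG t (x - y)\<bar> \<le> 1 / t\<^sup>2" for y using abs_heatG_le[OF t(2)] .
  have "integrable lborel (\<lambda>y. heatG t (x - y) * g y)" if "integrable lborel g" for g :: "real^4 \<Rightarrow> real"
   by (rule Bochner_Integration.integrable_bound[OF integrable_mult_right[of "1 / t\<^sup>2", OF that]])
     (use that b in \<open>auto simp: abs_mult intro!: mult_right_mono simp del: times_divide_eq_left\<close>)
  moreover have "integrable lborel (heatS \<tau> v0)"
   using nL_heatS[OF t(1), of v0 "LI x. \<bar>v0 x\<bar>"] v0 nL_integral[OF v0] by (intro integrable_nL_le) auto
  moreover note integrable_nL_le[OF Im IL]
  ultimately show ?thesis
   unfolding conv_def[of "heatG t"] by (subst Bochner_Integration.integral_add[symmetric]) (auto simp: distrib_left)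
 qed
 also have "heatS t (heatS \<tau> v0) = heatS (\<tau> + t) v0"
  using heatS_heatS[OF t(2,1) v0] by (simp add: add.commute)
 also have "heatS t (\<lambda>y. LINT s:{0<..<\<tau>}|lborel. heatP a (\<tau> - s) (f s) y) x
   = (LINT s:{0<..<\<tau>}|lborel. heatS t (heatP a (\<tau> - s) (f s)) x)"
  unfolding conv_def[of "heatG t"]
  by (rule Fubini_time[OF m1 _ _ _ nb, of _ "1 / t\<^sup>2"]) (use abs_heatG_le[OF t(2)] in auto)
 also have "\<dots> = (LINT s:{0<..<\<tau>}|lborel. heatP a (\<tau> + t - s) (f s) x)"
  by (rule set_lebesgue_integral_cong)
   (use t fi in \<open>auto simp: heatS_heatP add_diff_eq add.commute\<close>)
 finally show ?thesis
  using interval_split_shift[OF int] t by (simp add: add_diff_eq[symmetric])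
qed

lemma conv_cong_AE:
 assumes [measurable]: "k \<in> borel_measurable borel" "f \<in> borel_measurable borel" "g \<in> borel_measurable borel"
  and "AE y in lborel. f y = g y"
 shows "conv k f = conv k g"
 unfolding conv_def
 by (intro ext integral_cong_AE) (use assms(4) in \<open>auto elim!: eventually_mono\<close>)

text \<open>The representative \<open>v\<close> is the right-hand side of Duhamel's formula
  evaluated with \<open>u\<close>. It equals \<open>u\<close> almost everywhere at each positive
  time, and a convolution does not see null sets, so \<open>v\<close> satisfies the formula with its
  own square, now at every point.\<close>

lemma mild_solution_representative:
 assumes u0: "integrable lborel u0" and b: "AE x in lborel. \<bar>u0 x\<bar> \<le> C0" and sol: "mild_solution a u0 u"
 obtains v where "mild a v" "AE x in lborel. v 0 x = u0 x" "\<And>t. t > 0 \<Longrightarrow> AE x in lborel. u t x = v t x"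
proof -
 define K0 where "K0 = max 0 C0"
 \<comment> \<open>Truncation changes \<open>u0\<close> only on a null set and makes the bound at
   time 0 hold everywhere.\<close>
 define w where "w x = (if \<bar>u0 x\<bar> \<le> K0 then u0 x else 0)" for x
 define f where "f s y = (u s y)\<^sup>2" for s y
 define v where "v t x = (if t \<le> 0 then w x else heatS t w x + (LINT s:{0<..<t}|lborel. heatP a (t - s) (f s) x))" for t x
 note [measurable] = borel_measurable_integrable[OF u0]
 have wm[measurable]: "w \<in> borel_measurable borel" unfolding w_def by measurable
 have wu: "AE x in lborel. w x = u0 x" using b by eventually_elim (auto simp: w_def K0_def)
 have wb: "\<bar>w x\<bar> \<le> K0" for x by (auto simp: w_def K0_def)
 have wL: "nL w \<le> nL u0" by (intro nn_integral_mono) (auto simp: w_def)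
 have wi: "integrable lborel w" using u0 wL by (auto simp: integrable_iff_nL intro: le_less_trans)
 have um: "(\<lambda>z. u (fst z) (snd z)) \<in> borel_measurable (lborel \<Otimes>\<^sub>M lborel)"
  using sol by (simp add: mild_solution_def)
 note [measurable (raw)] = measurable_two_arguments[OF um]
 have fm: "(\<lambda>z. f (fst z) (snd z)) \<in> borel_measurable (lborel \<Otimes>\<^sub>M lborel)"
  unfolding f_def by measurable
 note [measurable (raw)] = measurable_two_arguments[OF fm]
 have um'[measurable]: "u t \<in> borel_measurable borel" for t by measurable
 have fm'[measurable]: "f t \<in> borel_measurable borel" for t by measurable
 have loc: "\<exists>C\<ge>0. \<forall>t\<in>{0<..T}. nL (u t) \<le> ennreal C \<and> (AE x in lborel. \<bar>u t x\<bar> \<le> C) \<and> nL (f t) \<le> ennreal (C * C) \<and> (AE x in lborel. \<bar>f t x\<bar> \<le> C * C)"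
  if T: "T > 0" for T
 proof -
  obtain C where C: "\<And>t. t \<in> {0<..T} \<Longrightarrow> integrable lborel (u t) \<and> (LI x. \<bar>u t x\<bar>) \<le> C \<and> (AE x in lborel. \<bar>u t x\<bar> \<le> C)"
   using sol T unfolding mild_solution_def by meson
  have "0 \<le> (LI x. \<bar>u T x\<bar>)" by simp
  moreover have "(LI x. \<bar>u T x\<bar>) \<le> C" using C[of T] T by auto
  ultimately have C0: "0 \<le> C" by (rule order_trans)
  have 1: "nL (u t) \<le> ennreal C" if "t \<in> {0<..T}" for t
   using C[OF that] by (subst nL_integral) (auto intro: ennreal_leI)
  have 2: "AE x in lborel. \<bar>f t x\<bar> \<le> C * C" if "t \<in> {0<..T}" for t
   using conjunct2[OF conjunct2[OF C[OF that]]]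
   by eventually_elim (simp add: f_def power2_eq_square abs_mult mult_mono C0 del: abs_mult_self_eq)
  have 3: "nL (f t) \<le> ennreal (C * C)" if "t \<in> {0<..T}" for t
  proof -
   have "nL (f t) \<le> (NI x. ennreal C * ennreal \<bar>u t x\<bar>)"
   proof (rule nn_integral_mono_AE)
    show "AE x in lborel. ennreal \<bar>f t x\<bar> \<le> ennreal C * ennreal \<bar>u t x\<bar>"
     using conjunct2[OF conjunct2[OF C[OF that]]]
     by eventually_elim (simp add: f_def power2_eq_square abs_mult ennreal_mult[symmetric] C0 mult_right_mono ennreal_leI del: abs_mult_self_eq)
   qed
   also have "\<dots> = ennreal C * nL (u t)" by (rule nn_integral_cmult) simp
   also have "\<dots> \<le> ennreal C * ennreal C" by (intro mult_left_mono 1 that) auto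
   finally show ?thesis using C0 by (simp add: ennreal_mult)
  qed
  show ?thesis using C0 1 2 3 C by blast
 qed
 have uv: "AE x in lborel. u t x = v t x" if t: "t > 0" for t
 proof -
  have "AE x in lborel. u t x = (LI y. heatG t (x - y) * u0 y)
       + (LINT s:{0<..<t}|lborel. (LI y. adot_grad a (heatG (t - s)) (x - y) * (u s y)^2))"
   using sol t unfolding mild_solution_def by blast
  moreover have "(LI y. heatG t (x - y) * u0 y) = heatS t w x" for x
   using conv_cong_AE[OF _ _ wm, of "heatG t" u0] wu by (auto simp: conv_def fun_eq_iff eq_commute)
  moreover have "(LINT s:{0<..<t}|lborel. (LI y. adot_grad a (heatG (t - s)) (x - y) * (u s y)^2))
   = (LINT s:{0<..<t}|lborel. heatP a (t - s) (f s) x)" for x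
   by (rule set_lebesgue_integral_cong) (auto simp: adot_grad_heatG conv_def f_def)
  ultimately show ?thesis using t by (simp add: v_def)
 qed
 have vm: "(\<lambda>z. v (fst z) (snd z)) \<in> borel_measurable (lborel \<Otimes>\<^sub>M lborel)"
 proof -
  \<comment> \<open>The interval depends on t, so joint measurability needs its indicator as a
    condition on the pair (s, t).\<close>
  have i: "indicator {0<..<t} s = (if 0 < s \<and> s < t then 1 else 0 :: real)" for s t :: real by (auto split: split_indicator)
  show ?thesis
   unfolding v_def set_lebesgue_integral_def conv_def i by measurable
 qed
 note [measurable (raw)] = measurable_two_arguments[OF vm]
 have v'[measurable]: "v t \<in> borel_measurable borel" for t by measurable
 have fv: "heatP a r (f s) = heatP a r (\<lambda>y. (v s y)\<^sup>2)" if "s > 0" for r s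
  by (rule conv_cong_AE) (use uv[OF that] in \<open>auto simp: f_def elim!: eventually_mono\<close>)
 have v_pos: "v t x = heatS t w x + (LINT s:{0<..<t}|lborel. heatP a (t - s) (f s) x)" if "t > 0" for t x
  using that by (simp add: v_def)
 have v0: "v 0 = w" by (simp add: v_def fun_eq_iff)
 have "mild a v"
 proof
  show "case_prod v \<in> borel_measurable (lborel \<Otimes>\<^sub>M lborel)" using vm by (simp add: case_prod_beta')
 next
  fix T :: real assume T: "T > 0"
  obtain C where C: "C \<ge> 0" "\<And>t. t \<in> {0<..T} \<Longrightarrow> nL (u t) \<le> ennreal C \<and> (AE x in lborel. \<bar>f t x\<bar> \<le> C * C)"
   using loc[OF T] by blast
  define D where "D = C + K0 + kc * norm a * (C * C) * (2 * sqrt T) + (LI x. \<bar>w x\<bar>)"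
  have K0: "0 \<le> K0" by (simp add: K0_def)
  have p: "0 \<le> kc * norm a * (C * C) * (2 * sqrt T)" "0 \<le> (LI x. \<bar>w x\<bar>)"
   using kc_pos C T by (auto simp: less_imp_le)
  have D: "0 \<le> D" using C K0 p by (simp add: D_def)
  have "nL (v t) \<le> ennreal D" if "t \<in> {0..T}" for t
  proof (cases "t = 0")
   case True
   then show ?thesis using nL_integral[OF wi] C K0 p by (auto simp: v0 D_def intro!: ennreal_leI)
  next
   case False
   then have "nL (v t) = nL (u t)"
    using that by (intro nn_integral_cong_AE) (auto intro: eventually_mono[OF uv[of t]])
   also have "\<dots> \<le> ennreal C" using C(2)[of t] that False by auto
   also have "\<dots> \<le> ennreal D" using K0 p by (intro ennreal_leI) (simp add: D_def)
   finally show ?thesis .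
  qed
  moreover have "\<bar>v t x\<bar> \<le> D" if "t \<in> {0..T}" for t x
  proof (cases "t = 0")
   case True
   then have "\<bar>v t x\<bar> \<le> K0" using wb[of x] by (simp add: v0)
   also have "K0 \<le> D" using C(1) p unfolding D_def by linarith
   finally show ?thesis .
  next
   case False
   then have t: "0 < t" "t \<le> T" using that by auto
   have "\<bar>heatS t w x\<bar> \<le> K0" by (rule abs_heatS_le[OF t(1) wb])
   moreover have "\<bar>LINT s:{0<..<t}|lborel. heatP a (t - s) (f s) x\<bar> \<le> kc * norm a * (C * C) * (2 * sqrt t)"
   proof (rule abs_set_integral_le)
    show "(nT {0<..<t} (\<lambda>s. kc * norm a * (C * C) * (1 / sqrt (t - s)))) \<le> ennreal (kc * norm a * (C * C) * (2 * sqrt t))"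
     using nn_integral_inverse_sqrt_reflect[of 0 t] t C kc_pos by (intro set_nn_integral_cmult) (auto simp: less_imp_le)
    fix s assume "s \<in> {0<..<t}"
    then show "\<bar>heatP a (t - s) (f s) x\<bar> \<le> kc * norm a * (C * C) * (1 / sqrt (t - s))"
     using abs_heatP_le_AE[of "t - s" "f s" "C * C" a x] C(2)[of s] t C(1) by (simp add: mult_ac)
   qed (use t C kc_pos in \<open>auto simp: less_imp_le\<close>)
   moreover have "kc * norm a * (C * C) * (2 * sqrt t) \<le> kc * norm a * (C * C) * (2 * sqrt T)"
    using t C kc_pos by (intro mult_left_mono) (auto simp: less_imp_le)
   ultimately show ?thesis using v_pos[OF t(1), of x] C p unfolding D_def by linarith
  qed
  ultimately show "\<exists>C\<ge>0. \<forall>t\<in>{0..T}. nL (v t) \<le> ennreal C \<and> (\<forall>x. \<bar>v t x\<bar> \<le> C)" using D by blast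
 next
  fix \<tau> t :: real and x assume t: "0 \<le> \<tau>" "0 < t"
  have e: "(LINT s:{0<..<t}|lborel. heatP a (t - s) (f (\<tau> + s)) x) = (LINT s:{0<..<t}|lborel. heatP a (t - s) (\<lambda>y. (v (\<tau> + s) y)\<^sup>2) x)"
   by (rule set_lebesgue_integral_cong) (use t in \<open>auto simp: fv\<close>)
  show "v (\<tau> + t) x = heatS t (v \<tau>) x + (LINT s:{0<..<t}|lborel. heatP a (t - s) (\<lambda>y. (v (\<tau> + s) y)\<^sup>2) x)"
  proof (cases "\<tau> = 0")
   case True
   then show ?thesis using t e by (simp add: v_pos v0)
  next
   case False
   obtain C where C: "C \<ge> 0" "\<And>s. s \<in> {0<..\<tau> + t} \<Longrightarrow> nL (f s) \<le> ennreal (C * C) \<and> (AE x in lborel. \<bar>f s x\<bar> \<le> C * C)"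
    using loc[of "\<tau> + t"] t by (metis add_nonneg_pos)
   have "v (\<tau> + t) x = heatS t (\<lambda>y. heatS \<tau> w y + (LINT s:{0<..<\<tau>}|lborel. heatP a (\<tau> - s) (f s) y)) x
     + (LINT s:{0<..<t}|lborel. heatP a (t - s) (f (\<tau> + s)) x)"
    using t False C(2) duhamel_restart[OF fm wi, of \<tau> t "C * C" x a] C(1) by (simp add: v_pos)
   also have "(\<lambda>y. heatS \<tau> w y + (LINT s:{0<..<\<tau>}|lborel. heatP a (\<tau> - s) (f s) y)) = v \<tau>"
    using t False by (simp add: v_pos fun_eq_iff)
   finally show ?thesis using e by simp
  qed
 qed
 moreover have "AE x in lborel. v 0 x = u0 x" using wu by (simp add: v0)
 ultimately show thesis using uv that by blast
qed

section \<open>Smoothing and dissipation of the heat flow\<close>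

lemma conv_reflect:
 assumes [measurable]: "k \<in> borel_measurable borel" "f \<in> borel_measurable borel"
 shows "conv k f x = (LI y. k y * f (x - y))"
 using integral_reflect[of "\<lambda>y. k y * f (x - y)" x] by (simp add: conv_def)

lemma integrable_mult_bounded:
 fixes f g :: "real^4 \<Rightarrow> real"
 assumes "integrable lborel f" and [measurable]: "g \<in> borel_measurable borel" and g: "\<And>x. \<bar>g x\<bar> \<le> C"
 shows "integrable lborel (\<lambda>x. f x * g x)"
proof (rule Bochner_Integration.integrable_bound[OF integrable_mult_right[of C "lborel :: (real^4) measure" f]])
 show "AE x in lborel. norm (f x * g x) \<le> norm (C * f x)"
 proof (intro AE_I2)
  fix x
  have "\<bar>g x\<bar> * \<bar>f x\<bar> \<le> \<bar>C\<bar> * \<bar>f x\<bar>" using g[of x] by (intro mult_right_mono) auto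
  then show "norm (f x * g x) \<le> norm (C * f x)" by (simp add: abs_mult mult.commute)
 qed
qed (use assms in auto)

lemma integrable_conv_kernel:
 fixes f k :: "real^4 \<Rightarrow> real"
 assumes "integrable lborel k" and [measurable]: "f \<in> borel_measurable borel" and f: "\<And>x. \<bar>f x\<bar> \<le> C"
 shows "integrable lborel (\<lambda>y. k (x - y) * f y)"
 by (rule integrable_mult_bounded[OF integrable_reflect[OF assms(1)]]) (use f in auto)

lemma integrable_conv_data:
 fixes f k :: "real^4 \<Rightarrow> real"
 assumes "integrable lborel f" and [measurable]: "k \<in> borel_measurable borel" and k: "\<And>x. \<bar>k x\<bar> \<le> C"
 shows "integrable lborel (\<lambda>y. k (x - y) * f y)"
 using integrable_mult_bounded[OF assms(1), of "\<lambda>y. k (x - y)" C] k by (simp add: mult.commute)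

lemma gK_abs_le: "t > 0 \<Longrightarrow> \<bar>gK b t x\<bar> \<le> kc * norm b / sqrt t * (1 / t\<^sup>2)"
proof -
 assume t: "t > 0"
 have "\<bar>gK b t x\<bar> \<le> kc * norm b / sqrt t * heatG (2 * t) x" by (rule gK_bound[OF t])
 also have "\<dots> \<le> kc * norm b / sqrt t * (1 / t\<^sup>2)"
 proof (rule mult_left_mono)
  have "1 / (2 * t)\<^sup>2 \<le> 1 / t\<^sup>2" using t by (intro divide_left_mono power_mono) auto
  then show "heatG (2 * t) x \<le> 1 / t\<^sup>2" using heatG_le[of "2 * t" x] t by linarith
  show "0 \<le> kc * norm b / sqrt t" using t kc_pos by (auto simp: less_imp_le)
 qed
 finally show ?thesis .
qed

lemma hG_abs_le: "t > 0 \<Longrightarrow> \<bar>hG b c t x\<bar> \<le> kc * (norm b * norm c) / t * (1 / t\<^sup>2)"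
proof -
 assume t: "t > 0"
 have "\<bar>hG b c t x\<bar> \<le> kc * (norm b * norm c) / t * heatG (2 * t) x" using hG_bound[OF t] t by simp
 also have "\<dots> \<le> kc * (norm b * norm c) / t * (1 / t\<^sup>2)"
 proof (rule mult_left_mono)
  have "1 / (2 * t)\<^sup>2 \<le> 1 / t\<^sup>2" using t by (intro divide_left_mono power_mono) auto
  then show "heatG (2 * t) x \<le> 1 / t\<^sup>2" using heatG_le[of "2 * t" x] t by linarith
  show "0 \<le> kc * (norm b * norm c) / t" using t kc_pos by (auto simp: less_imp_le)
 qed
 finally show ?thesis .
qed

lemma continuous_heatG_line: "t > 0 \<Longrightarrow> continuous_on UNIV (\<lambda>\<theta>. A * heatG t (x + \<theta> *\<^sub>R d))"
 by (intro continuous_at_imp_continuous_on ballI continuous_intros DERIV_isCont[OF DERIV_heatG_line]) 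

lemma nL_heatG_translate:
 assumes t: "t > 0"
 shows "nL (\<lambda>x. heatG t (x - y) - heatG t x) \<le> ennreal (kc * norm y / sqrt t)"
proof (rule nL_line_bound(1)[of "2 * t" _ _ "- y"])
 show "0 \<le> kc * norm y / sqrt t" using t kc_pos by (auto simp: less_imp_le)
 fix x
 show "ennreal \<bar>heatG t (x - y) - heatG t x\<bar> \<le> (nT {0..1} (\<lambda>\<theta>. kc * norm y / sqrt t * heatG (2 * t) (x + \<theta> *\<^sub>R - y)))"
  using taylor1_integral_bound[OF DERIV_heatG_line[OF t, of x "- y"] _ continuous_heatG_line[of "2 * t" "kc * norm y / sqrt t" x "- y"]]
   gK_bound[OF t, of "- y"] t by simp
qed (use t in auto)

lemma nL_gK_translate:
 assumes t: "t > 0"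
 shows "nL (\<lambda>x. gK b t (x - y) - gK b t x) \<le> ennreal (kc * (norm b * norm y) / t)"
proof (rule nL_line_bound(1)[of "2 * t" _ _ "- y"])
 show "0 \<le> kc * (norm b * norm y) / t" using t kc_pos by (auto simp: less_imp_le)
 fix x
 show "ennreal \<bar>gK b t (x - y) - gK b t x\<bar> \<le> (nT {0..1} (\<lambda>\<theta>. kc * (norm b * norm y) / t * heatG (2 * t) (x + \<theta> *\<^sub>R - y)))"
  using taylor1_integral_bound[OF DERIV_gK_line[OF t, of b x "- y"] _ continuous_heatG_line[of "2 * t" "kc * (norm b * norm y) / t" x "- y"]]
   hG_bound[OF t, of b "- y"] t by simp
qed (use t in auto)

lemma DERIV_quadratic_bound:
 fixes f :: "real \<Rightarrow> real"
 assumes "\<And>\<theta>. \<bar>f \<theta> - f 0 - \<theta> * D\<bar> \<le> K * \<theta>\<^sup>2"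
 shows "(f has_real_derivative D) (at 0)"
 unfolding DERIV_def
proof (rule LIM_zero_cancel, rule Lim_null_comparison)
 show "\<forall>\<^sub>F h in at 0. norm ((f (0 + h) - f 0) / h - D) \<le> \<bar>K\<bar> * \<bar>h\<bar>"
  unfolding eventually_at_filter
 proof (intro always_eventually allI impI)
  fix h :: real assume h: "h \<noteq> 0"
  have "\<bar>(f (0 + h) - f 0) / h - D\<bar> = \<bar>f h - f 0 - h * D\<bar> / \<bar>h\<bar>"
   using h by (simp add: abs_divide[symmetric] diff_divide_distrib)
  also have "\<dots> \<le> K * h\<^sup>2 / \<bar>h\<bar>" using assms[of h] by (intro divide_right_mono) auto
  also have "\<dots> \<le> \<bar>K\<bar> * h\<^sup>2 / \<bar>h\<bar>" by (intro divide_right_mono mult_right_mono) auto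
  also have "\<dots> = \<bar>K\<bar> * \<bar>h\<bar>" using h by (cases "h > 0") (auto simp: power2_eq_square)
  finally show "norm ((f (0 + h) - f 0) / h - D) \<le> \<bar>K\<bar> * \<bar>h\<bar>" by simp
 qed
 show "((\<lambda>h. \<bar>K\<bar> * \<bar>h\<bar>) \<longlongrightarrow> 0) (at 0)" by (rule tendsto_eq_intros refl | simp)+
qed

lemma second_order_bound:
 fixes \<phi> \<phi>1 \<phi>2 :: "real \<Rightarrow> real"
 assumes d: "\<And>\<theta>. (\<phi> has_real_derivative \<phi>1 \<theta>) (at \<theta>)" "\<And>\<theta>. (\<phi>1 has_real_derivative \<phi>2 \<theta>) (at \<theta>)"
  and b: "\<And>\<theta>. \<bar>\<phi>2 \<theta>\<bar> \<le> M"
 shows "\<bar>\<phi>1 \<theta> - \<phi>1 0\<bar> \<le> M * \<bar>\<theta>\<bar>" "\<bar>\<phi> \<theta> - \<phi> 0 - \<theta> * \<phi>1 0\<bar> \<le> M * \<theta>\<^sup>2"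
proof -
 have 1: "\<bar>\<phi>1 \<theta> - \<phi>1 0\<bar> \<le> M * \<bar>\<theta>\<bar>" for \<theta>
  using field_differentiable_bound[of UNIV \<phi>1 \<phi>2 M \<theta> 0] d b by simp
 then show "\<bar>\<phi>1 \<theta> - \<phi>1 0\<bar> \<le> M * \<bar>\<theta>\<bar>" .
 have M: "0 \<le> M" using b[of 0] by simp
 have "\<bar>(\<phi> \<theta> - \<theta> * \<phi>1 0) - (\<phi> 0 - 0 * \<phi>1 0)\<bar> \<le> (M * \<bar>\<theta>\<bar>) * \<bar>\<theta> - 0\<bar>"
 proof (rule field_differentiable_bound[where S = "{- \<bar>\<theta>\<bar>..\<bar>\<theta>\<bar>}" and f' = "\<lambda>\<theta>. \<phi>1 \<theta> - \<phi>1 0", simplified real_norm_def])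
  fix z assume z: "z \<in> {- \<bar>\<theta>\<bar>..\<bar>\<theta>\<bar>}"
  show "((\<lambda>\<theta>. \<phi> \<theta> - \<theta> * \<phi>1 0) has_real_derivative \<phi>1 z - \<phi>1 0) (at z within {- \<bar>\<theta>\<bar>..\<bar>\<theta>\<bar>})"
   by (rule DERIV_subset[OF _ subset_UNIV]) (auto intro!: derivative_eq_intros d)
  have "M * \<bar>z\<bar> \<le> M * \<bar>\<theta>\<bar>" using z M by (intro mult_left_mono) auto
  then show "\<bar>\<phi>1 z - \<phi>1 0\<bar> \<le> M * \<bar>\<theta>\<bar>" using 1[of z] by linarith
 qed auto
 then show "\<bar>\<phi> \<theta> - \<phi> 0 - \<theta> * \<phi>1 0\<bar> \<le> M * \<theta>\<^sup>2"
  by (simp add: power2_eq_square mult.assoc)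
qed

lemma abs_integral_product_le:
 fixes k f :: "real^4 \<Rightarrow> real"
 assumes "integrable lborel f" "\<And>y. \<bar>k y\<bar> \<le> M"
 shows "\<bar>LI y. k y * f y\<bar> \<le> M * (LI y. \<bar>f y\<bar>)"
proof -
 have M: "0 \<le> M" using assms(2)[of 0] by simp
 have "ennreal \<bar>LI y. k y * f y\<bar> \<le> (NI y. ennreal \<bar>k y * f y\<bar>)"
  by (rule ennreal_abs_integral_le)
 also have "\<dots> \<le> (NI y. ennreal M * ennreal \<bar>f y\<bar>)"
  using M by (intro nn_integral_mono) (auto simp: abs_mult ennreal_mult[symmetric] intro!: ennreal_leI mult_right_mono assms)
 also have "\<dots> = ennreal M * nL f" using assms(1) by (intro nn_integral_cmult) auto
 also have "\<dots> = ennreal (M * (LI y. \<bar>f y\<bar>))"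
  using nL_integral[OF assms(1)] M by (simp add: ennreal_mult)
 finally show ?thesis using M by simp
qed

text \<open>The second derivative \<open>hG\<close> of the kernel is bounded, so the first-order
  remainder is at most a constant times \<theta>^2, uniformly in the convolution variable.
  Integrated against |f| it is still quadratic, which replaces differentiation under the
  integral.\<close>

lemma DERIV_heatS_line:
 assumes t: "t > 0" and f: "integrable lborel f"
 shows "((\<lambda>\<theta>. heatS t f (x + \<theta> *\<^sub>R b)) has_real_derivative heatP b t f x) (at 0)"
proof (rule DERIV_quadratic_bound)
 fix \<theta> :: real
 let ?M = "kc * (norm b * norm b) / t * (1 / t\<^sup>2)"
 have "integrable lborel (\<lambda>y. heatG t (z - y) * f y)" for z
  by (rule integrable_conv_data[OF f, of _ "1 / t\<^sup>2"]) (use abs_heatG_le[OF t] in auto)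
 moreover have "integrable lborel (\<lambda>y. gK b t (z - y) * f y)" for z
  by (rule integrable_conv_data[OF f _ gK_abs_le[OF t]]) auto
 ultimately have "heatS t f (x + \<theta> *\<^sub>R b) - heatS t f (x + 0 *\<^sub>R b) - \<theta> * heatP b t f x
   = (LI y. heatG t (x + \<theta> *\<^sub>R b - y) * f y - heatG t (x - y) * f y - \<theta> * (gK b t (x - y) * f y))"
  by (simp add: conv_def)
 also have "\<dots> = (LI y. (heatG t (x - y + \<theta> *\<^sub>R b) - heatG t (x - y + 0 *\<^sub>R b) - \<theta> * gK b t (x - y + 0 *\<^sub>R b)) * f y)"
  by (intro Bochner_Integration.integral_cong) (simp_all add: algebra_simps)
 also have "\<bar>\<dots>\<bar> \<le> ?M * \<theta>\<^sup>2 * (LI y. \<bar>f y\<bar>)"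
  by (rule abs_integral_product_le[OF f])
    (rule second_order_bound(2)[OF DERIV_heatG_line[OF t] DERIV_gK_line[OF t] hG_abs_le[OF t]])
 finally show "\<bar>heatS t f (x + \<theta> *\<^sub>R b) - heatS t f (x + 0 *\<^sub>R b) - \<theta> * heatP b t f x\<bar> \<le> ?M * (LI y. \<bar>f y\<bar>) * \<theta>\<^sup>2"
  by (simp only: mult_ac)
qed

lemma continuous_heatP:
 assumes t: "t > 0" and f: "integrable lborel f"
 shows "continuous_on UNIV (heatP b t f)"
proof (rule lipschitz_on_continuous_on[of "kc * norm b / t * (1 / t\<^sup>2) * (LI y. \<bar>f y\<bar>)"], rule lipschitz_onI)
 fix x z :: "real^4"
 let ?M = "kc * (norm b * norm (x - z)) / t * (1 / t\<^sup>2)"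
 have "integrable lborel (\<lambda>y. gK b t (z - y) * f y)" for z
  by (rule integrable_conv_data[OF f _ gK_abs_le[OF t]]) auto
 then have "heatP b t f x - heatP b t f z = (LI y. (gK b t (x - y) - gK b t (z - y)) * f y)"
  by (simp add: conv_def algebra_simps)
 also have "\<bar>\<dots>\<bar> \<le> ?M * (LI y. \<bar>f y\<bar>)"
 proof (rule abs_integral_product_le[OF f])
  fix y
  have "\<bar>gK b t (z - y + 1 *\<^sub>R (x - z)) - gK b t (z - y + 0 *\<^sub>R (x - z))\<bar> \<le> ?M * \<bar>1 - 0\<bar>"
   using field_differentiable_bound[of UNIV "\<lambda>\<theta>. gK b t (z - y + \<theta> *\<^sub>R (x - z))" "\<lambda>\<theta>. hG b (x - z) t (z - y + \<theta> *\<^sub>R (x - z))" ?M 1 0]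
    DERIV_gK_line[OF t] hG_abs_le[OF t] by simp
  then show "\<bar>gK b t (x - y) - gK b t (z - y)\<bar> \<le> ?M" by (simp add: algebra_simps)
 qed
 finally show "dist (heatP b t f x) (heatP b t f z) \<le> kc * norm b / t * (1 / t\<^sup>2) * (LI y. \<bar>f y\<bar>) * dist x z"
  by (simp add: dist_norm mult_ac)
qed (use t kc_pos in \<open>auto simp: less_imp_le\<close>)

lemma continuous_heatS:
 assumes t: "t > 0" and f: "integrable lborel f"
 shows "continuous_on UNIV (heatS t f)"
proof (rule lipschitz_on_continuous_on[of "kc / sqrt t * (1 / t\<^sup>2) * (LI y. \<bar>f y\<bar>)"], rule lipschitz_onI)
 fix x z :: "real^4"
 let ?M = "kc * norm (x - z) / sqrt t * (1 / t\<^sup>2)"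
 have "integrable lborel (\<lambda>y. heatG t (z - y) * f y)" for z
  by (rule integrable_conv_data[OF f _ abs_heatG_le[OF t]]) auto
 then have "heatS t f x - heatS t f z = (LI y. (heatG t (x - y) - heatG t (z - y)) * f y)"
  by (simp add: conv_def algebra_simps)
 also have "\<bar>\<dots>\<bar> \<le> ?M * (LI y. \<bar>f y\<bar>)"
 proof (rule abs_integral_product_le[OF f])
  fix y
  have "\<bar>heatG t (z - y + 1 *\<^sub>R (x - z)) - heatG t (z - y + 0 *\<^sub>R (x - z))\<bar> \<le> ?M * \<bar>1 - 0\<bar>"
   using field_differentiable_bound[of UNIV "\<lambda>\<theta>. heatG t (z - y + \<theta> *\<^sub>R (x - z))" "\<lambda>\<theta>. gK (x - z) t (z - y + \<theta> *\<^sub>R (x - z))" ?M 1 0]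
    DERIV_heatG_line[OF t] gK_abs_le[OF t] by simp
  then show "\<bar>heatG t (x - y) - heatG t (z - y)\<bar> \<le> ?M" by (simp add: algebra_simps)
 qed
 finally show "dist (heatS t f x) (heatS t f z) \<le> kc / sqrt t * (1 / t\<^sup>2) * (LI y. \<bar>f y\<bar>) * dist x z"
  by (simp add: dist_norm mult_ac)
qed (use t kc_pos in \<open>auto simp: less_imp_le\<close>)

lemma Cauchy_Schwarz_lborel:
 fixes p q :: "real^4 \<Rightarrow> real"
 assumes "integrable lborel (\<lambda>y. g y * (p y)\<^sup>2)" "integrable lborel (\<lambda>y. g y * (q y)\<^sup>2)" "integrable lborel (\<lambda>y. g y * (p y * q y))"
  and "\<And>y. 0 \<le> g y"
 shows "(LI y. g y * (p y * q y))\<^sup>2 \<le> (LI y. g y * (p y)\<^sup>2) * (LI y. g y * (q y)\<^sup>2)"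
proof -
 define P Q R where "P = (LI y. g y * (p y)\<^sup>2)" "Q = (LI y. g y * (q y)\<^sup>2)" "R = (LI y. g y * (p y * q y))"
 have q: "0 \<le> l\<^sup>2 * P - 2 * l * R + Q" for l
 proof -
  have "0 \<le> (LI y. g y * (l * p y - q y)\<^sup>2)" using assms(4) by (intro Bochner_Integration.integral_nonneg) auto
  also have "(LI y. g y * (l * p y - q y)\<^sup>2) = (LI y. l\<^sup>2 * (g y * (p y)\<^sup>2) - (2 * l) * (g y * (p y * q y)) + g y * (q y)\<^sup>2)"
   by (intro Bochner_Integration.integral_cong) (simp_all add: power2_eq_square algebra_simps)
  also have "\<dots> = l\<^sup>2 * P - 2 * l * R + Q"
   unfolding P_Q_R_def using assms by simp
  finally show ?thesis .
 qed
 have P: "0 \<le> P" "0 \<le> Q" unfolding P_Q_R_def using assms(4) by (auto intro!: Bochner_Integration.integral_nonneg)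
 show ?thesis
 proof (cases "P = 0")
  case True
  have "R = 0"
  proof (rule ccontr)
   assume R: "R \<noteq> 0"
   \<comment> \<open>With P = 0 the quadratic form in \<open>l\<close> is affine. This
     \<open>l\<close> is chosen to give it the value -1.\<close>
   have "0 \<le> - 2 * ((Q + 1) / (2 * R)) * R + Q" using q[of "(Q + 1) / (2 * R)"] unfolding True by linarith
   moreover have "2 * ((Q + 1) / (2 * R)) * R = Q + 1" using R by simp
   ultimately show False by linarith
  qed
  then show ?thesis using True by (simp add: P_Q_R_def)
 next
  case False
  with P have P0: "P > 0" by simp
  have "0 \<le> (R / P)\<^sup>2 * P - 2 * (R / P) * R + Q" by (rule q)
  also have "\<dots> = Q - R\<^sup>2 / P" using P0 by (simp add: power2_eq_square)
  finally have "R\<^sup>2 \<le> P * Q" using P0 by (simp add: field_simps)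
  then show ?thesis by (simp add: P_Q_R_def)
 qed
qed

lemma integral_heatS:
 assumes t: "t > 0" and f: "integrable lborel f"
 shows "(LI x. heatS t f x) = (LI x. f x)"
proof -
 note [measurable] = borel_measurable_integrable[OF f]
 have I: "integrable (lborel \<Otimes>\<^sub>M lborel) (\<lambda>(x, y). heatG t (x - y) * f y)"
 proof (rule integrableI_bounded)
  have "(\<integral>\<^sup>+p. ennreal (norm (case p of (x, y) \<Rightarrow> heatG t (x - y) * f y)) \<partial>(lborel \<Otimes>\<^sub>M lborel))
   = (NI y. (NI x. ennreal \<bar>heatG t (x - y) * f y\<bar>))"
   by (subst lborel_pair.nn_integral_snd[symmetric]) (auto simp: case_prod_beta')
  also have "\<dots> = (NI y. (NI x. ennreal (heatG t (x - y))) * ennreal \<bar>f y\<bar>)"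
   by (intro nn_integral_cong) (simp add: abs_mult ennreal_mult nn_integral_multc)
  also have "\<dots> = nL f"
   using nn_integral_shift_minus[of "\<lambda>x. ennreal (heatG t x)"] t by (simp add: nn_integral_heatG)
  also have "\<dots> < \<infinity>" using f by (simp add: integrable_iff_nL)
  finally show "(\<integral>\<^sup>+p. ennreal (norm (case p of (x, y) \<Rightarrow> heatG t (x - y) * f y)) \<partial>(lborel \<Otimes>\<^sub>M lborel)) < \<infinity>" .
 qed (simp add: case_prod_beta')
 have "(LI x. heatS t f x) = (LI y. (LI x. heatG t (x - y) * f y))"
  unfolding conv_def using lborel_pair.Fubini_integral[of "\<lambda>x y. heatG t (x - y) * f y"] I by simp
 also have "\<dots> = (LI y. f y)"
  using integral_shift[of "heatG t"] t
  by (intro Bochner_Integration.integral_cong) (auto simp: diff_conv_add_uminus simp del: add_uminus_conv_diff)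
 finally show ?thesis .
qed

text \<open>The \<open>L\<^sup>2\<close> norm lost in one step of the heat flow is the integral of a variance, and
 Cauchy-Schwarz bounds the gradient of the smoothed function by that variance.\<close>

lemma gradient_le_dissipation:
 assumes h: "h > 0" and g: "integrable lborel g" "\<And>x. \<bar>g x\<bar> \<le> C"
 shows "(LI x. (heatP b h g x)\<^sup>2) \<le> (norm b)\<^sup>2 * mc 2 / h * ((LI x. (g x)\<^sup>2) - (LI x. (heatS h g x)\<^sup>2))"
  and "integrable lborel (\<lambda>x. (heatP b h g x)\<^sup>2)" and "integrable lborel (\<lambda>x. (heatS h g x)\<^sup>2)"
  and "integrable lborel (\<lambda>x. (g x)\<^sup>2)"
proof -
 note [measurable] = borel_measurable_integrable[OF g(1)]
 let ?w = "heatS h g"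
 have C: "0 \<le> C" using g(2)[of 0] by simp
 have wb: "\<bar>?w x\<bar> \<le> C" for x by (rule abs_heatS_le[OF h g(2)])
 have wi: "integrable lborel ?w"
  using nL_heatS[OF h, of g "LI x. \<bar>g x\<bar>"] g nL_integral[OF g(1)] by (intro integrable_nL_le) auto
 have gi2: "integrable lborel (\<lambda>x. (g x)\<^sup>2)"
  using integrable_mult_bounded[OF g(1) _ g(2)] by (simp add: power2_eq_square)
 then show "integrable lborel (\<lambda>x. (g x)\<^sup>2)" .
 have wi2: "integrable lborel (\<lambda>x. (?w x)\<^sup>2)"
  using integrable_mult_bounded[OF wi _ wb] by (simp add: power2_eq_square)
 then show "integrable lborel (\<lambda>x. (?w x)\<^sup>2)" .
 have pb: "\<bar>heatP b h g x\<bar> \<le> kc * norm b / sqrt h * C" for x by (rule abs_heatP_le[OF h g(2)])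
 have pi: "integrable lborel (heatP b h g)"
  using nL_heatP[OF h, of g "LI x. \<bar>g x\<bar>" b] g nL_integral[OF g(1)] by (intro integrable_nL_le) auto
 show pi2: "integrable lborel (\<lambda>x. (heatP b h g x)\<^sup>2)"
  using integrable_mult_bounded[OF pi _ pb] by (simp add: power2_eq_square)
 have mom: "integrable lborel (\<lambda>y. heatG h y * (norm y)\<^sup>2)" "(LI y. heatG h y * (norm y)\<^sup>2) \<le> mc 2 * h"
 proof -
  have b: "heatG h y * (norm y)\<^sup>2 \<le> mc 2 * h * heatG (2 * h) y" for y
   using heatG_moment[OF h, of y 2] h by (simp add: mult.commute)
  show i: "integrable lborel (\<lambda>y. heatG h y * (norm y)\<^sup>2)"
   by (rule Bochner_Integration.integrable_bound[of _ "\<lambda>y. mc 2 * h * heatG (2 * h) y"])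
     (use h b in \<open>auto simp: less_imp_le\<close>)
  have "(LI y. heatG h y * (norm y)\<^sup>2) \<le> (LI y. mc 2 * h * heatG (2 * h) y)"
   using h b by (intro integral_mono i) auto
  then show "(LI y. heatG h y * (norm y)\<^sup>2) \<le> mc 2 * h" using h by simp
 qed
 have var: "(heatP b h g x)\<^sup>2 \<le> (norm b)\<^sup>2 * mc 2 / h * (heatS h (\<lambda>x. (g x)\<^sup>2) x - (?w x)\<^sup>2)" for x
 proof -
  define q where "q y = g (x - y) - ?w x" for y
  have [measurable]: "q \<in> borel_measurable borel" unfolding q_def by measurable
  have qb: "\<bar>q y\<bar> \<le> 2 * C" for y
   unfolding q_def using g(2)[of "x - y"] wb[of x] by linarith
  have q2b: "\<bar>(q y)\<^sup>2\<bar> \<le> (2 * C)\<^sup>2" for y using power_mono[OF qb[of y], of 2] by simp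
  have gi: "integrable lborel (\<lambda>y. heatG h y * g (x - y))"
   using integrable_mult_bounded[OF integrable_heatG[OF h], of "\<lambda>y. g (x - y)" C] g(2) by simp
  have gi': "integrable lborel (\<lambda>y. heatG h y * (g (x - y))\<^sup>2)"
  proof (rule integrable_mult_bounded[OF integrable_heatG[OF h]])
   show "\<bar>(g (x - y))\<^sup>2\<bar> \<le> C\<^sup>2" for y using power_mono[OF g(2)[of "x - y"], of 2] by simp
  qed simp
  have qi: "integrable lborel (\<lambda>y. heatG h y * (q y)\<^sup>2)"
   by (rule integrable_mult_bounded[OF integrable_heatG[OF h] _ q2b]) simp
  have pq: "integrable lborel (\<lambda>y. heatG h y * ((b \<bullet> y) * q y))"
  proof -
   have "integrable lborel (\<lambda>y. - (2 * h) * (gK b h y * q y))"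
    by (intro integrable_mult_right integrable_mult_bounded[OF integrable_gK[OF h] _ qb]) simp
   moreover have "- (2 * h) * (gK b h y * q y) = heatG h y * ((b \<bullet> y) * q y)" for y
    using h by (simp add: gK_def)
   ultimately show ?thesis by (simp only:)
  qed
  have bi: "integrable lborel (\<lambda>y. heatG h y * (b \<bullet> y)\<^sup>2)"
  proof (rule Bochner_Integration.integrable_bound[OF integrable_mult_right[of "(norm b)\<^sup>2", OF mom(1)]])
   show "AE y in lborel. norm (heatG h y * (b \<bullet> y)\<^sup>2) \<le> norm ((norm b)\<^sup>2 * (heatG h y * (norm y)\<^sup>2))"
   proof (intro AE_I2)
    fix y
    have "(b \<bullet> y)\<^sup>2 \<le> (norm b * norm y)\<^sup>2" using power_mono[OF abs_inner_le[of b y], of 2] by simp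
    from mult_left_mono[OF this heatG_nonneg[of h y]] show "norm (heatG h y * (b \<bullet> y)\<^sup>2) \<le> norm ((norm b)\<^sup>2 * (heatG h y * (norm y)\<^sup>2))"
     by (simp add: abs_mult power_mult_distrib mult_ac)
   qed
  qed simp
  have "(LI y. heatG h y * (b \<bullet> y)\<^sup>2) \<le> (LI y. (norm b)\<^sup>2 * (heatG h y * (norm y)\<^sup>2))"
  proof (intro integral_mono bi integrable_mult_right mom)
   fix y
   have "(b \<bullet> y)\<^sup>2 \<le> (norm b * norm y)\<^sup>2" using power_mono[OF abs_inner_le[of b y], of 2] by simp
   from mult_left_mono[OF this heatG_nonneg[of h y]] show "heatG h y * (b \<bullet> y)\<^sup>2 \<le> (norm b)\<^sup>2 * (heatG h y * (norm y)\<^sup>2)"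
    by (simp add: power_mult_distrib mult_ac)
  qed
  also have "\<dots> \<le> (norm b)\<^sup>2 * (mc 2 * h)" using mom(2) by (simp add: mult_left_mono)
  finally have bm: "(LI y. heatG h y * (b \<bullet> y)\<^sup>2) \<le> (norm b)\<^sup>2 * (mc 2 * h)" .
  \<comment> \<open>\<open>gK\<close> has integral zero, so the local mean \<open>?w x\<close> can
    be subtracted for free. This turns the second factor of Cauchy-Schwarz into a variance.\<close>
  have "heatP b h g x = (LI y. gK b h y * q y)"
  proof -
   have "integrable lborel (\<lambda>y. gK b h y * g (x - y))"
    using integrable_mult_bounded[OF integrable_gK[OF h], of "\<lambda>y. g (x - y)" C] g(2) by simp
   then show ?thesis using h by (simp add: conv_reflect q_def right_diff_distrib)
  qed
  also have "\<dots> = - 1 / (2 * h) * (LI y. heatG h y * ((b \<bullet> y) * q y))"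
   unfolding integral_mult_right_zero[symmetric]
   by (intro Bochner_Integration.integral_cong) (auto simp: gK_def)
  finally have "(heatP b h g x)\<^sup>2 = 1 / (4 * h\<^sup>2) * (LI y. heatG h y * ((b \<bullet> y) * q y))\<^sup>2"
   by (simp add: power_mult_distrib power_divide)
  also have "\<dots> \<le> 1 / (4 * h\<^sup>2) * ((LI y. heatG h y * (b \<bullet> y)\<^sup>2) * (LI y. heatG h y * (q y)\<^sup>2))"
   by (intro mult_left_mono Cauchy_Schwarz_lborel bi qi pq) auto
  also have "\<dots> \<le> 1 / (4 * h\<^sup>2) * ((norm b)\<^sup>2 * (mc 2 * h) * (LI y. heatG h y * (q y)\<^sup>2))"
   by (intro mult_left_mono mult_right_mono bm) (auto intro!: Bochner_Integration.integral_nonneg)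
  also have "(LI y. heatG h y * (q y)\<^sup>2) = heatS h (\<lambda>x. (g x)\<^sup>2) x - (?w x)\<^sup>2"
  proof -
   have "heatG h y * (q y)\<^sup>2 = heatG h y * (g (x - y))\<^sup>2 - 2 * ?w x * (heatG h y * g (x - y)) + (?w x)\<^sup>2 * heatG h y" for y
    by (simp add: q_def power2_eq_square algebra_simps)
   then have "(LI y. heatG h y * (q y)\<^sup>2) = heatS h (\<lambda>x. (g x)\<^sup>2) x - 2 * ?w x * ?w x + (?w x)\<^sup>2"
    using gi gi' h by (simp add: conv_reflect)
   then show ?thesis by (simp add: power2_eq_square)
  qed
  also have "1 / (4 * h\<^sup>2) * ((norm b)\<^sup>2 * (mc 2 * h) * (heatS h (\<lambda>x. (g x)\<^sup>2) x - (?w x)\<^sup>2))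
    \<le> (norm b)\<^sup>2 * mc 2 / h * (heatS h (\<lambda>x. (g x)\<^sup>2) x - (?w x)\<^sup>2)"
  proof -
   have "0 \<le> (LI y. heatG h y * (q y)\<^sup>2)" by (auto intro!: Bochner_Integration.integral_nonneg)
   then have v0: "0 \<le> heatS h (\<lambda>x. (g x)\<^sup>2) x - (?w x)\<^sup>2"
    by (simp only: \<open>(LI y. heatG h y * (q y)\<^sup>2) = _\<close>)
   have "1 / (4 * h\<^sup>2) * ((norm b)\<^sup>2 * (mc 2 * h)) \<le> (norm b)\<^sup>2 * mc 2 / h"
    using h mc_pos[of 2] by (simp add: field_simps power2_eq_square less_imp_le)
   from mult_right_mono[OF this v0] show ?thesis by (simp only: mult.assoc)
  qed
  finally show ?thesis .
 qed
 have si: "integrable lborel (heatS h (\<lambda>x. (g x)\<^sup>2))"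
  using nL_heatS[OF h, of "\<lambda>x. (g x)\<^sup>2" "LI x. \<bar>(g x)\<^sup>2\<bar>"] nL_integral[OF gi2] by (intro integrable_nL_le) auto
 have "(LI x. (heatP b h g x)\<^sup>2) \<le> (LI x. (norm b)\<^sup>2 * mc 2 / h * (heatS h (\<lambda>x. (g x)\<^sup>2) x - (?w x)\<^sup>2))"
  by (intro integral_mono pi2 integrable_mult_right Bochner_Integration.integrable_diff si wi2 var)
 also have "\<dots> = (norm b)\<^sup>2 * mc 2 / h * ((LI x. (g x)\<^sup>2) - (LI x. (?w x)\<^sup>2))"
  using si wi2 integral_heatS[OF h gi2] by simp
 finally show "(LI x. (heatP b h g x)\<^sup>2) \<le> (norm b)\<^sup>2 * mc 2 / h * ((LI x. (g x)\<^sup>2) - (LI x. (?w x)\<^sup>2))" .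
qed

section \<open>Hardy's inequality and moduli of continuity\<close>

lemma nL_time:
 fixes F :: "real \<Rightarrow> real^4 \<Rightarrow> real"
 assumes "case_prod F \<in> borel_measurable (lborel \<Otimes>\<^sub>M lborel)" "A \<in> sets borel"
  and "\<And>s. s \<in> A \<Longrightarrow> nL (F s) \<le> \<alpha> s"
 shows "nL (\<lambda>x. LINT s:A|lborel. F s x) \<le> (\<integral>\<^sup>+s\<in>A. \<alpha> s \<partial>lborel)"
 using minkowski_time[of F "\<lambda>_. 1" A \<alpha>] assms by simp

lemma conv_integrable_bounded:
 assumes "t > 0" "integrable lborel g"
 shows "integrable lborel (heatS t g)" "integrable lborel (heatP b t g)"
proof -
 have [measurable]: "g \<in> borel_measurable borel" using assms(2) by simp
 have n: "nL g \<le> ennreal (LI x. \<bar>g x\<bar>)" using nL_integral[OF assms(2)] by simp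
 have p: "0 \<le> (LI x. \<bar>g x\<bar>)" by simp
 show "integrable lborel (heatS t g)" by (rule integrable_nL_le[OF _ nL_heatS[OF assms(1) _ n p]]) auto
 show "integrable lborel (heatP b t g)" by (rule integrable_nL_le[OF _ nL_heatP[OF assms(1) _ n p]]) auto
qed

text \<open>The derivative of the product of the two smoothed functions integrates to zero. This
  moves the derivative in the Duhamel term from the nonlinearity to the smoothed solution.\<close>

lemma ibp_heatS_heatP:
 assumes h: "h > 0" "\<sigma> > 0" and g: "integrable lborel g" "\<And>x. \<bar>g x\<bar> \<le> C" and f: "integrable lborel f" "\<And>x. \<bar>f x\<bar> \<le> D"
 shows "(LI x. heatS h g x * heatP b \<sigma> f x) = - (LI x. heatP b h g x * heatS \<sigma> f x)"
proof -
 note [measurable] = borel_measurable_integrable[OF g(1)] borel_measurable_integrable[OF f(1)]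
 let ?\<phi> = "\<lambda>x. heatS h g x * heatS \<sigma> f x"
 let ?\<phi>' = "\<lambda>x. heatP b h g x * heatS \<sigma> f x + heatP b \<sigma> f x * heatS h g x"
 have fb: "\<bar>heatS \<sigma> f x\<bar> \<le> D" for x by (rule abs_heatS_le[OF h(2) f(2)])
 have gb: "\<bar>heatS h g x\<bar> \<le> C" for x by (rule abs_heatS_le[OF h(1) g(2)])
 note i = conv_integrable_bounded[OF h(1) g(1)] conv_integrable_bounded[OF h(2) f(1)]
 have i1: "integrable lborel (\<lambda>x. heatP b h g x * heatS \<sigma> f x)"
  by (rule integrable_mult_bounded[OF i(2) _ fb]) simp
 have i2: "integrable lborel (\<lambda>x. heatP b \<sigma> f x * heatS h g x)"
  by (rule integrable_mult_bounded[OF i(4) _ gb]) simp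
 have "(LI x. ?\<phi>' x) = 0"
 proof (rule integral_directional_derivative_zero[where \<phi> = ?\<phi> and b = b])
  fix x
  show "((\<lambda>\<theta>. ?\<phi> (x + \<theta> *\<^sub>R b)) has_real_derivative ?\<phi>' x) (at 0)"
   using DERIV_mult[OF DERIV_heatS_line[OF h(1) g(1), where x = x and b = b] DERIV_heatS_line[OF h(2) f(1), where x = x and b = b]] by simp
  show "continuous_on UNIV ?\<phi>'"
   by (intro continuous_intros continuous_heatP continuous_heatS h f g)
  show "integrable lborel ?\<phi>" by (rule integrable_mult_bounded[OF i(1) _ fb]) simp
 qed (use i1 i2 in auto)
 then show ?thesis using i1 i2 by (simp add: mult.commute[of "heatS h g _"])
qed

text \<open>The integrand is a third of the derivative of the cube. This cancellation is why the
  nonlinearity does not feed the L^2 norm, independently of the size of the solution.\<close>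

lemma ibp_cube:
 assumes h: "h > 0" and g: "integrable lborel g" "\<And>x. \<bar>g x\<bar> \<le> C"
 shows "(LI x. heatP b h g x * (heatS h g x)\<^sup>2) = 0"
proof -
 note [measurable] = borel_measurable_integrable[OF g(1)]
 have gb: "\<bar>heatS h g x\<bar> \<le> C" for x by (rule abs_heatS_le[OF h(1) g(2)])
 have C: "0 \<le> C" using g(2)[of 0] by simp
 note i = conv_integrable_bounded[OF h(1) g(1)]
 have b2: "\<bar>(heatS h g x)\<^sup>2\<bar> \<le> C\<^sup>2" for x using power_mono[OF gb[of x], of 2] by simp
 have i1: "integrable lborel (\<lambda>x. heatP b h g x * (heatS h g x)\<^sup>2)"
  by (rule integrable_mult_bounded[OF i(2) _ b2]) simp
 have "(LI x. 3 * (heatP b h g x * (heatS h g x)\<^sup>2)) = 0"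
 proof (rule integral_directional_derivative_zero[where \<phi> = "\<lambda>x. heatS h g x * (heatS h g x)\<^sup>2" and b = b])
  fix x
  show "((\<lambda>\<theta>. heatS h g (x + \<theta> *\<^sub>R b) * (heatS h g (x + \<theta> *\<^sub>R b))\<^sup>2) has_real_derivative 3 * (heatP b h g x * (heatS h g x)\<^sup>2)) (at 0)"
   by (rule derivative_eq_intros DERIV_heatS_line[OF h(1) g(1), where x = x and b = b] refl)+ (simp add: power2_eq_square)
  show "continuous_on UNIV (\<lambda>x. 3 * (heatP b h g x * (heatS h g x)\<^sup>2))"
   by (intro continuous_intros continuous_heatP continuous_heatS h g)
  show "integrable lborel (\<lambda>x. heatS h g x * (heatS h g x)\<^sup>2)" by (rule integrable_mult_bounded[OF i(1) _ b2]) simp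
 qed (use i1 in auto)
 then show ?thesis by simp
qed

text \<open>Hardy's inequality, from the divergence of the vector field \<open>y / (|y|\<^sup>2 + \<tau>)\<close>.\<close>

lemma hardy:
 assumes h: "h > 0" and g: "integrable lborel g" "\<And>x. \<bar>g x\<bar> \<le> C" and \<tau>: "\<tau> > 0"
 shows "(LI y. (heatS h g y)\<^sup>2 / ((norm (y - x0))\<^sup>2 + \<tau>)) \<le> (\<Sum>j\<in>UNIV. LI y. (heatP (axis j 1) h g y)\<^sup>2)"
proof -
 note [measurable] = borel_measurable_integrable[OF g(1)]
 define w where "w = heatS h g"
 define P where "P j = heatP (axis j 1) h g" for j :: 4
 define D where "D y = (norm (y - x0))\<^sup>2 + \<tau>" for y
 define F where "F j y = (y $ j - x0 $ j) / D y" for j y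
 define F' where "F' j y = 1 / D y - 2 * (F j y)\<^sup>2" for j y
 have D: "D y \<ge> \<tau>" "D y > 0" for y using \<tau> by (auto simp: D_def add_nonneg_pos)
 have [measurable]: "D \<in> borel_measurable borel" unfolding D_def by measurable
 have [measurable]: "F j \<in> borel_measurable borel" for j unfolding F_def by measurable
 have [measurable]: "F' j \<in> borel_measurable borel" for j unfolding F'_def by measurable
 have [measurable]: "w \<in> borel_measurable borel" "P j \<in> borel_measurable borel" for j unfolding w_def P_def by auto
 have sumF: "(\<Sum>j\<in>UNIV. (F j y)\<^sup>2) = (norm (y - x0))\<^sup>2 / (D y)\<^sup>2" for y
  unfolding F_def by (simp add: power_divide sum_divide_distrib[symmetric] norm_vec_def L2_set_def sum_nonneg)
 have sumF_le: "(\<Sum>j\<in>UNIV. (F j y)\<^sup>2) \<le> 1 / D y" for y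
 proof -
  have "(norm (y - x0))\<^sup>2 / (D y)\<^sup>2 \<le> D y / (D y)\<^sup>2"
   using \<tau> by (intro divide_right_mono) (auto simp: D_def)
  also have "D y / (D y)\<^sup>2 = 1 / D y" using D(2)[of y] by (simp add: power2_eq_square)
  finally show ?thesis by (simp only: sumF)
 qed
 have F2: "(F j y)\<^sup>2 \<le> 1 / D y" for j y
  by (rule order_trans[OF member_le_sum[of j UNIV "\<lambda>j. (F j y)\<^sup>2"] sumF_le]) auto
 have Db: "1 / D y \<le> 1 / \<tau>" for y using D(1)[of y] \<tau> by (intro divide_left_mono) (auto simp: D)
 have Db': "\<bar>1 / D y\<bar> \<le> 1 / \<tau>" for y using Db[of y] D(2)[of y] by simp
 have Fb: "\<bar>F j y\<bar> \<le> sqrt (1 / \<tau>)" for j y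
  by (rule real_le_rsqrt) (use order_trans[OF F2[of j y] Db[of y]] in simp)
 have F'b: "\<bar>F' j y\<bar> \<le> 3 / \<tau>" for j y
 proof -
  have "0 < 1 / D y" "3 / \<tau> = 3 * (1 / \<tau>)" using D(2)[of y] by auto
  then show ?thesis
   using F2[of j y] Db[of y] zero_le_power2[of "F j y"] unfolding F'_def by (intro abs_leI) linarith+
 qed
 have wb: "\<bar>w y\<bar> \<le> C" for y unfolding w_def by (rule abs_heatS_le[OF h g(2)])
 have C: "0 \<le> C" using g(2)[of 0] by simp
 have w2b: "\<bar>(w y)\<^sup>2\<bar> \<le> C\<^sup>2" for y using power_mono[OF wb[of y], of 2] by simp
 note gd = gradient_le_dissipation[OF h g]
 have wi: "integrable lborel (\<lambda>y. (w y)\<^sup>2)" unfolding w_def by (rule gd(3))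
 have Pi: "integrable lborel (\<lambda>y. (P j y)\<^sup>2)" for j unfolding P_def by (rule gd(2))
 have PI: "integrable lborel (P j)" for j unfolding P_def by (rule conv_integrable_bounded[OF h g(1)])
 have iF': "integrable lborel (\<lambda>y. (w y)\<^sup>2 * F' j y)" for j
  by (rule integrable_mult_bounded[OF wi _ F'b]) simp
 have iPw: "integrable lborel (\<lambda>y. P j y * w y)" for j
  by (rule integrable_mult_bounded[OF PI _ wb]) simp
 have iP: "integrable lborel (\<lambda>y. P j y * w y * F j y)" for j
  by (rule integrable_mult_bounded[OF iPw _ Fb]) simp
 have iF2: "integrable lborel (\<lambda>y. (w y)\<^sup>2 * (F j y)\<^sup>2)" for j
 proof (rule integrable_mult_bounded[OF wi])
  show "\<bar>(F j y)\<^sup>2\<bar> \<le> 1 / \<tau>" for y using order_trans[OF F2[of j y] Db[of y]] by simp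
 qed simp
 have iD: "integrable lborel (\<lambda>y. (w y)\<^sup>2 * (1 / D y))"
  by (rule integrable_mult_bounded[OF wi _ Db']) simp
 have ibp: "(LI y. (w y)\<^sup>2 * F' j y + 2 * (P j y * w y * F j y)) = 0" for j
 proof (rule integral_directional_derivative_zero[where \<phi> = "\<lambda>y. (w y)\<^sup>2 * F j y" and b = "axis j 1"])
  fix x :: "real^4"
  have dD: "((\<lambda>\<theta>. D (x + \<theta> *\<^sub>R axis j 1)) has_real_derivative 2 * (x $ j - x0 $ j)) (at 0)"
  proof -
   have "D (x + \<theta> *\<^sub>R axis j 1) = D x + 2 * \<theta> * (x $ j - x0 $ j) + \<theta>\<^sup>2" for \<theta>
    unfolding D_def power2_norm_eq_inner
    by (simp add: inner_diff inner_add inner_axis inner_axis' inner_commute power2_eq_square algebra_simps)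
   then show ?thesis by (auto intro!: derivative_eq_intros)
  qed
  have dn: "((\<lambda>\<theta>. (x + \<theta> *\<^sub>R axis j 1) $ j - x0 $ j) has_real_derivative 1) (at 0)"
   by (auto intro!: derivative_eq_intros simp: axis_def)
  have dF: "((\<lambda>\<theta>. F j (x + \<theta> *\<^sub>R axis j 1)) has_real_derivative F' j x) (at 0)"
   unfolding F_def
   by (rule DERIV_cong[OF DERIV_divide[OF dn dD]])
     (use D(2)[of x] in \<open>auto simp: F'_def F_def field_simps power2_eq_square\<close>)
  have dw: "((\<lambda>\<theta>. w (x + \<theta> *\<^sub>R axis j 1)) has_real_derivative P j x) (at 0)"
   unfolding w_def P_def by (rule DERIV_heatS_line[OF h g(1)])
  show "((\<lambda>\<theta>. (w (x + \<theta> *\<^sub>R axis j 1))\<^sup>2 * F j (x + \<theta> *\<^sub>R axis j 1)) has_real_derivative (w x)\<^sup>2 * F' j x + 2 * (P j x * w x * F j x)) (at 0)"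
   unfolding power2_eq_square[of "w _"]
   by (rule DERIV_cong[OF DERIV_mult[OF DERIV_mult[OF dw dw] dF]]) (simp add: algebra_simps)
 next
  have cF: "continuous_on UNIV (F j)" unfolding F_def D_def
   using D(2) by (intro continuous_intros) (auto simp: D_def less_imp_neq[symmetric])
  have cD: "continuous_on UNIV (\<lambda>y. 1 / D y)"
   using D(2) unfolding D_def by (intro continuous_intros) (auto simp: D_def less_imp_neq[symmetric])
  show "continuous_on UNIV (\<lambda>y. (w y)\<^sup>2 * F' j y + 2 * (P j y * w y * F j y))"
   unfolding F'_def w_def P_def by (intro continuous_intros cF cD continuous_heatP continuous_heatS h g)
  show "integrable lborel (\<lambda>y. (w y)\<^sup>2 * F j y)" by (rule integrable_mult_bounded[OF wi _ Fb]) simp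
 qed (use iF' iP in auto)
 have step: "(LI y. (w y)\<^sup>2 * F' j y) \<le> (LI y. (w y)\<^sup>2 * (F j y)\<^sup>2) + (LI y. (P j y)\<^sup>2)" for j
 proof -
  have "(LI y. (w y)\<^sup>2 * F' j y) = (LI y. - (2 * (P j y * w y * F j y)))"
   using ibp[of j] iF'[of j] iP[of j] by simp
  also have "\<dots> \<le> (LI y. (w y)\<^sup>2 * (F j y)\<^sup>2 + (P j y)\<^sup>2)"
  proof (rule integral_mono)
   fix y
   have "0 \<le> (w y * F j y + P j y)\<^sup>2" by simp
   then show "- (2 * (P j y * w y * F j y)) \<le> (w y)\<^sup>2 * (F j y)\<^sup>2 + (P j y)\<^sup>2"
    by (simp add: power2_sum power_mult_distrib algebra_simps)
  qed (use iP iF2 Pi in auto)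
  finally show ?thesis using iF2 Pi by simp
 qed
 have "(LI y. (w y)\<^sup>2 * (1 / D y)) \<le> (LI y. (\<Sum>j\<in>UNIV. (w y)\<^sup>2 * F' j y - (w y)\<^sup>2 * (F j y)\<^sup>2))"
 proof (rule integral_mono)
  fix y
  \<comment> \<open>The divergence contributes 4/D - 2|F|^2 and Young's inequality costs another
    |F|^2. Since |F|^2 \<le> 1/D, exactly 1/D remains: the dimension 4 yields the Hardy constant
    (n-2)^2/4 = 1.\<close>
  have "1 / D y \<le> 4 / D y - 3 * (\<Sum>j\<in>UNIV. (F j y)\<^sup>2)" using sumF_le[of y] by (simp add: field_simps)
  also have "\<dots> = (\<Sum>j\<in>(UNIV :: 4 set). F' j y - (F j y)\<^sup>2)"
   unfolding F'_def by (simp add: sum_subtractf sum_distrib_left)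
  finally have "(w y)\<^sup>2 * (1 / D y) \<le> (w y)\<^sup>2 * (\<Sum>j\<in>UNIV. F' j y - (F j y)\<^sup>2)" by (intro mult_left_mono) auto
  then show "(w y)\<^sup>2 * (1 / D y) \<le> (\<Sum>j\<in>UNIV. (w y)\<^sup>2 * F' j y - (w y)\<^sup>2 * (F j y)\<^sup>2)"
   by (simp add: sum_distrib_left right_diff_distrib)
 qed (use iD iF' iF2 in auto)
 also have "\<dots> = (\<Sum>j\<in>UNIV. (LI y. (w y)\<^sup>2 * F' j y) - (LI y. (w y)\<^sup>2 * (F j y)\<^sup>2))"
  using iF' iF2 by simp
 also have "\<dots> \<le> (\<Sum>j\<in>UNIV. LI y. (P j y)\<^sup>2)"
  using step by (intro sum_mono) (simp add: algebra_simps)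
 finally show ?thesis by (simp add: w_def P_def D_def)
qed

section \<open>L^1 moduli of continuity under the heat kernel\<close>

definition m1 :: real where "m1 = 1 + mc 1"

lemma m1_pos [simp]: "0 < m1" by (simp add: m1_def add_pos_pos)

text \<open>Majorising sqrt |y| by an affine function of |y|/sqrt r means that only the moments of
  order 0 and 1 of the kernel are needed; their bounds 1 and \<open>mc 1\<close> add up to
  \<open>m1\<close>.\<close>

lemma sqrt_le_heat_scale:
 assumes "r > 0" "0 \<le> n"
 shows "sqrt n \<le> r powr (1/4) * (1 + n / sqrt r)"
proof -
 define z where "z = n / sqrt r"
 have z: "0 \<le> z" using assms by (simp add: z_def)
 have "z \<le> (1 + z)\<^sup>2" using z by (simp add: power2_eq_square algebra_simps)
 then have "sqrt z \<le> 1 + z" using z by (intro real_le_lsqrt) auto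
 moreover have "sqrt n = sqrt z * r powr (1/4)"
 proof -
  have "sqrt (sqrt r) = r powr (1/4)" using assms by (simp add: powr_half_sqrt[symmetric] powr_powr)
  then show ?thesis using assms by (simp add: z_def real_sqrt_divide)
 qed
 ultimately show ?thesis by (simp add: z_def mult.commute mult_right_mono)
qed

text \<open>A kernel concentrated at distance sqrt r sees increments of size r^(1/4). The two
  applications are \<open>heatG\<close>, for the distance of a function from its smoothing, and
  \<open>gK\<close>.\<close>

lemma nL_modulus_conv:
 assumes [measurable]: "g \<in> borel_measurable borel" "k \<in> borel_measurable borel"
  and g: "\<And>y. nL (\<lambda>x. g (x - y) - g x) \<le> ennreal (H * sqrt (norm y))" and H: "0 \<le> H"
  and k: "\<And>y. \<bar>k y\<bar> \<le> A * heatG r y" and A: "0 \<le> A" "r > 0"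
 shows "nL (\<lambda>x. LI y. k y * (g (x - y) - g x)) \<le> ennreal (A * (H * (m1 * r powr (1/4))))"
proof -
 have "nL (\<lambda>x. LI y. k y * (g (x - y) - g x)) \<le> (NI y. nL (\<lambda>x. k y * (g (x - y) - g x)))"
  using minkowski_weighted[OF lborel.sigma_finite_measure_axioms, of "\<lambda>y x. k y * (g (x - y) - g x)" "\<lambda>_. 1"] by (simp add: case_prod_beta')
 also have "\<dots> \<le> (NI y. ennreal (A * H * r powr (1/4) * (heatG r y + mc 1 * heatG (2 * r) y)))"
 proof (rule nn_integral_mono)
  fix y :: "real^4"
  have "nL (\<lambda>x. k y * (g (x - y) - g x)) = ennreal \<bar>k y\<bar> * nL (\<lambda>x. g (x - y) - g x)"
   by (simp add: abs_mult ennreal_mult nn_integral_cmult)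
  also have "\<dots> \<le> ennreal (A * heatG r y) * ennreal (H * sqrt (norm y))"
   by (intro mult_mono g ennreal_leI k) auto
  also have "\<dots> = ennreal (A * heatG r y * (H * sqrt (norm y)))" using A H by (simp add: ennreal_mult)
  also have "\<dots> \<le> ennreal (A * H * r powr (1/4) * (heatG r y + mc 1 * heatG (2 * r) y))"
  proof (rule ennreal_leI)
   have "heatG r y * sqrt (norm y) \<le> heatG r y * (r powr (1/4) * (1 + norm y / sqrt r))"
    using A by (intro mult_left_mono sqrt_le_heat_scale) auto
   also have "\<dots> = r powr (1/4) * (heatG r y + norm y ^ 1 * heatG r y / sqrt r)"
    by (simp add: algebra_simps)
   also have "\<dots> \<le> r powr (1/4) * (heatG r y + mc 1 * sqrt r ^ 1 * heatG (2 * r) y / sqrt r)"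
    using A by (intro mult_left_mono add_left_mono divide_right_mono heatG_moment) auto
   also have "\<dots> = r powr (1/4) * (heatG r y + mc 1 * heatG (2 * r) y)" using A by simp
   finally have "A * H * (heatG r y * sqrt (norm y)) \<le> A * H * (r powr (1/4) * (heatG r y + mc 1 * heatG (2 * r) y))"
    using A H by (intro mult_left_mono) auto
   then show "A * heatG r y * (H * sqrt (norm y)) \<le> A * H * r powr (1/4) * (heatG r y + mc 1 * heatG (2 * r) y)"
    by (simp add: mult_ac)
  qed
  finally show "nL (\<lambda>x. k y * (g (x - y) - g x)) \<le> ennreal (A * H * r powr (1/4) * (heatG r y + mc 1 * heatG (2 * r) y))" .
 qed
 also have "\<dots> = ennreal (A * H * r powr (1/4) * (1 + mc 1))"
 proof -
  have "(NI y. ennreal (heatG r y + mc 1 * heatG (2 * r) y)) = ennreal (1 + mc 1)"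
   using A by (simp add: ennreal_mult ennreal_plus nn_integral_add nn_integral_cmult nn_integral_heatG less_imp_le)
  moreover have "(NI y. ennreal (A * H * r powr (1/4) * (heatG r y + mc 1 * heatG (2 * r) y)))
   = ennreal (A * H * r powr (1/4)) * (NI y. ennreal (heatG r y + mc 1 * heatG (2 * r) y))"
   using A H by (subst nn_integral_cmult[symmetric]) (auto simp: ennreal_mult less_imp_le)
  moreover have "ennreal (1 + mc 1) = 1 + ennreal (mc 1)" by (simp add: less_imp_le)
  ultimately show ?thesis using A H by (simp add: ennreal_mult add_nonneg_nonneg less_imp_le)
 qed
 finally show ?thesis by (simp add: m1_def mult_ac)
qed

lemma nL_heatS_minus:
 assumes [measurable]: "g \<in> borel_measurable borel" and gb: "\<And>x. \<bar>g x\<bar> \<le> C"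
  and g: "\<And>y. nL (\<lambda>x. g (x - y) - g x) \<le> ennreal (H * sqrt (norm y))" and H: "0 \<le> H" and h: "h > 0"
 shows "nL (\<lambda>x. heatS h g x - g x) \<le> ennreal (H * (m1 * h powr (1/4)))"
proof -
 have "heatS h g x - g x = (LI y. heatG h y * (g (x - y) - g x))" for x
 proof -
  have "integrable lborel (\<lambda>y. heatG h y * g (x - y))"
   using integrable_mult_bounded[OF integrable_heatG[OF h], of "\<lambda>y. g (x - y)" C] gb by simp
  then show ?thesis using h by (simp add: conv_reflect right_diff_distrib)
 qed
 then show ?thesis using nL_modulus_conv[of g "heatG h" H 1 h] g H h by simp
qed

text \<open>As \<open>gK\<close> has mean zero, it acts on increments only, and the modulus improves
  the singularity h^(-1/2) to h^(-1/4). The factor 2 bounds 2^(1/4), since \<open>gK\<close> is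
  dominated by a Gaussian at time 2h.\<close>

lemma nL_heatP_modulus:
 assumes [measurable]: "g \<in> borel_measurable borel" and gb: "\<And>x. \<bar>g x\<bar> \<le> C"
  and g: "\<And>y. nL (\<lambda>x. g (x - y) - g x) \<le> ennreal (H * sqrt (norm y))" and H: "0 \<le> H" and h: "h > 0"
 shows "nL (heatP b h g) \<le> ennreal (kc * norm b * H * m1 * 2 * h powr - (1/4))"
proof -
 have e: "heatP b h g x = (LI y. gK b h y * (g (x - y) - g x))" for x
 proof -
  have "integrable lborel (\<lambda>y. gK b h y * g (x - y))"
   using integrable_mult_bounded[OF integrable_gK[OF h], of "\<lambda>y. g (x - y)" C] gb by simp
  then show ?thesis using h by (simp add: conv_reflect right_diff_distrib)
 qed
 have "nL (heatP b h g) \<le> ennreal (kc * norm b / sqrt h * (H * (m1 * (2 * h) powr (1/4))))"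
  unfolding e by (rule nL_modulus_conv[OF _ _ g H gK_bound[OF h]]) (use h kc_pos in \<open>auto simp: less_imp_le\<close>)
 also have "\<dots> \<le> ennreal (kc * norm b * H * m1 * 2 * h powr - (1/4))"
 proof (rule ennreal_leI)
  have "(2::real) powr (1/4) \<le> 2 powr 1" by (rule powr_mono) auto
  then have "(2 * h) powr (1/4) / sqrt h \<le> 2 * h powr (1/4) / sqrt h"
   using h by (intro divide_right_mono) (auto simp: powr_mult intro!: mult_right_mono)
  also have "\<dots> = 2 * h powr - (1/4)"
  proof -
   have "h powr (1/4) / sqrt h = h powr (1/4 - 1/2)" using h by (simp only: powr_half_sqrt[symmetric] powr_diff less_imp_le)
   then show ?thesis by simp
  qed
  finally have "kc * norm b * H * m1 * ((2 * h) powr (1/4) / sqrt h) \<le> kc * norm b * H * m1 * (2 * h powr - (1/4))"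
   using H kc_pos m1_pos by (intro mult_left_mono) (auto simp: less_imp_le)
  then show "kc * norm b / sqrt h * (H * (m1 * (2 * h) powr (1/4))) \<le> kc * norm b * H * m1 * 2 * h powr - (1/4)"
   by (simp add: mult_ac)
 qed
 finally show ?thesis .
qed

text \<open>A quantity below two bounds is below their geometric mean: this interpolates between a
  trivial and a Lipschitz bound.\<close>

lemma ennreal_le_sqrt:
 assumes "N \<le> ennreal A" "N \<le> ennreal B" "0 \<le> A" "0 \<le> B"
 shows "N \<le> ennreal (sqrt (A * B))"
proof (cases "A \<le> B")
 case True
 then have "A * A \<le> A * B" using assms by (intro mult_left_mono) auto
 then have "A \<le> sqrt (A * B)" using assms by (intro real_le_rsqrt) (simp add: power2_eq_square)
 then show ?thesis using assms(1) ennreal_leI order_trans by blast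
next
 case False
 then have "B * B \<le> A * B" using assms by (intro mult_right_mono) auto
 then have "B \<le> sqrt (A * B)" using assms by (intro real_le_rsqrt) (simp add: power2_eq_square)
 then show ?thesis using assms(2) ennreal_leI order_trans by blast
qed

lemma nL_minus_translate_le:
 assumes [measurable]: "k \<in> borel_measurable borel" and "nL k \<le> ennreal A" "0 \<le> A"
 shows "nL (\<lambda>x. k (x - y) - k x) \<le> ennreal (2 * A)"
proof -
 have "nL (\<lambda>x. k (x - y)) = nL k" by (rule nn_integral_shift_minus[of "\<lambda>x. ennreal \<bar>k x\<bar>"]) simp
 then show ?thesis using nL_add[of "\<lambda>x. k (x - y)" "\<lambda>x. - k x" A A] assms by simp
qed

lemma conv_translate_diff:
 assumes "integrable lborel k" and [measurable]: "f \<in> borel_measurable borel" and "\<And>x. \<bar>f x\<bar> \<le> C"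
 shows "conv k f (x - y) - conv k f x = conv (\<lambda>z. k (z - y) - k z) f x"
proof -
 have "integrable lborel (\<lambda>z. k (x - z) * f z)" for x
  by (rule integrable_conv_kernel[OF assms(1) _ assms(3)]) simp
 note this[of x] this[of "x - y"]
 then show ?thesis
  unfolding conv_def cancel_ab_semigroup_add_class.diff_right_commute[of x y] left_diff_distrib by (subst Bochner_Integration.integral_diff) auto
qed

context mild begin

text \<open>For the increment of \<open>gK\<close> at time t - s, the trivial L^1 bound is of order
  (t-s)^(-1/2) and the Lipschitz bound of order |y|/(t-s), which is not integrable up to s = t.
  Their geometric mean sqrt |y| (t-s)^(-3/4) is, hence a Hoelder exponent 1/2. Staying at times t
  \<ge> 1 keeps the contribution of the initial data bounded.\<close>

lemma v_modulus:
 assumes T: "T > 0"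
 shows "\<exists>H\<ge>0. \<forall>t\<in>{1..T}. \<forall>y. nL (\<lambda>x. v t (x - y) - v t x) \<le> ennreal (H * sqrt (norm y))"
proof -
 obtain C where C: "0 \<le> C" "\<And>t. t \<in> {0..T} \<Longrightarrow> nL (v t) \<le> ennreal C" "\<And>t x. t \<in> {0..T} \<Longrightarrow> \<bar>v t x\<bar> \<le> C"
  using v_local[OF T] by blast
 have f: "nL (\<lambda>y. (v s y)\<^sup>2) \<le> ennreal (C * C)" "\<bar>(v s x)\<^sup>2\<bar> \<le> C * C" if "s \<in> {0..T}" for s x
  using v_square_bounds[of s C C, OF C(2,3)[OF that] C(1)] by (auto simp: power2_eq_square)
 define B where "B = kc * norm a * sqrt 2 * (C * C)"
 have B: "0 \<le> B" using kc_pos by (simp add: B_def less_imp_le)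
 show ?thesis
 proof (intro exI[of _ "sqrt (2 * kc) * C + B * (4 * T powr (1/4))"] conjI ballI allI)
  fix t and y :: "real^4" assume "t \<in> {1..T}"
  then have t: "1 \<le> t" "t \<le> T" "0 < t" by auto
  let ?k = "\<lambda>z. heatG t (z - y) - heatG t z"
  let ?l = "\<lambda>s z. gK a (t - s) (z - y) - gK a (t - s) z"
  have k: "nL ?k \<le> ennreal (sqrt (2 * kc) * sqrt (norm y))"
  proof -
   have 1: "nL ?k \<le> ennreal (2 * 1)" by (rule nL_minus_translate_le) (use nL_heatG[OF t(3)] in auto)
   have "nL ?k \<le> ennreal (kc * norm y / sqrt t)" by (rule nL_heatG_translate[OF t(3)])
   also have "\<dots> \<le> ennreal (kc * norm y / 1)"
    using t kc_pos by (intro ennreal_leI divide_left_mono) (auto simp: less_imp_le)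
   finally show ?thesis using ennreal_le_sqrt[OF 1, of "kc * norm y"] kc_pos by (simp add: real_sqrt_mult less_imp_le mult_ac)
  qed
  have l: "nL (?l s) \<le> ennreal (kc * norm a * sqrt 2 * sqrt (norm y) * (t - s) powr - (3/4))" if s: "s < t" for s
  proof -
   have 1: "nL (?l s) \<le> ennreal (2 * (kc * norm a / sqrt (t - s)))"
    by (rule nL_minus_translate_le) (use nL_gK[of "t - s" a] s kc_pos in \<open>auto simp: less_imp_le\<close>)
   have 2: "nL (?l s) \<le> ennreal (kc * (norm a * norm y) / (t - s))"
    by (rule nL_gK_translate) (use s in auto)
   have e: "2 * (kc * norm a / sqrt (t - s)) * (kc * (norm a * norm y) / (t - s)) = (kc * norm a * sqrt 2 * sqrt (norm y) * (t - s) powr - (3/4))\<^sup>2"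
   proof -
    have "((t - s) powr - (3/4))\<^sup>2 = 1 / (sqrt (t - s) * (t - s))"
     using s by (simp add: power2_eq_square powr_half_sqrt[symmetric] powr_add[symmetric] powr_minus_divide powr_mult_base mult.commute)
    then show ?thesis by (simp add: power_mult_distrib) (simp add: power2_eq_square)
   qed
   show ?thesis
    using ennreal_le_sqrt[OF 1 2] s kc_pos unfolding e by (simp add: less_imp_le real_sqrt_abs)
  qed
  let ?\<beta> = "\<lambda>s. kc * norm a * (C * C) * (1 / sqrt (t - s))"
  have ib: "(nT {0<..<t} (\<lambda>s. ?\<beta> s)) \<le> ennreal (kc * norm a * (C * C) * (2 * sqrt t))"
   using nn_integral_inverse_sqrt_reflect[of 0 t] t C kc_pos by (intro set_nn_integral_cmult) (auto simp: less_imp_le)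
  have int: "set_integrable lborel {0<..<t} (\<lambda>s. heatP a (t - s) (\<lambda>y. (v s y)\<^sup>2) x)" for x
  proof (rule set_integrableI_bounded_by[OF _ _ _ ib])
   fix s assume "s \<in> {0<..<t}"
   then show "\<bar>heatP a (t - s) (\<lambda>y. (v s y)\<^sup>2) x\<bar> \<le> ?\<beta> s"
    using abs_heatP_le[of "t - s" "\<lambda>y. (v s y)\<^sup>2" "C * C" a x] f(2)[of s] t by (simp add: mult_ac)
  qed auto
  have e: "v t (x - y) - v t x = conv ?k (v 0) x + (LINT s:{0<..<t}|lborel. conv (?l s) (\<lambda>y. (v s y)\<^sup>2) x)" for x
  proof -
   have "v t (x - y) - v t x = (heatS t (v 0) (x - y) - heatS t (v 0) x)
     + (LINT s:{0<..<t}|lborel. heatP a (t - s) (\<lambda>y. (v s y)\<^sup>2) (x - y) - heatP a (t - s) (\<lambda>y. (v s y)\<^sup>2) x)"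
    using v_mild[of 0 t] t int by (simp add: set_integral_diff)
   also have "heatS t (v 0) (x - y) - heatS t (v 0) x = conv ?k (v 0) x"
    using C(3)[of 0] T t by (intro conv_translate_diff[of _ _ C]) auto
   also have "(LINT s:{0<..<t}|lborel. heatP a (t - s) (\<lambda>y. (v s y)\<^sup>2) (x - y) - heatP a (t - s) (\<lambda>y. (v s y)\<^sup>2) x)
     = (LINT s:{0<..<t}|lborel. conv (?l s) (\<lambda>y. (v s y)\<^sup>2) x)"
    by (rule set_lebesgue_integral_cong) (use t f(2) in \<open>auto intro!: conv_translate_diff[of _ _ "C * C"]\<close>)
   finally show ?thesis .
  qed
  have lm: "case_prod (\<lambda>s x. conv (?l s) (\<lambda>y. (v s y)\<^sup>2) x) \<in> borel_measurable (lborel \<Otimes>\<^sub>M lborel)"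
   unfolding conv_def by measurable
  have "nL (\<lambda>x. v t (x - y) - v t x) \<le> ennreal (sqrt (2 * kc) * sqrt (norm y) * C + B * sqrt (norm y) * (4 * t powr (1/4)))"
   unfolding e
  proof (rule nL_add)
   show "nL (conv ?k (v 0)) \<le> ennreal (sqrt (2 * kc) * sqrt (norm y) * C)"
    by (rule nL_conv[OF _ _ k]) (use C T kc_pos in \<open>auto simp: less_imp_le\<close>)
   have "nL (\<lambda>x. LINT s:{0<..<t}|lborel. conv (?l s) (\<lambda>y. (v s y)\<^sup>2) x) \<le> (nT {0<..<t} (\<lambda>s. B * sqrt (norm y) * (t - s) powr - (3/4)))"
   proof (rule nL_time[OF lm])
    fix s assume s: "s \<in> {0<..<t}"
    have "nL (conv (?l s) (\<lambda>y. (v s y)\<^sup>2)) \<le> ennreal (kc * norm a * sqrt 2 * sqrt (norm y) * (t - s) powr - (3/4) * (C * C))"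
     by (rule nL_conv[OF _ _ l]) (use s f(1)[of s] t C kc_pos in \<open>auto simp: less_imp_le\<close>)
    then show "nL (conv (?l s) (\<lambda>y. (v s y)\<^sup>2)) \<le> ennreal (B * sqrt (norm y) * (t - s) powr - (3/4))"
     by (simp add: B_def mult_ac)
   qed simp
   also have "\<dots> \<le> ennreal (B * sqrt (norm y) * (4 * t powr (1/4)))"
    using nn_integral_inverse_34_reflect[OF t(3)] B by (intro set_nn_integral_cmult) auto
   finally show "nL (\<lambda>x. LINT s:{0<..<t}|lborel. conv (?l s) (\<lambda>y. (v s y)\<^sup>2) x) \<le> ennreal (B * sqrt (norm y) * (4 * t powr (1/4)))" .
   show "(\<lambda>x. LINT s:{0<..<t}|lborel. conv (?l s) (\<lambda>y. (v s y)\<^sup>2) x) \<in> borel_measurable borel"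
    unfolding set_lebesgue_integral_def conv_def by measurable
  qed (use C B kc_pos in \<open>auto simp: less_imp_le\<close>)
  also have "\<dots> \<le> ennreal ((sqrt (2 * kc) * C + B * (4 * T powr (1/4))) * sqrt (norm y))"
  proof (rule ennreal_leI)
   have "B * sqrt (norm y) * (4 * t powr (1/4)) \<le> B * sqrt (norm y) * (4 * T powr (1/4))"
    using t B by (intro mult_left_mono powr_mono2) auto
   then show "sqrt (2 * kc) * sqrt (norm y) * C + B * sqrt (norm y) * (4 * t powr (1/4)) \<le> (sqrt (2 * kc) * C + B * (4 * T powr (1/4))) * sqrt (norm y)"
    by (simp add: algebra_simps)
  qed
  finally show "nL (\<lambda>x. v t (x - y) - v t x) \<le> ennreal ((sqrt (2 * kc) * C + B * (4 * T powr (1/4))) * sqrt (norm y))" .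
 qed (use C B kc_pos in \<open>auto simp: less_imp_le\<close>)
qed

end

section \<open>The energy inequality\<close>

lemma integral_square_le:
 fixes e :: "real^4 \<Rightarrow> real"
 assumes [measurable]: "e \<in> borel_measurable borel" and "nL e \<le> ennreal A" "\<And>x. \<bar>e x\<bar> \<le> B" "0 \<le> A"
 shows "integrable lborel (\<lambda>x. (e x)\<^sup>2)" "(LI x. (e x)\<^sup>2) \<le> B * A"
proof -
 have n: "nL (\<lambda>x. (e x)\<^sup>2) \<le> ennreal (A * B)"
  unfolding power2_eq_square by (rule nL_mult_bounded) (use assms in auto)
 show "integrable lborel (\<lambda>x. (e x)\<^sup>2)" by (rule integrable_nL_le[OF _ n]) simp
 have "0 \<le> B" using assms(3)[of 0] by simp
 then have "\<bar>LI x. (e x)\<^sup>2\<bar> \<le> A * B" using assms(4) by (intro abs_integral_le_nL[OF n]) simp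
 then show "(LI x. (e x)\<^sup>2) \<le> B * A" by (simp add: mult.commute)
qed

lemma nn_integral_inverse_14_reflect:
 assumes "0 < t"
 shows "(nT {0<..<t} (\<lambda>s. (t - s) powr - (1/4))) \<le> ennreal (2 * t powr (3/4))"
proof -
 have "(nT {0<..<t} (\<lambda>s. (t - s) powr - (1/4))) = ennreal (t powr (3/4) / (3/4))"
  using assms nn_integral_powr_0[of "1/4" t]
  by (subst nn_integral_interval_reflect[of "\<lambda>s. ennreal (s powr - (1/4))"]) auto
 also have "\<dots> \<le> ennreal (2 * t powr (3/4))" using powr_ge_zero[of t "3/4"] by (intro ennreal_leI) simp
 finally show ?thesis .
qed

context mild begin

text \<open>Write v(t+h) = w + z with w the heat flow of v(t) and z the Duhamel term. The square of
  z is of order h^(1/2 + 3/4). In the cross term, integration by parts puts the derivative on w, and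
  replacing the smoothed nonlinearity by w^2 gives zero by \<open>ibp_cube\<close>. The replacement
  error has L^1 norm of order h^(1/4), by the moduli of continuity, and is paired with the gradient
  by Young's inequality; the gradient part is absorbed by half of the dissipation. The second
  conclusion is used to pass from w back to v.\<close>

lemma energy_step:
 assumes T: "T \<ge> 1"
 shows "\<exists>K\<ge>0. \<forall>t\<in>{1..T}. \<forall>h\<in>{0<..1}.
   (LI x. (v (t + h) x)\<^sup>2) \<le> (LI x. (v t x)\<^sup>2)
     - ((LI x. (v t x)\<^sup>2) - (LI x. (heatS h (v t) x)\<^sup>2)) / 2 + K * h powr (5/4)
   \<and> nL (\<lambda>x. heatS h (v t) x - v t x) \<le> ennreal (K * h powr (1/4))"
proof -
 obtain C where C: "0 \<le> C" "\<And>t. t \<in> {0..T + 1} \<Longrightarrow> nL (v t) \<le> ennreal C" "\<And>t x. t \<in> {0..T + 1} \<Longrightarrow> \<bar>v t x\<bar> \<le> C"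
  using v_local[of "T + 1"] T by auto
 obtain H where H: "0 \<le> H" "\<And>t y. t \<in> {1..T + 1} \<Longrightarrow> nL (\<lambda>x. v t (x - y) - v t x) \<le> ennreal (H * sqrt (norm y))"
  using v_modulus[of "T + 1"] T by auto
 have f: "nL (\<lambda>y. (v s y)\<^sup>2) \<le> ennreal (C * C)" "\<bar>(v s x)\<^sup>2\<bar> \<le> C * C" if "s \<in> {0..T + 1}" for s x
  using v_square_bounds[of s C C, OF C(2,3)[OF that] C(1)] by (auto simp: power2_eq_square)
 have vi: "integrable lborel (v s)" "integrable lborel (\<lambda>x. (v s x)\<^sup>2)" if "s \<in> {0..T + 1}" for s
  using C(2)[OF that] f(1)[OF that] by (auto intro!: integrable_nL_le)
 define Hf where "Hf = 2 * C * H"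
 have Hf: "0 \<le> Hf" using C H by (simp add: Hf_def)
 have fm: "nL (\<lambda>x. (v s (x - y))\<^sup>2 - (v s x)\<^sup>2) \<le> ennreal (Hf * sqrt (norm y))" if "s \<in> {1..T + 1}" for s y
 proof -
  have "nL (\<lambda>x. (v s (x - y) - v s x) * (v s (x - y) + v s x)) \<le> ennreal (H * sqrt (norm y) * (2 * C))"
  proof (rule nL_mult_bounded[OF _ H(2)[OF that]])
   show "\<bar>v s (x - y) + v s x\<bar> \<le> 2 * C" for x
    using C(3)[of s x] C(3)[of s "x - y"] that by auto
  qed (use H in auto)
  moreover have "(v s (x - y) - v s x) * (v s (x - y) + v s x) = (v s (x - y))\<^sup>2 - (v s x)\<^sup>2" for x
   by (simp add: power2_eq_square algebra_simps)
  ultimately show ?thesis by (simp add: Hf_def mult_ac)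
 qed
 define Z1 where "Z1 = kc * norm a * Hf * m1 * 2 * 2"
 define Zs where "Zs = kc * norm a * (C * C) * 2"
 define K3 where "K3 = Z1 + H * m1"
 define K4 where "K4 = Hf * m1 + K3 * (2 * C) + H * m1 * (2 * C)"
 define Cg where "Cg = (norm a)\<^sup>2 * mc 2"
 \<comment> \<open>The weight in Young's inequality, chosen so that the gradient term consumes at
   most half of the dissipation.\<close>
 define \<eta> where "\<eta> = 1 / (4 * (Cg + 1))"
 \<comment> \<open>The three summands belong to the square of z, to the Young remainder of the cross
   term, and to the closeness of w and v.\<close>
 define K where "K = Zs * Z1 + 1 / (2 * \<eta>) * (2 * (C * C) * K4) + H * m1"
 have Cg: "0 \<le> Cg" by (simp add: Cg_def less_imp_le)
 have \<eta>: "0 < \<eta>" "2 * \<eta> * Cg \<le> 1 / 2"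
  using Cg by (auto simp: \<eta>_def field_simps)
 have pos: "0 \<le> Z1" "0 \<le> Zs" "0 \<le> K3" "0 \<le> K4" "0 \<le> K"
  using C H Hf kc_pos m1_pos \<eta> by (auto simp: Z1_def Zs_def K3_def K4_def K_def less_imp_le)
 define z where "z t s x = v (t + s) x - heatS s (v t) x" for t s x
 have z_eq: "z t s x = (LINT r:{0<..<s}|lborel. heatP a (s - r) (\<lambda>y. (v (t + r) y)\<^sup>2) x)" if "t \<in> {1..T}" "s \<in> {0<..1}" for t s x
  using v_mild[of t s x] that by (simp add: z_def)
 have zm[measurable]: "z t s \<in> borel_measurable borel" for t s unfolding z_def by measurable
 have zL: "nL (z t s) \<le> ennreal (Z1 * s powr (3/4))" and zS: "\<bar>z t s x\<bar> \<le> Zs * sqrt s"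
  if t: "t \<in> {1..T}" "s \<in> {0<..1}" for t s x
 proof -
  have m: "case_prod (\<lambda>r x. heatP a (s - r) (\<lambda>y. (v (t + r) y)\<^sup>2) x) \<in> borel_measurable (lborel \<Otimes>\<^sub>M lborel)"
   by measurable
  have "nL (z t s) \<le> (nT {0<..<s} (\<lambda>r. kc * norm a * Hf * m1 * 2 * (s - r) powr - (1/4)))"
   unfolding z_eq[OF t]
   by (rule nL_time[OF m], simp, rule nL_heatP_modulus[of _ "C * C"]) (use t f(2) fm Hf in auto)
  also have "\<dots> \<le> ennreal (kc * norm a * Hf * m1 * 2 * (2 * s powr (3/4)))"
   using nn_integral_inverse_14_reflect[of s] t Hf kc_pos m1_pos by (intro set_nn_integral_cmult) (auto simp: less_imp_le)
  finally show "nL (z t s) \<le> ennreal (Z1 * s powr (3/4))" by (simp add: Z1_def mult_ac)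
  have "\<bar>z t s x\<bar> \<le> kc * norm a * (C * C) * (2 * sqrt s)"
   unfolding z_eq[OF t]
  proof (rule abs_set_integral_le)
   show "(nT {0<..<s} (\<lambda>r. kc * norm a * (C * C) * (1 / sqrt (s - r)))) \<le> ennreal (kc * norm a * (C * C) * (2 * sqrt s))"
    using nn_integral_inverse_sqrt_reflect[of 0 s] t C kc_pos by (intro set_nn_integral_cmult) (auto simp: less_imp_le)
   fix r assume "r \<in> {0<..<s}"
   then show "\<bar>heatP a (s - r) (\<lambda>y. (v (t + r) y)\<^sup>2) x\<bar> \<le> kc * norm a * (C * C) * (1 / sqrt (s - r))"
    using abs_heatP_le[of "s - r" "\<lambda>y. (v (t + r) y)\<^sup>2" "C * C" a x] f(2)[of "t + r"] t by (simp add: mult_ac)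
  qed (use t C kc_pos in \<open>auto simp: less_imp_le\<close>)
  then show "\<bar>z t s x\<bar> \<le> Zs * sqrt s" by (simp add: Zs_def mult_ac)
 qed
 have hs: "nL (\<lambda>x. heatS h (v t) x - v t x) \<le> ennreal (H * m1 * h powr (1/4))" if "t \<in> {1..T}" "h > 0" for t h
  using nL_heatS_minus[of "v t" C H h] C(3)[of t] H that by (simp add: mult.assoc)
 have vt: "nL (\<lambda>x. v (t + s) x - v t x) \<le> ennreal (K3 * s powr (1/4))" if t: "t \<in> {1..T}" "s \<in> {0<..1}" for t s
 proof -
  have "nL (\<lambda>x. z t s x + (heatS s (v t) x - v t x)) \<le> ennreal (Z1 * s powr (3/4) + H * m1 * s powr (1/4))"
   by (rule nL_add) (use zL[OF t] hs[OF t(1), of s] t pos H m1_pos in \<open>auto simp: less_imp_le\<close>)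
  also have "\<dots> \<le> ennreal (K3 * s powr (1/4))"
  proof (rule ennreal_leI)
   have "s powr (3/4) \<le> s powr (1/4)" using t by (intro powr_mono') auto
   then have "Z1 * s powr (3/4) \<le> Z1 * s powr (1/4)" using pos by (intro mult_left_mono)
   then show "Z1 * s powr (3/4) + H * m1 * s powr (1/4) \<le> K3 * s powr (1/4)" by (simp add: K3_def distrib_right)
  qed
  finally show ?thesis by (simp add: z_def)
 qed
 have "(LI x. (v (t + h) x)\<^sup>2) \<le> (LI x. (v t x)\<^sup>2)
     - ((LI x. (v t x)\<^sup>2) - (LI x. (heatS h (v t) x)\<^sup>2)) / 2 + K * h powr (5/4)"
  if t: "t \<in> {1..T}" and h: "h \<in> {0<..1}" for t h
 proof -
  have h0: "0 < h" and h1: "h \<le> 1" using h by auto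
  have tT: "t \<in> {0..T + 1}" using t by auto
  define w where "w = heatS h (v t)"
  define P where "P = heatP a h (v t)"
  have [measurable]: "w \<in> borel_measurable borel" "P \<in> borel_measurable borel" by (auto simp: w_def P_def)
  note gd = gradient_le_dissipation[OF h0 vi(1)[OF tT] C(3)[OF tT]]
  have wb: "\<bar>w x\<bar> \<le> C" for x unfolding w_def by (rule abs_heatS_le[OF h0 C(3)[OF tT]])
  have w2b: "\<bar>(w x)\<^sup>2\<bar> \<le> C * C" for x using power_mono[OF wb[of x], of 2] by (simp add: power2_eq_square)
  have wi: "integrable lborel w" unfolding w_def by (rule conv_integrable_bounded[OF h0 vi(1)[OF tT]])
  have w2i: "integrable lborel (\<lambda>x. (w x)\<^sup>2)" unfolding w_def by (rule gd(3))
  have P2i: "integrable lborel (\<lambda>x. (P x)\<^sup>2)" unfolding P_def by (rule gd(2))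
  have Pi: "integrable lborel P" unfolding P_def by (rule conv_integrable_bounded[OF h0 vi(1)[OF tT]])
  define d where "d = (LI x. (v t x)\<^sup>2) - (LI x. (w x)\<^sup>2)"
  have Pd: "h * (LI x. (P x)\<^sup>2) \<le> Cg * d"
   using gd(1)[of a] h0 unfolding P_def[symmetric] w_def[symmetric] d_def[symmetric] Cg_def[symmetric] by (simp add: field_simps)
  have zb: "\<bar>z t h x\<bar> \<le> Zs * sqrt h" for x by (rule zS[OF t h])
  have zi: "integrable lborel (z t h)" by (rule integrable_nL_le[OF _ zL[OF t h]]) simp
  have z2: "integrable lborel (\<lambda>x. (z t h x)\<^sup>2)" "(LI x. (z t h x)\<^sup>2) \<le> Zs * sqrt h * (Z1 * h powr (3/4))"
   using integral_square_le[OF zm zL[OF t h] zb] pos by auto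
  have wz: "integrable lborel (\<lambda>x. w x * z t h x)"
   by (rule integrable_mult_bounded[OF wi _ zb]) simp
  have "(LI x. (v (t + h) x)\<^sup>2) = (LI x. (w x)\<^sup>2 + 2 * (w x * z t h x) + (z t h x)\<^sup>2)"
   by (intro Bochner_Integration.integral_cong) (simp_all add: z_def w_def power2_eq_square algebra_simps)
  also have "\<dots> = (LI x. (w x)\<^sup>2) + 2 * (LI x. w x * z t h x) + (LI x. (z t h x)\<^sup>2)"
   using w2i wz z2 by simp
  finally have E: "(LI x. (v (t + h) x)\<^sup>2) = (LI x. (w x)\<^sup>2) + 2 * (LI x. w x * z t h x) + (LI x. (z t h x)\<^sup>2)" .
  let ?f = "\<lambda>r y. (v (t + r) y)\<^sup>2"
  let ?I = "LI x. (P x)\<^sup>2"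
  let ?\<beta> = "\<eta> * ?I + 1 / (4 * \<eta>) * (2 * (C * C) * (K4 * h powr (1/4)))"
  have \<beta>0: "0 \<le> ?\<beta>" using \<eta> C pos by (auto intro!: add_nonneg_nonneg mult_nonneg_nonneg)
  have m: "case_prod (\<lambda>r x. heatP a (h - r) (?f r) x) \<in> borel_measurable (lborel \<Otimes>\<^sub>M lborel)"
   by measurable
  have inner: "\<bar>LI x. w x * heatP a (h - r) (?f r) x\<bar> \<le> ?\<beta>" if r: "r \<in> {0<..<h}" for r
  proof -
   have tr: "t + r \<in> {0..T + 1}" "t + r \<in> {1..T + 1}" "r \<in> {0<..1}" and hr: "h - r > 0" using r t h by auto
   define e where "e x = heatS (h - r) (?f r) x - (w x)\<^sup>2" for x
   have [measurable]: "e \<in> borel_measurable borel" unfolding e_def by measurable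
   have sb: "\<bar>heatS (h - r) (?f r) x\<bar> \<le> C * C" for x by (rule abs_heatS_le[OF hr f(2)[OF tr(1)]])
   have eb: "\<bar>e x\<bar> \<le> 2 * (C * C)" for x using sb[of x] w2b[of x] unfolding e_def by linarith
   have eL: "nL e \<le> ennreal (K4 * h powr (1/4))"
   proof -
    have p1: "(h - r) powr (1/4) \<le> h powr (1/4)" "r powr (1/4) \<le> h powr (1/4)"
     using r by (auto intro!: powr_mono2)
    have 1: "nL (\<lambda>x. heatS (h - r) (?f r) x - ?f r x) \<le> ennreal (Hf * (m1 * (h - r) powr (1/4)))"
     by (rule nL_heatS_minus[OF _ f(2)[OF tr(1)] fm[OF tr(2)] Hf hr]) simp
    have 2: "nL (\<lambda>x. (v (t + r) x - v t x) * (v (t + r) x + v t x)) \<le> ennreal (K3 * r powr (1/4) * (2 * C))"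
    proof (rule nL_mult_bounded[OF _ vt[OF t tr(3)]])
     show "\<bar>v (t + r) x + v t x\<bar> \<le> 2 * C" for x using C(3)[OF tr(1), of x] C(3)[OF tT, of x] by linarith
    qed (use pos in auto)
    have 3: "nL (\<lambda>x. (heatS h (v t) x - v t x) * - (w x + v t x)) \<le> ennreal (H * m1 * h powr (1/4) * (2 * C))"
    proof (rule nL_mult_bounded[OF _ hs[OF t h0]])
     show "\<bar>- (w x + v t x)\<bar> \<le> 2 * C" for x using wb[of x] C(3)[OF tT, of x] by linarith
    qed (use H m1_pos in \<open>auto simp: less_imp_le\<close>)
    \<comment> \<open>The error is telescoped: smoothing of the nonlinearity, its change from time t
      to t + r, and v^2 - w^2 at time t. Each difference of squares is an increment times a bounded
      sum.\<close>
    have "nL (\<lambda>x. ((heatS (h - r) (?f r) x - ?f r x) + (v (t + r) x - v t x) * (v (t + r) x + v t x)) + (heatS h (v t) x - v t x) * - (w x + v t x))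
      \<le> ennreal ((Hf * (m1 * (h - r) powr (1/4)) + K3 * r powr (1/4) * (2 * C)) + H * m1 * h powr (1/4) * (2 * C))"
     by (rule nL_add[OF _ _ nL_add[OF _ _ 1 2] 3]) (use Hf m1_pos pos C H in \<open>auto simp: less_imp_le\<close>)
    also have "(\<lambda>x. ((heatS (h - r) (?f r) x - ?f r x) + (v (t + r) x - v t x) * (v (t + r) x + v t x)) + (heatS h (v t) x - v t x) * - (w x + v t x)) = e"
     by (simp add: fun_eq_iff e_def w_def power2_eq_square algebra_simps)
    also have "(Hf * (m1 * (h - r) powr (1/4)) + K3 * r powr (1/4) * (2 * C)) + H * m1 * h powr (1/4) * (2 * C) \<le> K4 * h powr (1/4)"
    proof -
     have "Hf * (m1 * (h - r) powr (1/4)) \<le> Hf * (m1 * h powr (1/4))" "K3 * r powr (1/4) * (2 * C) \<le> K3 * h powr (1/4) * (2 * C)"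
      using p1 Hf m1_pos pos C by (auto intro!: mult_left_mono mult_right_mono simp: less_imp_le)
     then show ?thesis by (simp add: K4_def algebra_simps)
    qed
    finally show ?thesis by (simp add: ennreal_leI)
   qed
   have ei: "integrable lborel e" by (rule integrable_nL_le[OF _ eL]) simp
   have e2: "integrable lborel (\<lambda>x. (e x)\<^sup>2)" "(LI x. (e x)\<^sup>2) \<le> 2 * (C * C) * (K4 * h powr (1/4))"
    using integral_square_le[OF _ eL eb] pos by auto
   have Pe: "integrable lborel (\<lambda>x. P x * e x)" by (rule integrable_mult_bounded[OF Pi _ eb]) simp
   have Pw: "integrable lborel (\<lambda>x. P x * (w x)\<^sup>2)" by (rule integrable_mult_bounded[OF Pi _ w2b]) simp
   have "(LI x. w x * heatP a (h - r) (?f r) x) = - (LI x. P x * heatS (h - r) (?f r) x)"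
    unfolding w_def P_def by (rule ibp_heatS_heatP[OF h0 hr vi(1)[OF tT] C(3)[OF tT] vi(2)[OF tr(1)] f(2)[OF tr(1)]])
   also have "(LI x. P x * heatS (h - r) (?f r) x) = (LI x. P x * e x + P x * (w x)\<^sup>2)"
    by (intro Bochner_Integration.integral_cong) (simp_all add: e_def algebra_simps)
   also have "\<dots> = (LI x. P x * e x)"
    using Pe Pw ibp_cube[OF h0 vi(1)[OF tT] C(3)[OF tT], of a] by (simp add: P_def[symmetric] w_def[symmetric])
   finally have eq: "\<bar>LI x. w x * heatP a (h - r) (?f r) x\<bar> = \<bar>LI x. P x * e x\<bar>" by simp
   have "\<bar>LI x. P x * e x\<bar> \<le> (LI x. \<bar>P x * e x\<bar>)" by (rule integral_abs_bound)
   also have "\<dots> \<le> (LI x. \<eta> * (P x)\<^sup>2 + 1 / (4 * \<eta>) * (e x)\<^sup>2)"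
   proof (rule integral_mono)
    fix x
    have "0 \<le> (2 * \<eta> * \<bar>P x\<bar> - \<bar>e x\<bar>)\<^sup>2 / (4 * \<eta>)" using \<eta> by simp
    also have "\<dots> = \<eta> * (P x)\<^sup>2 + 1 / (4 * \<eta>) * (e x)\<^sup>2 - \<bar>P x * e x\<bar>"
     using \<eta> by (simp add: power2_diff power_mult_distrib abs_mult add_divide_distrib diff_divide_distrib) (simp add: power2_eq_square)
    finally show "\<bar>P x * e x\<bar> \<le> \<eta> * (P x)\<^sup>2 + 1 / (4 * \<eta>) * (e x)\<^sup>2" by simp
   qed (use Pe P2i e2 in auto)
   also have "\<dots> = \<eta> * ?I + 1 / (4 * \<eta>) * (LI x. (e x)\<^sup>2)" using P2i e2 by simp
   also have "\<dots> \<le> ?\<beta>" using e2(2) \<eta> by (intro add_left_mono mult_left_mono) auto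
   finally show ?thesis using eq by simp
  qed
  have "(LI x. w x * z t h x) = (LINT r:{0<..<h}|lborel. (LI x. w x * heatP a (h - r) (?f r) x))"
   unfolding z_eq[OF t h]
  proof (rule Fubini_time[OF m _ _ wb])
   have "(\<integral>\<^sup>+r\<in>{0<..<h}. nL (heatP a (h - r) (?f r)) \<partial>lborel) \<le> (nT {0<..<h} (\<lambda>r. kc * norm a * (C * C) * (1 / sqrt (h - r))))"
   proof (intro nn_integral_mono)
    fix r
    show "nL (heatP a (h - r) (?f r)) * indicator {0<..<h} r \<le> ennreal (kc * norm a * (C * C) * (1 / sqrt (h - r))) * indicator {0<..<h} r"
     using nL_heatP[of "h - r" "?f r" "C * C" a] f(1)[of "t + r"] t h C by (auto split: split_indicator simp: mult_ac)
   qed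
   also have "\<dots> \<le> ennreal (kc * norm a * (C * C) * (2 * sqrt h))"
    using nn_integral_inverse_sqrt_reflect[of 0 h] h0 C kc_pos by (intro set_nn_integral_cmult) (auto simp: less_imp_le)
   finally show "(\<integral>\<^sup>+r\<in>{0<..<h}. nL (heatP a (h - r) (?f r)) \<partial>lborel) \<le> ennreal (kc * norm a * (C * C) * (2 * sqrt h))" .
  qed auto
  also have "\<bar>\<dots>\<bar> \<le> ?\<beta> * h"
   by (rule abs_set_integral_le[OF inner]) (use \<beta>0 h0 in \<open>auto simp: nn_integral_cmult_indicator ennreal_mult\<close>)
  finally have wz_le: "2 * (LI x. w x * z t h x) \<le> 2 * (?\<beta> * h)" by linarith
  have "2 * (?\<beta> * h) = 2 * \<eta> * (h * ?I) + 1 / (2 * \<eta>) * (2 * (C * C) * K4) * (h powr (1/4) * h)"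
   by (simp add: algebra_simps)
  also have "\<dots> \<le> 2 * \<eta> * (Cg * d) + 1 / (2 * \<eta>) * (2 * (C * C) * K4) * h powr (5/4)"
  proof (intro add_mono mult_left_mono Pd)
   show "h powr (1/4) * h \<le> h powr (5/4)" using h0 powr_mult_base[of h "1/4"] by (simp add: mult.commute)
  qed (use \<eta> pos C in auto)
  finally have b1: "2 * (?\<beta> * h) \<le> 2 * \<eta> * (Cg * d) + 1 / (2 * \<eta>) * (2 * (C * C) * K4) * h powr (5/4)" .
  have "0 \<le> h * ?I" using h0 by simp
  with Pd have d0: "0 \<le> Cg * d" by (rule order_trans[rotated])
  have dd: "2 * \<eta> * (Cg * d) \<le> d / 2"
  \<comment> \<open>The dissipation d must be known to be nonnegative. The gradient in direction a
    shows it when a \<noteq> 0; when a = 0 a coordinate direction serves instead.\<close>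
  proof (cases "Cg = 0")
   case True
   have "0 \<le> h * (LI x. (heatP (axis 0 1) h (v t) x)\<^sup>2)" using h0 by simp
   also have "\<dots> \<le> (norm (axis 0 1 :: real^4))\<^sup>2 * mc 2 * d"
    using gd(1)[of "axis 0 1"] h0 unfolding w_def[symmetric] d_def[symmetric] by (simp add: field_simps)
   finally have "0 \<le> d" using mc_pos[of 2] by (simp add: zero_le_mult_iff)
   then show ?thesis using True by simp
  next
   case False
   then have "0 \<le> d" using d0 Cg by (simp add: zero_le_mult_iff)
   from mult_right_mono[OF \<eta>(2) this] show ?thesis by (simp add: mult_ac)
  qed
  have ZZ: "Zs * sqrt h * (Z1 * h powr (3/4)) = Zs * Z1 * h powr (5/4)"
  proof -
   have "sqrt h * h powr (3/4) = h powr (5/4)" using h0 by (simp add: powr_half_sqrt[symmetric] powr_add[symmetric])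
   then show ?thesis by (simp add: mult_ac)
  qed
  have Hm: "0 \<le> H * m1 * h powr (5/4)" using H m1_pos by (simp add: less_imp_le)
  have "(LI x. (v (t + h) x)\<^sup>2) \<le> (LI x. (w x)\<^sup>2) + d / 2 + K * h powr (5/4)"
  proof -
   have Kh: "K * h powr (5/4) = Zs * Z1 * h powr (5/4) + 1 / (2 * \<eta>) * (2 * (C * C) * K4) * h powr (5/4) + H * m1 * h powr (5/4)"
    by (simp only: K_def distrib_right)
   show ?thesis
    using order_trans[OF wz_le b1] dd z2(2) Hm
    unfolding E Kh ZZ by linarith
  qed
  then show ?thesis unfolding w_def[symmetric] d_def by (simp add: field_simps)
 qed
 moreover have "nL (\<lambda>x. heatS h (v t) x - v t x) \<le> ennreal (K * h powr (1/4))" if "t \<in> {1..T}" "h \<in> {0<..1}" for t h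
 proof -
  have "H * m1 * h powr (1/4) \<le> K * h powr (1/4)"
   using pos C \<eta> by (intro mult_right_mono) (auto simp: K_def)
  then show ?thesis using hs[OF that(1), of h] that(2) by (meson ennreal_leI greaterThanAtMost_iff order_trans)
 qed
 ultimately show ?thesis using pos by blast
qed

text \<open>Since the total dissipation over \<open>[1, 1 + T]\<close> is bounded independently of \<open>T\<close>, it is small in
 some short time step; Hardy's inequality turns this into smallness in a scaling-critical norm.\<close>

lemma small_hardy_norm:
 assumes \<epsilon>: "\<epsilon> > 0"
 shows "\<exists>T\<ge>1. \<forall>\<tau>>0. \<exists>t0\<in>{1..T}. \<forall>x0. (LI y. (v t0 y)\<^sup>2 / ((norm (y - x0))\<^sup>2 + \<tau>)) \<le> \<epsilon>"
proof -
 define E where "E t = (LI x. (v t x)\<^sup>2)" for t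
 have E0: "0 \<le> E t" for t by (simp add: E_def)
 \<comment> \<open>Over a time span L the best step has dissipation rate at most 2 E(1)/L up to
   errors; the 32 collects the four directions and the doubling when w is replaced by v, and leaves
   half of \<epsilon> for the errors.\<close>
 define L where "L = 1 + 32 * mc 2 * E 1 / \<epsilon>"
 have L: "1 \<le> L" "32 * mc 2 * E 1 / L \<le> \<epsilon>"
 proof -
  have p: "0 \<le> 32 * mc 2 * E 1 / \<epsilon>" using \<epsilon> E0[of 1] mc_pos[of 2] by (simp add: less_imp_le)
  then show "1 \<le> L" by (simp add: L_def)
  then show "32 * mc 2 * E 1 / L \<le> \<epsilon>" using \<epsilon> p by (simp add: L_def field_simps)
 qed
 obtain K where K: "K \<ge> 0" and step: "\<And>t h. t \<in> {1..1 + L} \<Longrightarrow> h \<in> {0<..1} \<Longrightarrow>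
   E (t + h) \<le> E t - (E t - (LI x. (heatS h (v t) x)\<^sup>2)) / 2 + K * h powr (5/4)"
  and hsm: "\<And>t h. t \<in> {1..1 + L} \<Longrightarrow> h \<in> {0<..1} \<Longrightarrow> nL (\<lambda>x. heatS h (v t) x - v t x) \<le> ennreal (K * h powr (1/4))"
  using energy_step[of "1 + L"] L unfolding E_def by auto
 obtain C where C: "0 \<le> C" "\<And>t. t \<in> {0..2 + L} \<Longrightarrow> nL (v t) \<le> ennreal C" "\<And>t x. t \<in> {0..2 + L} \<Longrightarrow> \<bar>v t x\<bar> \<le> C"
  using v_local[of "2 + L"] L by auto
 have "\<exists>t0\<in>{1..1 + L}. \<forall>x0. (LI y. (v t0 y)\<^sup>2 / ((norm (y - x0))\<^sup>2 + \<tau>)) \<le> \<epsilon>" if \<tau>: "\<tau> > 0" for \<tau>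
 proof -
  \<comment> \<open>The error constant depends on \<tau> through the bound 1/\<tau> of the weight,
    but only the step length h depends on it. The span L does not, and \<open>critical_decay\<close>
    chooses \<tau> after the span.\<close>
  define Q where "Q = 16 * mc 2 * K + 2 * (2 * C * (1 / \<tau>) * K)"
  have Q: "0 \<le> Q" using K C \<tau> mc_pos[of 2] by (auto simp: Q_def less_imp_le)
  \<comment> \<open>The fourth power undoes the exponent in h^(1/4), so that Q h^(1/4) \<le>
    \<epsilon>/2; the added 1 forces h \<le> 1.\<close>
  define N where "N = nat \<lceil>L * ((2 * Q + 1) / \<epsilon> + 1) ^ 4\<rceil>"
  have Nge: "L * ((2 * Q + 1) / \<epsilon> + 1) ^ 4 \<le> real N"
   unfolding N_def by linarith
  have big: "1 \<le> (2 * Q + 1) / \<epsilon> + 1" using Q \<epsilon> by simp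
  then have "L * 1 \<le> L * ((2 * Q + 1) / \<epsilon> + 1) ^ 4" using L by (intro mult_left_mono) auto
  with Nge have NL: "L \<le> real N" by linarith
  then have N0: "0 < N" using L by (cases N) auto
  define h where "h = L / real N"
  have h: "0 < h" "h \<le> 1" using NL N0 L by (auto simp: h_def)
  have hQ: "Q * h powr (1/4) \<le> \<epsilon> / 2"
  proof -
   have "h \<le> (1 / ((2 * Q + 1) / \<epsilon> + 1)) ^ 4"
    using Nge N0 L big by (simp add: h_def power_one_over field_simps)
   then have "h powr (1/4) \<le> ((1 / ((2 * Q + 1) / \<epsilon> + 1)) ^ 4) powr (1/4)"
    using h by (intro powr_mono2) auto
   also have "\<dots> = 1 / ((2 * Q + 1) / \<epsilon> + 1)"
   proof -
    have root: "(g ^ 4) powr (1/4) = g" if "0 < g" for g :: real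
    proof -
     have "(g ^ 4) powr (1/4) = (g powr 4) powr (1/4)" using that by simp
     also have "\<dots> = g powr 1" unfolding powr_powr by simp
     finally show ?thesis using that by simp
    qed
    show ?thesis by (rule root) (use big in simp)
   qed
   also have "\<dots> \<le> 1 / ((2 * Q + 1) / \<epsilon>)"
   proof -
    have aux: "1 / (B + 1) \<le> 1 / B" if "0 < B" for B :: real using that by (simp add: field_simps)
    show ?thesis by (rule aux) (use Q \<epsilon> in simp)
   qed
   finally have "Q * h powr (1/4) \<le> Q * (1 / ((2 * Q + 1) / \<epsilon>))" using Q by (intro mult_left_mono)
   also have "\<dots> \<le> \<epsilon> / 2" using Q \<epsilon> by (simp add: field_simps)
   finally show ?thesis .
  qed
  define tk where "tk k = 1 + real k * h" for k
  define dk where "dk k = E (tk k) - (LI x. (heatS h (v (tk k)) x)\<^sup>2)" for k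
  have tk: "tk k \<in> {1..1 + L}" if "k \<le> N" for k
   using that N0 L h by (auto simp: tk_def h_def field_simps)
  have sum: "(\<Sum>k<n. dk k) / 2 \<le> E 1 - E (tk n) + real n * (K * h powr (5/4))" if "n \<le> N" for n
   using that
  proof (induction n)
   case 0 then show ?case by (simp add: tk_def)
  next
   case (Suc n)
   have "E (tk n + h) \<le> E (tk n) - dk n / 2 + K * h powr (5/4)"
    unfolding dk_def by (rule step) (use Suc tk h in auto)
   moreover have "tk n + h = tk (Suc n)" by (simp add: tk_def algebra_simps)
   ultimately show ?case using Suc by (simp add: algebra_simps add_divide_distrib)
  qed
  \<comment> \<open>Pigeonhole: the sum of all losses is controlled by the initial energy, so some
    step loses no more than the average.\<close>
  have "\<exists>k<N. real N * dk k \<le> 2 * E 1 + 2 * real N * (K * h powr (5/4))"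
  proof (rule ccontr)
   assume "\<not> ?thesis"
   then have "\<And>k. k < N \<Longrightarrow> (2 * E 1 + 2 * real N * (K * h powr (5/4))) / real N < dk k"
    using N0 by (auto simp: not_le field_simps)
   then have "(\<Sum>k<N. (2 * E 1 + 2 * real N * (K * h powr (5/4))) / real N) < (\<Sum>k<N. dk k)"
    using N0 by (intro sum_strict_mono) auto
   then have "2 * E 1 + 2 * real N * (K * h powr (5/4)) < (\<Sum>k<N. dk k)" using N0 by simp
   with sum[of N] E0[of "tk N"] show False by simp
  qed
  then obtain k where k: "k < N" "real N * dk k \<le> 2 * E 1 + 2 * real N * (K * h powr (5/4))" by blast
  define t0 where "t0 = tk k"
  have t0: "t0 \<in> {1..1 + L}" "t0 \<in> {0..2 + L}" using tk[of k] k by (auto simp: t0_def)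
  have vi: "integrable lborel (v t0)" using C(2)[OF t0(2)] by (intro integrable_nL_le) auto
  have dh: "dk k / h \<le> 2 * E 1 / L + 2 * (K * h powr (1/4))"
  proof -
   have "dk k \<le> 2 * E 1 / real N + 2 * (K * h powr (5/4))" using k N0 by (simp add: field_simps)
   then have "dk k / h \<le> (2 * E 1 / real N + 2 * (K * h powr (5/4))) / h" using h by (intro divide_right_mono) auto
   also have "\<dots> = 2 * E 1 / L + 2 * (K * (h powr (5/4) / h))"
   proof -
    have "real N * h = L" using N0 by (simp add: h_def)
    then show ?thesis by (simp only: add_divide_distrib divide_divide_eq_left times_divide_eq_right)
   qed
   also have "h powr (5/4) / h = h powr (1/4)" using h powr_diff[of h "5/4" 1] by simp
   finally show ?thesis .
  qed
  show ?thesis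
  proof (intro bexI[OF _ t0(1)] allI)
   fix x0 :: "real^4"
   let ?D = "\<lambda>y. (norm (y - x0))\<^sup>2 + \<tau>"
   let ?w = "heatS h (v t0)"
   have D: "?D y > 0" "?D y \<ge> \<tau>" for y using \<tau> by (auto simp: add_nonneg_pos)
   have iD: "\<bar>1 / ?D y\<bar> \<le> 1 / \<tau>" for y using D[of y] \<tau> frac_le[of 1 1 \<tau> "?D y"] by simp
   have gd: "(LI x. (heatP (axis j 1) h (v t0) x)\<^sup>2) \<le> mc 2 * (dk k / h)" for j :: 4
    using gradient_le_dissipation(1)[OF h(1) vi C(3)[OF t0(2)], of "axis j 1"]
    by (simp add: dk_def t0_def E_def norm_axis_1 mult_ac)
   have "(LI y. (?w y)\<^sup>2 / ?D y) \<le> (\<Sum>j\<in>UNIV. LI y. (heatP (axis j 1) h (v t0) y)\<^sup>2)"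
    by (rule hardy[OF h(1) vi C(3)[OF t0(2)] \<tau>])
   also have "\<dots> \<le> (\<Sum>j\<in>(UNIV :: 4 set). mc 2 * (dk k / h))" by (intro sum_mono gd)
   also have "\<dots> = 4 * mc 2 * (dk k / h)" by simp
   also have "\<dots> \<le> 4 * mc 2 * (2 * E 1 / L + 2 * (K * h powr (1/4)))"
    using mc_pos[of 2] by (intro mult_left_mono dh) (auto simp: less_imp_le)
   finally have w_le: "(LI y. (?w y)\<^sup>2 / ?D y) \<le> 4 * mc 2 * (2 * E 1 / L + 2 * (K * h powr (1/4)))" .
   define e where "e y = ?w y - v t0 y" for y
   have [measurable]: "e \<in> borel_measurable borel" unfolding e_def by measurable
   have wb: "\<bar>?w x\<bar> \<le> C" for x by (rule abs_heatS_le[OF h(1) C(3)[OF t0(2)]])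
   have eb: "\<bar>e y\<bar> \<le> 2 * C" for y using wb[of y] C(3)[OF t0(2), of y] unfolding e_def by linarith
   have eL: "nL e \<le> ennreal (K * h powr (1/4))" unfolding e_def by (rule hsm[OF t0(1)]) (use h in auto)
   have e2: "integrable lborel (\<lambda>x. (e x)\<^sup>2)" "(LI x. (e x)\<^sup>2) \<le> 2 * C * (K * h powr (1/4))"
    using integral_square_le[OF _ eL eb] K by auto
   have w2: "integrable lborel (\<lambda>x. (?w x)\<^sup>2)" and v2: "integrable lborel (\<lambda>x. (v t0 x)\<^sup>2)"
    using gradient_le_dissipation(3,4)[OF h(1) vi C(3)[OF t0(2)]] by auto
   have i: "integrable lborel (\<lambda>y. g y / ?D y)" if "integrable lborel g" for g :: "real^4 \<Rightarrow> real"
    using integrable_mult_bounded[OF that, of "\<lambda>y. 1 / ?D y" "1 / \<tau>"] iD by simp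
   have "(LI y. (e y)\<^sup>2 / ?D y) \<le> (LI y. (e y)\<^sup>2 / \<tau>)"
   proof (rule integral_mono)
    show "(e y)\<^sup>2 / ?D y \<le> (e y)\<^sup>2 / \<tau>" for y using D[of y] \<tau> by (intro frac_le) auto
   qed (use i e2 in auto)
   also have "\<dots> \<le> 2 * C * (K * h powr (1/4)) / \<tau>" using e2 \<tau> by (simp add: divide_right_mono)
   finally have e_le: "(LI y. (e y)\<^sup>2 / ?D y) \<le> 2 * C * (K * h powr (1/4)) / \<tau>" .
   have "(LI y. (v t0 y)\<^sup>2 / ?D y) \<le> (LI y. 2 * ((?w y)\<^sup>2 / ?D y) + 2 * ((e y)\<^sup>2 / ?D y))"
   proof (rule integral_mono)
    fix y
    have "0 \<le> (?w y + e y)\<^sup>2" by simp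
    then have "(?w y - e y)\<^sup>2 \<le> 2 * (?w y)\<^sup>2 + 2 * (e y)\<^sup>2" by (simp add: power2_eq_square algebra_simps)
    then have "(v t0 y)\<^sup>2 \<le> 2 * (?w y)\<^sup>2 + 2 * (e y)\<^sup>2" by (simp add: e_def)
    then have "(v t0 y)\<^sup>2 / ?D y \<le> (2 * (?w y)\<^sup>2 + 2 * (e y)\<^sup>2) / ?D y" using D[of y] by (intro divide_right_mono) auto
    then show "(v t0 y)\<^sup>2 / ?D y \<le> 2 * ((?w y)\<^sup>2 / ?D y) + 2 * ((e y)\<^sup>2 / ?D y)" by (simp add: add_divide_distrib)
   qed (use i w2 e2 v2 in auto)
   also have "\<dots> = 2 * (LI y. (?w y)\<^sup>2 / ?D y) + 2 * (LI y. (e y)\<^sup>2 / ?D y)"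
    using i[OF w2] i[OF e2(1)] by (simp del: times_divide_eq_right)
   also have "\<dots> \<le> 2 * (4 * mc 2 * (2 * E 1 / L + 2 * (K * h powr (1/4)))) + 2 * (2 * C * (K * h powr (1/4)) / \<tau>)"
    using w_le e_le by linarith
   also have "\<dots> = (32 * mc 2 * E 1 / L) / 2 + Q * h powr (1/4)"
    by (simp add: Q_def algebra_simps)
   also have "\<dots> \<le> \<epsilon> / 2 + \<epsilon> / 2" by (intro add_mono hQ divide_right_mono L) simp
   also have "\<dots> = \<epsilon>" by simp
   finally show "(LI y. (v t0 y)\<^sup>2 / ?D y) \<le> \<epsilon>" .
  qed
 qed
 then show ?thesis using L by (intro exI[of _ "1 + L"]) auto
qed

end

section \<open>Smallness in the critical norm\<close>

lemma nn_absorb: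
 fixes G :: "'i \<Rightarrow> ennreal"
 assumes M: "0 \<le> M" "\<And>i. i \<in> S \<Longrightarrow> G i \<le> ennreal M" and X: "0 \<le> X"
  and step: "\<And>B. 0 \<le> B \<Longrightarrow> (\<And>i. i \<in> S \<Longrightarrow> G i \<le> ennreal B) \<Longrightarrow> (\<And>i. i \<in> S \<Longrightarrow> G i \<le> ennreal (X + B / 2))"
  and i: "i \<in> S"
 shows "G i \<le> ennreal (2 * X)"
proof -
 have *: "\<forall>i\<in>S. G i \<le> ennreal (2 * X + M / 2 ^ n)" for n
 proof (induction n)
  case 0
  show ?case
  proof
   fix i assume "i \<in> S"
   from M(2)[OF this] show "G i \<le> ennreal (2 * X + M / 2 ^ 0)"
    by (rule order_trans) (use X in \<open>auto intro!: ennreal_leI\<close>)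
  qed
 next
  case (Suc n)
  show ?case
  proof
   fix i assume "i \<in> S"
   with step[of "2 * X + M / 2 ^ n" i] Suc X M(1) have "G i \<le> ennreal (X + (2 * X + M / 2 ^ n) / 2)" by auto
   then show "G i \<le> ennreal (2 * X + M / 2 ^ Suc n)" by (simp add: add_divide_distrib mult.commute)
  qed
 qed
 have "(\<lambda>n. 2 * X + M * (1 / 2) ^ n) \<longlonglongrightarrow> 2 * X + M * 0"
  by (intro tendsto_intros LIMSEQ_realpow_zero) auto
 then have "(\<lambda>n. ennreal (2 * X + M / 2 ^ n)) \<longlonglongrightarrow> ennreal (2 * X)"
  by (intro tendsto_ennrealI) (simp add: power_one_over field_simps)
 then show ?thesis by (rule LIMSEQ_le_const) (use * i in auto)
qed

lemma ennreal_square: "ennreal (x\<^sup>2) = (ennreal \<bar>x\<bar>)\<^sup>2"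
 by (simp add: ennreal_power)

text \<open>Cauchy-Schwarz with weight |k| bounds the square of the convolution by A times |k|
  convolved with g^2. The translations then act on the weight, which is why the weighted norm is a
  supremum over all centres x0.\<close>

lemma conv_weighted_square:
 fixes \<omega> :: "real^4 \<Rightarrow> ennreal"
 assumes [measurable]: "k \<in> borel_measurable borel" "g \<in> borel_measurable borel" "\<omega> \<in> borel_measurable borel"
  and k: "nL k \<le> ennreal A" "0 \<le> A" and g: "\<And>x0. (NI x. \<omega> (x - x0) * ennreal ((g x)\<^sup>2)) \<le> ennreal B" "0 \<le> B"
 shows "(NI x. \<omega> (x - x0) * ennreal ((conv k g x)\<^sup>2)) \<le> ennreal (A\<^sup>2 * B)"
proof -
 have pt: "ennreal ((conv k g x)\<^sup>2) \<le> ennreal A * (NI z. ennreal \<bar>k z\<bar> * ennreal ((g (x - z))\<^sup>2))" for x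
 proof -
  have "ennreal ((conv k g x)\<^sup>2) \<le> (NI z. ennreal \<bar>k z * g (x - z)\<bar>)\<^sup>2"
   unfolding ennreal_square conv_reflect[OF assms(1,2)] by (intro power_mono ennreal_abs_integral_le) auto
  also have "(NI z. ennreal \<bar>k z * g (x - z)\<bar>) = (NI z. ennreal (sqrt \<bar>k z\<bar>) * ennreal (sqrt \<bar>k z\<bar> * \<bar>g (x - z)\<bar>))"
   by (intro nn_integral_cong) (simp add: abs_mult ennreal_mult[symmetric] mult.assoc[symmetric])
  also have "(\<dots>)\<^sup>2 \<le> (NI z. (ennreal (sqrt \<bar>k z\<bar>))\<^sup>2) * (NI z. (ennreal (sqrt \<bar>k z\<bar> * \<bar>g (x - z)\<bar>))\<^sup>2)"
   by (rule Cauchy_Schwarz_nn_integral) auto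
  also have "\<dots> = nL k * (NI z. ennreal \<bar>k z\<bar> * ennreal ((g (x - z))\<^sup>2))"
   by (simp add: ennreal_power power_mult_distrib ennreal_mult)
  also have "\<dots> \<le> ennreal A * (NI z. ennreal \<bar>k z\<bar> * ennreal ((g (x - z))\<^sup>2))"
   by (intro mult_right_mono k) auto
  finally show ?thesis .
 qed
 have "(NI x. \<omega> (x - x0) * ennreal ((conv k g x)\<^sup>2))
   \<le> (NI x. (NI z. ennreal A * (ennreal \<bar>k z\<bar> * (\<omega> (x - x0) * ennreal ((g (x - z))\<^sup>2)))))"
 proof (intro nn_integral_mono)
  fix x
  have "\<omega> (x - x0) * ennreal ((conv k g x)\<^sup>2) \<le> \<omega> (x - x0) * (ennreal A * (NI z. ennreal \<bar>k z\<bar> * ennreal ((g (x - z))\<^sup>2)))"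
   by (intro mult_left_mono pt) auto
  also have "\<dots> = (NI z. ennreal A * (ennreal \<bar>k z\<bar> * (\<omega> (x - x0) * ennreal ((g (x - z))\<^sup>2))))"
   by (simp add: nn_integral_cmult[symmetric] mult_ac)
  finally show "\<omega> (x - x0) * ennreal ((conv k g x)\<^sup>2) \<le> (NI z. ennreal A * (ennreal \<bar>k z\<bar> * (\<omega> (x - x0) * ennreal ((g (x - z))\<^sup>2))))" .
 qed
 also have "\<dots> = (NI z. (NI x. ennreal A * (ennreal \<bar>k z\<bar> * (\<omega> (x - x0) * ennreal ((g (x - z))\<^sup>2)))))"
  by (rule lborel_pair.Fubini') (simp add: case_prod_beta')
 also have "\<dots> \<le> (NI z. ennreal A * (ennreal \<bar>k z\<bar> * ennreal B))"
 proof (intro nn_integral_mono)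
  fix z
  have "(NI x. \<omega> (x - x0) * ennreal ((g (x - z))\<^sup>2)) = (NI x. \<omega> (x - (x0 - z)) * ennreal ((g x)\<^sup>2))"
   using nn_integral_shift_minus[of "\<lambda>x. \<omega> (x - (x0 - z)) * ennreal ((g x)\<^sup>2)" z] by simp
  also have "\<dots> \<le> ennreal B" by (rule g)
  finally have "ennreal A * (ennreal \<bar>k z\<bar> * (NI x. \<omega> (x - x0) * ennreal ((g (x - z))\<^sup>2))) \<le> ennreal A * (ennreal \<bar>k z\<bar> * ennreal B)"
   by (intro mult_left_mono) auto
  then show "(NI x. ennreal A * (ennreal \<bar>k z\<bar> * (\<omega> (x - x0) * ennreal ((g (x - z))\<^sup>2)))) \<le> ennreal A * (ennreal \<bar>k z\<bar> * ennreal B)"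
   by (simp add: nn_integral_cmult)
 qed
 also have "\<dots> = ennreal A * (nL k * ennreal B)" by (simp add: nn_integral_cmult nn_integral_multc)
 also have "\<dots> \<le> ennreal A * (ennreal A * ennreal B)" by (intro mult_left_mono mult_right_mono k) auto
 finally show ?thesis using k g by (simp add: ennreal_mult[symmetric] power2_eq_square mult.assoc)
qed

text \<open>Cauchy-Schwarz in time with the beta density m(s) as weight. Its integral, at most 6,
  enters once from each factor and gives 6^2.\<close>

lemma time_integral_weighted_square:
 fixes \<omega> :: "real^4 \<Rightarrow> ennreal" and F :: "real \<Rightarrow> real^4 \<Rightarrow> real"
 assumes F[measurable]: "case_prod F \<in> borel_measurable (lborel \<Otimes>\<^sub>M lborel)" "\<omega> \<in> borel_measurable borel" and t: "0 < t" "0 \<le> \<beta>"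
  and b: "\<And>s. s \<in> {0<..<t} \<Longrightarrow> (NI x. \<omega> x * ennreal ((F s x)\<^sup>2)) \<le> ennreal ((\<beta> * (1 / (sqrt (t - s) * sqrt s)))\<^sup>2)"
 shows "(NI x. \<omega> x * ennreal ((LINT s:{0<..<t}|lborel. F s x)\<^sup>2)) \<le> ennreal ((6 * \<beta>)\<^sup>2)"
proof -
 define m where "m s = 1 / (sqrt (t - s) * sqrt s)" for s
 have m0: "0 < m s" if "s \<in> {0<..<t}" for s using that by (simp add: m_def)
 have [measurable]: "m \<in> borel_measurable borel" unfolding m_def by measurable
 have [measurable]: "(\<lambda>z. F (fst z) (snd z)) \<in> borel_measurable (lborel \<Otimes>\<^sub>M lborel)"
  using F(1) by (simp add: case_prod_beta')
 have Fm[measurable]: "(\<lambda>s. F s x) \<in> borel_measurable borel" for x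
  using measurable_compose[of "\<lambda>s. (s, x)" lborel "lborel \<Otimes>\<^sub>M lborel", OF _ F(1)] by simp
 have Fm'[measurable]: "F s \<in> borel_measurable borel" for s
  using measurable_Pair2[OF F(1), of s] by simp
 let ?i = "indicator {0<..<t} :: real \<Rightarrow> ennreal"
 have pt: "ennreal ((LINT s:{0<..<t}|lborel. F s x)\<^sup>2) \<le> ennreal 6 * (NI s. ?i s * ennreal ((F s x)\<^sup>2 / m s))" for x
 proof -
  have "ennreal ((LINT s:{0<..<t}|lborel. F s x)\<^sup>2) \<le> (NI s. ennreal \<bar>indicator {0<..<t} s *\<^sub>R F s x\<bar>)\<^sup>2"
   unfolding ennreal_square set_lebesgue_integral_def by (intro power_mono ennreal_abs_integral_le) auto
  also have "(NI s. ennreal \<bar>indicator {0<..<t} s *\<^sub>R F s x\<bar>) = (NI s. (?i s * ennreal (sqrt (m s))) * (?i s * ennreal (\<bar>F s x\<bar> / sqrt (m s))))"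
  proof (intro nn_integral_cong)
   fix s
   show "ennreal \<bar>indicator {0<..<t} s *\<^sub>R F s x\<bar> = (?i s * ennreal (sqrt (m s))) * (?i s * ennreal (\<bar>F s x\<bar> / sqrt (m s)))"
    using m0[of s] by (auto split: split_indicator simp: ennreal_mult[symmetric])
  qed
  also have "(\<dots>)\<^sup>2 \<le> (NI s. (?i s * ennreal (sqrt (m s)))\<^sup>2) * (NI s. (?i s * ennreal (\<bar>F s x\<bar> / sqrt (m s)))\<^sup>2)"
   by (rule Cauchy_Schwarz_nn_integral) auto
  also have "(NI s. (?i s * ennreal (sqrt (m s)))\<^sup>2) = (nT {0<..<t} (\<lambda>s. m s))"
   by (intro nn_integral_cong) (use m0 in \<open>auto split: split_indicator simp: ennreal_power less_imp_le\<close>)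
  also have "(NI s. (?i s * ennreal (\<bar>F s x\<bar> / sqrt (m s)))\<^sup>2) = (NI s. ?i s * ennreal ((F s x)\<^sup>2 / m s))"
  proof (intro nn_integral_cong)
   fix s
   show "(?i s * ennreal (\<bar>F s x\<bar> / sqrt (m s)))\<^sup>2 = ?i s * ennreal ((F s x)\<^sup>2 / m s)"
    using m0[of s] by (auto split: split_indicator simp: ennreal_power power_divide)
  qed
  also have "(nT {0<..<t} (\<lambda>s. m s)) * (NI s. ?i s * ennreal ((F s x)\<^sup>2 / m s)) \<le> ennreal 6 * (NI s. ?i s * ennreal ((F s x)\<^sup>2 / m s))"
   unfolding m_def by (intro mult_right_mono nn_integral_beta_half t) auto
  finally show ?thesis .
 qed
 have "(NI x. \<omega> x * ennreal ((LINT s:{0<..<t}|lborel. F s x)\<^sup>2))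
   \<le> (NI x. (NI s. ennreal 6 * (?i s * (\<omega> x * ennreal ((F s x)\<^sup>2 / m s)))))"
 proof (intro nn_integral_mono)
  fix x
  have "\<omega> x * ennreal ((LINT s:{0<..<t}|lborel. F s x)\<^sup>2) \<le> \<omega> x * (ennreal 6 * (NI s. ?i s * ennreal ((F s x)\<^sup>2 / m s)))"
   by (intro mult_left_mono pt) auto
  also have "\<dots> = (NI s. ennreal 6 * (?i s * (\<omega> x * ennreal ((F s x)\<^sup>2 / m s))))"
   by (simp add: nn_integral_cmult[symmetric] mult_ac)
  finally show "\<omega> x * ennreal ((LINT s:{0<..<t}|lborel. F s x)\<^sup>2) \<le> (NI s. ennreal 6 * (?i s * (\<omega> x * ennreal ((F s x)\<^sup>2 / m s))))" .
 qed
 also have "\<dots> = (NI s. (NI x. ennreal 6 * (?i s * (\<omega> x * ennreal ((F s x)\<^sup>2 / m s)))))"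
  by (rule lborel_pair.Fubini') (simp add: case_prod_beta')
 also have "\<dots> \<le> (NI s. ennreal (6 * \<beta>\<^sup>2) * (ennreal (m s) * ?i s))"
 proof (intro nn_integral_mono)
  fix s
  show "(NI x. ennreal 6 * (?i s * (\<omega> x * ennreal ((F s x)\<^sup>2 / m s)))) \<le> ennreal (6 * \<beta>\<^sup>2) * (ennreal (m s) * ?i s)"
  proof (cases "s \<in> {0<..<t}")
   case True
   have "(NI x. ennreal 6 * (?i s * (\<omega> x * ennreal ((F s x)\<^sup>2 / m s))))
     = (NI x. ennreal (6 / m s) * (\<omega> x * ennreal ((F s x)\<^sup>2)))"
   proof (intro nn_integral_cong)
    fix x
    have "ennreal 6 * ennreal ((F s x)\<^sup>2 / m s) = ennreal (6 / m s) * ennreal ((F s x)\<^sup>2)"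
     using m0[OF True] by (simp add: ennreal_mult[symmetric] del: ennreal_numeral)
    then show "ennreal 6 * (?i s * (\<omega> x * ennreal ((F s x)\<^sup>2 / m s))) = ennreal (6 / m s) * (\<omega> x * ennreal ((F s x)\<^sup>2))"
     using True by (simp add: mult_ac del: ennreal_numeral)
   qed
   also have "\<dots> = ennreal (6 / m s) * (NI x. \<omega> x * ennreal ((F s x)\<^sup>2))" by (rule nn_integral_cmult) simp
   also have "\<dots> \<le> ennreal (6 / m s) * ennreal ((\<beta> * m s)\<^sup>2)"
    unfolding m_def by (intro mult_left_mono b True) auto
   also have "\<dots> = ennreal (6 * \<beta>\<^sup>2 * m s)"
   proof -
    have "6 / m s * (\<beta> * m s)\<^sup>2 = 6 * \<beta>\<^sup>2 * m s" using m0[OF True] by (simp add: power2_eq_square)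
    moreover have "ennreal (6 / m s) * ennreal ((\<beta> * m s)\<^sup>2) = ennreal (6 / m s * (\<beta> * m s)\<^sup>2)"
     using m0[OF True] by (subst ennreal_mult) auto
    ultimately show ?thesis by (simp only:)
   qed
   finally show ?thesis using True m0[OF True] by (simp add: ennreal_mult[symmetric])
  qed simp
 qed
 also have "\<dots> = ennreal (6 * \<beta>\<^sup>2) * (nT {0<..<t} (\<lambda>s. m s))" by (rule nn_integral_cmult) simp
 also have "\<dots> \<le> ennreal (6 * \<beta>\<^sup>2) * ennreal 6"
  unfolding m_def by (intro mult_left_mono nn_integral_beta_half t) auto
 also have "\<dots> = ennreal ((6 * \<beta>)\<^sup>2)" by (simp add: ennreal_mult[symmetric] power2_eq_square del: ennreal_numeral)
 finally show ?thesis .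
qed

section \<open>The Hardy-weighted norm and the heat flow\<close>

definition hardy_weight :: "real \<Rightarrow> real^4 \<Rightarrow> ennreal" where
 "hardy_weight \<tau> z = ennreal (1 / ((norm z)\<^sup>2 + \<tau>))"

lemma borel_measurable_hardy_weight [measurable]: "hardy_weight \<tau> \<in> borel_measurable borel"
 unfolding hardy_weight_def by measurable

text \<open>The kernel at time \<sigma> lies below a multiple of the Hardy weight at the same scale.
  This is the link between smallness in the weighted norm and pointwise decay.\<close>

lemma heatG_hardy_weight:
 assumes "\<sigma> > 0"
 shows "heatG \<sigma> z * ((norm z)\<^sup>2 + \<sigma>) \<le> (mc 2 + 1) / \<sigma>"
proof -
 have "(norm z)\<^sup>2 * heatG \<sigma> z \<le> mc 2 * (sqrt \<sigma>)\<^sup>2 * heatG (2 * \<sigma>) z" by (rule heatG_moment[OF assms])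
 also have "\<dots> \<le> mc 2 * \<sigma> * (1 / (2 * \<sigma>)\<^sup>2)"
  unfolding real_sqrt_pow2[OF less_imp_le[OF assms]]
  by (rule mult_left_mono[OF heatG_le]) (use assms mc_pos[of 2] in \<open>auto simp: less_imp_le\<close>)
 also have "\<dots> \<le> mc 2 / \<sigma>" using assms mc_pos[of 2] by (simp add: field_simps power2_eq_square)
 finally have 1: "(norm z)\<^sup>2 * heatG \<sigma> z \<le> mc 2 / \<sigma>" .
 have "heatG \<sigma> z * \<sigma> \<le> 1 / \<sigma>\<^sup>2 * \<sigma>" using assms by (intro mult_right_mono heatG_le) auto
 then have "heatG \<sigma> z * \<sigma> \<le> 1 / \<sigma>" using assms by (simp add: power2_eq_square)
 with 1 show ?thesis by (simp add: algebra_simps add_divide_distrib)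
qed

lemma hardy_weight_mono: "0 < \<tau> \<Longrightarrow> \<tau> \<le> \<sigma> \<Longrightarrow> 1 / ((norm z)\<^sup>2 + \<sigma>) \<le> 1 / ((norm z)\<^sup>2 + \<tau>)" for z :: "real^4"
 by (intro divide_left_mono mult_pos_pos add_nonneg_pos) auto

text \<open>Cauchy-Schwarz after multiplying and dividing by the square root of |y-x|^2 + s. The
  kernel factor is of order 1/s by \<open>heatG_hardy_weight\<close>, and the weight at scale s is
  below the one at scale \<tau> because \<tau> \<le> s. The rate s^(-1/2) is the scale-invariant
  one.\<close>

lemma heatS_hardy:
 assumes [measurable]: "g \<in> borel_measurable borel" and \<tau>: "0 < \<tau>" "\<tau> \<le> s" and B: "0 \<le> B"
  and g: "\<And>x0. (NI x. hardy_weight \<tau> (x - x0) * ennreal ((g x)\<^sup>2)) \<le> ennreal B"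
 shows "\<bar>heatS s g x\<bar> \<le> sqrt ((mc 2 + 1) * B) / sqrt s"
proof -
 have s: "0 < s" using \<tau> by simp
 define D where "D y = (norm (y - x))\<^sup>2 + s" for y
 have D: "0 < D y" for y using s by (simp add: D_def add_nonneg_pos)
 have [measurable]: "D \<in> borel_measurable borel" unfolding D_def by measurable
 have "ennreal ((heatS s g x)\<^sup>2) \<le> (NI y. ennreal \<bar>heatG s (x - y) * g y\<bar>)\<^sup>2"
  unfolding ennreal_square conv_def by (intro power_mono ennreal_abs_integral_le) auto
 also have "(NI y. ennreal \<bar>heatG s (x - y) * g y\<bar>) = (NI y. ennreal (heatG s (x - y) * sqrt (D y)) * ennreal (\<bar>g y\<bar> / sqrt (D y)))"
 proof (intro nn_integral_cong)
  fix y show "ennreal \<bar>heatG s (x - y) * g y\<bar> = ennreal (heatG s (x - y) * sqrt (D y)) * ennreal (\<bar>g y\<bar> / sqrt (D y))"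
   using D[of y] by (simp add: ennreal_mult[symmetric] abs_mult)
 qed
 also have "(\<dots>)\<^sup>2 \<le> (NI y. (ennreal (heatG s (x - y) * sqrt (D y)))\<^sup>2) * (NI y. (ennreal (\<bar>g y\<bar> / sqrt (D y)))\<^sup>2)"
  by (rule Cauchy_Schwarz_nn_integral) auto
 also have "\<dots> \<le> ennreal ((mc 2 + 1) / s) * ennreal B"
 proof (intro mult_mono)
  have "(NI y. (ennreal (heatG s (x - y) * sqrt (D y)))\<^sup>2) \<le> (NI y. ennreal ((mc 2 + 1) / s) * ennreal (heatG s (x - y)))"
  proof (intro nn_integral_mono)
   fix y
   have "heatG s (x - y) * (heatG s (x - y) * D y) \<le> heatG s (x - y) * ((mc 2 + 1) / s)"
    using heatG_hardy_weight[OF s, of "x - y"] by (intro mult_left_mono) (auto simp: D_def norm_minus_commute)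
   moreover have "(heatG s (x - y) * sqrt (D y))\<^sup>2 = heatG s (x - y) * (heatG s (x - y) * D y)"
    using D[of y] by (simp add: power_mult_distrib) (simp add: power2_eq_square)
   ultimately have "ennreal ((heatG s (x - y) * sqrt (D y))\<^sup>2) \<le> ennreal ((mc 2 + 1) / s * heatG s (x - y))"
    by (intro ennreal_leI) (simp add: mult.commute)
   then show "(ennreal (heatG s (x - y) * sqrt (D y)))\<^sup>2 \<le> ennreal ((mc 2 + 1) / s) * ennreal (heatG s (x - y))"
    using s D[of y] by (simp add: ennreal_power ennreal_mult[symmetric] add_nonneg_nonneg less_imp_le)
  qed
  also have "\<dots> = ennreal ((mc 2 + 1) / s) * (NI y. ennreal (heatG s (x - y)))"
   by (rule nn_integral_cmult) simp
  also have "\<dots> = ennreal ((mc 2 + 1) / s)"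
   using nn_integral_reflect[of "\<lambda>y. ennreal (heatG s y)" x] nn_integral_heatG[OF s] by simp
  finally show "(NI y. (ennreal (heatG s (x - y) * sqrt (D y)))\<^sup>2) \<le> ennreal ((mc 2 + 1) / s)" .
  have "(NI y. (ennreal (\<bar>g y\<bar> / sqrt (D y)))\<^sup>2) \<le> (NI y. hardy_weight \<tau> (y - x) * ennreal ((g y)\<^sup>2))"
  proof (intro nn_integral_mono)
   fix y
   have "(\<bar>g y\<bar> / sqrt (D y))\<^sup>2 = 1 / D y * (g y)\<^sup>2" using D[of y] by (simp add: power_divide)
   also have "\<dots> \<le> 1 / ((norm (y - x))\<^sup>2 + \<tau>) * (g y)\<^sup>2"
    unfolding D_def by (intro mult_right_mono hardy_weight_mono \<tau>) auto
   finally show "(ennreal (\<bar>g y\<bar> / sqrt (D y)))\<^sup>2 \<le> hardy_weight \<tau> (y - x) * ennreal ((g y)\<^sup>2)"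
    using D[of y] \<tau> by (simp add: ennreal_power hardy_weight_def ennreal_mult[symmetric] add_nonneg_nonneg less_imp_le ennreal_leI)
  qed
  also have "\<dots> \<le> ennreal B" by (rule g)
  finally show "(NI y. (ennreal (\<bar>g y\<bar> / sqrt (D y)))\<^sup>2) \<le> ennreal B" .
 qed auto
 also have "\<dots> = ennreal ((mc 2 + 1) / s * B)" using s B by (simp add: ennreal_mult[symmetric] add_nonneg_nonneg less_imp_le)
 finally have "(heatS s g x)\<^sup>2 \<le> (mc 2 + 1) / s * B"
  using s B by (subst (asm) ennreal_le_iff) (auto intro!: mult_nonneg_nonneg divide_nonneg_pos add_nonneg_nonneg simp: less_imp_le)
 then have "\<bar>heatS s g x\<bar> \<le> sqrt ((mc 2 + 1) / s * B)" by (intro real_le_rsqrt) simp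
 then show ?thesis by (simp add: real_sqrt_divide real_sqrt_mult)
qed

text \<open>The kernel \<open>gK\<close> itself is dominated by \<sigma>^(-3/2) times the Hardy
  weight, so it can be paired directly with g^2. The singularity at \<sigma> = 0 is not integrable,
  which restricts the bound to the first half of the Duhamel integral.\<close>

lemma heatP_square_hardy:
 assumes [measurable]: "g \<in> borel_measurable borel" and \<tau>: "0 < \<tau>" "\<tau> \<le> \<sigma>" and B: "0 \<le> B"
  and g: "\<And>x0. (NI x. hardy_weight \<tau> (x - x0) * ennreal ((g x)\<^sup>2)) \<le> ennreal B"
 shows "\<bar>heatP b \<sigma> (\<lambda>y. (g y)\<^sup>2) x\<bar> \<le> kc * norm b * (mc 2 + 1) * B / (\<sigma> * sqrt \<sigma>)"
proof -
 have s: "0 < \<sigma>" using \<tau> by simp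
 let ?c = "kc * norm b * (mc 2 + 1) / (\<sigma> * sqrt \<sigma>)"
 have c: "0 \<le> ?c" using s kc_pos mc_pos[of 2] by (auto intro!: divide_nonneg_pos mult_nonneg_nonneg add_nonneg_nonneg simp: less_imp_le)
 have K: "\<bar>gK b \<sigma> z\<bar> \<le> ?c * (1 / ((norm z)\<^sup>2 + \<tau>))" for z
 proof -
  have D: "0 < (norm z)\<^sup>2 + 2 * \<sigma>" "0 < (norm z)\<^sup>2 + \<tau>" using s \<tau> by (auto intro: add_nonneg_pos)
  have "heatG (2 * \<sigma>) z \<le> (mc 2 + 1) / (2 * \<sigma>) * (1 / ((norm z)\<^sup>2 + 2 * \<sigma>))"
  proof -
   have "heatG (2 * \<sigma>) z \<le> (mc 2 + 1) / (2 * \<sigma>) / ((norm z)\<^sup>2 + 2 * \<sigma>)"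
    unfolding pos_le_divide_eq[OF D(1)] by (rule heatG_hardy_weight) (use s in simp)
   then show ?thesis by simp
  qed
  also have "\<dots> \<le> (mc 2 + 1) / \<sigma> * (1 / ((norm z)\<^sup>2 + \<tau>))"
   using s \<tau> mc_pos[of 2] by (intro mult_mono hardy_weight_mono frac_le) (auto intro!: divide_nonneg_pos add_nonneg_nonneg add_nonneg_pos simp: less_imp_le)
  finally have "kc * norm b / sqrt \<sigma> * heatG (2 * \<sigma>) z \<le> kc * norm b / sqrt \<sigma> * ((mc 2 + 1) / \<sigma> * (1 / ((norm z)\<^sup>2 + \<tau>)))"
   using s kc_pos by (intro mult_left_mono) (auto simp: less_imp_le)
  with gK_bound[OF s, of b z] show ?thesis by (simp add: mult_ac)
 qed
 have "ennreal \<bar>heatP b \<sigma> (\<lambda>y. (g y)\<^sup>2) x\<bar> \<le> (NI y. ennreal \<bar>gK b \<sigma> (x - y) * (g y)\<^sup>2\<bar>)"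
  unfolding conv_def by (rule ennreal_abs_integral_le)
 also have "\<dots> \<le> (NI y. ennreal ?c * (hardy_weight \<tau> (y - x) * ennreal ((g y)\<^sup>2)))"
 proof (intro nn_integral_mono)
  fix y
  have "\<bar>gK b \<sigma> (x - y) * (g y)\<^sup>2\<bar> \<le> ?c * (1 / ((norm (y - x))\<^sup>2 + \<tau>)) * (g y)\<^sup>2"
   using mult_right_mono[OF K[of "x - y"], of "(g y)\<^sup>2"] by (simp add: abs_mult norm_minus_commute)
  then have "ennreal \<bar>gK b \<sigma> (x - y) * (g y)\<^sup>2\<bar> \<le> ennreal (?c * (1 / ((norm (y - x))\<^sup>2 + \<tau>)) * (g y)\<^sup>2)" by (rule ennreal_leI)
  also have "\<dots> = ennreal ?c * (hardy_weight \<tau> (y - x) * ennreal ((g y)\<^sup>2))"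
   unfolding hardy_weight_def using c \<tau> by (subst ennreal_mult[symmetric], auto simp: add_nonneg_nonneg less_imp_le ennreal_mult[symmetric] mult.assoc simp del: times_divide_eq_left times_divide_eq_right)
  finally show "ennreal \<bar>gK b \<sigma> (x - y) * (g y)\<^sup>2\<bar> \<le> ennreal ?c * (hardy_weight \<tau> (y - x) * ennreal ((g y)\<^sup>2))" .
 qed
 also have "\<dots> = ennreal ?c * (NI y. hardy_weight \<tau> (y - x) * ennreal ((g y)\<^sup>2))"
  by (rule nn_integral_cmult) simp
 also have "\<dots> \<le> ennreal ?c * ennreal B" by (intro mult_left_mono g) auto
 finally have "ennreal \<bar>heatP b \<sigma> (\<lambda>y. (g y)\<^sup>2) x\<bar> \<le> ennreal (?c * B)" using c B by (simp add: ennreal_mult[symmetric])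
 then have "\<bar>heatP b \<sigma> (\<lambda>y. (g y)\<^sup>2) x\<bar> \<le> ?c * B" unfolding ennreal_le_iff[OF mult_nonneg_nonneg[OF c B]] .
 then show ?thesis by simp
qed


section \<open>Propagation of smallness in time\<close>

context mild begin

text \<open>With one factor of v^2 bounded by \<kappa>/sqrt s, the Duhamel term is linear in v and
  its weighted norm is a beta integral. Squaring the sum doubles both parts: 2 * 6^2 = 72 is the
  constant in the smallness condition, and absorbing gives twice 2 B0.\<close>

lemma hardy_norm_bound:
 assumes \<tau>: "0 < \<tau>" and t0: "0 \<le> t0" and t1: "0 < t1" and \<kappa>: "0 \<le> \<kappa>" "72 * (kc * norm a * \<kappa>)\<^sup>2 \<le> 1 / 2" and B0: "0 \<le> B0"
  and init: "\<And>x0. (NI x. hardy_weight \<tau> (x - x0) * ennreal ((v t0 x)\<^sup>2)) \<le> ennreal B0"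
  and small: "\<And>s x. s \<in> {0<..t1} \<Longrightarrow> \<bar>v (t0 + s) x\<bar> \<le> \<kappa> / sqrt s"
  and s: "s \<in> {0<..t1}"
 shows "(NI x. hardy_weight \<tau> (x - x0) * ennreal ((v (t0 + s) x)\<^sup>2)) \<le> ennreal (4 * B0)"
proof -
 obtain C where C: "0 \<le> C" "\<And>t. t \<in> {0..t0 + t1} \<Longrightarrow> nL (v t) \<le> ennreal C" "\<And>t x. t \<in> {0..t0 + t1} \<Longrightarrow> \<bar>v t x\<bar> \<le> C"
  using v_local[of "t0 + t1"] t0 t1 by auto
 let ?G = "\<lambda>(s, x0). NI x. hardy_weight \<tau> (x - x0) * ennreal ((v (t0 + s) x)\<^sup>2)"
 have "?G (s, x0) \<le> ennreal (2 * (2 * B0))"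
 \<comment> \<open>The finite starting bound exists because the weight is at most 1/\<tau>.\<close>
 proof (rule nn_absorb[where S = "{0<..t1} \<times> UNIV" and M = "1 / \<tau> * (C * C)"])
  show "0 \<le> 1 / \<tau> * (C * C)" using \<tau> C by simp
  fix i :: "real \<times> (real^4)" assume "i \<in> {0<..t1} \<times> UNIV"
  then obtain r z where i: "i = (r, z)" "r \<in> {0<..t1}" by auto
  have "(NI x. hardy_weight \<tau> (x - z) * ennreal ((v (t0 + r) x)\<^sup>2)) \<le> (NI x. ennreal (1 / \<tau>) * ennreal \<bar>(v (t0 + r) x)\<^sup>2\<bar>)"
  proof (intro nn_integral_mono mult_mono)
   fix x
   show "hardy_weight \<tau> (x - z) \<le> ennreal (1 / \<tau>)"
    unfolding hardy_weight_def using \<tau> by (intro ennreal_leI frac_le) auto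
  qed auto
  also have "\<dots> = ennreal (1 / \<tau>) * nL (\<lambda>x. (v (t0 + r) x)\<^sup>2)" by (rule nn_integral_cmult) simp
  also have "\<dots> \<le> ennreal (1 / \<tau>) * ennreal (C * C)"
   by (intro mult_left_mono v_square_bounds C) (use i t0 in auto)
  finally show "?G i \<le> ennreal (1 / \<tau> * (C * C))" using \<tau> C i by (simp add: ennreal_mult[symmetric])
 next
  show "0 \<le> 2 * B0" using B0 by simp
  fix B :: real and i :: "real \<times> (real^4)"
  assume B: "0 \<le> B" and hyp: "\<And>i. i \<in> {0<..t1} \<times> UNIV \<Longrightarrow> ?G i \<le> ennreal B" and "i \<in> {0<..t1} \<times> UNIV"
  then obtain r z where i: "i = (r, z)" "0 < r" "r \<le> t1" by auto
  let ?I = "\<lambda>x. LINT s:{0<..<r}|lborel. heatP a (r - s) (\<lambda>y. (v (t0 + s) y)\<^sup>2) x"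
  have m: "case_prod (\<lambda>s x. heatP a (r - s) (\<lambda>y. (v (t0 + s) y)\<^sup>2) x) \<in> borel_measurable (lborel \<Otimes>\<^sub>M lborel)"
   by measurable
  have S: "(NI x. hardy_weight \<tau> (x - z) * ennreal ((heatS r (v t0) x)\<^sup>2)) \<le> ennreal B0"
   using conv_weighted_square[OF _ _ _ nL_heatG[OF i(2)] _ init B0, of z] by simp
  have I: "(NI x. hardy_weight \<tau> (x - z) * ennreal ((?I x)\<^sup>2)) \<le> ennreal ((6 * (kc * norm a * \<kappa> * sqrt B))\<^sup>2)"
  proof (rule time_integral_weighted_square[OF m])
   fix s assume s: "s \<in> {0<..<r}"
   have s1: "s \<in> {0<..t1}" "0 < r - s" using s i by auto
   have "(NI x. hardy_weight \<tau> (x - z) * ennreal ((heatP a (r - s) (\<lambda>y. (v (t0 + s) y)\<^sup>2) x)\<^sup>2)) \<le> ennreal ((kc * norm a / sqrt (r - s))\<^sup>2 * ((\<kappa> / sqrt s)\<^sup>2 * B))"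
   proof (rule conv_weighted_square[OF _ _ _ nL_gK[OF s1(2)]])
    fix x0
    have "(NI x. hardy_weight \<tau> (x - x0) * ennreal (((v (t0 + s) x)\<^sup>2)\<^sup>2))
     \<le> (NI x. ennreal ((\<kappa> / sqrt s)\<^sup>2) * (hardy_weight \<tau> (x - x0) * ennreal ((v (t0 + s) x)\<^sup>2)))"
    proof (intro nn_integral_mono)
     fix x
     have "(v (t0 + s) x)\<^sup>2 \<le> (\<kappa> / sqrt s)\<^sup>2" using power_mono[OF small[OF s1(1), of x], of 2] by simp
     then have "((v (t0 + s) x)\<^sup>2)\<^sup>2 \<le> (\<kappa> / sqrt s)\<^sup>2 * (v (t0 + s) x)\<^sup>2"
      unfolding power2_eq_square[of "(v (t0 + s) x)\<^sup>2"] by (intro mult_right_mono) auto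
     then have "ennreal (((v (t0 + s) x)\<^sup>2)\<^sup>2) \<le> ennreal ((\<kappa> / sqrt s)\<^sup>2) * ennreal ((v (t0 + s) x)\<^sup>2)"
      by (simp add: ennreal_mult[symmetric] ennreal_leI)
     from mult_left_mono[OF this, of "hardy_weight \<tau> (x - x0)"]
     show "hardy_weight \<tau> (x - x0) * ennreal (((v (t0 + s) x)\<^sup>2)\<^sup>2) \<le> ennreal ((\<kappa> / sqrt s)\<^sup>2) * (hardy_weight \<tau> (x - x0) * ennreal ((v (t0 + s) x)\<^sup>2))"
      by (simp add: mult_ac)
    qed
    also have "\<dots> = ennreal ((\<kappa> / sqrt s)\<^sup>2) * ?G (s, x0)" by (simp add: nn_integral_cmult)
    also have "\<dots> \<le> ennreal ((\<kappa> / sqrt s)\<^sup>2) * ennreal B" by (intro mult_left_mono hyp) (use s1 in auto)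
    finally show "(NI x. hardy_weight \<tau> (x - x0) * ennreal (((v (t0 + s) x)\<^sup>2)\<^sup>2)) \<le> ennreal ((\<kappa> / sqrt s)\<^sup>2 * B)"
     using B by (simp add: ennreal_mult[symmetric])
   qed (use kc_pos s B in \<open>auto simp: less_imp_le\<close>)
   also have "(kc * norm a / sqrt (r - s))\<^sup>2 * ((\<kappa> / sqrt s)\<^sup>2 * B) = (kc * norm a * \<kappa> * sqrt B * (1 / (sqrt (r - s) * sqrt s)))\<^sup>2"
    using B by (simp add: power_mult_distrib power_divide)
   finally show "(NI x. hardy_weight \<tau> (x - z) * ennreal ((heatP a (r - s) (\<lambda>y. (v (t0 + s) y)\<^sup>2) x)\<^sup>2))
     \<le> ennreal ((kc * norm a * \<kappa> * sqrt B * (1 / (sqrt (r - s) * sqrt s)))\<^sup>2)" .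
  qed (use i \<kappa> kc_pos B in \<open>auto simp: less_imp_le\<close>)
  have Im: "?I \<in> borel_measurable borel"
   unfolding set_lebesgue_integral_def conv_def by measurable
  have "(NI x. hardy_weight \<tau> (x - z) * ennreal ((v (t0 + r) x)\<^sup>2))
    \<le> (NI x. 2 * (hardy_weight \<tau> (x - z) * ennreal ((heatS r (v t0) x)\<^sup>2)) + 2 * (hardy_weight \<tau> (x - z) * ennreal ((?I x)\<^sup>2)))"
  proof (intro nn_integral_mono)
   fix x
   have "0 \<le> (heatS r (v t0) x - ?I x)\<^sup>2" by simp
   then have "(v (t0 + r) x)\<^sup>2 \<le> 2 * (heatS r (v t0) x)\<^sup>2 + 2 * (?I x)\<^sup>2"
    unfolding v_mild[OF t0 i(2)] by (simp add: power2_eq_square algebra_simps)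
   then have "ennreal ((v (t0 + r) x)\<^sup>2) \<le> ennreal (2 * (heatS r (v t0) x)\<^sup>2 + 2 * (?I x)\<^sup>2)" by (rule ennreal_leI)
   also have "\<dots> = 2 * ennreal ((heatS r (v t0) x)\<^sup>2) + 2 * ennreal ((?I x)\<^sup>2)" by (simp add: ennreal_mult)
finally have e: "ennreal ((v (t0 + r) x)\<^sup>2) \<le> 2 * ennreal ((heatS r (v t0) x)\<^sup>2) + 2 * ennreal ((?I x)\<^sup>2)" .
   show "hardy_weight \<tau> (x - z) * ennreal ((v (t0 + r) x)\<^sup>2) \<le> 2 * (hardy_weight \<tau> (x - z) * ennreal ((heatS r (v t0) x)\<^sup>2)) + 2 * (hardy_weight \<tau> (x - z) * ennreal ((?I x)\<^sup>2))"
    using mult_left_mono[OF e, of "hardy_weight \<tau> (x - z)"] by (simp add: distrib_left mult.left_commute)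
  qed
  also have "\<dots> = 2 * (NI x. hardy_weight \<tau> (x - z) * ennreal ((heatS r (v t0) x)\<^sup>2)) + 2 * (NI x. hardy_weight \<tau> (x - z) * ennreal ((?I x)\<^sup>2))"
   using Im by (simp add: nn_integral_add nn_integral_cmult)
  also have "\<dots> \<le> 2 * ennreal B0 + 2 * ennreal ((6 * (kc * norm a * \<kappa> * sqrt B))\<^sup>2)"
   by (intro add_mono mult_left_mono S I) auto
  also have "\<dots> = ennreal (2 * B0 + 72 * (kc * norm a * \<kappa>)\<^sup>2 * B)"
  proof -
   have "2 * (6 * (kc * norm a * \<kappa> * sqrt B))\<^sup>2 = 72 * (kc * norm a * \<kappa>)\<^sup>2 * B" using B by (simp add: power_mult_distrib)
   moreover have "2 * ennreal B0 + 2 * ennreal ((6 * (kc * norm a * \<kappa> * sqrt B))\<^sup>2) = ennreal (2 * B0 + 2 * (6 * (kc * norm a * \<kappa> * sqrt B))\<^sup>2)"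
    using B0 by (simp add: ennreal_mult)
   ultimately show ?thesis by (simp only:)
  qed
  also have "\<dots> \<le> ennreal (2 * B0 + B / 2)"
   using mult_right_mono[OF \<kappa>(2) B] by (intro ennreal_leI) simp
  finally show "?G i \<le> ennreal (2 * B0 + B / 2)" by (simp add: i)
 qed (use s in auto)
 then show ?thesis by simp
qed

text \<open>Three ranges of s: up to t/2 the Hardy norm is used, since the kernel is regular there;
  between t/2 and t1 the decay known so far; and on (t1, t), where nothing is known yet, the crude
  bound C. The last contribution is small because t - t1 is, and this lets the decay be extended
  beyond t1.\<close>

lemma sup_norm_step:
 assumes \<tau>: "0 < \<tau>" and t0: "0 \<le> t0" and \<kappa>: "0 \<le> \<kappa>" and B0: "0 \<le> B0" and t: "2 * \<tau> \<le> t"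
  and init: "\<And>x0. (NI x. hardy_weight \<tau> (x - x0) * ennreal ((v t0 x)\<^sup>2)) \<le> ennreal B0"
  and hb: "\<And>s x0. s \<in> {0<..t / 2} \<Longrightarrow> (NI x. hardy_weight \<tau> (x - x0) * ennreal ((v (t0 + s) x)\<^sup>2)) \<le> ennreal (4 * B0)"
  and t1: "t / 2 \<le> t1" "t1 < t" and small: "\<And>s x. s \<in> {0<..t1} \<Longrightarrow> \<bar>v (t0 + s) x\<bar> \<le> \<kappa> / sqrt s"
  and C: "\<And>s x. s \<in> {0<..t} \<Longrightarrow> \<bar>v (t0 + s) x\<bar> \<le> C" "0 \<le> C"
 shows "sqrt t * \<bar>v (t0 + t) x\<bar> \<le> sqrt ((mc 2 + 1) * B0) + 12 * kc * norm a * (mc 2 + 1) * B0 + 4 * kc * norm a * \<kappa>\<^sup>2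
  + sqrt t * (2 * kc * norm a * C\<^sup>2 * sqrt (t - t1))"
proof -
 have tp: "0 < t" using \<tau> t by linarith
 define k where "k = kc * norm a"
 have k: "0 \<le> k" using kc_pos by (simp add: k_def less_imp_le)
 define c2 where "c2 = 12 * k * (mc 2 + 1) * B0 / (t * sqrt t)"
 have mcp: "0 \<le> mc 2 + 1" using mc_pos[of 2] by linarith
 have c2: "0 \<le> c2" using k mcp B0 tp by (simp add: c2_def)
 let ?f = "\<lambda>s. k * (2 * \<kappa>\<^sup>2 / t) * (1 / sqrt (t - s))"
 let ?g = "\<lambda>s. if t1 < s then k * C\<^sup>2 * (1 / sqrt (t - s)) else 0"
 have S: "\<bar>heatS t (v t0) x\<bar> \<le> sqrt ((mc 2 + 1) * B0) / sqrt t"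
  by (rule heatS_hardy[OF _ \<tau> _ B0 init]) (use t \<tau> in auto)
 have I: "\<bar>LINT s:{0<..<t}|lborel. heatP a (t - s) (\<lambda>y. (v (t0 + s) y)\<^sup>2) x\<bar> \<le> (c2 * t + k * (2 * \<kappa>\<^sup>2 / t) * (2 * sqrt t)) + k * C\<^sup>2 * (2 * sqrt (t - t1))"
 proof (rule abs_set_integral_le)
  fix s assume s: "s \<in> {0<..<t}"
  have p: "0 < sqrt (t - s)" using s by simp
  show "\<bar>heatP a (t - s) (\<lambda>y. (v (t0 + s) y)\<^sup>2) x\<bar> \<le> (c2 + ?f s) + ?g s"
  proof (cases "s \<le> t / 2")
   case True
   have "\<bar>heatP a (t - s) (\<lambda>y. (v (t0 + s) y)\<^sup>2) x\<bar> \<le> kc * norm a * (mc 2 + 1) * (4 * B0) / ((t - s) * sqrt (t - s))"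
    by (rule heatP_square_hardy[OF _ \<tau> _ _ hb]) (use True s t B0 in auto)
   also have "\<dots> \<le> kc * norm a * (mc 2 + 1) * (4 * B0) / (t * sqrt t / 3)"
   proof (rule divide_left_mono)
    have "t / 2 * sqrt (t / 2) \<le> (t - s) * sqrt (t - s)"
     using True tp by (intro mult_mono) auto
    moreover have "t * sqrt t / 3 \<le> t / 2 * sqrt (t / 2)"
    proof -
     have "sqrt 2 \<le> 1.5" by (rule real_le_lsqrt) (auto simp: power2_eq_square)
     then have "1 / 3 \<le> 1 / (2 * sqrt 2)" by (intro divide_left_mono) auto
     from mult_left_mono[OF this, of "t * sqrt t"] show ?thesis using tp by (simp add: real_sqrt_divide)
    qed
    ultimately show "t * sqrt t / 3 \<le> (t - s) * sqrt (t - s)" by linarith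
    show "0 \<le> kc * norm a * (mc 2 + 1) * (4 * B0)" using kc_pos mcp B0 by (simp add: less_imp_le)
    show "0 < (t - s) * sqrt (t - s) * (t * sqrt t / 3)" using s tp by simp
   qed
   also have "\<dots> = c2" by (simp add: c2_def k_def)
   finally have "\<bar>heatP a (t - s) (\<lambda>y. (v (t0 + s) y)\<^sup>2) x\<bar> \<le> c2" .
   moreover have "0 \<le> ?f s" "0 \<le> ?g s" using k \<kappa> tp C p by auto
   ultimately show ?thesis by linarith
  next
   case False
   show ?thesis
   proof (cases "t1 < s")
    case True
    have "\<bar>heatP a (t - s) (\<lambda>y. (v (t0 + s) y)\<^sup>2) x\<bar> \<le> kc * norm a / sqrt (t - s) * C\<^sup>2"
    proof (rule abs_heatP_le)
     show "\<bar>(v (t0 + s) y)\<^sup>2\<bar> \<le> C\<^sup>2" for y using power_mono[OF C(1)[of s y], of 2] s by simp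
    qed (use s in auto)
    moreover have "0 \<le> ?f s" using k \<kappa> tp C p by auto
    ultimately show ?thesis using True c2 by (simp add: k_def mult_ac)
   next
    case F: False
    have "\<bar>heatP a (t - s) (\<lambda>y. (v (t0 + s) y)\<^sup>2) x\<bar> \<le> kc * norm a / sqrt (t - s) * (2 * \<kappa>\<^sup>2 / t)"
    proof (rule abs_heatP_le)
     fix y
     have "\<bar>(v (t0 + s) y)\<^sup>2\<bar> \<le> (\<kappa> / sqrt s)\<^sup>2" using power_mono[OF small[of s y], of 2] s F by simp
     also have "\<dots> = \<kappa>\<^sup>2 / s" using s by (simp add: power_divide)
     also have "\<dots> \<le> \<kappa>\<^sup>2 / (t / 2)" using False s tp by (intro divide_left_mono) auto
     finally show "\<bar>(v (t0 + s) y)\<^sup>2\<bar> \<le> 2 * \<kappa>\<^sup>2 / t" by (simp add: mult.commute)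
    qed (use s in auto)
    then show ?thesis using F c2 by (simp add: k_def mult_ac)
   qed
  qed
 next
  show "(nT {0<..<t} (\<lambda>s. (c2 + ?f s) + ?g s)) \<le> ennreal ((c2 * t + k * (2 * \<kappa>\<^sup>2 / t) * (2 * sqrt t)) + k * C\<^sup>2 * (2 * sqrt (t - t1)))"
  proof (rule set_nn_integral_add)
   show "(nT {0<..<t} (\<lambda>s. c2 + ?f s)) \<le> ennreal (c2 * t + k * (2 * \<kappa>\<^sup>2 / t) * (2 * sqrt t))"
   proof (rule set_nn_integral_add)
    show "(\<integral>\<^sup>+s\<in>{0<..<t}. ennreal c2 \<partial>lborel) \<le> ennreal (c2 * t)"
     using c2 tp by (simp add: nn_integral_cmult_indicator ennreal_mult)
    show "(nT {0<..<t} (\<lambda>s. ?f s)) \<le> ennreal (k * (2 * \<kappa>\<^sup>2 / t) * (2 * sqrt t))"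
     using nn_integral_inverse_sqrt_reflect[of 0 t] tp k by (intro set_nn_integral_cmult) auto
   qed (use c2 k tp in auto)
   have "(nT {0<..<t} (\<lambda>s. ?g s)) = (nT {t1<..<t} (\<lambda>s. k * C\<^sup>2 * (1 / sqrt (t - s))))"
    by (intro nn_integral_cong) (use t1 tp in \<open>auto split: split_indicator\<close>)
   also have "\<dots> \<le> ennreal (k * C\<^sup>2 * (2 * sqrt (t - t1)))"
    using nn_integral_inverse_sqrt_reflect[of t1 t] t1 k by (intro set_nn_integral_cmult) auto
   finally show "(nT {0<..<t} (\<lambda>s. ?g s)) \<le> ennreal (k * C\<^sup>2 * (2 * sqrt (t - t1)))" .
  qed (use c2 k tp t1 in auto)
  show "0 \<le> (c2 * t + k * (2 * \<kappa>\<^sup>2 / t) * (2 * sqrt t)) + k * C\<^sup>2 * (2 * sqrt (t - t1))"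
   using c2 k tp t1 by (intro add_nonneg_nonneg mult_nonneg_nonneg) auto
 qed
 have "\<bar>v (t0 + t) x\<bar> \<le> sqrt ((mc 2 + 1) * B0) / sqrt t + ((c2 * t + k * (2 * \<kappa>\<^sup>2 / t) * (2 * sqrt t)) + k * C\<^sup>2 * (2 * sqrt (t - t1)))"
  unfolding v_mild[OF t0 tp] using S I by linarith
 then have "sqrt t * \<bar>v (t0 + t) x\<bar> \<le> sqrt t * (sqrt ((mc 2 + 1) * B0) / sqrt t + ((c2 * t + k * (2 * \<kappa>\<^sup>2 / t) * (2 * sqrt t)) + k * C\<^sup>2 * (2 * sqrt (t - t1))))"
  using tp by (intro mult_left_mono) auto
 also have "\<dots> = sqrt ((mc 2 + 1) * B0) + c2 * (t * sqrt t) + 4 * k * \<kappa>\<^sup>2 * (sqrt t * sqrt t / t) + sqrt t * (2 * k * C\<^sup>2 * sqrt (t - t1))"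
  using tp by (simp add: field_simps del: real_sqrt_mult_self)
 also have "c2 * (t * sqrt t) = 12 * k * (mc 2 + 1) * B0" using tp by (simp add: c2_def)
 also have "sqrt t * sqrt t / t = 1" using tp by simp
 finally show ?thesis by (simp add: k_def mult_ac)
qed

text \<open>The order of choices avoids circularity: \<kappa> fixes B0, B0 fixes the span T, the
  bound on [0, T + 1] fixes s0 and hence \<tau>, and only then is the time t0 selected. From t0 the
  estimate holds on (0, s0] by the local bound and is extended by steps of fixed length.\<close>

lemma critical_decay:
 assumes \<kappa>: "0 < \<kappa>" "16 * (kc * norm a) * \<kappa> \<le> 1"
 shows "\<exists>t0\<ge>1. \<forall>s>0. \<forall>x. \<bar>v (t0 + s) x\<bar> \<le> \<kappa> / sqrt s"
proof -
 define k where "k = kc * norm a"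
 have k: "0 \<le> k" using kc_pos by (simp add: k_def less_imp_le)
 have k\<kappa>: "k * \<kappa> \<le> 1 / 16" "0 \<le> k * \<kappa>" using \<kappa> k by (auto simp: k_def)
 have k72: "72 * (kc * norm a * \<kappa>)\<^sup>2 \<le> 1 / 2"
 proof -
  have "(k * \<kappa>)\<^sup>2 \<le> (1 / 16)\<^sup>2" using k\<kappa> by (intro power_mono) auto
  then show ?thesis by (simp add: k_def power2_eq_square)
 qed
 have mcp: "0 < mc 2 + 1" using mc_pos[of 2] by linarith
 \<comment> \<open>The two entries keep the linear term and the early Duhamel term below \<kappa>/4
   each. The quadratic term and the uncontrolled last piece take the other two quarters.\<close>
 define B0 where "B0 = min (\<kappa>\<^sup>2 / (16 * (mc 2 + 1))) (\<kappa> / (4 * (12 * (k + 1) * (mc 2 + 1))))"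
 have B0: "0 < B0" using \<kappa> k mcp by (auto simp: B0_def)
 have b1: "sqrt ((mc 2 + 1) * B0) \<le> \<kappa> / 4"
 proof (rule real_le_lsqrt)
  have "B0 \<le> \<kappa>\<^sup>2 / (16 * (mc 2 + 1))" by (simp add: B0_def)
  then show "(mc 2 + 1) * B0 \<le> (\<kappa> / 4)\<^sup>2" using mcp by (simp add: field_simps power_divide)
 qed (use \<kappa> in auto)
 have b2: "12 * kc * norm a * (mc 2 + 1) * B0 \<le> \<kappa> / 4"
 proof -
  have "12 * kc * norm a * (mc 2 + 1) * B0 \<le> (12 * (k + 1) * (mc 2 + 1)) * B0"
   using B0 mcp by (intro mult_right_mono) (auto simp: k_def)
  also have "\<dots> \<le> (12 * (k + 1) * (mc 2 + 1)) * (\<kappa> / (4 * (12 * (k + 1) * (mc 2 + 1))))"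
   using k mcp by (intro mult_left_mono) (auto simp: B0_def)
  also have "\<dots> = \<kappa> / 4"
  proof -
   have aux: "D * (\<kappa> / (4 * D)) = \<kappa> / 4" if "D \<noteq> 0" for D :: real using that by simp
   show ?thesis by (rule aux) (use k mcp in simp)
  qed
  finally show ?thesis .
 qed
 have b3: "4 * kc * norm a * \<kappa>\<^sup>2 \<le> \<kappa> / 4"
  using mult_right_mono[OF k\<kappa>(1), of "4 * \<kappa>"] \<kappa> by (simp add: k_def power2_eq_square mult_ac)
 obtain T where T: "T \<ge> 1" and small: "\<And>\<tau>. \<tau> > 0 \<Longrightarrow> \<exists>t0\<in>{1..T}. \<forall>x0. (LI y. (v t0 y)\<^sup>2 / ((norm (y - x0))\<^sup>2 + \<tau>)) \<le> B0"
  using small_hardy_norm[OF B0] by blast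
 obtain C1 where C1: "0 \<le> C1" "\<And>t. t \<in> {0..T + 1} \<Longrightarrow> nL (v t) \<le> ennreal C1" "\<And>t x. t \<in> {0..T + 1} \<Longrightarrow> \<bar>v t x\<bar> \<le> C1"
  using v_local[of "T + 1"] T by auto
 \<comment> \<open>Up to time s0 a function bounded by C1 is already below \<kappa>/sqrt s.\<close>
 define s0 where "s0 = min 1 ((\<kappa> / (C1 + 1))\<^sup>2)"
 have s0: "0 < s0" "s0 \<le> 1" using \<kappa> C1 by (auto simp: s0_def)
 have s0C: "C1 \<le> \<kappa> / sqrt s" if "0 < s" "s \<le> s0" for s
 proof -
  have "sqrt s \<le> sqrt ((\<kappa> / (C1 + 1))\<^sup>2)" using that by (intro real_sqrt_le_mono) (simp add: s0_def)
  then have "sqrt s \<le> \<kappa> / (C1 + 1)" using \<kappa> C1 by simp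
  then have "(C1 + 1) * sqrt s \<le> \<kappa>" using C1 by (simp add: field_simps)
  moreover have "C1 * sqrt s \<le> (C1 + 1) * sqrt s" using that by (intro mult_right_mono) auto
  ultimately have "C1 * sqrt s \<le> \<kappa>" by linarith
  then show ?thesis using that by (simp add: field_simps)
 qed
 define \<tau> where "\<tau> = s0 / 2"
 have \<tau>: "0 < \<tau>" using s0 by (simp add: \<tau>_def)
 obtain t0 where t0: "t0 \<in> {1..T}" and hb: "\<And>x0. (LI y. (v t0 y)\<^sup>2 / ((norm (y - x0))\<^sup>2 + \<tau>)) \<le> B0"
  using small[OF \<tau>] by blast
 have init: "(NI x. hardy_weight \<tau> (x - x0) * ennreal ((v t0 x)\<^sup>2)) \<le> ennreal B0" for x0
 proof -
  have i2: "integrable lborel (\<lambda>x. (v t0 x)\<^sup>2)"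
   using v_square_bounds(1)[of t0 C1 C1] C1 t0 by (intro integrable_nL_le[of _ "C1 * C1"]) auto
  have i: "integrable lborel (\<lambda>x. (v t0 x)\<^sup>2 * (1 / ((norm (x - x0))\<^sup>2 + \<tau>)))"
  proof (rule integrable_mult_bounded[OF i2])
   show "\<bar>1 / ((norm (x - x0))\<^sup>2 + \<tau>)\<bar> \<le> 1 / \<tau>" for x
    using \<tau> frac_le[of 1 1 \<tau> "(norm (x - x0))\<^sup>2 + \<tau>"] by (simp add: add_nonneg_nonneg less_imp_le)
  qed simp
  have "(NI x. hardy_weight \<tau> (x - x0) * ennreal ((v t0 x)\<^sup>2)) = (NI x. ennreal ((v t0 x)\<^sup>2 * (1 / ((norm (x - x0))\<^sup>2 + \<tau>))))"
   unfolding hardy_weight_def using \<tau> by (intro nn_integral_cong) (simp add: ennreal_mult[symmetric] add_nonneg_nonneg less_imp_le)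
  also have "\<dots> = ennreal (LI x. (v t0 x)\<^sup>2 * (1 / ((norm (x - x0))\<^sup>2 + \<tau>)))"
   by (rule nn_integral_eq_integral[OF i]) (use \<tau> in \<open>auto simp: add_nonneg_nonneg less_imp_le\<close>)
  also have "\<dots> \<le> ennreal B0" using hb[of x0] by (intro ennreal_leI) simp
  finally show ?thesis .
 qed
 have "\<bar>v (t0 + t) x\<bar> \<le> \<kappa> / sqrt t" if tpos: "0 < t" for t x
 proof -
  define T' where "T' = max 1 t"
  have T': "1 \<le> T'" "t \<le> T'" by (auto simp: T'_def)
  obtain C2 where C2: "0 \<le> C2" "\<And>s. s \<in> {0..t0 + T'} \<Longrightarrow> nL (v s) \<le> ennreal C2" "\<And>s x. s \<in> {0..t0 + T'} \<Longrightarrow> \<bar>v s x\<bar> \<le> C2"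
   using v_local[of "t0 + T'"] T' t0 by auto
  define X where "X = sqrt T' * (2 * k * C2\<^sup>2)"
  have X: "0 \<le> X" using T' k by (simp add: X_def)
  \<comment> \<open>The step length: small enough for the uncontrolled piece, and at most s0, so
    that t1 is beyond half of the new time.\<close>
  define \<eta> where "\<eta> = min s0 ((\<kappa> / (4 * (X + 1)))\<^sup>2)"
  have \<eta>: "0 < \<eta>" "\<eta> \<le> s0" using s0 \<kappa> X by (auto simp: \<eta>_def)
  have X\<eta>: "X * sqrt \<eta> \<le> \<kappa> / 4"
  proof -
   have "sqrt \<eta> \<le> sqrt ((\<kappa> / (4 * (X + 1)))\<^sup>2)" by (intro real_sqrt_le_mono) (simp add: \<eta>_def)
   then have "sqrt \<eta> \<le> \<kappa> / (4 * (X + 1))" using \<kappa> X by simp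
   then have "X * sqrt \<eta> \<le> X * (\<kappa> / (4 * (X + 1)))" using X by (intro mult_left_mono)
   also have "\<dots> \<le> \<kappa> / 4" using X \<kappa> by (simp add: field_simps)
   finally show ?thesis .
  qed
  \<comment> \<open>The step \<eta> depends on T' but not on n, so finitely many steps reach the
    given time t.\<close>
  have main: "\<forall>s\<in>{0<..T'}. s \<le> s0 + real n * \<eta> \<longrightarrow> (\<forall>x. \<bar>v (t0 + s) x\<bar> \<le> \<kappa> / sqrt s)" for n
  proof (induction n)
   case 0
   show ?case
   proof (intro ballI impI allI)
    fix s x assume "s \<in> {0<..T'}" "s \<le> s0 + real 0 * \<eta>"
    then have s: "0 < s" "s \<le> s0" by auto
    have "\<bar>v (t0 + s) x\<bar> \<le> C1" by (rule C1(3)) (use s s0 t0 in auto)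
    also note s0C[OF s]
    finally show "\<bar>v (t0 + s) x\<bar> \<le> \<kappa> / sqrt s" .
   qed
  next
   case (Suc n)
   define t1 where "t1 = s0 + real n * \<eta>"
   have t1: "s0 \<le> t1" using \<eta> by (simp add: t1_def)
   show ?case
   proof (intro ballI impI allI)
    fix s x assume s: "s \<in> {0<..T'}" "s \<le> s0 + real (Suc n) * \<eta>"
    show "\<bar>v (t0 + s) x\<bar> \<le> \<kappa> / sqrt s"
    proof (cases "s \<le> t1")
     case True
     then show ?thesis using Suc s by (auto simp: t1_def)
    next
     case False
     have st: "t1 < s" "s - t1 \<le> \<eta>" "s / 2 \<le> t1" "0 < t1" "s \<le> T'" "0 < s"
     proof -
      have "s \<le> t1 + \<eta>" using s by (simp add: t1_def algebra_simps)
      with False s \<eta> t1 s0 show "t1 < s" "s - t1 \<le> \<eta>" "s / 2 \<le> t1" "0 < t1" "s \<le> T'" "0 < s" by auto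
     qed
     have sm: "\<bar>v (t0 + r) x\<bar> \<le> \<kappa> / sqrt r" if "r \<in> {0<..t1}" for r x
      using Suc that st by (auto simp: t1_def)
     have "sqrt s * \<bar>v (t0 + s) x\<bar> \<le> sqrt ((mc 2 + 1) * B0) + 12 * kc * norm a * (mc 2 + 1) * B0 + 4 * kc * norm a * \<kappa>\<^sup>2
       + sqrt s * (2 * kc * norm a * C2\<^sup>2 * sqrt (s - t1))"
     proof (rule sup_norm_step[OF \<tau> _ _ _ _ init])
      show "2 * \<tau> \<le> s" using st t1 by (simp add: \<tau>_def)
      show "(NI x. hardy_weight \<tau> (x - x0) * ennreal ((v (t0 + r) x)\<^sup>2)) \<le> ennreal (4 * B0)" if "r \<in> {0<..s / 2}" for r x0
       by (rule hardy_norm_bound[OF \<tau> _ st(4) _ k72 _ init sm]) (use that st t0 \<kappa> B0 in auto)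
      show "\<bar>v (t0 + r) x\<bar> \<le> C2" if "r \<in> {0<..s}" for r x
       by (rule C2(3)) (use that st t0 in auto)
     qed (use t0 \<kappa> B0 st sm C2 in auto)
     also have "sqrt s * (2 * kc * norm a * C2\<^sup>2 * sqrt (s - t1)) \<le> sqrt T' * (2 * kc * norm a * C2\<^sup>2 * sqrt \<eta>)"
      using st k T' kc_pos by (intro mult_mono) (auto simp: less_imp_le)
     also have "\<dots> = X * sqrt \<eta>" by (simp add: X_def k_def)
     finally have "sqrt s * \<bar>v (t0 + s) x\<bar> \<le> \<kappa>" using b1 b2 b3 X\<eta> by linarith
     then show ?thesis using st by (simp add: field_simps)
    qed
   qed
  qed
  obtain n :: nat where "t / \<eta> \<le> real n" using real_arch_simple by blast
  then have "t \<le> s0 + real n * \<eta>" using \<eta> s0 by (simp add: field_simps)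
  with main[of n] T' tpos show ?thesis by auto
 qed
 then show ?thesis using t0 by (intro exI[of _ t0]) auto
qed

end

section \<open>Global decay and moments\<close>

text \<open>Truncating at R makes the weighted norm finite as soon as the L^1 norm is, which
  \<open>nn_absorb\<close> requires. The bounds do not involve R, and R tends to infinity in
  \<open>global_bounds\<close>.\<close>

definition trunc_cube :: "real \<Rightarrow> real^4 \<Rightarrow> ennreal" where
 "trunc_cube R x = ennreal (min (norm x ^ 3) R)"

lemma borel_measurable_trunc_cube [measurable]: "trunc_cube R \<in> borel_measurable borel"
 unfolding trunc_cube_def by measurable

text \<open>The 4 is the constant of (p+q)^3 \<le> 4(p^3 + q^3), and truncation does not worsen it.
  Subadditivity distributes the weight over the two factors of a convolution.\<close>

lemma trunc_cube_subadditive: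
 assumes "0 < R"
 shows "trunc_cube R x \<le> 4 * (trunc_cube R (x - y) + trunc_cube R y)"
proof -
 define p q where "p = norm (x - y)" "q = norm y"
 have pq: "0 \<le> p" "0 \<le> q" by (auto simp: p_q_def)
 have "norm x \<le> p + q" unfolding p_q_def using norm_triangle_ineq[of "x - y" y] by simp
 then have "norm x ^ 3 \<le> (p + q) ^ 3" by (intro power_mono) auto
 also have "\<dots> \<le> 4 * (p ^ 3 + q ^ 3)"
 proof -
  have "0 \<le> 3 * (p + q) * (p - q)\<^sup>2" using pq by simp
  also have "\<dots> = 4 * (p ^ 3 + q ^ 3) - (p + q) ^ 3" by (simp add: power2_eq_square power3_eq_cube algebra_simps)
  finally show ?thesis by simp
 qed
 finally have "norm x ^ 3 \<le> 4 * (p ^ 3 + q ^ 3)" .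
 then have "min (norm x ^ 3) R \<le> 4 * (min (p ^ 3) R + min (q ^ 3) R)"
 proof -
  have aux: "min X R \<le> 4 * (min P R + min Q R)" if "X \<le> 4 * (P + Q)" "0 \<le> P" "0 \<le> Q" for X P Q :: real
   using that assms by (auto simp: min_def)
  show "min (norm x ^ 3) R \<le> 4 * (min (p ^ 3) R + min (q ^ 3) R)" if "norm x ^ 3 \<le> 4 * (p ^ 3 + q ^ 3)"
   by (rule aux[OF that]) (use pq in auto)
 qed
 then have "trunc_cube R x \<le> ennreal (4 * (min (p ^ 3) R + min (q ^ 3) R))"
  unfolding trunc_cube_def by (rule ennreal_leI)
 also have "\<dots> = 4 * (trunc_cube R (x - y) + trunc_cube R y)"
  using assms pq by (simp add: trunc_cube_def p_q_def ennreal_mult ennreal_plus)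
 finally show ?thesis .
qed

lemma trunc_cube_conv:
 assumes [measurable]: "k \<in> borel_measurable borel" "g \<in> borel_measurable borel" and R: "0 < R"
  and k: "(NI x. trunc_cube R x * ennreal \<bar>k x\<bar>) \<le> ennreal K3" "nL k \<le> ennreal K" "0 \<le> K3" "0 \<le> K"
  and g: "(NI x. trunc_cube R x * ennreal \<bar>g x\<bar>) \<le> ennreal G3" "nL g \<le> ennreal G" "0 \<le> G3" "0 \<le> G"
 shows "(NI x. trunc_cube R x * ennreal \<bar>conv k g x\<bar>) \<le> ennreal (4 * (K3 * G + K * G3))"
proof -
 have "(NI x. trunc_cube R x * ennreal \<bar>conv k g x\<bar>)
   \<le> (NI y. (4 * (ennreal K3 + trunc_cube R y * ennreal K)) * ennreal \<bar>g y\<bar>)"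
 proof (rule conv_weighted)
  fix y
  have "(NI x. trunc_cube R x * ennreal \<bar>k (x - y)\<bar>)
    \<le> (NI x. 4 * (trunc_cube R (x - y) * ennreal \<bar>k (x - y)\<bar> + trunc_cube R y * ennreal \<bar>k (x - y)\<bar>))"
  proof (intro nn_integral_mono)
   fix x
   show "trunc_cube R x * ennreal \<bar>k (x - y)\<bar> \<le> 4 * (trunc_cube R (x - y) * ennreal \<bar>k (x - y)\<bar> + trunc_cube R y * ennreal \<bar>k (x - y)\<bar>)"
    using mult_right_mono[OF trunc_cube_subadditive[OF R, of x y], of "ennreal \<bar>k (x - y)\<bar>"]
    by (simp add: distrib_left distrib_right mult.assoc)
  qed
  also have "\<dots> = 4 * ((NI x. trunc_cube R (x - y) * ennreal \<bar>k (x - y)\<bar>) + trunc_cube R y * (NI x. ennreal \<bar>k (x - y)\<bar>))"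
   by (simp add: nn_integral_cmult nn_integral_add)
  also have "\<dots> = 4 * ((NI x. trunc_cube R x * ennreal \<bar>k x\<bar>) + trunc_cube R y * nL k)"
   using nn_integral_shift_minus[of "\<lambda>x. trunc_cube R x * ennreal \<bar>k x\<bar>" y] nn_integral_shift_minus[of "\<lambda>x. ennreal \<bar>k x\<bar>" y] by simp
  also have "\<dots> \<le> 4 * (ennreal K3 + trunc_cube R y * ennreal K)"
   by (intro mult_left_mono add_mono k) auto
  finally show "(NI x. trunc_cube R x * ennreal \<bar>k (x - y)\<bar>) \<le> 4 * (ennreal K3 + trunc_cube R y * ennreal K)" .
 qed auto
 also have "\<dots> = (NI y. 4 * (ennreal K3 * ennreal \<bar>g y\<bar> + ennreal K * (trunc_cube R y * ennreal \<bar>g y\<bar>)))"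
  by (intro nn_integral_cong) (simp add: distrib_left distrib_right mult_ac)
 also have "\<dots> = 4 * (ennreal K3 * nL g + ennreal K * (NI y. trunc_cube R y * ennreal \<bar>g y\<bar>))"
  by (simp add: nn_integral_cmult nn_integral_add)
 also have "\<dots> \<le> 4 * (ennreal K3 * ennreal G + ennreal K * ennreal G3)"
  by (intro mult_left_mono add_mono g) auto
 also have "\<dots> = ennreal (4 * (K3 * G + K * G3))"
  using k g by (simp add: ennreal_mult ennreal_plus)
 finally show ?thesis .
qed

lemma trunc_cube_le_moment:
 assumes "\<And>x. norm x ^ 3 * \<bar>k x\<bar> \<le> A * heatG r x" "0 \<le> A" "0 < r"
 shows "(NI x. trunc_cube R x * ennreal \<bar>k x\<bar>) \<le> ennreal A"
proof -
 have "(NI x. trunc_cube R x * ennreal \<bar>k x\<bar>) \<le> (NI x. ennreal A * ennreal (heatG r x))"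
 proof (intro nn_integral_mono)
  fix x
  have "trunc_cube R x * ennreal \<bar>k x\<bar> \<le> ennreal (norm x ^ 3) * ennreal \<bar>k x\<bar>"
   unfolding trunc_cube_def by (intro mult_right_mono ennreal_leI) auto
  also have "\<dots> = ennreal (norm x ^ 3 * \<bar>k x\<bar>)" by (simp add: ennreal_mult)
  also have "\<dots> \<le> ennreal (A * heatG r x)" by (intro ennreal_leI assms)
  finally show "trunc_cube R x * ennreal \<bar>k x\<bar> \<le> ennreal A * ennreal (heatG r x)" using assms by (simp add: ennreal_mult)
 qed
 also have "\<dots> = ennreal A" using assms by (simp add: nn_integral_cmult nn_integral_heatG)
 finally show ?thesis .
qed

lemma trunc_cube_heatG: "t > 0 \<Longrightarrow> (NI x. trunc_cube R x * ennreal \<bar>heatG t x\<bar>) \<le> ennreal (mc 3 * (t * sqrt t))"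
proof (rule trunc_cube_le_moment[where r = "2 * t"])
 fix x assume "t > 0"
 then show "norm x ^ 3 * \<bar>heatG t x\<bar> \<le> mc 3 * (t * sqrt t) * heatG (2 * t) x"
  using heatG_moment[of t x 3] by (simp add: power3_eq_cube)
qed (auto simp: less_imp_le)

lemma trunc_cube_gK: "t > 0 \<Longrightarrow> (NI x. trunc_cube R x * ennreal \<bar>gK b t x\<bar>) \<le> ennreal (mc 4 * norm b * t)"
proof (rule trunc_cube_le_moment[where r = "2 * t"])
 fix x assume t: "t > 0"
 have "\<bar>gK b t x\<bar> \<le> norm b * norm x / (2 * t) * heatG t x"
  unfolding gK_def using t abs_inner_le[of b x] by (simp add: abs_mult divide_right_mono mult_right_mono)
 then have "norm x ^ 3 * \<bar>gK b t x\<bar> \<le> norm x ^ 3 * (norm b * norm x / (2 * t) * heatG t x)" by (intro mult_left_mono) auto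
 also have "\<dots> = norm b / (2 * t) * (norm x ^ 4 * heatG t x)" by (simp add: power4_eq_xxxx power3_eq_cube)
 also have "\<dots> \<le> norm b / (2 * t) * (mc 4 * sqrt t ^ 4 * heatG (2 * t) x)"
  using t by (intro mult_left_mono heatG_moment) auto
 also have "sqrt t ^ 4 = t * t" using t by (simp add: power4_eq_xxxx)
 also have "norm b / (2 * t) * (mc 4 * (t * t) * heatG (2 * t) x) = mc 4 * norm b * t * heatG (2 * t) x / 2" using t by simp
 also have "\<dots> \<le> mc 4 * norm b * t * heatG (2 * t) x" using t by (simp add: less_imp_le)
 finally show "norm x ^ 3 * \<bar>gK b t x\<bar> \<le> mc 4 * norm b * t * heatG (2 * t) x" .
qed (auto simp: less_imp_le)

context mild begin

text \<open>Bounding one factor of v^2 by \<kappa>/sqrt s makes the Duhamel term linear in the L^1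
  norm with a scale-free beta integral as coefficient, so the norm at most doubles over all later
  times.\<close>

lemma nL_decay:
 assumes t0: "0 \<le> t0" and \<kappa>: "0 < \<kappa>" "48 * (kc * norm a) * \<kappa> \<le> 1" and small: "\<And>s x. s > 0 \<Longrightarrow> \<bar>v (t0 + s) x\<bar> \<le> \<kappa> / sqrt s"
  and A: "nL (v t0) \<le> ennreal A" "0 \<le> A" and t: "t > 0"
 shows "nL (v (t0 + t)) \<le> ennreal (2 * A)"
proof -
 obtain C where C: "0 \<le> C" "\<And>s. s \<in> {0..t0 + t} \<Longrightarrow> nL (v s) \<le> ennreal C"
  using v_local[of "t0 + t"] t0 t by (metis add_nonneg_pos)
 show ?thesis
 proof (rule nn_absorb[where G = "\<lambda>s. nL (v (t0 + s))" and S = "{0<..t}" and M = C])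
 show "0 \<le> C" by fact
 show "nL (v (t0 + i)) \<le> ennreal C" if "i \<in> {0<..t}" for i using that t0 by (intro C) auto
next
 fix B r assume B: "0 \<le> B" "\<And>i. i \<in> {0<..t} \<Longrightarrow> nL (v (t0 + i)) \<le> ennreal B" and r: "r \<in> {0<..t}"
 let ?k = "kc * norm a * \<kappa> * B"
 have k: "0 \<le> ?k" using kc_pos \<kappa> B by (simp add: less_imp_le)
 have r0: "0 < r" using r by simp
 have m: "case_prod (\<lambda>s x. heatP a (r - s) (\<lambda>y. (v (t0 + s) y)\<^sup>2) x) \<in> borel_measurable (lborel \<Otimes>\<^sub>M lborel)"
  by measurable
 have "nL (\<lambda>x. heatS r (v t0) x + (LINT s:{0<..<r}|lborel. heatP a (r - s) (\<lambda>y. (v (t0 + s) y)\<^sup>2) x)) \<le> ennreal (A + ?k * 6)"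
 proof (rule nL_add)
  show "nL (heatS r (v t0)) \<le> ennreal A" by (rule nL_heatS[OF r0 _ A]) simp
  have "nL (\<lambda>x. LINT s:{0<..<r}|lborel. heatP a (r - s) (\<lambda>y. (v (t0 + s) y)\<^sup>2) x) \<le> (nT {0<..<r} (\<lambda>s. ?k * (1 / (sqrt (r - s) * sqrt s))))"
  proof (rule nL_time[OF m])
   fix s assume s: "s \<in> {0<..<r}"
   have f: "nL (\<lambda>y. (v (t0 + s) y)\<^sup>2) \<le> ennreal (B * (\<kappa> / sqrt s))"
    by (rule v_square_bounds(1)) (use s r B small in auto)
   have "nL (heatP a (r - s) (\<lambda>y. (v (t0 + s) y)\<^sup>2)) \<le> ennreal (kc * norm a / sqrt (r - s) * (B * (\<kappa> / sqrt s)))"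
    by (rule nL_heatP[OF _ _ f]) (use s B \<kappa> in auto)
   then show "nL (heatP a (r - s) (\<lambda>y. (v (t0 + s) y)\<^sup>2)) \<le> ennreal (?k * (1 / (sqrt (r - s) * sqrt s)))"
    by (simp add: mult_ac)
  qed simp
  also have "\<dots> \<le> ennreal (?k * 6)" using nn_integral_beta_half[OF r0] k by (intro set_nn_integral_cmult) auto
  finally show "nL (\<lambda>x. LINT s:{0<..<r}|lborel. heatP a (r - s) (\<lambda>y. (v (t0 + s) y)\<^sup>2) x) \<le> ennreal (?k * 6)" .
  show "(\<lambda>x. LINT s:{0<..<r}|lborel. heatP a (r - s) (\<lambda>y. (v (t0 + s) y)\<^sup>2) x) \<in> borel_measurable borel"
   unfolding set_lebesgue_integral_def conv_def by measurable
 qed (use A k in auto)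
 also have "\<dots> \<le> ennreal (A + B / 2)"
 proof (rule ennreal_leI)
  have "48 * (kc * norm a) * \<kappa> * B \<le> 1 * B" by (intro mult_right_mono \<kappa> B)
  then show "A + ?k * 6 \<le> A + B / 2" using B by (simp add: mult_ac) 
 qed
 finally show "nL (v (t0 + r)) \<le> ennreal (A + B / 2)" using v_mild[OF t0 r0] by simp
 qed (use A t in auto)
qed

text \<open>For s \<le> r/2 the kernel is bounded and the L^1 norm is used; for s > r/2 one factor
  of v^2 takes \<kappa>/sqrt s and the other the bound B/s^2 to be improved. Both halves give
  r^(-5/2) times an integrable inverse root. The 6 bounds 2^(5/2).\<close>

lemma sup_decay:
 assumes t0: "0 \<le> t0" and \<kappa>: "0 < \<kappa>" "48 * (kc * norm a) * \<kappa> \<le> 1" and small: "\<And>s x. s > 0 \<Longrightarrow> \<bar>v (t0 + s) x\<bar> \<le> \<kappa> / sqrt s"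
  and A: "\<And>s. s \<ge> 0 \<Longrightarrow> nL (v (t0 + s)) \<le> ennreal A" "0 \<le> A" and t: "t > 0"
 shows "\<bar>v (t0 + t) x\<bar> * t\<^sup>2 \<le> 4 * A"
proof -
 let ?G = "\<lambda>(s, x). ennreal (\<bar>v (t0 + s) x\<bar> * s\<^sup>2)"
 obtain C where C: "0 \<le> C" "\<And>s x. s \<in> {0..t0 + t} \<Longrightarrow> \<bar>v s x\<bar> \<le> C"
  using v_local[of "t0 + t"] t0 t by (metis add_nonneg_pos)
 have "?G (t, x) \<le> ennreal (2 * (2 * A))"
 proof (rule nn_absorb[where S = "{0<..t} \<times> UNIV" and M = "C * t\<^sup>2"])
  show "0 \<le> C * t\<^sup>2" using C by simp
  fix i :: "real \<times> (real^4)" assume "i \<in> {0<..t} \<times> UNIV"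
  then show "?G i \<le> ennreal (C * t\<^sup>2)"
   using t0 C by (auto intro!: ennreal_leI mult_mono power_mono)
 next
  fix B :: real and i :: "real \<times> (real^4)"
  assume B: "0 \<le> B" and hyp: "\<And>i. i \<in> {0<..t} \<times> UNIV \<Longrightarrow> ?G i \<le> ennreal B" and "i \<in> {0<..t} \<times> UNIV"
  then obtain r z where i: "i = (r, z)" "0 < r" "r \<le> t" by auto
  define k where "k = kc * norm a * \<kappa>"
  have k: "0 \<le> k" "48 * k \<le> 1" using \<kappa> kc_pos by (auto simp: k_def less_imp_le)
  have vB: "\<bar>v (t0 + s) y\<bar> \<le> B / s\<^sup>2" if "0 < s" "s \<le> t" for s y
  proof -
   have "ennreal (\<bar>v (t0 + s) y\<bar> * s\<^sup>2) \<le> ennreal B" using hyp[of "(s, y)"] that by simp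
   then have "\<bar>v (t0 + s) y\<bar> * s\<^sup>2 \<le> B" using B by simp
   then show ?thesis using that by (simp add: field_simps)
  qed
  let ?\<beta> = "\<lambda>s. 6 * k * A / (r\<^sup>2 * sqrt r) * (1 / sqrt s) + 6 * k * B / (r\<^sup>2 * sqrt r) * (1 / sqrt (r - s))"
  have sq2: "sqrt 2 \<le> 1.5" by (rule real_le_lsqrt) (auto simp: power2_eq_square)
  have "\<bar>LINT s:{0<..<r}|lborel. heatP a (r - s) (\<lambda>y. (v (t0 + s) y)\<^sup>2) z\<bar> \<le> 6 * k * A / (r\<^sup>2 * sqrt r) * (2 * sqrt r) + 6 * k * B / (r\<^sup>2 * sqrt r) * (2 * sqrt r)"
  proof (rule abs_set_integral_le)
   fix s assume s: "s \<in> {0<..<r}"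
   have pos: "0 \<le> 6 * k * A / (r\<^sup>2 * sqrt r) * (1 / sqrt s)" "0 \<le> 6 * k * B / (r\<^sup>2 * sqrt r) * (1 / sqrt (r - s))"
    using s k A B i by auto
   show "\<bar>heatP a (r - s) (\<lambda>y. (v (t0 + s) y)\<^sup>2) z\<bar> \<le> ?\<beta> s"
   proof (cases "s \<le> r / 2")
    case True
    have f: "nL (\<lambda>y. (v (t0 + s) y)\<^sup>2) \<le> ennreal (A * (\<kappa> / sqrt s))"
     by (rule v_square_bounds(1)) (use s A small in auto)
    have "\<bar>heatP a (r - s) (\<lambda>y. (v (t0 + s) y)\<^sup>2) z\<bar> \<le> kc * norm a / sqrt (r - s) * (1 / (r - s)\<^sup>2) * (A * (\<kappa> / sqrt s))"
     by (rule abs_conv_le_sup_kernel[OF _ _ f]) (use s A \<kappa> gK_abs_le[of "r - s" a] in auto)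
    also have "\<dots> = k * A * (1 / sqrt s) * (1 / ((r - s)\<^sup>2 * sqrt (r - s)))" by (simp add: k_def mult_ac)
    also have "\<dots> \<le> k * A * (1 / sqrt s) * (6 / (r\<^sup>2 * sqrt r))"
    proof (rule mult_left_mono)
     have h: "0 < r / 2" "r / 2 \<le> r - s" using True i by auto
     have "(r / 2)\<^sup>2 * sqrt (r / 2) \<le> (r - s)\<^sup>2 * sqrt (r - s)"
      using h by (intro mult_mono power_mono) auto
     moreover have "r\<^sup>2 * sqrt r / 6 \<le> (r / 2)\<^sup>2 * sqrt (r / 2)"
     proof -
      have "1 / 6 \<le> 1 / (4 * sqrt 2)" using sq2 by (intro divide_left_mono) auto
      from mult_left_mono[OF this, of "r\<^sup>2 * sqrt r"] show ?thesis using i by (simp add: real_sqrt_divide power_divide)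
     qed
     ultimately have "r\<^sup>2 * sqrt r / 6 \<le> (r - s)\<^sup>2 * sqrt (r - s)" by linarith
     then have "1 / ((r - s)\<^sup>2 * sqrt (r - s)) \<le> 1 / (r\<^sup>2 * sqrt r / 6)" using i by (intro frac_le) auto
     then show "1 / ((r - s)\<^sup>2 * sqrt (r - s)) \<le> 6 / (r\<^sup>2 * sqrt r)" by simp
    qed (use k A s in auto)
    finally show ?thesis using pos by (simp add: mult_ac)
   next
    case False
    have "\<bar>heatP a (r - s) (\<lambda>y. (v (t0 + s) y)\<^sup>2) z\<bar> \<le> kc * norm a / sqrt (r - s) * (\<kappa> * B * (6 / (r\<^sup>2 * sqrt r)))"
    proof (rule abs_heatP_le)
     fix y
     have "\<bar>v (t0 + s) y\<bar> * \<bar>v (t0 + s) y\<bar> \<le> \<kappa> / sqrt s * (B / s\<^sup>2)"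
      using s i \<kappa> by (intro mult_mono small vB) auto
     also have "\<dots> = \<kappa> * B * (1 / (s\<^sup>2 * sqrt s))" by simp
     also have "\<dots> \<le> \<kappa> * B * (6 / (r\<^sup>2 * sqrt r))"
     proof (rule mult_left_mono)
      have h: "0 < r / 2" "r / 2 \<le> s" using False i by auto
      have "(r / 2)\<^sup>2 * sqrt (r / 2) \<le> s\<^sup>2 * sqrt s"
       using h by (intro mult_mono power_mono) auto
      moreover have "r\<^sup>2 * sqrt r / 6 \<le> (r / 2)\<^sup>2 * sqrt (r / 2)"
      proof -
       have "1 / 6 \<le> 1 / (4 * sqrt 2)" using sq2 by (intro divide_left_mono) auto
       from mult_left_mono[OF this, of "r\<^sup>2 * sqrt r"] show ?thesis using i by (simp add: real_sqrt_divide power_divide)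
      qed
      ultimately have "r\<^sup>2 * sqrt r / 6 \<le> s\<^sup>2 * sqrt s" by linarith
      then have "1 / (s\<^sup>2 * sqrt s) \<le> 1 / (r\<^sup>2 * sqrt r / 6)" using i by (intro frac_le) auto
      then show "1 / (s\<^sup>2 * sqrt s) \<le> 6 / (r\<^sup>2 * sqrt r)" by simp
     qed (use \<kappa> B in auto)
     finally show "\<bar>(v (t0 + s) y)\<^sup>2\<bar> \<le> \<kappa> * B * (6 / (r\<^sup>2 * sqrt r))" by (simp add: power2_eq_square abs_mult)
    qed (use s in auto)
    then show ?thesis using pos by (simp add: k_def mult_ac)
   qed
  next
   show "(nT {0<..<r} (\<lambda>s. ?\<beta> s)) \<le> ennreal (6 * k * A / (r\<^sup>2 * sqrt r) * (2 * sqrt r) + 6 * k * B / (r\<^sup>2 * sqrt r) * (2 * sqrt r))"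
    using nn_integral_inverse_sqrt[of r] nn_integral_inverse_sqrt_reflect[of 0 r] i k A B
    by (intro set_nn_integral_add set_nn_integral_cmult) auto
  qed (use i k A B in auto)
  moreover have "\<bar>heatS r (v t0) z\<bar> \<le> 1 / r\<^sup>2 * A"
   by (rule abs_conv_le_sup_kernel) (use A(1)[of 0] A(2) abs_heatG_le[OF i(2)] in auto)
  ultimately have "\<bar>v (t0 + r) z\<bar> \<le> 1 / r\<^sup>2 * A + (6 * k * A / (r\<^sup>2 * sqrt r) * (2 * sqrt r) + 6 * k * B / (r\<^sup>2 * sqrt r) * (2 * sqrt r))"
   unfolding v_mild[OF t0 i(2)] by linarith
  also have "\<dots> = (A + 12 * k * A + 12 * k * B) / r\<^sup>2"
   using i by (simp add: field_simps)
  finally have "\<bar>v (t0 + r) z\<bar> * r\<^sup>2 \<le> A + 12 * k * A + 12 * k * B" using i by (simp add: field_simps)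
  also have "\<dots> \<le> 2 * A + B / 2"
   using mult_right_mono[OF k(2) A(2)] mult_right_mono[OF k(2) B] A B by (simp add: mult_ac)
  finally show "?G i \<le> ennreal (2 * A + B / 2)" using i by (auto intro!: ennreal_leI)
 qed (use A t in auto)
 then show ?thesis using A by simp
qed

text \<open>The kernels contribute third moments of order t^(3/2) and t, and the nonlinearity
  contributes 4 * 6 = 24 times kc |a| \<kappa> B. Requiring this to be at most B/2 is the origin of
  the 48. Since decay is assumed only on (0, L], the lemma also applies to short steps before the
  solution has become small.\<close>

lemma moment_step:
 assumes R: "0 < R" and t0: "0 \<le> t0" and L: "0 < L" and \<kappa>: "0 < \<kappa>" "48 * (kc * norm a) * \<kappa> \<le> 1"
  and small: "\<And>s x. s \<in> {0<..L} \<Longrightarrow> \<bar>v (t0 + s) x\<bar> \<le> \<kappa> / sqrt s"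
  and A: "\<And>s. s \<ge> 0 \<Longrightarrow> nL (v s) \<le> ennreal A" "0 \<le> A"
  and m: "(NI x. trunc_cube R x * ennreal \<bar>v t0 x\<bar>) \<le> ennreal m" "0 \<le> m"
  and t: "t \<in> {0<..L}"
 shows "(NI x. trunc_cube R x * ennreal \<bar>v (t0 + t) x\<bar>)
  \<le> ennreal (2 * (4 * m + (4 * mc 3 * A + 8 * mc 4 * norm a * \<kappa> * A) * (L * sqrt L)))"
proof (rule nn_absorb[where G = "\<lambda>t. NI x. trunc_cube R x * ennreal \<bar>v (t0 + t) x\<bar>" and S = "{0<..L}"])
 show "0 \<le> R * A" using R A by simp
 fix r assume r: "r \<in> {0<..L}"
 have "(NI x. trunc_cube R x * ennreal \<bar>v (t0 + r) x\<bar>) \<le> (NI x. ennreal R * ennreal \<bar>v (t0 + r) x\<bar>)"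
  by (intro nn_integral_mono mult_right_mono) (auto simp: trunc_cube_def intro!: ennreal_leI)
 also have "\<dots> = ennreal R * nL (v (t0 + r))" by (rule nn_integral_cmult) simp
 also have "\<dots> \<le> ennreal R * ennreal A" by (intro mult_left_mono A) (use r t0 in auto)
 finally show "(NI x. trunc_cube R x * ennreal \<bar>v (t0 + r) x\<bar>) \<le> ennreal (R * A)" using R A by (simp add: ennreal_mult)
next
 fix B r assume B: "0 \<le> B" and hyp: "\<And>i. i \<in> {0<..L} \<Longrightarrow> (NI x. trunc_cube R x * ennreal \<bar>v (t0 + i) x\<bar>) \<le> ennreal B" and r: "r \<in> {0<..L}"
 define k where "k = kc * norm a"
 have k: "0 \<le> k" "48 * k * \<kappa> \<le> 1" using kc_pos \<kappa> by (auto simp: k_def less_imp_le)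
 have r0: "0 < r" "r \<le> L" using r by auto
 let ?F = "\<lambda>s x. heatP a (r - s) (\<lambda>y. (v (t0 + s) y)\<^sup>2) x"
 let ?I = "\<lambda>x. LINT s:{0<..<r}|lborel. ?F s x"
 have mm: "case_prod ?F \<in> borel_measurable (lborel \<Otimes>\<^sub>M lborel)" by measurable
 have Im[measurable]: "?I \<in> borel_measurable borel"
  unfolding set_lebesgue_integral_def conv_def by measurable
 have S: "(NI x. trunc_cube R x * ennreal \<bar>heatS r (v t0) x\<bar>) \<le> ennreal (4 * (mc 3 * (r * sqrt r) * A + 1 * m))"
  by (rule trunc_cube_conv[OF _ _ R trunc_cube_heatG nL_heatG _ _ m(1) A(1)]) (use r0 A m t0 in \<open>auto simp: less_imp_le\<close>)
 let ?\<beta> = "\<lambda>s. 4 * (mc 4 * norm a * L * A * \<kappa>) * (1 / sqrt s) + 4 * (k * \<kappa> * B) * (1 / (sqrt (r - s) * sqrt s))"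
 have I: "(NI x. trunc_cube R x * ennreal \<bar>?I x\<bar>) \<le> ennreal (4 * (mc 4 * norm a * L * A * \<kappa>) * (2 * sqrt r) + 4 * (k * \<kappa> * B) * 6)"
 proof (rule order_trans[OF minkowski_time[OF mm, of _ _ "\<lambda>s. ennreal (?\<beta> s)"]])
  fix s assume s: "s \<in> {0<..<r}"
  have sL: "s \<in> {0<..L}" using s r0 by auto
  have f: "nL (\<lambda>y. (v (t0 + s) y)\<^sup>2) \<le> ennreal (A * (\<kappa> / sqrt s))"
   by (rule v_square_bounds(1)) (use s A small sL t0 in auto)
  have f3: "(NI x. trunc_cube R x * ennreal \<bar>(v (t0 + s) x)\<^sup>2\<bar>) \<le> ennreal (\<kappa> / sqrt s * B)"
  proof -
   have "(NI x. trunc_cube R x * ennreal \<bar>(v (t0 + s) x)\<^sup>2\<bar>) \<le> (NI x. ennreal (\<kappa> / sqrt s) * (trunc_cube R x * ennreal \<bar>v (t0 + s) x\<bar>))"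
   proof (intro nn_integral_mono)
    fix x
    have "\<bar>(v (t0 + s) x)\<^sup>2\<bar> \<le> \<kappa> / sqrt s * \<bar>v (t0 + s) x\<bar>"
     using mult_right_mono[OF small[OF sL, of x], of "\<bar>v (t0 + s) x\<bar>"] by (simp add: power2_eq_square)
    then have "ennreal \<bar>(v (t0 + s) x)\<^sup>2\<bar> \<le> ennreal (\<kappa> / sqrt s * \<bar>v (t0 + s) x\<bar>)" by (rule ennreal_leI)
    also have "\<dots> = ennreal (\<kappa> / sqrt s) * ennreal \<bar>v (t0 + s) x\<bar>" using \<kappa> s by (intro ennreal_mult) auto
    finally show "trunc_cube R x * ennreal \<bar>(v (t0 + s) x)\<^sup>2\<bar> \<le> ennreal (\<kappa> / sqrt s) * (trunc_cube R x * ennreal \<bar>v (t0 + s) x\<bar>)"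
     using mult_left_mono[of _ _ "trunc_cube R x"] by (simp add: mult.left_commute)
   qed
   also have "\<dots> = ennreal (\<kappa> / sqrt s) * (NI x. trunc_cube R x * ennreal \<bar>v (t0 + s) x\<bar>)"
    by (rule nn_integral_cmult) simp
   also have "\<dots> \<le> ennreal (\<kappa> / sqrt s) * ennreal B" by (intro mult_left_mono hyp sL) auto
   also have "\<dots> = ennreal (\<kappa> / sqrt s * B)" using \<kappa> s B by (intro ennreal_mult[symmetric]) auto
   finally show ?thesis .
  qed
  have "(NI x. trunc_cube R x * ennreal \<bar>?F s x\<bar>)
   \<le> ennreal (4 * (mc 4 * norm a * (r - s) * (A * (\<kappa> / sqrt s)) + kc * norm a / sqrt (r - s) * (\<kappa> / sqrt s * B)))"
   by (rule trunc_cube_conv[OF _ _ R trunc_cube_gK nL_gK _ _ f3 f]) (use s \<kappa> A B kc_pos in \<open>auto simp: less_imp_le\<close>)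
  also have "\<dots> \<le> ennreal (?\<beta> s)"
  proof (rule ennreal_leI)
   have "mc 4 * norm a * (r - s) * (A * (\<kappa> / sqrt s)) \<le> mc 4 * norm a * L * (A * (\<kappa> / sqrt s))"
    using s r0 A \<kappa> by (intro mult_right_mono mult_left_mono) (auto simp: less_imp_le)
   then have "4 * (mc 4 * norm a * (r - s) * (A * (\<kappa> / sqrt s)) + kc * norm a / sqrt (r - s) * (\<kappa> / sqrt s * B))
    \<le> 4 * (mc 4 * norm a * L * (A * (\<kappa> / sqrt s)) + kc * norm a / sqrt (r - s) * (\<kappa> / sqrt s * B))" by simp
   also have "\<dots> = ?\<beta> s" by (simp add: k_def algebra_simps)
   finally show "4 * (mc 4 * norm a * (r - s) * (A * (\<kappa> / sqrt s)) + kc * norm a / sqrt (r - s) * (\<kappa> / sqrt s * B)) \<le> ?\<beta> s" .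
  qed
  finally show "(NI x. trunc_cube R x * ennreal \<bar>?F s x\<bar>) \<le> ennreal (?\<beta> s)" .
 next
  show "(nT {0<..<r} (\<lambda>s. ?\<beta> s)) \<le> ennreal (4 * (mc 4 * norm a * L * A * \<kappa>) * (2 * sqrt r) + 4 * (k * \<kappa> * B) * 6)"
   using nn_integral_inverse_sqrt[of r] nn_integral_beta_half[of r] r0 k A B \<kappa> L
   by (intro set_nn_integral_add set_nn_integral_cmult) (auto simp: less_imp_le)
 qed auto
 have "(NI x. trunc_cube R x * ennreal \<bar>v (t0 + r) x\<bar>)
   \<le> (NI x. trunc_cube R x * ennreal \<bar>heatS r (v t0) x\<bar> + trunc_cube R x * ennreal \<bar>?I x\<bar>)"
 proof (intro nn_integral_mono)
  fix x
  have "ennreal \<bar>v (t0 + r) x\<bar> \<le> ennreal (\<bar>heatS r (v t0) x\<bar> + \<bar>?I x\<bar>)"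
   unfolding v_mild[OF t0 r0(1)] by (intro ennreal_leI abs_triangle_ineq)
  also have "\<dots> = ennreal \<bar>heatS r (v t0) x\<bar> + ennreal \<bar>?I x\<bar>" by simp
  finally have e: "ennreal \<bar>v (t0 + r) x\<bar> \<le> ennreal \<bar>heatS r (v t0) x\<bar> + ennreal \<bar>?I x\<bar>" .
  show "trunc_cube R x * ennreal \<bar>v (t0 + r) x\<bar> \<le> trunc_cube R x * ennreal \<bar>heatS r (v t0) x\<bar> + trunc_cube R x * ennreal \<bar>?I x\<bar>"
   using mult_left_mono[OF e, of "trunc_cube R x"] by (simp add: distrib_left)
 qed
 also have "\<dots> = (NI x. trunc_cube R x * ennreal \<bar>heatS r (v t0) x\<bar>) + (NI x. trunc_cube R x * ennreal \<bar>?I x\<bar>)"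
  by (rule nn_integral_add) auto
 also have "\<dots> \<le> ennreal (4 * (mc 3 * (r * sqrt r) * A + 1 * m)) + ennreal (4 * (mc 4 * norm a * L * A * \<kappa>) * (2 * sqrt r) + 4 * (k * \<kappa> * B) * 6)"
  by (intro add_mono S I)
 also have "\<dots> = ennreal (4 * (mc 3 * (r * sqrt r) * A + 1 * m) + (4 * (mc 4 * norm a * L * A * \<kappa>) * (2 * sqrt r) + 4 * (k * \<kappa> * B) * 6))"
  using r0 A m k \<kappa> B L by (intro ennreal_plus[symmetric]) (auto simp: less_imp_le intro!: add_nonneg_nonneg mult_nonneg_nonneg)
 also have "\<dots> \<le> ennreal (4 * m + (4 * mc 3 * A + 8 * mc 4 * norm a * \<kappa> * A) * (L * sqrt L) + B / 2)"
 proof (rule ennreal_leI)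
  have "mc 3 * A * (r * sqrt r) \<le> mc 3 * A * (L * sqrt L)"
   using r0 A by (intro mult_left_mono mult_mono) (auto simp: less_imp_le)
  moreover have "mc 4 * norm a * A * \<kappa> * L * sqrt r \<le> mc 4 * norm a * A * \<kappa> * L * sqrt L"
   using r0 A \<kappa> L by (intro mult_left_mono) (auto simp: less_imp_le)
  moreover have "4 * (k * \<kappa> * B) * 6 \<le> B / 2" using mult_right_mono[OF k(2) B] by (simp add: mult_ac)
  ultimately show "4 * (mc 3 * (r * sqrt r) * A + 1 * m) + (4 * (mc 4 * norm a * L * A * \<kappa>) * (2 * sqrt r) + 4 * (k * \<kappa> * B) * 6)
    \<le> 4 * m + (4 * mc 3 * A + 8 * mc 4 * norm a * \<kappa> * A) * (L * sqrt L) + B / 2"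
   by (simp add: algebra_simps)
 qed
 finally show "(NI x. trunc_cube R x * ennreal \<bar>v (t0 + r) x\<bar>) \<le> ennreal (4 * m + (4 * mc 3 * A + 8 * mc 4 * norm a * \<kappa> * A) * (L * sqrt L) + B / 2)" .
qed (use m A \<kappa> L t in \<open>auto simp: less_imp_le intro!: add_nonneg_nonneg mult_nonneg_nonneg\<close>)


lemma global_decay:
 "\<exists>t0\<ge>1. \<exists>\<kappa>>0. 48 * (kc * norm a) * \<kappa> \<le> 1 \<and> (\<forall>s>0. \<forall>x. \<bar>v (t0 + s) x\<bar> \<le> \<kappa> / sqrt s) \<and>
   (\<exists>C\<ge>0. \<forall>t\<ge>0. nL (v t) \<le> ennreal C \<and> (\<forall>x. \<bar>v t x\<bar> \<le> C / (1 + t)\<^sup>2))"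
proof -
 define k where "k = kc * norm a"
 have k: "0 \<le> k" using kc_pos by (simp add: k_def less_imp_le)
 define \<kappa> where "\<kappa> = 1 / (48 * (k + 1))"
 have \<kappa>: "0 < \<kappa>" "48 * (kc * norm a) * \<kappa> \<le> 1" using k by (auto simp: \<kappa>_def k_def[symmetric] field_simps)
 then have "16 * (kc * norm a) * \<kappa> \<le> 1" using k by (simp add: k_def)
 then obtain t0 where t0: "t0 \<ge> 1" and small: "\<And>s x. s > 0 \<Longrightarrow> \<bar>v (t0 + s) x\<bar> \<le> \<kappa> / sqrt s"
  using critical_decay[OF \<kappa>(1)] by blast
 obtain C1 where C1: "0 \<le> C1" "\<And>t. t \<in> {0..t0 + 1} \<Longrightarrow> nL (v t) \<le> ennreal C1" "\<And>t x. t \<in> {0..t0 + 1} \<Longrightarrow> \<bar>v t x\<bar> \<le> C1"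
  using v_local[of "t0 + 1"] t0 by auto
 have A: "nL (v (t0 + s)) \<le> ennreal (2 * C1)" if "s \<ge> 0" for s
 proof (cases "s = 0")
  case True
  have "nL (v t0) \<le> ennreal C1" using C1 t0 by auto
  also have "\<dots> \<le> ennreal (2 * C1)" using C1 by (intro ennreal_leI) auto
  finally show ?thesis using True by simp
 next
  case False
  then show ?thesis using nL_decay[OF _ \<kappa> small, of C1 s] C1 t0 that by auto
 qed
 have S: "\<bar>v (t0 + s) x\<bar> * s\<^sup>2 \<le> 8 * C1" if "s > 0" for s x
  using sup_decay[OF _ \<kappa> small A, of s x] C1 t0 that by auto
 define C where "C = 8 * C1 * (2 + t0)\<^sup>2"
 have C: "0 \<le> C" using C1 by (simp add: C_def)
 have "1 \<le> (2 + t0)\<^sup>2" using t0 by (intro one_le_power) auto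
 then have "8 * C1 * 1 \<le> C" unfolding C_def using C1 by (intro mult_left_mono) auto
 then have CC: "2 * C1 \<le> C" using C1 by linarith
 have "nL (v t) \<le> ennreal C" if "0 \<le> t" for t
 proof (cases "t \<le> t0")
  case True
  have "nL (v t) \<le> ennreal C1" using C1 t0 that True by auto
  also have "\<dots> \<le> ennreal C" using C1 CC by (intro ennreal_leI) auto
  finally show ?thesis .
 next
  case False
  have "nL (v t) \<le> ennreal (2 * C1)" using A[of "t - t0"] False by simp
  also have "\<dots> \<le> ennreal C" using CC by (intro ennreal_leI) auto
  finally show ?thesis .
 qed
 moreover have "\<bar>v t x\<bar> \<le> C / (1 + t)\<^sup>2" if "0 \<le> t" for t x
 proof (cases "t \<le> t0 + 1")
  case True
  have "\<bar>v t x\<bar> * (1 + t)\<^sup>2 \<le> C1 * (2 + t0)\<^sup>2"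
   using True that C1 t0 by (intro mult_mono power_mono) auto
  also have "\<dots> \<le> C" using C1 by (simp add: C_def)
  finally show ?thesis using that by (simp add: field_simps)
 next
  case False
  define s where "s = t - t0"
  have s: "1 \<le> s" "t = t0 + s" using False by (auto simp: s_def)
  have "1 + t \<le> (2 + t0) * s"
   using mult_left_mono[OF s(1), of "1 + t0"] t0 s by (simp add: algebra_simps)
  then have "(1 + t)\<^sup>2 \<le> ((2 + t0) * s)\<^sup>2" using that by (intro power_mono) auto
  then have "\<bar>v t x\<bar> * (1 + t)\<^sup>2 \<le> \<bar>v t x\<bar> * ((2 + t0) * s)\<^sup>2" by (intro mult_left_mono) auto
  also have "\<dots> = \<bar>v (t0 + s) x\<bar> * s\<^sup>2 * (2 + t0)\<^sup>2" by (simp add: s(2) power_mult_distrib mult_ac)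
  also have "\<dots> \<le> 8 * C1 * (2 + t0)\<^sup>2" by (intro mult_right_mono S) (use s in auto)
  finally show ?thesis using that by (simp add: C_def field_simps)
 qed
 ultimately show ?thesis using t0 \<kappa> small C by blast
qed

text \<open>Before t0 the solution need not be small, but a bounded solution satisfies the decay
  hypothesis of \<open>moment_step\<close> on any short enough interval. Finitely many short steps
  reach t0 with some finite moment. From t0 on, a single application over the whole remaining time
  gives the growth t^(3/2); iterating would lose a factor at each step.\<close>

lemma global_bounds:
 assumes mom: "(NI x. ennreal (norm x ^ 3) * ennreal \<bar>v 0 x\<bar>) < \<infinity>"
 shows "\<exists>C\<ge>0. \<forall>t\<ge>0. nL (v t) \<le> ennreal C \<and> (\<forall>x. \<bar>v t x\<bar> \<le> C / (1 + t)\<^sup>2)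
   \<and> (NI x. ennreal (norm x ^ 3) * ennreal \<bar>v t x\<bar>) \<le> ennreal (C * ((1 + t) * sqrt (1 + t)))"
proof -
 obtain t0 \<kappa> C where t0: "t0 \<ge> 1" and \<kappa>: "\<kappa> > 0" "48 * (kc * norm a) * \<kappa> \<le> 1"
  and small: "\<And>s x. s > 0 \<Longrightarrow> \<bar>v (t0 + s) x\<bar> \<le> \<kappa> / sqrt s"
  and C: "0 \<le> C" "\<And>t. t \<ge> 0 \<Longrightarrow> nL (v t) \<le> ennreal C" "\<And>t x. t \<ge> 0 \<Longrightarrow> \<bar>v t x\<bar> \<le> C / (1 + t)\<^sup>2"
  using global_decay by blast
 define MR where "MR R t = (NI x. trunc_cube R x * ennreal \<bar>v t x\<bar>)" for R t
 define D where "D = 4 * mc 3 * C + 8 * mc 4 * norm a * \<kappa> * C"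
 have D: "0 \<le> D" using C \<kappa> by (auto simp: D_def less_imp_le)
 obtain M0 where M0: "0 \<le> M0" "(NI x. ennreal (norm x ^ 3) * ennreal \<bar>v 0 x\<bar>) = ennreal M0"
  using mom by (cases "(NI x. ennreal (norm x ^ 3) * ennreal \<bar>v 0 x\<bar>)") auto
 have init: "MR R 0 \<le> ennreal M0" for R
  unfolding M0(2)[symmetric] MR_def trunc_cube_def by (intro nn_integral_mono mult_right_mono ennreal_leI) auto
 have Cs: "\<bar>v t x\<bar> \<le> C" if "t \<ge> 0" for t x
 proof -
  have "1 \<le> (1 + t)\<^sup>2" using that by (intro one_le_power) auto
  then have "C / (1 + t)\<^sup>2 \<le> C / 1" using C by (intro divide_left_mono) auto
  with C(3)[OF that, of x] show ?thesis by simp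
 qed
 \<comment> \<open>Chosen so that C \<le> \<kappa>/sqrt s for all s \<le> \<eta>, uniformly in the
   starting time.\<close>
 define \<eta> where "\<eta> = (\<kappa> / (C + 1))\<^sup>2"
 have \<eta>: "0 < \<eta>" using \<kappa> C by (simp add: \<eta>_def add_nonneg_pos)
 have \<eta>small: "\<bar>v (\<tau> + s) x\<bar> \<le> \<kappa> / sqrt s" if "0 \<le> \<tau>" "s \<in> {0<..\<eta>}" for \<tau> s x
 proof -
  have "sqrt s \<le> sqrt \<eta>" using that by simp
  also have "\<dots> = \<kappa> / (C + 1)" using \<kappa> C by (simp add: \<eta>_def)
  finally have "(C + 1) * sqrt s \<le> \<kappa>" using C by (simp add: field_simps)
  moreover have "\<bar>v (\<tau> + s) x\<bar> * sqrt s \<le> (C + 1) * sqrt s"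
   using Cs[of "\<tau> + s" x] that by (intro mult_right_mono) auto
  ultimately show ?thesis using that by (simp add: field_simps)
 qed
 have loc: "\<exists>m\<ge>0. \<forall>R>0. \<forall>t\<ge>0. t \<le> real n * \<eta> \<longrightarrow> MR R t \<le> ennreal m" for n
 proof (induction n)
  case 0
  then show ?case using init M0 by (intro exI[of _ M0]) auto
 next
  case (Suc n)
  then obtain m where m: "0 \<le> m" "\<And>R t. R > 0 \<Longrightarrow> t \<ge> 0 \<Longrightarrow> t \<le> real n * \<eta> \<Longrightarrow> MR R t \<le> ennreal m" by blast
  define m' where "m' = m + 2 * (4 * m + D * (\<eta> * sqrt \<eta>))"
  have m': "m \<le> m'" "2 * (4 * m + D * (\<eta> * sqrt \<eta>)) \<le> m'" using m D \<eta> by (auto simp: m'_def)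
  have "MR R t \<le> ennreal m'" if "R > 0" "t \<ge> 0" "t \<le> real (Suc n) * \<eta>" for R t
  proof (cases "t \<le> real n * \<eta>")
   case True
   then show ?thesis using m(2)[of R t] that m'(1) by (meson ennreal_leI order_trans)
  next
   case False
   define s where "s = t - real n * \<eta>"
   have s: "s \<in> {0<..\<eta>}" "t = real n * \<eta> + s" using False that by (auto simp: s_def algebra_simps)
   have n: "0 \<le> real n * \<eta>" using \<eta> by simp
   have "MR R (real n * \<eta> + s) \<le> ennreal (2 * (4 * m + D * (\<eta> * sqrt \<eta>)))"
    unfolding MR_def D_def
    by (rule moment_step[OF that(1) n \<eta> \<kappa> \<eta>small[OF n] C(2) C(1) _ m(1) s(1)])
      (use m(2)[OF that(1) n] in \<open>auto simp: MR_def\<close>)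
   also have "\<dots> \<le> ennreal m'" using m' by (intro ennreal_leI)
   finally show ?thesis using s by simp
  qed
  then show ?case using m m'(1) by (intro exI[of _ m']) auto
 qed
 obtain n :: nat where "t0 / \<eta> \<le> real n" using real_arch_simple by blast
 then have n: "t0 \<le> real n * \<eta>" using \<eta> by (simp add: field_simps)
 obtain m where m: "0 \<le> m" "\<And>R t. R > 0 \<Longrightarrow> t \<ge> 0 \<Longrightarrow> t \<le> real n * \<eta> \<Longrightarrow> MR R t \<le> ennreal m" using loc[of n] by blast
 define C' where "C' = C + 8 * m + 2 * D"
 have C': "C \<le> C'" "0 \<le> C'" using m D C by (auto simp: C'_def)
 have MR: "MR R t \<le> ennreal (C' * ((1 + t) * sqrt (1 + t)))" if "R > 0" "t \<ge> 0" for R t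
 proof -
  have one: "1 \<le> (1 + t) * sqrt (1 + t)" using that mult_mono[of 1 "1 + t" 1 "sqrt (1 + t)"] by simp
  show ?thesis
  proof (cases "t \<le> t0")
   case True
   have "MR R t \<le> ennreal m" by (rule m(2)) (use that True n in auto)
   also have "\<dots> \<le> ennreal (C' * ((1 + t) * sqrt (1 + t)))"
   proof (rule ennreal_leI)
    have "m \<le> C' * 1" using C D m by (simp add: C'_def)
    also have "\<dots> \<le> C' * ((1 + t) * sqrt (1 + t))" by (intro mult_left_mono one C')
    finally show "m \<le> C' * ((1 + t) * sqrt (1 + t))" .
   qed
   finally show ?thesis .
  next
   case False
   define L where "L = t - t0"
   have L: "0 < L" "t = t0 + L" "L \<le> 1 + t" using False t0 by (auto simp: L_def)
   have "MR R (t0 + L) \<le> ennreal (2 * (4 * m + D * (L * sqrt L)))"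
    unfolding MR_def D_def
    by (rule moment_step[OF that(1) _ L(1) \<kappa> small C(2) C(1) _ m(1)])
      (use m(2)[OF that(1), of t0] n t0 L in \<open>auto simp: MR_def\<close>)
   also have "\<dots> \<le> ennreal (C' * ((1 + t) * sqrt (1 + t)))"
   proof (rule ennreal_leI)
    have "L * sqrt L \<le> (1 + t) * sqrt (1 + t)" using L by (intro mult_mono) auto
    then have 1: "D * (L * sqrt L) \<le> D * ((1 + t) * sqrt (1 + t))" using D by (rule mult_left_mono)
    have 2: "m \<le> m * ((1 + t) * sqrt (1 + t))" "0 \<le> C * ((1 + t) * sqrt (1 + t))"
     using mult_left_mono[OF one m(1)] C that by auto
    have aux: "2 * (4 * m + z) \<le> (C + 8 * m + 2 * D) * y" if "z \<le> D * y" "m \<le> m * y" "0 \<le> C * y" for y z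
    proof -
     have e: "(C + 8 * m + 2 * D) * y = C * y + 8 * (m * y) + 2 * (D * y)" by (simp add: algebra_simps)
     show ?thesis unfolding e using that by simp
    qed
    show "2 * (4 * m + D * (L * sqrt L)) \<le> C' * ((1 + t) * sqrt (1 + t))"
     unfolding C'_def by (rule aux[OF 1 2])
   qed
   finally show ?thesis using L by simp
  qed
 qed
 have "(NI x. ennreal (norm x ^ 3) * ennreal \<bar>v t x\<bar>) \<le> ennreal (C' * ((1 + t) * sqrt (1 + t)))" if "t \<ge> 0" for t
 proof -
  \<comment> \<open>At each point the truncation is inactive for large n, so monotone convergence
    removes it.\<close>
  have "(NI x. ennreal (norm x ^ 3) * ennreal \<bar>v t x\<bar>) \<le> (NI x. (SUP n::nat. trunc_cube (real (Suc n)) x * ennreal \<bar>v t x\<bar>))"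
  proof (intro nn_integral_mono)
   fix x :: "real^4"
   obtain n :: nat where "norm x ^ 3 \<le> real n" using real_arch_simple by blast
   then have "trunc_cube (real (Suc n)) x = ennreal (norm x ^ 3)" by (simp add: trunc_cube_def min_def)
   then show "ennreal (norm x ^ 3) * ennreal \<bar>v t x\<bar> \<le> (SUP n::nat. trunc_cube (real (Suc n)) x * ennreal \<bar>v t x\<bar>)"
    by (intro SUP_upper2[of n]) auto
  qed
  also have "\<dots> = (SUP n::nat. NI x. trunc_cube (real (Suc n)) x * ennreal \<bar>v t x\<bar>)"
   by (rule nn_integral_monotone_convergence_SUP)
     (auto simp: incseq_def le_fun_def trunc_cube_def intro!: mult_right_mono ennreal_leI)
  also have "\<dots> \<le> ennreal (C' * ((1 + t) * sqrt (1 + t)))"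
   using MR[OF _ that] by (intro SUP_least) (auto simp: MR_def)
  finally show ?thesis .
 qed
 moreover have "nL (v t) \<le> ennreal C'" if "t \<ge> 0" for t
  using C(2)[OF that] C'(1) by (meson ennreal_leI order_trans)
 moreover have "\<bar>v t x\<bar> \<le> C' / (1 + t)\<^sup>2" if "t \<ge> 0" for t x
  using C(3)[OF that, of x] divide_right_mono[OF C'(1), of "(1 + t)\<^sup>2"] by simp
 ultimately show ?thesis using C'(2) by blast
qed

end

section \<open>Taylor expansion of the kernel\<close>

text \<open>The square of a Gaussian is a Gaussian at half the time: (2 pi s)^2 / (4 pi s)^4 = 1/(64
  pi^2 s^2). Every constant in the logarithmic term comes from here.\<close>

lemma heatG_square:
 assumes "s > 0"
 shows "(heatG s x)\<^sup>2 = heatG (s / 2) x / (64 * pi\<^sup>2 * s\<^sup>2)"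
proof -
 have "(exp (- (x \<bullet> x) / (4 * s)))\<^sup>2 = exp (- (x \<bullet> x) / (4 * (s / 2)))"
  by (simp add: exp_double[symmetric] del: dot_square_norm) 
 then show ?thesis using assms by (simp add: heatG_eq power_divide power2_eq_square del: dot_square_norm)
qed

lemma integral_heatG_square:
 assumes "s > 0"
 shows "(LI x. (heatG s x)\<^sup>2) = 1 / (64 * pi\<^sup>2 * s\<^sup>2)" "integrable lborel (\<lambda>x. (heatG s x)\<^sup>2)"
 using assms by (simp_all add: heatG_square)

lemma integrable_heatG_second_moment:
 assumes t: "t > 0"
 shows "integrable lborel (\<lambda>x. (b \<bullet> x) * (c \<bullet> x) * heatG t x)"
proof (rule Bochner_Integration.integrable_bound[of _ "\<lambda>x. norm b * norm c * (mc 2 * (sqrt t)\<^sup>2) * heatG (2 * t) x"])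
 show "AE x in lborel. norm ((b \<bullet> x) * (c \<bullet> x) * heatG t x) \<le> norm (norm b * norm c * (mc 2 * (sqrt t)\<^sup>2) * heatG (2 * t) x)"
 proof (intro AE_I2)
  fix x
  have "\<bar>b \<bullet> x\<bar> * \<bar>c \<bullet> x\<bar> * heatG t x \<le> (norm b * norm x) * (norm c * norm x) * heatG t x"
   by (intro mult_right_mono mult_mono abs_inner_le) auto
  also have "\<dots> = norm b * norm c * (norm x ^ 2 * heatG t x)" by (simp add: power2_eq_square)
  also have "\<dots> \<le> norm b * norm c * (mc 2 * sqrt t ^ 2 * heatG (2 * t) x)" by (intro mult_left_mono heatG_moment t) auto
  finally show "norm ((b \<bullet> x) * (c \<bullet> x) * heatG t x) \<le> norm (norm b * norm c * (mc 2 * (sqrt t)\<^sup>2) * heatG (2 * t) x)"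
   using t by (simp add: abs_mult less_imp_le mult.assoc)
 qed
qed (use t in auto)

text \<open>\<open>hG\<close> is a derivative of \<open>gK\<close>, hence integrates to zero.
  Expanding \<open>hG\<close> leaves the second moment and the known mass.\<close>

lemma integral_heatG_second_moment:
 assumes t: "t > 0"
 shows "(LI x. (b \<bullet> x) * (c \<bullet> x) * heatG t x) = 2 * t * (b \<bullet> c)"
proof -
 have e: "hG b c t x = 1 / (4 * t\<^sup>2) * ((b \<bullet> x) * (c \<bullet> x) * heatG t x) - (b \<bullet> c) / (2 * t) * heatG t x" for x
  by (simp add: hG_def algebra_simps)
 have i: "integrable lborel (hG b c t)"
  unfolding e using integrable_heatG_second_moment[OF t] t by (intro Bochner_Integration.integrable_diff integrable_mult_right) auto
 have "(LI x. hG b c t x) = 0"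
 proof (rule integral_directional_derivative_zero[where \<phi> = "gK b t" and b = c])
  fix x
  show "((\<lambda>\<theta>. gK b t (x + \<theta> *\<^sub>R c)) has_real_derivative hG b c t x) (at 0)"
   using DERIV_gK_line[OF t, of b x c 0] by simp
  show "continuous_on UNIV (hG b c t)"
   unfolding hG_def heatG_eq[OF t] using t by (intro continuous_intros) auto
 qed (use i t in auto)
 then have "1 / (4 * t\<^sup>2) * (LI x. (b \<bullet> x) * (c \<bullet> x) * heatG t x) - (b \<bullet> c) / (2 * t) = 0"
  unfolding e using integrable_heatG_second_moment[OF t, of b c] t by simp
 then show ?thesis using t by (simp add: field_simps power2_eq_square)
qed

lemma hG_minus [simp]: "hG a (- y) t x = - hG a y t x"
 by (simp add: hG_def algebra_simps)

lemma hG_minus_left [simp]: "hG (- y) c t x = - hG y c t x"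
 by (simp add: hG_def algebra_simps)

lemma gK_minus_left [simp]: "gK (- y) t x = - gK y t x"
 by (simp add: gK_def)

lemma tG_minus_minus [simp]: "tG a (- y) (- y) t x = tG a y y t x"
 by (simp add: tG_def)

lemma taylor_heatG:
 fixes y :: "real^4"
 assumes t: "t > 0"
 defines "r \<equiv> \<lambda>x. heatG t (x - y) - heatG t x + gK y t x - hG y y t x / 2"
 shows "nL r \<le> ennreal (kc * norm y ^ 3 / sqrt t ^ 3)" "\<bar>r x\<bar> \<le> kc * norm y ^ 3 / sqrt t ^ 3 / t\<^sup>2"
proof -
 let ?A = "kc * norm y ^ 3 / sqrt t ^ 3"
 have A: "0 \<le> ?A" using t kc_pos by (simp add: less_imp_le)
 have b: "ennreal \<bar>r x\<bar> \<le> (nT {0..1} (\<lambda>\<theta>. ?A * heatG (2 * t) (x + \<theta> *\<^sub>R - y)))" for x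
 proof -
  have "ennreal \<bar>heatG t (x + 1 *\<^sub>R - y) - heatG t (x + 0 *\<^sub>R - y) - gK (- y) t (x + 0 *\<^sub>R - y) - hG (- y) (- y) t (x + 0 *\<^sub>R - y) / 2\<bar>
   \<le> (nT {0..1} (\<lambda>\<theta>. ?A * heatG (2 * t) (x + \<theta> *\<^sub>R - y)))"
  proof (rule taylor3_integral_bound[OF DERIV_heatG_line[OF t] DERIV_gK_line[OF t] DERIV_hG_line[OF t]])
   show "\<bar>tG (- y) (- y) (- y) t (x + \<theta> *\<^sub>R - y)\<bar> \<le> ?A * heatG (2 * t) (x + \<theta> *\<^sub>R - y)" for \<theta>
    using tG_bound[OF t, of "- y" "- y" "- y" "x + \<theta> *\<^sub>R - y"] by (simp add: power3_eq_cube)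
   show "continuous_on UNIV (\<lambda>\<theta>. ?A * heatG (2 * t) (x + \<theta> *\<^sub>R - y))"
    by (rule continuous_heatG_line) (use t in auto)
  qed
  then show ?thesis by (simp add: r_def)
 qed
 have m: "r \<in> borel_measurable borel" unfolding r_def by measurable
 have t2: "2 * t > 0" using t by simp
 show "nL r \<le> ennreal ?A" by (rule nL_line_bound(1)[OF t2 A m b])
 have "\<bar>r x\<bar> \<le> ?A / (2 * t)\<^sup>2" by (rule nL_line_bound(2)[OF t2 A m b])
 also have "\<dots> \<le> ?A / t\<^sup>2" using A t by (intro divide_left_mono power_mono) auto
 finally show "\<bar>r x\<bar> \<le> ?A / t\<^sup>2" .
qed

lemma taylor_gK:
 fixes a y :: "real^4"
 assumes t: "t > 0"
 defines "r \<equiv> \<lambda>x. gK a t (x - y) - gK a t x + hG a y t x - tG a y y t x / 2"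
 shows "nL r \<le> ennreal (kc * (norm a * norm y ^ 3) / t\<^sup>2)" "\<bar>r x\<bar> \<le> kc * (norm a * norm y ^ 3) / t\<^sup>2 / (2 * t)\<^sup>2"
proof -
 let ?A = "kc * (norm a * norm y ^ 3) / t\<^sup>2"
 have A: "0 \<le> ?A" using t kc_pos by (simp add: less_imp_le)
 have t4: "sqrt t ^ 4 = t\<^sup>2" using t power_mult[of "sqrt t" 2 2] by simp
 have b: "ennreal \<bar>r x\<bar> \<le> (nT {0..1} (\<lambda>\<theta>. ?A * heatG (2 * t) (x + \<theta> *\<^sub>R - y)))" for x
 proof -
  have "ennreal \<bar>gK a t (x + 1 *\<^sub>R - y) - gK a t (x + 0 *\<^sub>R - y) - hG a (- y) t (x + 0 *\<^sub>R - y) - tG a (- y) (- y) t (x + 0 *\<^sub>R - y) / 2\<bar>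
   \<le> (nT {0..1} (\<lambda>\<theta>. ?A * heatG (2 * t) (x + \<theta> *\<^sub>R - y)))"
  proof (rule taylor3_integral_bound[OF DERIV_gK_line[OF t] DERIV_hG_line[OF t] DERIV_tG_line[OF t]])
   show "\<bar>qG a (- y) t (x + \<theta> *\<^sub>R - y)\<bar> \<le> ?A * heatG (2 * t) (x + \<theta> *\<^sub>R - y)" for \<theta>
    using qG_bound[OF t, of a "- y" "x + \<theta> *\<^sub>R - y"] by (simp add: t4)
   show "continuous_on UNIV (\<lambda>\<theta>. ?A * heatG (2 * t) (x + \<theta> *\<^sub>R - y))"
    by (rule continuous_heatG_line) (use t in auto)
  qed
  then show ?thesis by (simp add: r_def)
 qed
 have m: "r \<in> borel_measurable borel" unfolding r_def by measurable
 have t2: "2 * t > 0" using t by simp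
 show "nL r \<le> ennreal ?A" by (rule nL_line_bound(1)[OF t2 A m b])
 show "\<bar>r x\<bar> \<le> ?A / (2 * t)\<^sup>2" by (rule nL_line_bound(2)[OF t2 A m b])
qed

section \<open>Expansion of the kernel in time\<close>

lemma second_order_bound_interval:
 fixes \<phi> p' p'' :: "real \<Rightarrow> real"
 assumes "0 \<le> s" and d: "\<And>\<theta>. \<theta> \<in> {0..s} \<Longrightarrow> (\<phi> has_real_derivative p' \<theta>) (at \<theta>)" "\<And>\<theta>. \<theta> \<in> {0..s} \<Longrightarrow> (p' has_real_derivative p'' \<theta>) (at \<theta>)"
  and b: "\<And>\<theta>. \<theta> \<in> {0..s} \<Longrightarrow> \<bar>p'' \<theta>\<bar> \<le> M"
 shows "\<bar>\<phi> s - \<phi> 0 - s * p' 0\<bar> \<le> M * s\<^sup>2"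
proof -
 have M: "0 \<le> M" using b[of 0] assms(1) by auto
 have 1: "\<bar>p' \<theta> - p' 0\<bar> \<le> M * s" if "\<theta> \<in> {0..s}" for \<theta>
 proof -
  have "\<bar>p' \<theta> - p' 0\<bar> \<le> M * \<bar>\<theta> - 0\<bar>"
   using field_differentiable_bound[of "{0..s}" p' p'' M \<theta> 0] d(2) b that assms(1) by (auto intro: DERIV_subset)
  also have "\<dots> \<le> M * s" using that M by (intro mult_left_mono) auto
  finally show ?thesis .
 qed
 have "\<bar>(\<phi> s - s * p' 0) - (\<phi> 0 - 0 * p' 0)\<bar> \<le> (M * s) * \<bar>s - 0\<bar>"
 proof (rule field_differentiable_bound[where S = "{0..s}" and f' = "\<lambda>\<theta>. p' \<theta> - p' 0", simplified real_norm_def])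
  fix z assume z: "z \<in> {0..s}"
  show "((\<lambda>\<theta>. \<phi> \<theta> - \<theta> * p' 0) has_real_derivative p' z - p' 0) (at z within {0..s})"
   by (rule DERIV_subset[OF _ subset_UNIV]) (use z in \<open>auto intro!: derivative_eq_intros d\<close>)
  show "\<bar>p' z - p' 0\<bar> \<le> M * s" by (rule 1[OF z])
 qed (use assms(1) in auto)
 then show ?thesis using assms(1) by (simp add: power2_eq_square mult.assoc)
qed

lemma first_order_bound_interval:
 fixes \<phi> p' :: "real \<Rightarrow> real"
 assumes "0 \<le> s" and d: "\<And>\<theta>. \<theta> \<in> {0..s} \<Longrightarrow> (\<phi> has_real_derivative p' \<theta>) (at \<theta>)"
  and b: "\<And>\<theta>. \<theta> \<in> {0..s} \<Longrightarrow> \<bar>p' \<theta>\<bar> \<le> M"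
 shows "\<bar>\<phi> s - \<phi> 0\<bar> \<le> M * s"
 using field_differentiable_bound[of "{0..s}" \<phi> p' M s 0] d b assms(1) by (auto intro: DERIV_subset)

lemma DERIV_reflect_time:
 fixes f :: "real \<Rightarrow> real"
 assumes "(f has_real_derivative D) (at (t - \<theta>))"
 shows "((\<lambda>\<theta>. f (t - \<theta>)) has_real_derivative - D) (at \<theta>)"
proof -
 have "((\<lambda>\<theta>. t - \<theta>) has_real_derivative - 1) (at \<theta>)" by (auto intro!: derivative_eq_intros)
 from DERIV_chain2[OF assms this] show ?thesis by simp
qed

text \<open>Replaces a time in [t/2, t] by t in all kernel bounds: 24 = 6 * 4, with 6 for the power
  of sqrt t, since 2^(5/2) \<le> 6, and 4 from \<open>heatG_half_le\<close>.\<close>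

lemma gauss_scale_bound:
 assumes t: "0 < t" "t / 2 \<le> \<tau>" "\<tau> \<le> t" and "\<bar>e\<bar> \<le> kc * N / sqrt \<tau> ^ m * heatG (2 * \<tau>) x" "m \<le> 5" "0 \<le> N"
 shows "\<bar>e\<bar> \<le> 24 * kc * N / sqrt t ^ m * heatG (2 * t) x"
proof -
 have sq2: "sqrt 2 \<le> 1.5" by (rule real_le_lsqrt) (auto simp: power2_eq_square)
 have "sqrt 2 ^ m \<le> sqrt 2 ^ 5" using assms(5) by (intro power_increasing) auto
 also have "\<dots> = 4 * sqrt 2" by (simp add: eval_nat_numeral)
 finally have s6: "sqrt 2 ^ m \<le> 6" using sq2 by linarith
 have "sqrt t / sqrt 2 \<le> sqrt \<tau>" using t by (simp add: real_sqrt_divide[symmetric])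
 then have "(sqrt t / sqrt 2) ^ m \<le> sqrt \<tau> ^ m" using t by (intro power_mono) auto
 moreover have "sqrt t ^ m / 6 \<le> (sqrt t / sqrt 2) ^ m"
  unfolding power_divide using t s6 by (intro divide_left_mono) auto
 ultimately have le: "sqrt t ^ m / 6 \<le> sqrt \<tau> ^ m" by linarith
 have p: "0 < sqrt t ^ m" "0 < sqrt \<tau> ^ m" using t by auto
 have "\<bar>e\<bar> \<le> kc * N / sqrt \<tau> ^ m * heatG (2 * \<tau>) x" by fact
 also have "\<dots> \<le> kc * N / (sqrt t ^ m / 6) * (4 * heatG (2 * t) x)"
  using le p kc_pos assms(6) by (intro mult_mono divide_left_mono heatG_half_le[OF t]) (auto simp: less_imp_le)
 finally show ?thesis by simp
qed

text \<open>One summand for each truncated expansion: third order in y of \<open>gK\<close>, second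
  order in s of \<open>gK\<close>, and first order in s of the coefficients \<open>hG\<close> and
  \<open>tG\<close>.\<close>

definition rem_size :: "real \<Rightarrow> real \<Rightarrow> real^4 \<Rightarrow> real" where
 "rem_size t s y = norm y ^ 3 / sqrt t ^ 4 + s\<^sup>2 / sqrt t ^ 5 + norm y * s / sqrt t ^ 4 + norm y ^ 2 * s / sqrt t ^ 5"

text \<open>The parabolic Taylor expansion of the kernel: third order in \<open>y\<close> and second order in \<open>s\<close>.\<close>

lemma kernel_remainder:
 fixes a y :: "real^4"
 assumes t: "0 < t" and s: "0 \<le> s" "s \<le> t / 2"
 defines "r \<equiv> \<lambda>x. gK a (t - s) (x - y) - gK a t x + hG a y t x + s * lK a t x - tG a y y t x / 2"
 shows "nL r \<le> ennreal (24 * kc * norm a * rem_size t s y)" "\<bar>r x\<bar> \<le> 24 * kc * norm a * rem_size t s y / t\<^sup>2"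
proof -
 define \<tau> where "\<tau> = t - s"
 have \<tau>: "0 < \<tau>" "t / 2 \<le> \<tau>" "\<tau> \<le> t" using t s by (auto simp: \<tau>_def)
 have rng: "t / 2 \<le> t - \<theta>" "t - \<theta> \<le> t" "0 < t - \<theta>" if "\<theta> \<in> {0..s}" for \<theta> using that s t by auto
 let ?q = "sqrt t"
 define N where "N = norm a"
 have N: "0 \<le> N" by (simp add: N_def)
 define A1 where "A1 = 24 * kc * (N * norm y ^ 3) / ?q ^ 4"
 define A2 where "A2 = 24 * kc * N / ?q ^ 5 * s\<^sup>2 + 24 * kc * (N * norm y) / ?q ^ 4 * s + 24 * kc * (N * norm y ^ 2) / ?q ^ 5 * s"
 have A: "0 \<le> A1" "0 \<le> A2" using kc_pos t s by (auto simp: A1_def A2_def N_def less_imp_le)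
 \<comment> \<open>The expansion is done in two stages: in y at the fixed time \<tau> = t - s, and
   then each coefficient is carried from \<tau> to t. No mixed derivatives of the remainder are
   needed.\<close>
 define T3 where "T3 x = gK a \<tau> (x - y) - gK a \<tau> x + hG a y \<tau> x - tG a y y \<tau> x / 2" for x
 define D where "D x = (gK a \<tau> x - gK a t x + s * lK a t x) - (hG a y \<tau> x - hG a y t x) + (tG a y y \<tau> x - tG a y y t x) / 2" for x
 have [measurable]: "T3 \<in> borel_measurable borel" "D \<in> borel_measurable borel" unfolding T3_def D_def by measurable
 have "kc * (N * norm y ^ 3) / \<tau>\<^sup>2 \<le> A1"
 proof -
  have "(t / 2)\<^sup>2 \<le> \<tau>\<^sup>2" using \<tau> t by (intro power_mono) auto
  then have "kc * (N * norm y ^ 3) / \<tau>\<^sup>2 \<le> kc * (N * norm y ^ 3) / (t / 2)\<^sup>2"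
   using kc_pos N t \<tau> by (intro divide_left_mono) (auto simp: less_imp_le)
  also have "\<dots> = 4 * (kc * (N * norm y ^ 3)) / t\<^sup>2" by (simp add: power_divide)
  also have "\<dots> \<le> 24 * (kc * (N * norm y ^ 3)) / t\<^sup>2" using kc_pos N by (intro divide_right_mono mult_right_mono) (auto simp: less_imp_le)
  also have "\<dots> = A1" using t power_mult[of ?q 2 2] by (simp add: A1_def)
  finally show ?thesis .
 qed
 note T3A = this
 have T3: "nL T3 \<le> ennreal A1" "\<bar>T3 x\<bar> \<le> A1 / t\<^sup>2" for x
 proof -
  show "nL T3 \<le> ennreal A1"
   using taylor_gK(1)[OF \<tau>(1), of a y] T3A unfolding T3_def N_def by (meson ennreal_leI order_trans)
  have "\<bar>T3 x\<bar> \<le> kc * (N * norm y ^ 3) / \<tau>\<^sup>2 / (2 * \<tau>)\<^sup>2"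
   unfolding T3_def N_def by (rule taylor_gK(2)[OF \<tau>(1)])
  also have "\<dots> \<le> A1 / (2 * \<tau>)\<^sup>2" by (intro divide_right_mono T3A) auto
  also have "\<dots> \<le> A1 / t\<^sup>2"
   using \<tau> t A by (intro divide_left_mono power_mono) auto
  finally show "\<bar>T3 x\<bar> \<le> A1 / t\<^sup>2" .
 qed
 have Db: "\<bar>D x\<bar> \<le> A2 * heatG (2 * t) x" for x
 proof -
  let ?g = "heatG (2 * t) x"
  have 1: "\<bar>gK a (t - s) x - gK a (t - 0) x - s * - lK a (t - 0) x\<bar> \<le> (24 * kc * N / ?q ^ 5 * ?g) * s\<^sup>2"
  proof (rule second_order_bound_interval[where \<phi> = "\<lambda>\<theta>. gK a (t - \<theta>) x" and p' = "\<lambda>\<theta>. - lK a (t - \<theta>) x" and p'' = "\<lambda>\<theta>. llK a (t - \<theta>) x"])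
   fix \<theta> assume \<theta>: "\<theta> \<in> {0..s}"
   show "((\<lambda>\<theta>. gK a (t - \<theta>) x) has_real_derivative - lK a (t - \<theta>) x) (at \<theta>)"
    by (rule DERIV_reflect_time[OF DERIV_gK_time[OF rng(3)[OF \<theta>]]])
   show "((\<lambda>\<theta>. - lK a (t - \<theta>) x) has_real_derivative llK a (t - \<theta>) x) (at \<theta>)"
    using DERIV_minus[OF DERIV_reflect_time[OF DERIV_lK_time[OF rng(3)[OF \<theta>]]]] by simp
   show "\<bar>llK a (t - \<theta>) x\<bar> \<le> 24 * kc * N / ?q ^ 5 * ?g"
    by (rule gauss_scale_bound[OF t rng(1,2)[OF \<theta>]]) (use llK_bound[OF rng(3)[OF \<theta>]] in \<open>auto simp: N_def\<close>)
  qed (use s in auto)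
  have 2: "\<bar>hG a y (t - s) x - hG a y (t - 0) x\<bar> \<le> (24 * kc * (N * norm y) / ?q ^ 4 * ?g) * s"
  proof (rule first_order_bound_interval[where \<phi> = "\<lambda>\<theta>. hG a y (t - \<theta>) x"])
   fix \<theta> assume \<theta>: "\<theta> \<in> {0..s}"
   show "((\<lambda>\<theta>. hG a y (t - \<theta>) x) has_real_derivative - lhG a y (t - \<theta>) x) (at \<theta>)"
    by (rule DERIV_reflect_time[OF DERIV_hG_time[OF rng(3)[OF \<theta>]]])
   show "\<bar>- lhG a y (t - \<theta>) x\<bar> \<le> 24 * kc * (N * norm y) / ?q ^ 4 * ?g"
    by (rule gauss_scale_bound[OF t rng(1,2)[OF \<theta>]]) (use lhG_bound[OF rng(3)[OF \<theta>]] in \<open>auto simp: N_def\<close>)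
  qed (use s in auto)
  have 3: "\<bar>tG a y y (t - s) x - tG a y y (t - 0) x\<bar> \<le> (24 * kc * (N * norm y ^ 2) / ?q ^ 5 * ?g) * s"
  proof (rule first_order_bound_interval[where \<phi> = "\<lambda>\<theta>. tG a y y (t - \<theta>) x"])
   fix \<theta> assume \<theta>: "\<theta> \<in> {0..s}"
   show "((\<lambda>\<theta>. tG a y y (t - \<theta>) x) has_real_derivative - ltG a y (t - \<theta>) x) (at \<theta>)"
    by (rule DERIV_reflect_time[OF DERIV_tG_time[OF rng(3)[OF \<theta>]]])
   show "\<bar>- ltG a y (t - \<theta>) x\<bar> \<le> 24 * kc * (N * norm y ^ 2) / ?q ^ 5 * ?g"
    by (rule gauss_scale_bound[OF t rng(1,2)[OF \<theta>]]) (use ltG_bound[OF rng(3)[OF \<theta>]] in \<open>auto simp: N_def\<close>)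
  qed (use s in auto)
  have tri: "\<bar>p - q + r / 2\<bar> \<le> e1 + e2 + e3" if "\<bar>p\<bar> \<le> e1" and "\<bar>q\<bar> \<le> e2" and "\<bar>r\<bar> \<le> e3" for p q r e1 e2 e3 :: real
   using that by linarith
  from 1 have 1: "\<bar>gK a \<tau> x - gK a t x + s * lK a t x\<bar> \<le> (24 * kc * N / ?q ^ 5 * ?g) * s\<^sup>2" by (simp add: \<tau>_def)
  have "\<bar>D x\<bar> \<le> (24 * kc * N / ?q ^ 5 * ?g) * s\<^sup>2 + (24 * kc * (N * norm y) / ?q ^ 4 * ?g) * s + (24 * kc * (N * norm y ^ 2) / ?q ^ 5 * ?g) * s"
   unfolding D_def by (rule tri[OF 1]) (use 2 3 in \<open>simp_all add: \<tau>_def\<close>)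
  also have "\<dots> = A2 * ?g" by (simp add: A2_def algebra_simps)
  finally show ?thesis .
 qed
 have r: "r = (\<lambda>x. T3 x + D x)" by (simp add: r_def T3_def D_def \<tau>_def fun_eq_iff diff_divide_distrib)
 have sz: "A1 + A2 = 24 * kc * norm a * rem_size t s y"
  by (simp add: A1_def A2_def N_def rem_size_def algebra_simps)
 have D1: "nL D \<le> ennreal A2" by (rule nL_kernel_bound[OF Db]) (use t A in auto)
 show "nL r \<le> ennreal (24 * kc * norm a * rem_size t s y)"
  unfolding r sz[symmetric] by (rule nL_add[OF _ _ T3(1) D1]) (use A in auto)
 have "\<bar>D x\<bar> \<le> A2 / t\<^sup>2"
 proof -
  have "heatG (2 * t) x \<le> 1 / (2 * t)\<^sup>2" using t by (intro heatG_le) auto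
  also have "\<dots> \<le> 1 / t\<^sup>2" using t by (intro divide_left_mono power_mono) auto
  finally have "A2 * heatG (2 * t) x \<le> A2 * (1 / t\<^sup>2)" using A by (intro mult_left_mono)
  with Db[of x] show ?thesis by simp
 qed
 with T3(2)[of x] have "\<bar>T3 x + D x\<bar> \<le> (A1 + A2) / t\<^sup>2" by (simp add: add_divide_distrib)
 then show "\<bar>r x\<bar> \<le> 24 * kc * norm a * rem_size t s y / t\<^sup>2" unfolding r sz .
qed

lemma nn_integral_powr_tail:
 assumes "1 < p" "0 \<le> A"
 shows "(nT {A..} (\<lambda>s. (1 + s) powr - p)) = ennreal ((1 + A) powr (1 - p) / (p - 1))"
proof -
 have "(NI s. ennreal ((1 + s) powr - p) * indicator {A ..} s) = ennreal (0 - (- ((1 + A) powr (1 - p) / (p - 1))))"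
 proof (rule nn_integral_FTC_atLeast)
  fix s assume "A \<le> s"
  then have "0 < 1 + s" using assms by simp
  then have "((\<lambda>s. (1 + s) powr (1 - p)) has_real_derivative (1 - p) * (1 + s) powr (1 - p - 1)) (at s)"
   by (auto intro!: derivative_eq_intros)
  from DERIV_minus[OF DERIV_cdivide[OF this, of "p - 1"]]
  show "((\<lambda>s. - ((1 + s) powr (1 - p) / (p - 1))) has_real_derivative (1 + s) powr - p) (at s)"
   by (rule DERIV_cong) (use assms in \<open>simp add: field_simps\<close>)
  show "0 \<le> (1 + s) powr - p" by simp
 next
  have "((\<lambda>s. (1 + s) powr (1 - p)) \<longlongrightarrow> 0) at_top"
   by (rule tendsto_neg_powr) (use assms in \<open>auto intro!: filterlim_tendsto_add_at_top filterlim_ident tendsto_const\<close>)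
  then have "((\<lambda>s. - ((1 + s) powr (1 - p) / (p - 1))) \<longlongrightarrow> - (0 / (p - 1))) at_top"
   by (intro tendsto_intros) (use assms in auto)
  then show "((\<lambda>s. - ((1 + s) powr (1 - p) / (p - 1))) \<longlongrightarrow> 0) at_top" by simp
 qed simp
 then show ?thesis by simp
qed

text \<open>Comparing with \<open>c / (1 + s)\<close> instead of \<open>c / s\<close> keeps the integrand regular at the origin.\<close>

lemma log_integral_bound:
 fixes \<phi> :: "real \<Rightarrow> real"
 assumes [measurable]: "\<phi> \<in> borel_measurable borel" and D: "0 \<le> D"
  and \<phi>: "\<And>s. s > 0 \<Longrightarrow> \<bar>\<phi> s - c / (1 + s)\<bar> \<le> D * (1 + s) powr - (7/6)" and t: "t \<ge> 2"
 shows "\<bar>(LINT s:{0<..<t/2}|lborel. \<phi> s) - c * ln t\<bar> \<le> 6 * D + \<bar>c\<bar>" "set_integrable lborel {0<..<t/2} \<phi>"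
proof -
 have nb: "(nT {0<..<t/2} (\<lambda>s. D * (1 + s) powr - (7/6))) \<le> ennreal (D * 6)"
 proof (rule set_nn_integral_cmult)
  \<comment> \<open>The 6 is 1/(7/6 - 1). The rate 7/6 is the one from
    \<open>f_profile_mom2\<close>; what counts is that it exceeds 1.\<close>
  have "(nT {0..} (\<lambda>s. (1 + s) powr - (7/6))) = ennreal 6"
   using nn_integral_powr_tail[of "7/6" 0] by simp
  then have "(nT {0..} (\<lambda>s. (1 + s) powr - (7/6))) \<le> ennreal 6" by simp
  then show "(nT {0<..<t/2} (\<lambda>s. (1 + s) powr - (7/6))) \<le> ennreal 6"
   by (rule set_nn_integral_subset[of _ "{0..}", rotated]) auto
 qed (use D in auto)
 have i1: "set_integrable lborel {0<..<t/2} (\<lambda>s. \<phi> s - c / (1 + s))"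
  by (rule set_integrableI_bounded_by[OF _ _ _ nb]) (use \<phi> in auto)
 have F: "has_bochner_integral lborel (\<lambda>s. indicator {0..t/2} s *\<^sub>R (c / (1 + s))) (c * ln (1 + t/2) - c * ln (1 + 0))"
 proof (rule has_bochner_integral_FTC_Icc)
  fix s assume s: "0 \<le> s" "s \<le> t/2"
  show "((\<lambda>s. c * ln (1 + s)) has_vector_derivative c / (1 + s)) (at s within {0..t/2})"
   unfolding has_real_derivative_iff_has_vector_derivative[symmetric]
   by (rule DERIV_subset[OF _ subset_UNIV]) (use s in \<open>auto intro!: derivative_eq_intros\<close>)
 qed (use t in \<open>auto intro!: continuous_intros\<close>)
 have AEe: "AE s in lborel. indicator {0..t/2} s *\<^sub>R (c / (1 + s)) = indicator {0<..<t/2} s *\<^sub>R (c / (1 + s))"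
  by (rule AE_mp[OF AE_lborel_singleton[of 0]], rule AE_mp[OF AE_lborel_singleton[of "t/2"]]) (auto split: split_indicator)
 have i2: "set_integrable lborel {0<..<t/2} (\<lambda>s. c / (1 + s))"
  unfolding set_integrable_def
  using F integrable_cong_AE[of "\<lambda>s. indicator {0..t/2} s *\<^sub>R (c / (1 + s))" lborel "\<lambda>s. indicator {0<..<t/2} s *\<^sub>R (c / (1 + s))"] AEe
  by (auto simp: has_bochner_integral_iff)
 have e2: "(LINT s:{0<..<t/2}|lborel. c / (1 + s)) = c * ln (1 + t/2)"
 proof -
  have "(LINT s:{0<..<t/2}|lborel. c / (1 + s)) = (LI s. indicator {0..t/2} s *\<^sub>R (c / (1 + s)))"
   unfolding set_lebesgue_integral_def by (rule integral_cong_AE[OF _ _ AEe, symmetric]) auto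
  then show ?thesis using F by (simp add: has_bochner_integral_iff)
 qed
 have "set_integrable lborel {0<..<t/2} (\<lambda>s. (\<phi> s - c / (1 + s)) + c / (1 + s))"
  by (rule set_integral_add(1)[OF i1 i2])
 then show i: "set_integrable lborel {0<..<t/2} \<phi>" by simp
 have "\<bar>LINT s:{0<..<t/2}|lborel. \<phi> s - c / (1 + s)\<bar> \<le> D * 6"
  by (rule abs_set_integral_le[OF _ nb]) (use \<phi> D in auto)
 then have 1: "\<bar>(LINT s:{0<..<t/2}|lborel. \<phi> s) - c * ln (1 + t/2)\<bar> \<le> 6 * D"
  using set_integral_diff(2)[OF i i2] e2 by simp
 have "\<bar>c * ln (1 + t/2) - c * ln t\<bar> \<le> \<bar>c\<bar>"
 proof -
  have "ln (1 + t/2) \<le> ln t" using t by simp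
  moreover have "ln t - ln (1 + t/2) \<le> 1"
  proof -
   have "ln t - ln (1 + t/2) = ln (t / (1 + t/2))" using t by (simp add: ln_div)
   also have "\<dots> \<le> t / (1 + t/2) - 1" using t by (intro ln_le_minus_one) auto
   also have "\<dots> \<le> 1" using t by (simp add: field_simps)
   finally show ?thesis .
  qed
  ultimately have "\<bar>ln (1 + t/2) - ln t\<bar> \<le> 1" by simp
  from mult_left_mono[OF this, of "\<bar>c\<bar>"] show ?thesis by (simp add: abs_mult[symmetric] right_diff_distrib)
 qed
 with 1 show "\<bar>(LINT s:{0<..<t/2}|lborel. \<phi> s) - c * ln t\<bar> \<le> 6 * D + \<bar>c\<bar>" by linarith
qed

section \<open>Asymptotics of the nonlinearity\<close>

text \<open>The two bounds scale like the heat kernel: mass A and height A/t^2. Interpolated, they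
  give A t^(-\<gamma>) in every L^q with \<gamma> = \<open>gamma_q q\<close>, so a remainder has to
  be estimated only once, with A of order t^(-3/2).\<close>

definition heat_small :: "real \<Rightarrow> real \<Rightarrow> (real^4 \<Rightarrow> real) \<Rightarrow> bool" where
 "heat_small t A \<phi> \<longleftrightarrow> \<phi> \<in> borel_measurable borel \<and> nL \<phi> \<le> ennreal A \<and> (\<forall>x. \<bar>\<phi> x\<bar> \<le> A / t\<^sup>2)"

lemma heat_smallD:
 assumes "heat_small t A \<phi>"
 shows "\<phi> \<in> borel_measurable borel" "nL \<phi> \<le> ennreal A" "\<bar>\<phi> x\<bar> \<le> A / t\<^sup>2"
 using assms by (auto simp: heat_small_def)

lemma heat_small_nonneg:
 assumes "heat_small t A \<phi>" "0 < t"
 shows "0 \<le> A"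
proof -
 have "0 \<le> A / t\<^sup>2" using heat_smallD(3)[OF assms(1), of 0] by linarith
 then show ?thesis using assms(2) by (simp add: zero_le_divide_iff)
qed

lemma heat_small_mono:
 assumes "heat_small t A \<phi>" "A \<le> B"
 shows "heat_small t B \<phi>"
proof -
 have "A / t\<^sup>2 \<le> B / t\<^sup>2" using assms by (intro divide_right_mono) auto
 then show ?thesis using assms unfolding heat_small_def by (meson ennreal_leI order_trans)
qed

lemma heat_small_add:
 assumes "heat_small t A \<phi>" "heat_small t B \<psi>" "0 < t"
 shows "heat_small t (A + B) (\<lambda>x. \<phi> x + \<psi> x)"
 unfolding heat_small_def
proof (intro conjI allI)
 note h = heat_smallD[OF assms(1)] heat_smallD[OF assms(2)]
 have [measurable]: "\<phi> \<in> borel_measurable borel" "\<psi> \<in> borel_measurable borel" using h by auto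
 show "(\<lambda>x. \<phi> x + \<psi> x) \<in> borel_measurable borel" by measurable
 show "nL (\<lambda>x. \<phi> x + \<psi> x) \<le> ennreal (A + B)"
  by (rule nL_add[OF h(1,4,2,5) heat_small_nonneg[OF assms(1,3)] heat_small_nonneg[OF assms(2,3)]])
 show "\<bar>\<phi> x + \<psi> x\<bar> \<le> (A + B) / t\<^sup>2" for x
  using h(3)[of x] h(6)[of x] by (simp add: add_divide_distrib)
qed

lemma heat_small_cmult:
 assumes "heat_small t A \<phi>" "\<bar>c\<bar> \<le> B" "0 < t"
 shows "heat_small t (B * A) (\<lambda>x. c * \<phi> x)"
 unfolding heat_small_def
proof (intro conjI allI)
 note h = heat_smallD[OF assms(1)]
 note A = heat_small_nonneg[OF assms(1,3)]
 have [measurable]: "\<phi> \<in> borel_measurable borel" using h by auto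
 show "(\<lambda>x. c * \<phi> x) \<in> borel_measurable borel" by measurable
 show "nL (\<lambda>x. c * \<phi> x) \<le> ennreal (B * A)"
  using nL_mult_bounded[OF h(1,2), of "\<lambda>_. c", OF assms(2) A] by (simp add: mult.commute)
 show "\<bar>c * \<phi> x\<bar> \<le> B * A / t\<^sup>2" for x
  using mult_mono[OF assms(2) h(3)[of x]] assms(2) by (simp add: abs_mult)
qed

lemma heat_small_kernel:
 assumes "\<phi> \<in> borel_measurable borel" and b: "\<And>x. \<bar>\<phi> x\<bar> \<le> A * heatG (2 * t) x" and t: "0 < t" "0 \<le> A"
 shows "heat_small t A \<phi>"
 unfolding heat_small_def
proof (intro conjI allI assms(1))
 show "nL \<phi> \<le> ennreal A" by (rule nL_kernel_bound[OF b]) (use t in auto)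
 fix x
 have "heatG (2 * t) x \<le> 1 / (2 * t)\<^sup>2" using t by (intro heatG_le) auto
 also have "\<dots> \<le> 1 / t\<^sup>2" using t by (intro divide_left_mono power_mono) auto
 finally have "A * heatG (2 * t) x \<le> A * (1 / t\<^sup>2)" using t by (intro mult_left_mono)
 with b[of x] show "\<bar>\<phi> x\<bar> \<le> A / t\<^sup>2" by simp
qed

text \<open>Minkowski's inequality for both norms at once: the size of a superposition of kernels is
  the integral of their sizes, so a moment of \<open>g\<close> becomes a remainder bound.\<close>

lemma heat_small_integral:
 fixes K :: "real^4 \<Rightarrow> real^4 \<Rightarrow> real"
 assumes [measurable]: "case_prod K \<in> borel_measurable (lborel \<Otimes>\<^sub>M lborel)" "g \<in> borel_measurable borel"
  and K: "\<And>y. heat_small t (w y) (K y)" and w: "(NI y. ennreal (w y * \<bar>g y\<bar>)) \<le> ennreal A" and t: "0 < t" "0 \<le> A"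
  and [measurable]: "w \<in> borel_measurable borel"
 shows "heat_small t A (\<lambda>x. LI y. K y x * g y)"
 unfolding heat_small_def
proof (intro conjI allI)
 have [measurable]: "(\<lambda>x. K (fst x) (snd x)) \<in> borel_measurable (lborel \<Otimes>\<^sub>M lborel)"
  using assms(1) by (simp add: case_prod_beta')
 have [measurable]: "(\<lambda>x. K (snd x) (fst x)) \<in> borel_measurable (lborel \<Otimes>\<^sub>M lborel)"
  by (rule measurable_two_arguments) auto
 note w0 = heat_small_nonneg[OF K t(1)]
 show "(\<lambda>x. LI y. K y x * g y) \<in> borel_measurable borel" by measurable
 have "nL (\<lambda>x. LI y. K y x * g y) \<le> (NI y. nL (\<lambda>x. K y x * g y))"
  using minkowski_weighted[of lborel "\<lambda>y x. K y x * g y" "\<lambda>_. 1"] lborel.sigma_finite_measure_axioms by simp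
 also have "\<dots> \<le> (NI y. ennreal (w y * \<bar>g y\<bar>))"
 proof (intro nn_integral_mono)
  fix y
  have "heat_small t (\<bar>g y\<bar> * w y) (\<lambda>x. g y * K y x)" by (rule heat_small_cmult[OF K _ t(1)]) simp
  from heat_smallD(2)[OF this] show "nL (\<lambda>x. K y x * g y) \<le> ennreal (w y * \<bar>g y\<bar>)" by (simp add: mult.commute)
 qed
 also note w
 finally show "nL (\<lambda>x. LI y. K y x * g y) \<le> ennreal A" .
 fix x
 have "ennreal \<bar>LI y. K y x * g y\<bar> \<le> (NI y. ennreal \<bar>K y x * g y\<bar>)" by (rule ennreal_abs_integral_le)
 also have "\<dots> \<le> (NI y. ennreal (1 / t\<^sup>2) * ennreal (w y * \<bar>g y\<bar>))"
 proof (intro nn_integral_mono)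
  fix y
  have "\<bar>K y x\<bar> * \<bar>g y\<bar> \<le> w y / t\<^sup>2 * \<bar>g y\<bar>" by (intro mult_right_mono heat_smallD(3)[OF K]) auto
  then show "ennreal \<bar>K y x * g y\<bar> \<le> ennreal (1 / t\<^sup>2) * ennreal (w y * \<bar>g y\<bar>)"
   using w0 by (simp add: abs_mult ennreal_mult[symmetric] ennreal_leI)
 qed
 also have "\<dots> = ennreal (1 / t\<^sup>2) * (NI y. ennreal (w y * \<bar>g y\<bar>))" by (rule nn_integral_cmult) measurable
 also have "\<dots> \<le> ennreal (1 / t\<^sup>2) * ennreal A" by (intro mult_left_mono w) auto
 also have "\<dots> = ennreal (A / t\<^sup>2)" using t by (simp add: ennreal_mult[symmetric])
 finally show "\<bar>LI y. K y x * g y\<bar> \<le> A / t\<^sup>2" using t by simp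
qed

lemma heat_small_time:
 fixes F :: "real \<Rightarrow> real^4 \<Rightarrow> real"
 assumes F: "case_prod F \<in> borel_measurable (lborel \<Otimes>\<^sub>M lborel)" and S: "S \<in> sets borel"
  and b: "\<And>s. s \<in> S \<Longrightarrow> heat_small t (\<alpha> s) (F s)" and \<alpha>: "(nT S (\<lambda>s. \<alpha> s)) \<le> ennreal A"
   "\<alpha> \<in> borel_measurable borel" and t: "0 < t" "0 \<le> A"
 shows "heat_small t A (\<lambda>x. LINT s:S|lborel. F s x)"
 unfolding heat_small_def
proof (intro conjI allI)
 have "(\<lambda>x. F (fst x) (snd x)) \<in> borel_measurable (lborel \<Otimes>\<^sub>M lborel)"
  using F by (simp add: case_prod_beta')
 then have [measurable]: "(\<lambda>x. F (snd x) (fst x)) \<in> borel_measurable (lborel \<Otimes>\<^sub>M lborel)"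
  by (rule measurable_two_arguments) auto
 note [measurable] = S
 show "(\<lambda>x. LINT s:S|lborel. F s x) \<in> borel_measurable borel" unfolding set_lebesgue_integral_def by measurable
 have "nL (\<lambda>x. LINT s:S|lborel. F s x) \<le> (nT S (\<lambda>s. \<alpha> s))"
  by (rule nL_time[OF F S]) (rule heat_smallD(2)[OF b])
 then show "nL (\<lambda>x. LINT s:S|lborel. F s x) \<le> ennreal A" using \<alpha>(1) by (rule order_trans)
 fix x
 show "\<bar>LINT s:S|lborel. F s x\<bar> \<le> A / t\<^sup>2"
 proof (rule abs_set_integral_le)
  show "\<bar>F s x\<bar> \<le> 1 / t\<^sup>2 * \<alpha> s" if "s \<in> S" for s using heat_smallD(3)[OF b[OF that], of x] by simp
  have "(nT S (\<lambda>s. 1 / t\<^sup>2 * \<alpha> s)) \<le> ennreal (1 / t\<^sup>2 * A)"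
   by (rule set_nn_integral_cmult[OF \<alpha>(2) S _ \<alpha>(1)]) simp
  then show "(nT S (\<lambda>s. 1 / t\<^sup>2 * \<alpha> s)) \<le> ennreal (A / t\<^sup>2)" by simp
 qed (use t in auto)
qed

text \<open>Inside radius \<rho> the power is at most \<rho>^k; outside, the missing powers are
  supplied by n/\<rho> > 1. The radius is free, to be tuned to the decay of mass and third
  moment.\<close>

lemma power_interpolation:
 fixes n \<rho> :: real
 assumes "0 < \<rho>" "0 \<le> n" "k \<le> 3"
 shows "n ^ k \<le> \<rho> ^ k + \<rho> ^ k / \<rho> ^ 3 * n ^ 3"
proof (cases "n \<le> \<rho>")
 case True
 then have "n ^ k \<le> \<rho> ^ k" using assms by (intro power_mono) auto
 then show ?thesis using assms by (simp add: add_increasing2)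
next
 case False
 obtain j where j: "3 = k + j" using assms(3) le_Suc_ex by blast
 have "n ^ k * \<rho> ^ j \<le> n ^ k * n ^ j" using False assms by (intro mult_left_mono power_mono) auto
 then have "n ^ k \<le> n ^ 3 / \<rho> ^ j" using assms by (simp add: j power_add field_simps)
 also have "\<dots> = \<rho> ^ k / \<rho> ^ 3 * n ^ 3" using assms by (simp add: j power_add)
 finally show ?thesis using assms by (simp add: add_increasing)
qed

lemma nL_moment_interpolation:
 fixes g :: "real^4 \<Rightarrow> real"
 assumes [measurable]: "g \<in> borel_measurable borel" and g: "nL g \<le> ennreal A"
  "(NI x. ennreal (norm x ^ 3) * ennreal \<bar>g x\<bar>) \<le> ennreal B" and p: "0 \<le> A" "0 \<le> B" "0 < \<rho>" "k \<le> 3"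
 shows "nL (\<lambda>x. norm x ^ k * g x) \<le> ennreal (\<rho> ^ k * A + \<rho> ^ k / \<rho> ^ 3 * B)"
proof -
 have "nL (\<lambda>x. norm x ^ k * g x) \<le> (NI x. ennreal (\<rho> ^ k) * ennreal \<bar>g x\<bar> + ennreal (\<rho> ^ k / \<rho> ^ 3) * (ennreal (norm x ^ 3) * ennreal \<bar>g x\<bar>))"
 proof (intro nn_integral_mono)
  fix x :: "real^4"
  have "norm x ^ k * \<bar>g x\<bar> \<le> (\<rho> ^ k + \<rho> ^ k / \<rho> ^ 3 * norm x ^ 3) * \<bar>g x\<bar>"
   by (intro mult_right_mono power_interpolation) (use p in auto)
  also have "ennreal \<dots> = ennreal (\<rho> ^ k) * ennreal \<bar>g x\<bar> + ennreal (\<rho> ^ k / \<rho> ^ 3) * (ennreal (norm x ^ 3) * ennreal \<bar>g x\<bar>)"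
   using p by (simp add: ennreal_mult[symmetric] ennreal_plus[symmetric] distrib_right mult.assoc del: ennreal_plus)
  finally show "ennreal \<bar>norm x ^ k * g x\<bar> \<le> ennreal (\<rho> ^ k) * ennreal \<bar>g x\<bar> + ennreal (\<rho> ^ k / \<rho> ^ 3) * (ennreal (norm x ^ 3) * ennreal \<bar>g x\<bar>)"
   by (simp add: abs_mult ennreal_leI)
 qed
 also have "\<dots> = ennreal (\<rho> ^ k) * nL g + ennreal (\<rho> ^ k / \<rho> ^ 3) * (NI x. ennreal (norm x ^ 3) * ennreal \<bar>g x\<bar>)"
  by (simp add: nn_integral_add nn_integral_cmult)
 also have "\<dots> \<le> ennreal (\<rho> ^ k) * ennreal A + ennreal (\<rho> ^ k / \<rho> ^ 3) * ennreal B"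
  by (intro add_mono mult_left_mono g) auto
 also have "\<dots> = ennreal (\<rho> ^ k * A + \<rho> ^ k / \<rho> ^ 3 * B)"
  using p by (simp add: ennreal_mult[symmetric] ennreal_plus[symmetric] del: ennreal_plus)
 finally show ?thesis .
qed

lemma sqrt_powers:
 assumes "0 \<le> t"
 shows "sqrt t ^ 2 = t" "sqrt t ^ 3 = t * sqrt t" "sqrt t ^ 4 = t\<^sup>2" "sqrt t ^ 5 = t\<^sup>2 * sqrt t"
 using assms power_mult[of "sqrt t" 2 2] by (simp_all add: eval_nat_numeral)

lemma nn_integral_inverse_square_tail:
 assumes "0 \<le> A"
 shows "(nT {A..} (\<lambda>s. 1 / (1 + s)\<^sup>2)) = ennreal (1 / (1 + A))"
proof -
 have "(nT {A..} (\<lambda>s. 1 / (1 + s)\<^sup>2)) = (nT {A..} (\<lambda>s. (1 + s) powr - 2))"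
  using assms by (intro nn_integral_cong) (auto simp: powr_minus_divide split: split_indicator)
 also have "\<dots> = ennreal (1 / (1 + A))"
  by (subst nn_integral_powr_tail) (use assms in \<open>auto simp: powr_minus_divide\<close>)
 finally show ?thesis .
qed

section \<open>Moments of the squared solution and its first-order profile\<close>

locale mild_decay = mild +
 fixes C :: real
 assumes C_nonneg: "0 \<le> C" and v_L1: "\<And>t. 0 \<le> t \<Longrightarrow> nL (v t) \<le> ennreal C"
  and v_sup: "\<And>t x. 0 \<le> t \<Longrightarrow> \<bar>v t x\<bar> \<le> C / (1 + t)\<^sup>2"
  and v_mom3: "\<And>t. 0 \<le> t \<Longrightarrow> (NI x. ennreal (norm x ^ 3) * ennreal \<bar>v t x\<bar>) \<le> ennreal (C * ((1 + t) * sqrt (1 + t)))"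
begin

definition f :: "real \<Rightarrow> real^4 \<Rightarrow> real" where "f s y = (v s y)\<^sup>2"

definition M :: real where "M = (LI x. v 0 x)"

lemma borel_measurable_f [measurable (raw)]:
 assumes [measurable]: "g \<in> borel_measurable N" "h \<in> borel_measurable N"
 shows "(\<lambda>z. f (g z) (h z)) \<in> borel_measurable N"
 unfolding f_def by measurable

lemma f_borel [measurable]: "f s \<in> borel_measurable borel"
 by measurable

lemma f_nonneg [simp]: "0 \<le> f s y"
 by (simp add: f_def)

lemma f_bounds:
 assumes "0 \<le> s"
 shows "nL (f s) \<le> ennreal (C\<^sup>2 / (1 + s)\<^sup>2)" "f s y \<le> C\<^sup>2 / (1 + s) ^ 4"
proof -
 show "nL (f s) \<le> ennreal (C\<^sup>2 / (1 + s)\<^sup>2)"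
  using v_square_bounds(1)[OF v_L1[OF assms] v_sup[OF assms] C_nonneg] by (simp add: f_def[abs_def] power2_eq_square)
 have "\<bar>v s y\<bar>\<^sup>2 \<le> (C / (1 + s)\<^sup>2)\<^sup>2" by (intro power_mono v_sup assms) simp
 then show "f s y \<le> C\<^sup>2 / (1 + s) ^ 4" by (simp add: f_def power_divide)
qed

lemma f_mom3:
 assumes "0 \<le> s"
 shows "(NI x. ennreal (norm x ^ 3) * ennreal \<bar>f s x\<bar>) \<le> ennreal (C\<^sup>2 / sqrt (1 + s))"
proof -
 have "(NI x. ennreal (norm x ^ 3) * ennreal \<bar>f s x\<bar>)
   \<le> (NI x. ennreal (C / (1 + s)\<^sup>2) * (ennreal (norm x ^ 3) * ennreal \<bar>v s x\<bar>))"
 proof (intro nn_integral_mono)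
  fix x :: "real^4"
  have "norm x ^ 3 * f s x = norm x ^ 3 * (\<bar>v s x\<bar> * \<bar>v s x\<bar>)" by (simp add: f_def power2_eq_square)
  also have "\<dots> \<le> norm x ^ 3 * (C / (1 + s)\<^sup>2 * \<bar>v s x\<bar>)" by (intro mult_left_mono mult_right_mono v_sup assms) auto
  finally show "ennreal (norm x ^ 3) * ennreal \<bar>f s x\<bar> \<le> ennreal (C / (1 + s)\<^sup>2) * (ennreal (norm x ^ 3) * ennreal \<bar>v s x\<bar>)"
   using C_nonneg by (simp add: ennreal_mult[symmetric] ennreal_leI mult_ac)
 qed
 also have "\<dots> = ennreal (C / (1 + s)\<^sup>2) * (NI x. ennreal (norm x ^ 3) * ennreal \<bar>v s x\<bar>)"
  by (rule nn_integral_cmult) measurable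
 also have "\<dots> \<le> ennreal (C / (1 + s)\<^sup>2) * ennreal (C * ((1 + s) * sqrt (1 + s)))"
  by (intro mult_left_mono v_mom3 assms) auto
 also have "\<dots> = ennreal (C\<^sup>2 / sqrt (1 + s))"
 proof -
  define r where "r = sqrt (1 + s)"
  have r: "1 + s = r * r" "0 < r" using assms by (simp_all add: r_def)
  have "C / (1 + s)\<^sup>2 * (C * ((1 + s) * sqrt (1 + s))) = C\<^sup>2 / sqrt (1 + s)"
   unfolding r_def[symmetric] unfolding r(1) using r(2) by (simp add: field_simps power2_eq_square)
  then show ?thesis using C_nonneg assms by (simp add: ennreal_mult[symmetric])
 qed
 finally show ?thesis .
qed

text \<open>Interpolation at the diffusive radius sqrt (1 + s) gives the k-th moment the rate
  (1+s)^((k-4)/2). Orders 0 and 1 are integrable in time, order 2 is the borderline 1/s that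
  produces the logarithm, and order 3 is controlled only through the extra decay of the
  kernel.\<close>

lemma nL_f_moment:
 assumes "0 \<le> s" "k \<le> 3"
 shows "nL (\<lambda>y. norm y ^ k * f s y) \<le> ennreal (2 * C\<^sup>2 * sqrt (1 + s) ^ k / sqrt (1 + s) ^ 4)"
proof -
 define r where "r = sqrt (1 + s)"
 have r: "1 + s = r * r" "0 < r" using assms by (simp_all add: r_def)
 have "nL (\<lambda>y. norm y ^ k * f s y) \<le> ennreal (r ^ k * (C\<^sup>2 / (1 + s)\<^sup>2) + r ^ k / r ^ 3 * (C\<^sup>2 / r))"
  unfolding r_def by (rule nL_moment_interpolation[OF f_borel f_bounds(1) f_mom3]) (use assms in auto)
 also have "r ^ k * (C\<^sup>2 / (1 + s)\<^sup>2) + r ^ k / r ^ 3 * (C\<^sup>2 / r) = 2 * C\<^sup>2 * r ^ k / r ^ 4"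
  unfolding r(1) using r(2) by (simp add: field_simps eval_nat_numeral)
 finally show ?thesis by (simp add: r_def)
qed

lemma nL_v0_moment: "k \<le> 3 \<Longrightarrow> nL (\<lambda>y. norm y ^ k * v 0 y) \<le> ennreal (2 * C)"
 using nL_moment_interpolation[OF v_borel v_L1[of 0], of C 1 k] v_mom3[of 0] C_nonneg by simp

lemma abs_M_le: "\<bar>M\<bar> \<le> C"
 unfolding M_def by (rule abs_integral_le_nL[OF v_L1]) (use C_nonneg in auto)

lemma integrable_f [simp]: "0 \<le> s \<Longrightarrow> integrable lborel (f s)"
 by (rule integrable_nL_le[OF f_borel f_bounds(1)])

lemma integrable_v [simp]: "0 \<le> s \<Longrightarrow> integrable lborel (v s)"
 by (rule integrable_nL_le[OF v_borel v_L1])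

lemma v_eq:
 assumes "0 < t"
 shows "v t x = heatS t (v 0) x + (LINT s:{0<..<t}|lborel. heatP a (t - s) (f s) x)"
 using v_mild[of 0 t x] assms by (simp add: f_def[abs_def])

text \<open>The linear part is compared with M times the kernel by translating it, at the cost of a
  first moment. In the Duhamel part, early times have integrable mass and a kernel of order
  s^(-1/2), and late times have mass at most 1/s, which the integrated kernel sqrt s turns into
  s^(-1/2).\<close>

lemma nL_v_minus_heatG:
 assumes s: "0 < s"
 shows "nL (\<lambda>x. v s x - M * heatG s x) \<le> ennreal ((2 * kc * C + 4 * kc * norm a * C\<^sup>2) / sqrt s)"
proof -
 let ?K = "kc * norm a * C\<^sup>2"
 have K: "0 \<le> ?K" using kc_pos by (simp add: less_imp_le)
 have lin: "nL (\<lambda>x. LI y. (heatG s (x - y) - heatG s x) * v 0 y) \<le> ennreal (2 * kc * C / sqrt s)"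
 proof -
  have "nL (\<lambda>x. LI y. (heatG s (x - y) - heatG s x) * v 0 y) \<le> (NI y. nL (\<lambda>x. (heatG s (x - y) - heatG s x) * v 0 y))"
   using minkowski_weighted[of lborel "\<lambda>y x. (heatG s (x - y) - heatG s x) * v 0 y" "\<lambda>_. 1"] lborel.sigma_finite_measure_axioms by simp
  also have "\<dots> \<le> (NI y. ennreal (kc / sqrt s) * ennreal \<bar>norm y ^ 1 * v 0 y\<bar>)"
  proof (intro nn_integral_mono)
   fix y :: "real^4"
   have "nL (\<lambda>x. (heatG s (x - y) - heatG s x) * v 0 y) \<le> ennreal (kc * norm y / sqrt s * \<bar>v 0 y\<bar>)"
    by (rule nL_mult_bounded[OF _ nL_heatG_translate[OF s]]) (use s in \<open>auto simp: less_imp_le\<close>)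
   also have "\<dots> = ennreal (kc / sqrt s) * ennreal \<bar>norm y ^ 1 * v 0 y\<bar>"
    using s by (simp add: ennreal_mult[symmetric] abs_mult less_imp_le mult_ac)
   finally show "nL (\<lambda>x. (heatG s (x - y) - heatG s x) * v 0 y) \<le> ennreal (kc / sqrt s) * ennreal \<bar>norm y ^ 1 * v 0 y\<bar>" .
  qed
  also have "\<dots> = ennreal (kc / sqrt s) * nL (\<lambda>y. norm y ^ 1 * v 0 y)" by (rule nn_integral_cmult) measurable
  also have "\<dots> \<le> ennreal (kc / sqrt s) * ennreal (2 * C)" by (intro mult_left_mono nL_v0_moment) auto
  also have "\<dots> = ennreal (2 * kc * C / sqrt s)" using s C_nonneg by (simp add: ennreal_mult[symmetric] less_imp_le mult_ac)
  finally show ?thesis .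
 qed
 have nlin: "nL (\<lambda>x. LINT r:{0<..<s}|lborel. heatP a (s - r) (f r) x) \<le> ennreal (4 * kc * norm a * C\<^sup>2 / sqrt s)"
 proof -
  have "nL (\<lambda>x. LINT r:{0<..<s}|lborel. heatP a (s - r) (f r) x)
   \<le> (nT {0<..<s} (\<lambda>r. ?K * (2 / sqrt s * (1 / (1 + r)\<^sup>2) + 1 / s * (1 / sqrt (s - r)))))"
  proof (rule nL_time)
   show "(\<lambda>(r, x). heatP a (s - r) (f r) x) \<in> borel_measurable (lborel \<Otimes>\<^sub>M lborel)"
    unfolding f_def[abs_def] by measurable
   fix r assume r: "r \<in> {0<..<s}"
   have "nL (heatP a (s - r) (f r)) \<le> ennreal (kc * norm a / sqrt (s - r) * (C\<^sup>2 / (1 + r)\<^sup>2))"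
    by (rule nL_heatP[OF _ f_borel f_bounds(1)]) (use r in auto)
   also have "kc * norm a / sqrt (s - r) * (C\<^sup>2 / (1 + r)\<^sup>2) = ?K * (1 / sqrt (s - r) * (1 / (1 + r)\<^sup>2))" by simp
   also have "1 / sqrt (s - r) * (1 / (1 + r)\<^sup>2) \<le> 2 / sqrt s * (1 / (1 + r)\<^sup>2) + 1 / s * (1 / sqrt (s - r))"
   proof (cases "r \<le> s / 2")
    case True
    have "sqrt s / 2 \<le> sqrt (s - r)" using True s r by (intro real_le_rsqrt) (auto simp: power_divide)
    then have "1 / sqrt (s - r) \<le> 1 / (sqrt s / 2)" using s r by (intro divide_left_mono) auto
    then have "1 / sqrt (s - r) * (1 / (1 + r)\<^sup>2) \<le> 1 / (sqrt s / 2) * (1 / (1 + r)\<^sup>2)" by (intro mult_right_mono) auto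
    then show ?thesis using s r by (simp add: add_increasing2)
   next
    case False
    \<comment> \<open>For r > s/2 the decay 1/(1+r)^2 is needed only in the weaker form 1/s, which
      is what balances with the other half.\<close>
    have "s \<le> 1 + s + (s / 2)\<^sup>2" by simp
    also have "\<dots> = (1 + s / 2)\<^sup>2" by (simp add: power2_eq_square algebra_simps)
    also have "\<dots> \<le> (1 + r)\<^sup>2" using False s by (intro power_mono) auto
    finally have "1 / (1 + r)\<^sup>2 \<le> 1 / s" using s r by (intro divide_left_mono) auto
    then have "1 / sqrt (s - r) * (1 / (1 + r)\<^sup>2) \<le> 1 / sqrt (s - r) * (1 / s)" using r by (intro mult_left_mono) auto
    then show ?thesis using s r by (simp add: add_increasing mult.commute)
   qed
   finally show "nL (heatP a (s - r) (f r)) \<le> ennreal (?K * (2 / sqrt s * (1 / (1 + r)\<^sup>2) + 1 / s * (1 / sqrt (s - r))))"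
    using K by (simp add: mult_left_mono ennreal_leI)
  qed simp
  also have "\<dots> \<le> ennreal (?K * (2 / sqrt s * 1 + 1 / s * (2 * sqrt s)))"
  proof (intro set_nn_integral_cmult set_nn_integral_add)
   show "(nT {0<..<s} (\<lambda>r. 1 / (1 + r)\<^sup>2)) \<le> ennreal 1"
    by (rule set_nn_integral_subset[of _ "{0..}"]) (use nn_integral_inverse_square_tail[of 0] in auto)
   show "(nT {0<..<s} (\<lambda>r. 1 / sqrt (s - r))) \<le> ennreal (2 * sqrt s)"
    using nn_integral_inverse_sqrt_reflect[of 0 s] s by simp
  qed (use s K in auto)
  also have "?K * (2 / sqrt s * 1 + 1 / s * (2 * sqrt s)) = 4 * kc * norm a * C\<^sup>2 / sqrt s"
  proof -
   have "1 / s * (2 * sqrt s) = 2 / sqrt s" using s by (simp add: field_simps)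
   then show ?thesis by simp
  qed
  finally show ?thesis .
 qed
 have e: "v s x - M * heatG s x = (LI y. (heatG s (x - y) - heatG s x) * v 0 y) + (LINT r:{0<..<s}|lborel. heatP a (s - r) (f r) x)" for x
 proof -
  have i: "integrable lborel (\<lambda>y. heatG s (x - y) * v 0 y)"
   by (rule integrable_conv_data[OF integrable_v _ abs_heatG_le[OF s]]) auto
  have "(LI y. (heatG s (x - y) - heatG s x) * v 0 y) = (LI y. heatG s (x - y) * v 0 y - heatG s x * v 0 y)"
   by (simp add: left_diff_distrib)
  also have "\<dots> = heatS s (v 0) x - heatG s x * M"
   using i by (simp add: conv_def M_def)
  finally show ?thesis using v_eq[OF s] by (simp add: mult.commute)
 qed
 have m: "(\<lambda>x. LINT r:{0<..<s}|lborel. heatP a (s - r) (f r) x) \<in> borel_measurable borel"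
  unfolding set_lebesgue_integral_def f_def[abs_def] by measurable
 have "nL (\<lambda>x. v s x - M * heatG s x) \<le> ennreal (2 * kc * C / sqrt s + 4 * kc * norm a * C\<^sup>2 / sqrt s)"
  unfolding e by (rule nL_add[OF _ m lin nlin]) (use s C_nonneg in \<open>auto simp: less_imp_le\<close>)
 then show ?thesis by (simp add: add_divide_distrib)
qed

end

lemma weighted_moment:
 fixes g W :: "real^4 \<Rightarrow> real"
 assumes [measurable]: "g \<in> borel_measurable borel" "W \<in> borel_measurable borel"
  and W: "\<And>y. \<bar>W y\<bar> \<le> B * norm y ^ k" "0 \<le> B" and g: "nL (\<lambda>y. norm y ^ k * g y) \<le> ennreal A" "0 \<le> A"
 shows "integrable lborel (\<lambda>y. W y * g y)" "\<bar>LI y. W y * g y\<bar> \<le> B * A"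
proof -
 have "nL (\<lambda>y. W y * g y) \<le> (NI y. ennreal B * ennreal \<bar>norm y ^ k * g y\<bar>)"
 proof (intro nn_integral_mono)
  fix y
  have "\<bar>W y\<bar> * \<bar>g y\<bar> \<le> B * norm y ^ k * \<bar>g y\<bar>" by (intro mult_right_mono W) auto
  then show "ennreal \<bar>W y * g y\<bar> \<le> ennreal B * ennreal \<bar>norm y ^ k * g y\<bar>"
   using W by (simp add: abs_mult ennreal_mult[symmetric] ennreal_leI mult.assoc)
 qed
 also have "\<dots> = ennreal B * nL (\<lambda>y. norm y ^ k * g y)" by (rule nn_integral_cmult) measurable
 also have "\<dots> \<le> ennreal B * ennreal A" by (intro mult_left_mono g) auto
 also have "\<dots> = ennreal (B * A)" using W g by (simp add: ennreal_mult)
 finally have *: "nL (\<lambda>y. W y * g y) \<le> ennreal (B * A)" .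
 show "integrable lborel (\<lambda>y. W y * g y)" by (rule integrable_nL_le[OF _ *]) measurable
 show "\<bar>LI y. W y * g y\<bar> \<le> B * A" by (rule abs_integral_le_nL[OF *]) (use W g in auto)
qed

lemma vector_moment:
 fixes g :: "real^4 \<Rightarrow> real"
 assumes [measurable]: "g \<in> borel_measurable borel" and g: "nL (\<lambda>y. norm y ^ 1 * g y) \<le> ennreal A" "0 \<le> A"
 shows "integrable lborel (\<lambda>y. g y *\<^sub>R y)" "norm (LI y. g y *\<^sub>R y) \<le> A"
proof -
 have i: "integrable lborel (\<lambda>y. norm y ^ 1 * g y)" by (rule integrable_nL_le[OF _ g(1)]) measurable
 then show "integrable lborel (\<lambda>y. g y *\<^sub>R y)"
  by (rule Bochner_Integration.integrable_bound) (auto simp: abs_mult mult.commute)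
 have "norm (LI y. g y *\<^sub>R y) \<le> (LI y. norm (g y *\<^sub>R y))" by (rule integral_norm_bound)
 also have "\<dots> = (LI y. \<bar>norm y ^ 1 * g y\<bar>)" by (simp add: abs_mult mult.commute)
 also have "\<dots> \<le> A" using g nL_integral[OF i] by simp
 finally show "norm (LI y. g y *\<^sub>R y) \<le> A" .
qed

lemma inner_weight_le: "\<bar>(b \<bullet> y) * (c \<bullet> y)\<bar> \<le> norm b * norm c * norm y ^ 2" for b c y :: "real^4"
proof -
 have "\<bar>b \<bullet> y\<bar> * \<bar>c \<bullet> y\<bar> \<le> (norm b * norm y) * (norm c * norm y)" by (intro mult_mono abs_inner_le) auto
 then show ?thesis by (simp add: abs_mult power2_eq_square mult_ac)
qed

text \<open>Changing c/s to c/(1+s) costs |c|/(s(1+s)), below s^(-7/6) for s \<ge> 1; for s < 1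
  plain boundedness suffices. The 4 bounds 2^(7/6).\<close>

lemma decay_combine:
 fixes X :: real
 assumes s: "0 < s" and 1: "1 \<le> s \<Longrightarrow> \<bar>X - c / s\<bar> \<le> E * s powr - (7/6)" and 2: "s < 1 \<Longrightarrow> \<bar>X\<bar> \<le> B"
  and p: "\<bar>c\<bar> \<le> K" "0 \<le> E" "0 \<le> B"
 shows "\<bar>X - c / (1 + s)\<bar> \<le> 4 * (E + B + K) * (1 + s) powr - (7/6)"
proof -
 have four: "(2::real) powr (7/6) \<le> 4" using powr_mono[of "7/6" 2 "2::real"] by simp
 have K: "0 \<le> K" using p by linarith
 show ?thesis
 proof (cases "1 \<le> s")
  case True
  have "(1 + s) powr (7/6) \<le> (2 * s) powr (7/6)" using True by (intro powr_mono2) auto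
  also have "\<dots> = 2 powr (7/6) * s powr (7/6)" by (rule powr_mult)
  also have "\<dots> \<le> 4 * s powr (7/6)" by (intro mult_right_mono four) auto
  finally have le: "s powr - (7/6) \<le> 4 * (1 + s) powr - (7/6)"
   using s by (simp add: powr_minus_divide field_simps)
  have "c / s - c / (1 + s) = c * (1 / (s * (1 + s)))" using s by (simp add: field_simps)
  then have "\<bar>c / s - c / (1 + s)\<bar> = \<bar>c\<bar> * (1 / (s * (1 + s)))" using s by (simp add: abs_mult)
  also have "\<dots> \<le> K * s powr - (7/6)"
  proof (intro mult_mono p(1))
   have "s powr (7/6) \<le> s powr 2" using True by (intro powr_mono) auto
   also have "\<dots> \<le> s * (1 + s)" using s by (simp add: power2_eq_square)
   finally show "1 / (s * (1 + s)) \<le> s powr - (7/6)" using s by (simp add: powr_minus_divide frac_le)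
  qed (use K s in auto)
  finally have "\<bar>X - c / (1 + s)\<bar> \<le> E * s powr - (7/6) + K * s powr - (7/6)" using 1[OF True] by linarith
  also have "\<dots> \<le> (E + B + K) * s powr - (7/6)" using p by (simp add: distrib_right)
  also have "\<dots> \<le> (E + B + K) * (4 * (1 + s) powr - (7/6))" using p K by (intro mult_left_mono le) auto
  finally show ?thesis by (simp only: mult_ac)
 next
  case False
  have "(1 + s) powr (7/6) \<le> 2 powr (7/6)" using False s by (intro powr_mono2) auto
  then have le: "1 \<le> 4 * (1 + s) powr - (7/6)" using four s by (simp add: powr_minus_divide)
  have "\<bar>c / (1 + s)\<bar> \<le> K"
  proof -
   have "\<bar>c\<bar> / (1 + s) \<le> K / 1" using s p K by (intro frac_le) auto
   then show ?thesis using s by simp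
  qed
  moreover have "\<bar>X\<bar> \<le> B" using 2 False by simp
  ultimately have "\<bar>X - c / (1 + s)\<bar> \<le> (E + B + K) * 1"
   using abs_triangle_ineq4[of X "c / (1 + s)"] p(2) by simp
  also have "\<dots> \<le> (E + B + K) * (4 * (1 + s) powr - (7/6))" using p K by (intro mult_left_mono le) auto
  finally show ?thesis by (simp only: mult_ac)
 qed
qed

lemma powr_tail:
 fixes F :: "real \<Rightarrow> 'a::{banach, second_countable_topology}"
 assumes [measurable]: "F \<in> borel_measurable borel" and F: "\<And>s. 0 < s \<Longrightarrow> norm (F s) \<le> B * (1 + s) powr - p"
  and p: "1 < p" "0 \<le> B" and r: "0 < r"
 shows "set_integrable lborel {0<..} F"
  and "norm ((LINT s:{0<..}|lborel. F s) - (LINT s:{0<..<r}|lborel. F s)) \<le> B * ((1 + r) powr (1 - p) / (p - 1))"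
proof -
 have bd: "(NI s. ennreal (norm (indicator S s *\<^sub>R F s))) \<le> ennreal (B * ((1 + A) powr (1 - p) / (p - 1)))"
  if "S \<subseteq> {A..}" "S \<subseteq> {0<..}" "0 \<le> A" for A S
 proof -
  have "(NI s. ennreal (norm (indicator S s *\<^sub>R F s))) \<le> (nT {A..} (\<lambda>s. B * (1 + s) powr - p))"
   by (intro nn_integral_mono) (use that F in \<open>auto split: split_indicator intro!: ennreal_leI\<close>)
  also have "\<dots> \<le> ennreal (B * ((1 + A) powr (1 - p) / (p - 1)))"
   by (rule set_nn_integral_cmult) (use p that in \<open>auto simp: nn_integral_powr_tail\<close>)
  finally show ?thesis .
 qed
 show i: "set_integrable lborel {0<..} F"
  unfolding set_integrable_def
 proof (rule integrableI_bounded)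
  show "(NI s. ennreal (norm (indicator {0<..} s *\<^sub>R F s))) < \<infinity>"
   by (rule le_less_trans[OF bd[of _ 0]]) auto
 qed measurable
 have s: "set_integrable lborel {0<..<r} F" "set_integrable lborel {r..} F"
  by (rule set_integrable_subset[OF i]; use r in auto)+
 have U: "{0<..<r} \<union> {r..} = {0<..}" using r by auto
 have "(LINT s:{0<..}|lborel. F s) = (LINT s:{0<..<r}|lborel. F s) + (LINT s:{r..}|lborel. F s)"
  by (rule set_integral_Un[OF _ s, unfolded U]) auto
 then have e: "(LINT s:{0<..}|lborel. F s) - (LINT s:{0<..<r}|lborel. F s) = (LINT s:{r..}|lborel. F s)" by simp
 have "ennreal (norm (LINT s:{r..}|lborel. F s)) \<le> (NI s. ennreal (norm (indicator {r..} s *\<^sub>R F s)))"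
  unfolding set_lebesgue_integral_def
  by (rule integral_norm_bound_ennreal) (use s(2) in \<open>simp add: set_integrable_def\<close>)
 also have "\<dots> \<le> ennreal (B * ((1 + r) powr (1 - p) / (p - 1)))" by (rule bd) (use r in auto)
 finally show "norm ((LINT s:{0<..}|lborel. F s) - (LINT s:{0<..<r}|lborel. F s)) \<le> B * ((1 + r) powr (1 - p) / (p - 1))"
  unfolding e using p by simp
qed

section \<open>Comparison of the nonlinearity with the squared Gaussian\<close>

context mild_decay begin

text \<open>The squared profile M^2 G(s)^2 has mass c0/s^2 and second moments c0 (b \<bullet> c)/s.
  Hence the same constant governs both logarithmic contributions.\<close>

definition c0 :: real where "c0 = M\<^sup>2 / (64 * pi\<^sup>2)"

lemma c0_nonneg [simp]: "0 \<le> c0"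
 by (simp add: c0_def)

definition D0 :: real where "D0 = 2 * kc * C + 4 * kc * norm a * C\<^sup>2"

lemma D0_nonneg [simp]: "0 \<le> D0"
 using C_nonneg kc_pos by (simp add: D0_def less_imp_le)

lemma M_square_le: "M\<^sup>2 \<le> C\<^sup>2"
 using power_mono[OF abs_M_le, of 2] by simp

text \<open>Difference of two squares: the L^1 error s^(-1/2) of the profile times the supremum
  s^(-2) of the sum.\<close>

lemma f_profile_L1:
 assumes s: "1 \<le> s"
 shows "nL (\<lambda>x. f s x - M\<^sup>2 * (heatG s x)\<^sup>2) \<le> ennreal (2 * C * D0 * s powr - (5/2))"
proof -
 have e: "f s x - M\<^sup>2 * (heatG s x)\<^sup>2 = (v s x - M * heatG s x) * (v s x + M * heatG s x)" for x
  by (simp add: f_def power2_eq_square algebra_simps)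
 have "nL (\<lambda>x. f s x - M\<^sup>2 * (heatG s x)\<^sup>2) \<le> ennreal (D0 / sqrt s * (2 * C / s\<^sup>2))"
  unfolding e
 proof (rule nL_mult_bounded)
  show "nL (\<lambda>x. v s x - M * heatG s x) \<le> ennreal (D0 / sqrt s)"
   unfolding D0_def by (rule nL_v_minus_heatG) (use s in auto)
  fix x
  have "\<bar>v s x\<bar> \<le> C / (1 + s)\<^sup>2" using v_sup s by auto
  also have "\<dots> \<le> C / s\<^sup>2" using s C_nonneg by (intro divide_left_mono power_mono) auto
  finally have 1: "\<bar>v s x\<bar> \<le> C / s\<^sup>2" .
  have "\<bar>M * heatG s x\<bar> \<le> C * (1 / s\<^sup>2)"
   unfolding abs_mult by (intro mult_mono abs_M_le abs_heatG_le) (use s C_nonneg in auto)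
  with 1 show "\<bar>v s x + M * heatG s x\<bar> \<le> 2 * C / s\<^sup>2" by simp
 qed (use s in auto)
 also have "D0 / sqrt s * (2 * C / s\<^sup>2) = 2 * C * D0 * s powr - (5/2)"
 proof -
  have "s powr (5/2) = s powr (2 + 1/2)" by simp
  also have "\<dots> = s\<^sup>2 * sqrt s" unfolding powr_add using s by (simp add: powr_half_sqrt)
  finally show ?thesis using s by (simp add: powr_minus_divide mult_ac)
 qed
 finally show ?thesis .
qed

text \<open>No cancellation is sought here: both third moments are of order s^(-1/2) separately. The
  gain in the second moment comes from interpolating with the small L^1 error.\<close>

lemma f_profile_mom3:
 assumes s: "1 \<le> s"
 shows "(NI x. ennreal (norm x ^ 3) * ennreal \<bar>f s x - M\<^sup>2 * (heatG s x)\<^sup>2\<bar>) \<le> ennreal ((C\<^sup>2 + C\<^sup>2 * mc 3) * s powr - (1/2))"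
proof -
 let ?h = "C\<^sup>2 * mc 3 / sqrt s"
 have s0: "0 < s" using s by simp
 have "(NI x. ennreal (norm x ^ 3) * ennreal \<bar>f s x - M\<^sup>2 * (heatG s x)\<^sup>2\<bar>)
  \<le> (NI x. ennreal (norm x ^ 3) * ennreal \<bar>f s x\<bar> + ennreal ?h * ennreal (heatG (2 * s) x))"
 proof (intro nn_integral_mono)
  fix x :: "real^4"
  have "norm x ^ 3 * (M\<^sup>2 * (heatG s x)\<^sup>2) = M\<^sup>2 * (heatG s x * (norm x ^ 3 * heatG s x))" by (simp add: power2_eq_square)
  also have "\<dots> \<le> C\<^sup>2 * (1 / s\<^sup>2 * (mc 3 * sqrt s ^ 3 * heatG (2 * s) x))"
   by (intro mult_mono M_square_le heatG_le heatG_moment s0) (use s0 in \<open>auto simp: less_imp_le\<close>)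
  also have "\<dots> = ?h * heatG (2 * s) x"
   using s0 unfolding sqrt_powers(2)[OF less_imp_le[OF s0]] by (simp add: field_simps power2_eq_square)
  finally have 1: "norm x ^ 3 * (M\<^sup>2 * (heatG s x)\<^sup>2) \<le> ?h * heatG (2 * s) x" .
  have "norm x ^ 3 * \<bar>f s x - M\<^sup>2 * (heatG s x)\<^sup>2\<bar> \<le> norm x ^ 3 * (f s x + M\<^sup>2 * (heatG s x)\<^sup>2)"
   by (intro mult_left_mono) (auto simp: abs_le_iff add_increasing2)
  also have "\<dots> \<le> norm x ^ 3 * f s x + ?h * heatG (2 * s) x" using 1 by (simp add: distrib_left)
  finally show "ennreal (norm x ^ 3) * ennreal \<bar>f s x - M\<^sup>2 * (heatG s x)\<^sup>2\<bar> \<le> ennreal (norm x ^ 3) * ennreal \<bar>f s x\<bar> + ennreal ?h * ennreal (heatG (2 * s) x)"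
   using s0 by (simp add: ennreal_mult[symmetric] ennreal_plus[symmetric] ennreal_leI less_imp_le del: ennreal_plus)
 qed
 also have "\<dots> = (NI x. ennreal (norm x ^ 3) * ennreal \<bar>f s x\<bar>) + ennreal ?h * (NI x. ennreal (heatG (2 * s) x))"
  by (simp add: nn_integral_add nn_integral_cmult)
 also have "\<dots> \<le> ennreal (C\<^sup>2 / sqrt s) + ennreal ?h * 1"
 proof (intro add_mono mult_left_mono)
  have "C\<^sup>2 / sqrt (1 + s) \<le> C\<^sup>2 / sqrt s" using s0 by (intro divide_left_mono) auto
  then show "(NI x. ennreal (norm x ^ 3) * ennreal \<bar>f s x\<bar>) \<le> ennreal (C\<^sup>2 / sqrt s)"
   using f_mom3[of s] s0 by (meson ennreal_leI less_imp_le order_trans)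
 qed (use s0 nn_integral_heatG[of "2 * s"] in auto)
 also have "\<dots> = ennreal ((C\<^sup>2 + C\<^sup>2 * mc 3) * s powr - (1/2))"
  using s0 by (simp add: ennreal_plus[symmetric] powr_minus_divide powr_half_sqrt add_divide_distrib less_imp_le del: ennreal_plus)
 finally show ?thesis .
qed

definition E0 :: real where "E0 = 2 * C * D0 + (C\<^sup>2 + C\<^sup>2 * mc 3)"

lemma E0_nonneg [simp]: "0 \<le> E0"
 using C_nonneg by (simp add: E0_def less_imp_le)

text \<open>The radius \<open>s powr (2/3)\<close> balances the \<open>L\<^sup>1\<close> error against the third moment.\<close>

lemma f_profile_mom2:
 assumes s: "1 \<le> s"
 shows "nL (\<lambda>x. norm x ^ 2 * (f s x - M\<^sup>2 * (heatG s x)\<^sup>2)) \<le> ennreal (E0 * s powr - (7/6))"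
proof -
 define \<rho> where "\<rho> = s powr (2/3)"
 have \<rho>: "0 < \<rho>" using s by (simp add: \<rho>_def)
 have "nL (\<lambda>x. norm x ^ 2 * (f s x - M\<^sup>2 * (heatG s x)\<^sup>2))
   \<le> ennreal (\<rho> ^ 2 * (2 * C * D0 * s powr - (5/2)) + \<rho> ^ 2 / \<rho> ^ 3 * ((C\<^sup>2 + C\<^sup>2 * mc 3) * s powr - (1/2)))"
  by (rule nL_moment_interpolation[OF _ f_profile_L1[OF s] f_profile_mom3[OF s]]) (use \<rho> C_nonneg in \<open>auto simp: less_imp_le\<close>)
 also have "\<rho> ^ 2 * (2 * C * D0 * s powr - (5/2)) = 2 * C * D0 * s powr - (7/6)"
 proof -
  have "\<rho> ^ 2 = s powr (4/3)" using s by (simp add: \<rho>_def powr_power)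
  moreover have "s powr (4/3) * s powr - (5/2) = s powr - (7/6)" using s by (simp add: powr_add[symmetric])
  ultimately show ?thesis by simp
 qed
 also have "\<rho> ^ 2 / \<rho> ^ 3 * ((C\<^sup>2 + C\<^sup>2 * mc 3) * s powr - (1/2)) = (C\<^sup>2 + C\<^sup>2 * mc 3) * s powr - (7/6)"
 proof -
  have "\<rho> ^ 2 / \<rho> ^ 3 = 1 / \<rho>" using \<rho> by (simp add: eval_nat_numeral)
  also have "\<dots> = s powr - (2/3)" by (simp add: \<rho>_def powr_minus_divide)
  finally have "\<rho> ^ 2 / \<rho> ^ 3 = s powr - (2/3)" .
  moreover have "s powr - (2/3) * s powr - (1/2) = s powr - (7/6)" using s by (simp add: powr_add[symmetric])
  ultimately show ?thesis by simp
 qed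
 finally show ?thesis by (simp add: E0_def distrib_right)
qed

definition D1 :: real where "D1 = 4 * (E0 + 2 * C\<^sup>2 + c0)"

lemma D1_nonneg [simp]: "0 \<le> D1"
 by (simp add: D1_def)

definition I2 :: "real^4 \<Rightarrow> real^4 \<Rightarrow> real \<Rightarrow> real" where
 "I2 b c s = (LI y. (b \<bullet> y) * (c \<bullet> y) * f s y)"

lemma integrable_I2:
 assumes "0 \<le> s"
 shows "integrable lborel (\<lambda>y. (b \<bullet> y) * (c \<bullet> y) * f s y)"
 by (rule weighted_moment(1)[OF f_borel _ inner_weight_le _ nL_f_moment]) (use assms in auto)

lemma I2_asymptotics:
 assumes s: "0 < s"
 shows "\<bar>I2 b c s - c0 * (b \<bullet> c) / (1 + s)\<bar> \<le> norm b * norm c * D1 * (1 + s) powr - (7/6)"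
proof -
 let ?n = "norm b * norm c"
 have "\<bar>I2 b c s - c0 * (b \<bullet> c) / (1 + s)\<bar> \<le> 4 * (?n * E0 + ?n * (2 * C\<^sup>2) + ?n * c0) * (1 + s) powr - (7/6)"
 proof (rule decay_combine[OF s])
  show "\<bar>c0 * (b \<bullet> c)\<bar> \<le> ?n * c0" using mult_left_mono[OF abs_inner_le[of b c] c0_nonneg] by (simp add: abs_mult mult.commute)
  show "\<bar>I2 b c s\<bar> \<le> ?n * (2 * C\<^sup>2)"
  proof -
   have "\<bar>I2 b c s\<bar> \<le> ?n * (2 * C\<^sup>2 * sqrt (1 + s) ^ 2 / sqrt (1 + s) ^ 4)"
    unfolding I2_def by (rule weighted_moment(2)[OF f_borel _ inner_weight_le _ nL_f_moment]) (use s in auto)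
   also have "\<dots> \<le> ?n * (2 * C\<^sup>2)"
   proof (rule mult_left_mono)
    have "2 * C\<^sup>2 * sqrt (1 + s) ^ 2 / sqrt (1 + s) ^ 4 = 2 * C\<^sup>2 / (1 + s)"
     using s by (simp add: sqrt_powers power2_eq_square)
    also have "\<dots> \<le> 2 * C\<^sup>2 / 1" using s by (intro divide_left_mono) auto
    finally show "2 * C\<^sup>2 * sqrt (1 + s) ^ 2 / sqrt (1 + s) ^ 4 \<le> 2 * C\<^sup>2" by simp
   qed simp
   finally show ?thesis .
  qed
  assume s1: "1 \<le> s"
  let ?g = "\<lambda>y. (b \<bullet> y) * (c \<bullet> y) * (M\<^sup>2 * (heatG s y)\<^sup>2)"
  have g: "?g y = M\<^sup>2 / (64 * pi\<^sup>2 * s\<^sup>2) * ((b \<bullet> y) * (c \<bullet> y) * heatG (s / 2) y)" for y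
   using heatG_square[OF s, of y] by simp
  have ig: "integrable lborel ?g"
   unfolding g by (intro integrable_mult_right integrable_heatG_second_moment) (use s in auto)
  \<comment> \<open>By \<open>heatG_square\<close> the profile is a Gaussian at time s/2, so its
    variance contributes 2 (s/2) = s.\<close>
  have "(LI y. ?g y) = M\<^sup>2 / (64 * pi\<^sup>2 * s\<^sup>2) * (2 * (s / 2) * (b \<bullet> c))"
   unfolding g using integral_heatG_second_moment[of "s / 2" b c] s by simp
  also have "\<dots> = c0 * (b \<bullet> c) / s" using s by (simp add: c0_def power2_eq_square)
  finally have "I2 b c s - c0 * (b \<bullet> c) / s = (LI y. (b \<bullet> y) * (c \<bullet> y) * (f s y - M\<^sup>2 * (heatG s y)\<^sup>2))"
   unfolding I2_def using Bochner_Integration.integral_diff[OF integrable_I2[of s b c] ig] s by (simp add: right_diff_distrib)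
  also have "\<bar>\<dots>\<bar> \<le> ?n * (E0 * s powr - (7/6))"
   by (rule weighted_moment(2)[OF _ _ inner_weight_le _ f_profile_mom2[OF s1]]) (use s in auto)
  finally show "\<bar>I2 b c s - c0 * (b \<bullet> c) / s\<bar> \<le> ?n * E0 * s powr - (7/6)" by (simp add: mult.assoc)
 qed auto
 then show ?thesis by (simp add: D1_def algebra_simps)
qed

definition F0 :: "real \<Rightarrow> real" where "F0 s = (LI y. f s y)"

lemma F0_le: "0 \<le> s \<Longrightarrow> \<bar>F0 s\<bar> \<le> C\<^sup>2 / (1 + s)\<^sup>2"
 unfolding F0_def by (rule abs_integral_le_nL[OF f_bounds(1)]) auto

lemma F0_asymptotics:
 assumes s: "0 < s"
 shows "\<bar>s * F0 s - c0 / (1 + s)\<bar> \<le> D1 * (1 + s) powr - (7/6)"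
proof -
 have "\<bar>s * F0 s - c0 / (1 + s)\<bar> \<le> 4 * (E0 + 2 * C\<^sup>2 + c0) * (1 + s) powr - (7/6)"
 proof (rule decay_combine[OF s])
  assume "s < 1"
  have "C\<^sup>2 / (1 + s)\<^sup>2 \<le> C\<^sup>2 / 1" using s by (intro divide_left_mono one_le_power) auto
  then have "\<bar>F0 s\<bar> \<le> C\<^sup>2" using F0_le[of s] s by simp
  with \<open>s < 1\<close> s have "s * \<bar>F0 s\<bar> \<le> 1 * C\<^sup>2" by (intro mult_mono) auto
  also have "\<dots> \<le> 2 * C\<^sup>2" by simp
  finally show "\<bar>s * F0 s\<bar> \<le> 2 * C\<^sup>2" using s by (simp add: abs_mult)
 next
  assume s1: "1 \<le> s"
  have "(LI y. M\<^sup>2 * (heatG s y)\<^sup>2) = c0 / s\<^sup>2" using integral_heatG_square(1)[OF s] by (simp add: c0_def)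
  then have "F0 s - c0 / s\<^sup>2 = (LI y. f s y - M\<^sup>2 * (heatG s y)\<^sup>2)"
   unfolding F0_def using integral_heatG_square(2)[OF s] s by simp
  also have "\<bar>\<dots>\<bar> \<le> 2 * C * D0 * s powr - (5/2)"
   by (rule abs_integral_le_nL[OF f_profile_L1[OF s1]]) (use C_nonneg in auto)
  finally have "s * \<bar>F0 s - c0 / s\<^sup>2\<bar> \<le> s * (2 * C * D0 * s powr - (5/2))" using s by (intro mult_left_mono) auto
  also have "\<dots> = 2 * C * D0 * (s powr 1 * s powr - (5/2))" using s by simp
  also have "s powr 1 * s powr - (5/2) = s powr - (3/2)" unfolding powr_add[symmetric] by simp
  also have "2 * C * D0 * s powr - (3/2) \<le> E0 * s powr - (7/6)"
  proof (intro mult_mono powr_mono s1)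
   show "2 * C * D0 \<le> E0" by (simp add: E0_def less_imp_le)
  qed auto
  also have "s * \<bar>F0 s - c0 / s\<^sup>2\<bar> = \<bar>s * F0 s - c0 / s\<bar>"
  proof -
   have "s * F0 s - c0 / s = s * (F0 s - c0 / s\<^sup>2)" using s by (simp add: field_simps power2_eq_square)
   then show ?thesis using s by (simp add: abs_mult)
  qed
  finally show "\<bar>s * F0 s - c0 / s\<bar> \<le> E0 * s powr - (7/6)" .
 qed auto
 then show ?thesis by (simp add: D1_def)
qed

end

section \<open>The expansion of the solution\<close>

text \<open>Displays the linearity in the direction as an inner product with a vector independent of
  \<open>c\<close>. Vector-valued moments can then be pulled out of the kernel by linearity of the
  integral.\<close>

lemma gK_inner: "gK c t x = c \<bullet> ((- heatG t x / (2 * t)) *\<^sub>R x)"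
 by (simp add: gK_def)

lemma hG_inner: "hG a c t x = c \<bullet> (heatG t x *\<^sub>R ((a \<bullet> x / (4 * t\<^sup>2)) *\<^sub>R x - (1 / (2 * t)) *\<^sub>R a))"
 by (simp add: hG_def inner_diff_right inner_commute algebra_simps)

lemma integral_gK_left:
 fixes g :: "real^4 \<Rightarrow> real"
 assumes i: "integrable lborel (\<lambda>y. g y *\<^sub>R y)"
 shows "integrable lborel (\<lambda>y. gK y t x * g y)" "(LI y. gK y t x * g y) = gK (LI y. g y *\<^sub>R y) t x"
proof -
 define w where "w = (- heatG t x / (2 * t)) *\<^sub>R x"
 have e: "gK y t x = y \<bullet> w" for y by (simp add: w_def gK_inner)
 have s: "y \<bullet> w * g y = (g y *\<^sub>R y) \<bullet> w" for y by simp
 show "integrable lborel (\<lambda>y. gK y t x * g y)" unfolding e s by (intro integrable_inner_left i)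
 show "(LI y. gK y t x * g y) = gK (LI y. g y *\<^sub>R y) t x"
  unfolding e s by (rule integral_inner_left) (rule i)
qed

lemma integral_hG_right:
 fixes g :: "real^4 \<Rightarrow> real"
 assumes i: "integrable lborel (\<lambda>y. g y *\<^sub>R y)"
 shows "integrable lborel (\<lambda>y. hG a y t x * g y)" "(LI y. hG a y t x * g y) = hG a (LI y. g y *\<^sub>R y) t x"
proof -
 define w where "w = heatG t x *\<^sub>R ((a \<bullet> x / (4 * t\<^sup>2)) *\<^sub>R x - (1 / (2 * t)) *\<^sub>R a)"
 have e: "hG a y t x = y \<bullet> w" for y by (simp add: w_def hG_inner)
 have s: "y \<bullet> w * g y = (g y *\<^sub>R y) \<bullet> w" for y by simp
 show "integrable lborel (\<lambda>y. hG a y t x * g y)" unfolding e s by (intro integrable_inner_left i)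
 show "(LI y. hG a y t x * g y) = hG a (LI y. g y *\<^sub>R y) t x"
  unfolding e s by (rule integral_inner_left) (rule i)
qed

lemma set_integral_hG_right:
 fixes F :: "real \<Rightarrow> real^4"
 assumes i: "set_integrable lborel S F"
 shows "set_integrable lborel S (\<lambda>s. hG a (F s) t x)" "(LINT s:S|lborel. hG a (F s) t x) = hG a (LINT s:S|lborel. F s) t x"
proof -
 define w where "w = heatG t x *\<^sub>R ((a \<bullet> x / (4 * t\<^sup>2)) *\<^sub>R x - (1 / (2 * t)) *\<^sub>R a)"
 have e: "hG a y t x = y \<bullet> w" for y by (simp add: w_def hG_inner)
 have s: "indicator S s *\<^sub>R (F s \<bullet> w) = (indicator S s *\<^sub>R F s) \<bullet> w" for s by simp
 show "set_integrable lborel S (\<lambda>s. hG a (F s) t x)"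
  using i unfolding e set_integrable_def s by (intro integrable_inner_left)
 show "(LINT s:S|lborel. hG a (F s) t x) = hG a (LINT s:S|lborel. F s) t x"
  using i unfolding e set_lebesgue_integral_def s set_integrable_def by (intro integral_inner_left)
qed

lemma nn_integral_polynomial_weight:
 fixes g :: "real^4 \<Rightarrow> real"
 assumes [measurable]: "g \<in> borel_measurable borel" and g: "\<And>k. k \<le> 3 \<Longrightarrow> nL (\<lambda>y. norm y ^ k * g y) \<le> ennreal (A k)"
  and p: "\<And>k. 0 \<le> c k" "\<And>k. 0 \<le> A k"
 shows "(NI y. ennreal ((\<Sum>k\<le>3. c k * norm y ^ k) * \<bar>g y\<bar>)) \<le> ennreal (\<Sum>k\<le>3. c k * A k)"
proof -
 have e: "ennreal ((\<Sum>k\<le>3. c k * norm y ^ k) * \<bar>g y\<bar>) = (\<Sum>k\<le>3. ennreal (c k) * ennreal \<bar>norm y ^ k * g y\<bar>)" for y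
 proof -
  have "(\<Sum>k\<le>3. c k * norm y ^ k) * \<bar>g y\<bar> = (\<Sum>k\<le>3. c k * \<bar>norm y ^ k * g y\<bar>)"
   by (simp add: sum_distrib_right abs_mult mult.assoc)
  then show ?thesis using p by (simp add: sum_ennreal[symmetric] ennreal_mult)
 qed
 have "(NI y. ennreal ((\<Sum>k\<le>3. c k * norm y ^ k) * \<bar>g y\<bar>)) = (\<Sum>k\<le>3. ennreal (c k) * nL (\<lambda>y. norm y ^ k * g y))"
  unfolding e by (subst nn_integral_sum) (auto simp: nn_integral_cmult)
 also have "\<dots> \<le> (\<Sum>k\<le>3. ennreal (c k) * ennreal (A k))" by (intro sum_mono mult_left_mono g) auto
 also have "\<dots> = ennreal (\<Sum>k\<le>3. c k * A k)" using p by (simp add: sum_ennreal[symmetric] ennreal_mult)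
 finally show ?thesis .
qed

section \<open>Remainders of the linear term and of both halves of Duhamel's formula\<close>

context mild_decay begin

text \<open>The third-order Taylor remainder of the kernel is of size |y|^3 t^(-3/2), and the third
  moment of the data is finite.\<close>

lemma linear_part:
 assumes t: "0 < t"
 shows "heat_small t (2 * kc * C / (t * sqrt t)) (\<lambda>x. heatS t (v 0) x - M * heatG t x + gK (LI y. v 0 y *\<^sub>R y) t x
   - (LI y. hG y y t x * v 0 y) / 2)"
proof -
 let ?K = "\<lambda>y x. heatG t (x - y) - heatG t x + gK y t x - hG y y t x / 2"
 let ?w = "\<lambda>y::real^4. kc * norm y ^ 3 / sqrt t ^ 3"
 have "heat_small t (2 * kc * C / (t * sqrt t)) (\<lambda>x. LI y. ?K y x * v 0 y)"
 proof (rule heat_small_integral[where w = ?w])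
  show "(\<lambda>(y, x). ?K y x) \<in> borel_measurable (lborel \<Otimes>\<^sub>M lborel)"
   unfolding gK_def hG_def by measurable
  show "heat_small t (?w y) (?K y)" for y
   unfolding heat_small_def
  proof (intro conjI allI)
   show "?K y \<in> borel_measurable borel" by measurable
  qed (rule taylor_heatG[OF t])+
  have "(NI y. ennreal (?w y * \<bar>v 0 y\<bar>)) = (NI y. ennreal (kc / sqrt t ^ 3) * ennreal \<bar>norm y ^ 3 * v 0 y\<bar>)"
   using t by (intro nn_integral_cong) (simp add: ennreal_mult[symmetric] abs_mult less_imp_le mult_ac)
  also have "\<dots> = ennreal (kc / sqrt t ^ 3) * nL (\<lambda>y. norm y ^ 3 * v 0 y)" by (rule nn_integral_cmult) measurable
  also have "\<dots> \<le> ennreal (kc / sqrt t ^ 3) * ennreal (2 * C)" by (intro mult_left_mono nL_v0_moment) auto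
  also have "\<dots> = ennreal (2 * kc * C / (t * sqrt t))"
   using t C_nonneg by (simp add: ennreal_mult[symmetric] sqrt_powers less_imp_le mult_ac)
  finally show "(NI y. ennreal (?w y * \<bar>v 0 y\<bar>)) \<le> ennreal (2 * kc * C / (t * sqrt t))" .
  show "0 \<le> 2 * kc * C / (t * sqrt t)" using t C_nonneg by (simp add: less_imp_le)
 qed (use t in auto)
 moreover have "(LI y. ?K y x * v 0 y) = heatS t (v 0) x - M * heatG t x + gK (LI y. v 0 y *\<^sub>R y) t x
   - (LI y. hG y y t x * v 0 y) / 2" for x
 proof -
  have i1: "integrable lborel (\<lambda>y. heatG t (x - y) * v 0 y)"
   by (rule integrable_conv_data[OF integrable_v _ abs_heatG_le[OF t]]) auto
  have iv: "integrable lborel (\<lambda>y. v 0 y *\<^sub>R y)"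
   by (rule vector_moment(1)[OF v_borel nL_v0_moment]) (use C_nonneg in auto)
  have i4: "integrable lborel (\<lambda>y. hG y y t x * v 0 y)"
  proof (rule weighted_moment(1)[OF v_borel _ _ _ nL_v0_moment[of 2]])
   show "\<bar>hG y y t x\<bar> \<le> kc / t * (1 / t\<^sup>2) * norm y ^ 2" for y
    using hG_abs_le[OF t, of y y x] by (simp add: power2_eq_square)
   show "(\<lambda>y. hG y y t x) \<in> borel_measurable borel" unfolding hG_def by measurable
  qed (use t C_nonneg in \<open>auto simp: less_imp_le\<close>)
  have "(LI y. ?K y x * v 0 y) = (LI y. heatG t (x - y) * v 0 y - heatG t x * v 0 y + gK y t x * v 0 y - hG y y t x * v 0 y / 2)"
   by (simp add: algebra_simps)
  also have "\<dots> = heatS t (v 0) x - heatG t x * M + gK (LI y. v 0 y *\<^sub>R y) t x - (LI y. hG y y t x * v 0 y) / 2"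
   using i1 i4 integral_gK_left[OF iv, of t x] by (simp add: conv_def M_def)
  finally show ?thesis by (simp add: mult.commute)
 qed
 ultimately show ?thesis by simp
qed

text \<open>Nothing is expanded on (t/2, t): the nonlinearity is of order t^(-2) in L^1 and t^(-4)
  in supremum, and the singular kernel integrates to sqrt t. The 16 is 2^4 from (t/2)^4, the 32 its
  double.\<close>

lemma late_part:
 assumes t: "0 < t"
 shows "heat_small t (32 * kc * norm a * C\<^sup>2 / (t * sqrt t)) (\<lambda>x. LINT s:{0<..<t/2}|lborel. heatP a (t / 2 - s) (f (t / 2 + s)) x)"
proof -
 let ?K = "16 * kc * norm a * C\<^sup>2 / t\<^sup>2"
 have K: "0 \<le> ?K" by (simp add: less_imp_le)
 show ?thesis
 proof (rule heat_small_time)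
  show "(\<lambda>(s, x). heatP a (t / 2 - s) (f (t / 2 + s)) x) \<in> borel_measurable (lborel \<Otimes>\<^sub>M lborel)"
   unfolding f_def[abs_def] by measurable
  fix s assume s: "s \<in> {0<..<t/2}"
  have r: "0 \<le> kc * norm a / sqrt (t / 2 - s)" using s by (simp add: less_imp_le)
  have p: "(t / 2) ^ n \<le> (1 + (t / 2 + s)) ^ n" for n using s t by (intro power_mono) auto
  show "heat_small t (?K * (1 / sqrt (t / 2 - s))) (heatP a (t / 2 - s) (f (t / 2 + s)))"
   unfolding heat_small_def
  proof (intro conjI allI)
   show "heatP a (t / 2 - s) (f (t / 2 + s)) \<in> borel_measurable borel" by measurable
   have "nL (heatP a (t / 2 - s) (f (t / 2 + s))) \<le> ennreal (kc * norm a / sqrt (t / 2 - s) * (C\<^sup>2 / (1 + (t / 2 + s))\<^sup>2))"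
    by (rule nL_heatP[OF _ f_borel f_bounds(1)]) (use s t in auto)
   also have "\<dots> \<le> ennreal (kc * norm a / sqrt (t / 2 - s) * (16 * C\<^sup>2 / t\<^sup>2))"
   proof (intro ennreal_leI mult_left_mono r)
    have "C\<^sup>2 / (1 + (t / 2 + s))\<^sup>2 \<le> C\<^sup>2 / (t / 2)\<^sup>2" using t s p[of 2] by (intro divide_left_mono) auto
    also have "\<dots> = 4 * C\<^sup>2 / t\<^sup>2" by (simp add: power_divide)
    also have "\<dots> \<le> 16 * C\<^sup>2 / t\<^sup>2" by (intro divide_right_mono) auto
    finally show "C\<^sup>2 / (1 + (t / 2 + s))\<^sup>2 \<le> 16 * C\<^sup>2 / t\<^sup>2" .
   qed
   also have "kc * norm a / sqrt (t / 2 - s) * (16 * C\<^sup>2 / t\<^sup>2) = ?K * (1 / sqrt (t / 2 - s))" by (simp add: mult_ac)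
   finally show "nL (heatP a (t / 2 - s) (f (t / 2 + s))) \<le> ennreal (?K * (1 / sqrt (t / 2 - s)))" .
   fix x
   have "\<bar>heatP a (t / 2 - s) (f (t / 2 + s)) x\<bar> \<le> kc * norm a / sqrt (t / 2 - s) * (C\<^sup>2 / (1 + (t / 2 + s)) ^ 4)"
    by (rule abs_heatP_le) (use s t f_bounds(2) in auto)
   also have "\<dots> \<le> kc * norm a / sqrt (t / 2 - s) * (16 * C\<^sup>2 / t ^ 4)"
   proof (intro mult_left_mono r)
    have "C\<^sup>2 / (1 + (t / 2 + s)) ^ 4 \<le> C\<^sup>2 / (t / 2) ^ 4" using t s p[of 4] by (intro divide_left_mono) auto
    then show "C\<^sup>2 / (1 + (t / 2 + s)) ^ 4 \<le> 16 * C\<^sup>2 / t ^ 4" by (simp add: power_divide mult.commute)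
   qed
   also have "\<dots> = ?K * (1 / sqrt (t / 2 - s)) / t\<^sup>2" by (simp add: eval_nat_numeral mult_ac)
   finally show "\<bar>heatP a (t / 2 - s) (f (t / 2 + s)) x\<bar> \<le> ?K * (1 / sqrt (t / 2 - s)) / t\<^sup>2" .
  qed
 next
  have "(nT {0<..<t/2} (\<lambda>s. ?K * (1 / sqrt (t / 2 - s)))) \<le> ennreal (?K * (2 * sqrt (t / 2 - 0)))"
   by (rule set_nn_integral_cmult) (use K t nn_integral_inverse_sqrt_reflect[of 0 "t / 2"] in auto)
  also have "\<dots> \<le> ennreal (?K * (2 * sqrt t))" using K t by (intro ennreal_leI mult_left_mono) auto
  also have "?K * (2 * sqrt t) = 32 * kc * norm a * C\<^sup>2 / (t * sqrt t)"
   using t by (simp add: field_simps power2_eq_square)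
  finally show "(nT {0<..<t/2} (\<lambda>s. ?K * (1 / sqrt (t / 2 - s)))) \<le> ennreal (32 * kc * norm a * C\<^sup>2 / (t * sqrt t))" .
 qed (use t in \<open>auto simp: less_imp_le\<close>)
qed

definition R :: "real \<Rightarrow> real \<Rightarrow> real^4 \<Rightarrow> real^4 \<Rightarrow> real" where
 "R t s y x = gK a (t - s) (x - y) - gK a t x + hG a y t x + s * lK a t x - tG a y y t x / 2"

lemma rem_size_sum: "rem_size t s y = (\<Sum>k\<le>3. (if k = 0 then s\<^sup>2 / sqrt t ^ 5 else if k = 1 then s / sqrt t ^ 4 else if k = 2 then s / sqrt t ^ 5 else 1 / sqrt t ^ 4) * norm y ^ k)"
 by (simp add: rem_size_def atMost_Suc numeral_3_eq_3 power2_eq_square mult_ac)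

text \<open>Each summand of \<open>rem_size\<close> is paired with the moment of the matching order.
  Dividing the powers of s and |y| by the diffusive scale leaves t^(-2) s^(-1/2) or t^(-5/2), and
  both integrate over (0, t/2) to order t^(-3/2).\<close>

lemma early_part:
 assumes t: "0 < t"
 shows "heat_small t (288 * kc * norm a * C\<^sup>2 / (t * sqrt t)) (\<lambda>x. LINT s:{0<..<t/2}|lborel. (LI y. R t s y x * f s y))"
proof -
 let ?K = "24 * kc * norm a * (4 * C\<^sup>2)"
 let ?\<alpha> = "\<lambda>s. ?K * (1 / t\<^sup>2 * (1 / sqrt s) + 1 / (t\<^sup>2 * sqrt t))"
 have K: "0 \<le> ?K" by (simp add: less_imp_le)
 show ?thesis
 proof (rule heat_small_time)
  show "(\<lambda>(s, x). LI y. R t s y x * f s y) \<in> borel_measurable (lborel \<Otimes>\<^sub>M lborel)"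
   unfolding R_def by measurable
  fix s assume s: "s \<in> {0<..<t/2}"
  define c where "c k = (if k = 0 then s\<^sup>2 / sqrt t ^ 5 else if k = 1 then s / sqrt t ^ 4 else if k = 2 then s / sqrt t ^ 5 else 1 / sqrt t ^ 4)" for k :: nat
  let ?w = "\<lambda>y. 24 * kc * norm a * rem_size t s y"
  show "heat_small t (?\<alpha> s) (\<lambda>x. LI y. R t s y x * f s y)"
  proof (rule heat_small_integral[where w = ?w])
   show "(\<lambda>(y, x). R t s y x) \<in> borel_measurable (lborel \<Otimes>\<^sub>M lborel)"
    unfolding R_def by measurable
   show "heat_small t (?w y) (R t s y)" for y
    unfolding heat_small_def
   proof (intro conjI allI)
    show "R t s y \<in> borel_measurable borel" unfolding R_def by measurable
    show "nL (R t s y) \<le> ennreal (?w y)" unfolding R_def by (rule kernel_remainder(1)) (use s t in auto)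
    show "\<bar>R t s y x\<bar> \<le> ?w y / t\<^sup>2" for x unfolding R_def by (rule kernel_remainder(2)) (use s t in auto)
   qed
   have "(NI y. ennreal (?w y * \<bar>f s y\<bar>)) = (NI y. ennreal ((\<Sum>k\<le>3. (24 * kc * norm a * c k) * norm y ^ k) * \<bar>f s y\<bar>))"
    unfolding rem_size_sum c_def[symmetric] by (simp add: sum_distrib_left mult_ac)
   also have "\<dots> \<le> ennreal (\<Sum>k\<le>3. (24 * kc * norm a * c k) * (2 * C\<^sup>2 * sqrt (1 + s) ^ k / sqrt (1 + s) ^ 4))"
    by (rule nn_integral_polynomial_weight[OF f_borel nL_f_moment]) (use s t in \<open>auto simp: c_def less_imp_le\<close>)
   also have "\<dots> \<le> ennreal (?\<alpha> s)"
   proof (rule ennreal_leI)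
    \<comment> \<open>With s \<le> r^2 and sqrt s \<le> r, the terms of order 0 and 2 fall under
      t^(-5/2), those of order 1 and 3 under t^(-2) s^(-1/2).\<close>
    define r where "r = sqrt (1 + s)"
    have r: "0 < r" "sqrt s \<le> r" "s \<le> r\<^sup>2" using s by (auto simp: r_def)
    have ss: "0 < sqrt s" "0 < s" using s by auto
    have s4: "s\<^sup>2 \<le> r ^ 4" using power_mono[OF r(3), of 2] s by simp
    have 0: "c 0 * (r ^ 0 / r ^ 4) \<le> 1 / (t\<^sup>2 * sqrt t)"
    proof -
     have "c 0 * (r ^ 0 / r ^ 4) = s\<^sup>2 / r ^ 4 * (1 / (t\<^sup>2 * sqrt t))" using t by (simp add: c_def sqrt_powers)
     also have "\<dots> \<le> 1 * (1 / (t\<^sup>2 * sqrt t))" using s4 r t by (intro mult_right_mono) auto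
     finally show ?thesis by simp
    qed
    have 3: "1 / r \<le> 1 / sqrt s" using frac_le[of 1 1 "sqrt s" r] r(2) ss(1) by simp
    have 1: "c 1 * (r ^ 1 / r ^ 4) \<le> 1 / t\<^sup>2 * (1 / sqrt s)"
    proof -
     have "c 1 * (r ^ 1 / r ^ 4) = 1 / t\<^sup>2 * (s / r\<^sup>2 * (1 / r))" using t r by (simp add: c_def sqrt_powers eval_nat_numeral)
     also have "\<dots> \<le> 1 / t\<^sup>2 * (1 * (1 / sqrt s))" using r 3 by (intro mult_left_mono mult_mono) auto
     finally show ?thesis by simp
    qed
    have 2: "c 2 * (r ^ 2 / r ^ 4) \<le> 1 / (t\<^sup>2 * sqrt t)"
    proof -
     have "c 2 * (r ^ 2 / r ^ 4) = s / r\<^sup>2 * (1 / (t\<^sup>2 * sqrt t))" using t r by (simp add: c_def sqrt_powers eval_nat_numeral)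
     also have "\<dots> \<le> 1 * (1 / (t\<^sup>2 * sqrt t))" using r t by (intro mult_right_mono) auto
     finally show ?thesis by simp
    qed
    have 3: "c 3 * (r ^ 3 / r ^ 4) \<le> 1 / t\<^sup>2 * (1 / sqrt s)"
    proof -
     have "c 3 * (r ^ 3 / r ^ 4) = 1 / t\<^sup>2 * (1 / r)" using t r by (simp add: c_def sqrt_powers eval_nat_numeral)
     also have "\<dots> \<le> 1 / t\<^sup>2 * (1 / sqrt s)" by (intro mult_left_mono 3) auto
     finally show ?thesis .
    qed
    have "(\<Sum>k\<le>3. (24 * kc * norm a * c k) * (2 * C\<^sup>2 * r ^ k / r ^ 4)) = 24 * kc * norm a * (2 * C\<^sup>2) * (\<Sum>k\<le>3. c k * (r ^ k / r ^ 4))"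
     by (simp add: sum_distrib_left mult_ac)
    also have "\<dots> \<le> 24 * kc * norm a * (2 * C\<^sup>2) * (2 * (1 / t\<^sup>2 * (1 / sqrt s)) + 2 * (1 / (t\<^sup>2 * sqrt t)))"
    proof (rule mult_left_mono)
     have "(\<Sum>k\<le>3. c k * (r ^ k / r ^ 4)) = c 0 * (r ^ 0 / r ^ 4) + c 1 * (r ^ 1 / r ^ 4) + c 2 * (r ^ 2 / r ^ 4) + c 3 * (r ^ 3 / r ^ 4)"
      by (simp add: eval_nat_numeral)
     then show "(\<Sum>k\<le>3. c k * (r ^ k / r ^ 4)) \<le> 2 * (1 / t\<^sup>2 * (1 / sqrt s)) + 2 * (1 / (t\<^sup>2 * sqrt t))"
      using 0 1 2 3 by linarith
    qed (simp add: less_imp_le)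
    also have "\<dots> = ?\<alpha> s" by (simp add: algebra_simps)
    finally show "(\<Sum>k\<le>3. (24 * kc * norm a * c k) * (2 * C\<^sup>2 * sqrt (1 + s) ^ k / sqrt (1 + s) ^ 4)) \<le> ?\<alpha> s"
     unfolding r_def .
   qed
   finally show "(NI y. ennreal (?w y * \<bar>f s y\<bar>)) \<le> ennreal (?\<alpha> s)" .
   show "0 \<le> ?\<alpha> s" by (rule mult_nonneg_nonneg[OF K]) (use s t in auto)
   show "?w \<in> borel_measurable borel" unfolding rem_size_def by measurable
  qed (use t in auto)
 next
  have "(nT {0<..<t/2} (\<lambda>s. ?\<alpha> s)) \<le> ennreal (?K * (1 / t\<^sup>2 * (2 * sqrt (t / 2)) + 1 / (t\<^sup>2 * sqrt t) * (t / 2)))"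
  proof (rule set_nn_integral_cmult)
   show "(nT {0<..<t/2} (\<lambda>s. 1 / t\<^sup>2 * (1 / sqrt s) + 1 / (t\<^sup>2 * sqrt t))) \<le> ennreal (1 / t\<^sup>2 * (2 * sqrt (t / 2)) + 1 / (t\<^sup>2 * sqrt t) * (t / 2))"
   proof (rule set_nn_integral_add)
    show "(nT {0<..<t/2} (\<lambda>s. 1 / t\<^sup>2 * (1 / sqrt s))) \<le> ennreal (1 / t\<^sup>2 * (2 * sqrt (t / 2)))"
     by (rule set_nn_integral_cmult) (use t nn_integral_inverse_sqrt[of "t / 2"] in auto)
    show "(nT {0<..<t/2} (\<lambda>s. 1 / (t\<^sup>2 * sqrt t))) \<le> ennreal (1 / (t\<^sup>2 * sqrt t) * (t / 2))"
     using t by (simp add: nn_integral_cmult_indicator ennreal_mult'[symmetric])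
   qed (use t in auto)
  qed (use K in auto)
  also have "\<dots> \<le> ennreal (?K * (3 / (t * sqrt t)))"
  proof (intro ennreal_leI mult_left_mono K)
   have "1 / t\<^sup>2 * (2 * sqrt (t / 2)) \<le> 1 / t\<^sup>2 * (2 * sqrt t)" using t by (intro mult_left_mono) auto
   also have "\<dots> = 2 / (t * sqrt t)" using t by (simp add: field_simps power2_eq_square)
   finally have 1: "1 / t\<^sup>2 * (2 * sqrt (t / 2)) \<le> 2 / (t * sqrt t)" .
   have "1 / (t\<^sup>2 * sqrt t) * (t / 2) = (1 / 2) / (t * sqrt t)" using t by (simp add: power2_eq_square)
   also have "\<dots> \<le> 1 / (t * sqrt t)" using t by (intro divide_right_mono) auto
   finally have 2: "1 / (t\<^sup>2 * sqrt t) * (t / 2) \<le> 1 / (t * sqrt t)" .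
   have "2 / (t * sqrt t) + 1 / (t * sqrt t) = 3 / (t * sqrt t)" unfolding add_divide_distrib[symmetric] by simp
   with add_mono[OF 1 2] show "1 / t\<^sup>2 * (2 * sqrt (t / 2)) + 1 / (t\<^sup>2 * sqrt t) * (t / 2) \<le> 3 / (t * sqrt t)" by metis
  qed
  also have "?K * (3 / (t * sqrt t)) = 288 * kc * norm a * C\<^sup>2 / (t * sqrt t)" by simp
  finally show "(nT {0<..<t/2} (\<lambda>s. ?\<alpha> s)) \<le> ennreal (288 * kc * norm a * C\<^sup>2 / (t * sqrt t))" .
 qed (use t in \<open>auto simp: less_imp_le\<close>)
qed

end

section \<open>Leading terms and the logarithm\<close>

context mild_decay begin

definition F1 :: "real \<Rightarrow> real^4" where "F1 s = (LI y. f s y *\<^sub>R y)"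

definition TT :: "real \<Rightarrow> real^4 \<Rightarrow> real \<Rightarrow> real" where "TT t x s = (LI y. tG a y y t x * f s y)"

definition I0 :: real where "I0 = (LINT s:{0<..}|lborel. F0 s)"

definition V :: "real^4" where "V = (LINT s:{0<..}|lborel. F1 s)"

lemma borel_measurable_F [measurable]: "F0 \<in> borel_measurable borel" "F1 \<in> borel_measurable borel" "TT t x \<in> borel_measurable borel"
 unfolding F0_def[abs_def] F1_def[abs_def] TT_def[abs_def] by measurable

lemma F0_tail:
 assumes "0 < r"
 shows "set_integrable lborel {0<..} F0" "\<bar>I0 - (LINT s:{0<..<r}|lborel. F0 s)\<bar> \<le> C\<^sup>2 / (1 + r)"
proof -
 have b: "norm (F0 s) \<le> C\<^sup>2 * (1 + s) powr - 2" if "0 < s" for s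
  using F0_le[of s] that by (simp add: powr_minus_divide)
 show "set_integrable lborel {0<..} F0" by (rule powr_tail(1)[OF _ b _ _ assms]) auto
 have "norm (I0 - (LINT s:{0<..<r}|lborel. F0 s)) \<le> C\<^sup>2 * ((1 + r) powr (1 - 2) / (2 - 1))"
  unfolding I0_def by (rule powr_tail(2)[OF _ b _ _ assms]) auto
 then show "\<bar>I0 - (LINT s:{0<..<r}|lborel. F0 s)\<bar> \<le> C\<^sup>2 / (1 + r)"
  using assms by (simp add: powr_minus_divide)
qed

lemma f_vector_moment:
 assumes "0 \<le> s"
 shows "integrable lborel (\<lambda>y. f s y *\<^sub>R y)" "norm (F1 s) \<le> 2 * C\<^sup>2 * (1 + s) powr - (3/2)"
proof -
 let ?A = "2 * C\<^sup>2 * sqrt (1 + s) ^ 1 / sqrt (1 + s) ^ 4"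
 have m: "nL (\<lambda>y. norm y ^ 1 * f s y) \<le> ennreal ?A" by (rule nL_f_moment) (use assms in auto)
 show "integrable lborel (\<lambda>y. f s y *\<^sub>R y)" by (rule vector_moment(1)[OF f_borel m]) (use assms in auto)
 have "norm (F1 s) \<le> ?A" unfolding F1_def by (rule vector_moment(2)[OF f_borel m]) (use assms in auto)
 also have "?A = 2 * C\<^sup>2 / sqrt (1 + s) ^ 3" using assms by (simp add: eval_nat_numeral)
 also have "sqrt (1 + s) ^ 3 = (1 + s) powr (3/2)"
  using assms by (simp add: powr_half_sqrt[symmetric] powr_power)
 finally show "norm (F1 s) \<le> 2 * C\<^sup>2 * (1 + s) powr - (3/2)" by (simp add: powr_minus_divide)
qed

text \<open>The tail of the first moment is only of order t^(-1/2); the missing t^(-1) is supplied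
  by \<open>hG\<close> when the full integral V replaces the integral up to t/2.\<close>

lemma F1_tail:
 assumes "0 < r"
 shows "set_integrable lborel {0<..} F1" "norm (V - (LINT s:{0<..<r}|lborel. F1 s)) \<le> 4 * C\<^sup>2 / sqrt (1 + r)"
proof -
 have b: "norm (F1 s) \<le> 2 * C\<^sup>2 * (1 + s) powr - (3/2)" if "0 < s" for s
  using f_vector_moment(2)[of s] that by simp
 show "set_integrable lborel {0<..} F1" by (rule powr_tail(1)[OF _ b _ _ assms]) auto
 have "norm (V - (LINT s:{0<..<r}|lborel. F1 s)) \<le> 2 * C\<^sup>2 * ((1 + r) powr (1 - 3/2) / (3/2 - 1))"
  unfolding V_def by (rule powr_tail(2)[OF _ b _ _ assms]) auto
 also have "\<dots> = 4 * C\<^sup>2 / sqrt (1 + r)"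
  using assms by (simp add: powr_minus_divide powr_half_sqrt)
 finally show "norm (V - (LINT s:{0<..<r}|lborel. F1 s)) \<le> 4 * C\<^sup>2 / sqrt (1 + r)" .
qed

lemma integrable_tG_f:
 assumes "0 < t" "0 \<le> s"
 shows "integrable lborel (\<lambda>y. tG a y y t x * f s y)"
proof (rule weighted_moment(1)[OF f_borel _ _ _ nL_f_moment[OF assms(2), of 2]])
 show "(\<lambda>y. tG a y y t x) \<in> borel_measurable borel" by measurable
 show "\<bar>tG a y y t x\<bar> \<le> kc * norm a / sqrt t ^ 3 * heatG (2 * t) x * norm y ^ 2" for y
  using tG_bound[OF assms(1), of a y y x] by (simp add: power2_eq_square mult_ac)
qed (use assms in \<open>auto simp: less_imp_le\<close>)

text \<open>\<open>tG a y y\<close> is a quadratic form in y, so its integral depends only on the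
  second moments of f. To leading order these are isotropic, and contracting the form with the
  identity yields the Laplacian of \<open>gK a\<close>, that is \<open>lK a\<close>.\<close>

lemma TT_asymptotics:
 assumes t: "0 < t" and s: "0 < s"
 shows "\<bar>TT t x s - c0 * lK a t x / (1 + s)\<bar> \<le> D1 * (norm a * (2 * mc 1 + mc 3) / (t * sqrt t) * heatG (2 * t) x) * (1 + s) powr - (7/6)"
proof -
 let ?G = "heatG t x"
 define p where "p = D1 * (1 + s) powr - (7/6)"
 have p: "0 \<le> p" by (simp add: p_def)
 define w where "w = c0 * (1 / (1 + s))"
 define S where "S = (LI y. (y \<bullet> y) * f s y)"
 have yy: "y \<bullet> y * f s y = (\<Sum>b\<in>Basis. (b \<bullet> y) * (b \<bullet> y) * f s y)" for y :: "real^4"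
  by (subst euclidean_inner) (simp add: sum_distrib_right inner_commute)
 have iS: "integrable lborel (\<lambda>y. (y \<bullet> y) * f s y)"
  unfolding yy by (intro Bochner_Integration.integrable_sum integrable_I2) (use s in auto)
 have S: "S = (\<Sum>b\<in>Basis. I2 b b s)"
  unfolding S_def yy I2_def by (rule Bochner_Integration.integral_sum) (use integrable_I2 s in auto)
 have d: "\<bar>I2 b c s - w * (b \<bullet> c)\<bar> \<le> norm b * norm c * p" for b c
  using I2_asymptotics[OF s, of b c] by (simp add: w_def p_def mult_ac)
 \<comment> \<open>The trace of the second-moment matrix: one w per dimension.\<close>
 have dS: "\<bar>S - 4 * w\<bar> \<le> 4 * p"
 proof -
  have "S - 4 * w = (\<Sum>b\<in>Basis. I2 b b s - w * (b \<bullet> b))"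
   unfolding S by (simp add: sum_subtractf inner_Basis)
  also have "\<bar>\<dots>\<bar> \<le> (\<Sum>b\<in>(Basis::(real^4) set). p)"
  proof (rule sum_abs[THEN order_trans], rule sum_mono)
   fix b :: "real^4" assume "b \<in> Basis"
   then show "\<bar>I2 b b s - w * (b \<bullet> b)\<bar> \<le> p" using d[of b b] by simp
  qed
  finally show ?thesis by simp
 qed
 have T: "TT t x s = ((2 * I2 a x s + (a \<bullet> x) * S) * (1 / (4 * t\<^sup>2)) - (a \<bullet> x) * I2 x x s * (1 / (8 * t ^ 3))) * ?G"
 proof -
  have "tG a y y t x * f s y = (1 / (4 * t\<^sup>2) * (2 * ((a \<bullet> y) * (x \<bullet> y) * f s y) + (a \<bullet> x) * ((y \<bullet> y) * f s y))
    - (a \<bullet> x) * (1 / (8 * t ^ 3)) * ((x \<bullet> y) * (x \<bullet> y) * f s y)) * ?G" for y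
   unfolding tG_def inner_commute[of y x] by (simp only: ring_inv)
  note e = this
  have lin: "(LI y. (u * (2 * p1 y + k * p2 y) - k * u' * p3 y) * g) = ((2 * integral\<^sup>L lborel p1 + k * integral\<^sup>L lborel p2) * u - k * integral\<^sup>L lborel p3 * u') * g"
   if "integrable lborel p1" "integrable lborel p2" "integrable lborel p3" for p1 p2 p3 :: "real^4 \<Rightarrow> real" and u u' k g :: real
   using that by (simp add: mult_ac)
  show ?thesis
   unfolding TT_def I2_def S_def e by (rule lin[OF integrable_I2 iS integrable_I2]) (use s in auto)
 qed
 \<comment> \<open>Coefficient matching: the isotropic moments give 2 w from the two mixed terms and
   4 w from the trace, which is the 6 here.\<close>
 have K: "lK a t x = (6 * (a \<bullet> x) * (1 / (4 * t\<^sup>2)) - (a \<bullet> x) * (x \<bullet> x) * (1 / (8 * t ^ 3))) * ?G"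
  using t by (simp add: lK_def field_simps power2_eq_square power3_eq_cube del: dot_square_norm)
 have "TT t x s - w * lK a t x = ((2 * (I2 a x s - w * (a \<bullet> x)) + (a \<bullet> x) * (S - 4 * w)) * (1 / (4 * t\<^sup>2)) - (a \<bullet> x) * (I2 x x s - w * (x \<bullet> x)) * (1 / (8 * t ^ 3))) * ?G"
  unfolding T K by (simp only: algebra_simps)
 also have "\<bar>\<dots>\<bar> \<le> ((2 * (norm a * norm x * p) + (norm a * norm x) * (4 * p)) * (1 / (4 * t\<^sup>2)) + (norm a * norm x) * (norm x * norm x * p) * (1 / (8 * t ^ 3))) * ?G"
 proof -
  have 1: "\<bar>2 * (I2 a x s - w * (a \<bullet> x)) + (a \<bullet> x) * (S - 4 * w)\<bar> \<le> 2 * (norm a * norm x * p) + (norm a * norm x) * (4 * p)"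
   by (rule order_trans[OF abs_triangle_ineq], unfold abs_mult) (intro add_mono mult_mono d dS abs_inner_le; simp)
  have 2: "\<bar>(a \<bullet> x) * (I2 x x s - w * (x \<bullet> x))\<bar> \<le> (norm a * norm x) * (norm x * norm x * p)"
   unfolding abs_mult by (intro mult_mono d abs_inner_le) auto
  have 3: "\<bar>(X * u - Y * u') * g\<bar> \<le> (X' * u + Y' * u') * g" if "\<bar>X\<bar> \<le> X'" "\<bar>Y\<bar> \<le> Y'" "0 \<le> u" "0 \<le> u'" "0 \<le> g" for X Y X' Y' u u' g :: real
  proof -
   have "\<bar>X * u - Y * u'\<bar> \<le> \<bar>X\<bar> * u + \<bar>Y\<bar> * u'" using abs_triangle_ineq4[of "X * u" "Y * u'"] that by (simp add: abs_mult)
   also have "\<dots> \<le> X' * u + Y' * u'" by (intro add_mono mult_right_mono that)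
   finally have "\<bar>X * u - Y * u'\<bar> * g \<le> (X' * u + Y' * u') * g" by (rule mult_right_mono) (rule that)
   then show ?thesis using that by (simp add: abs_mult)
  qed
  show ?thesis by (rule 3[OF 1 2]) (use t in auto)
 qed
 also have "\<dots> = norm a * p * (3 / (2 * t\<^sup>2) * (norm x ^ 1 * ?G) + 1 / (8 * t ^ 3) * (norm x ^ 3 * ?G))"
  by (simp add: power3_eq_cube algebra_simps)
 also have "\<dots> \<le> norm a * p * (3 / (2 * t\<^sup>2) * (mc 1 * sqrt t ^ 1 * heatG (2 * t) x) + 1 / (8 * t ^ 3) * (mc 3 * sqrt t ^ 3 * heatG (2 * t) x))"
  using p t by (intro mult_left_mono add_mono heatG_moment t) auto
 also have "\<dots> \<le> norm a * p * ((2 * mc 1 + mc 3) / (t * sqrt t) * heatG (2 * t) x)"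
 proof (rule mult_left_mono)
  have tt: "sqrt t / t\<^sup>2 = 1 / (t * sqrt t)" using t by (simp add: field_simps power2_eq_square)
  have "3 / (2 * t\<^sup>2) * (mc 1 * sqrt t ^ 1 * heatG (2 * t) x) = 3 / 2 * (sqrt t / t\<^sup>2) * (mc 1 * heatG (2 * t) x)" by simp
  also have "\<dots> \<le> 2 * (1 / (t * sqrt t)) * (mc 1 * heatG (2 * t) x)"
   unfolding tt using t by (intro mult_right_mono) (auto simp: less_imp_le)
  finally have 1: "3 / (2 * t\<^sup>2) * (mc 1 * sqrt t ^ 1 * heatG (2 * t) x) \<le> 2 * (1 / (t * sqrt t)) * (mc 1 * heatG (2 * t) x)" .
  have "1 / (8 * t ^ 3) * (mc 3 * sqrt t ^ 3 * heatG (2 * t) x) = 1 / 8 * (sqrt t / t\<^sup>2) * (mc 3 * heatG (2 * t) x)"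
   using t by (simp add: sqrt_powers power3_eq_cube power2_eq_square)
  also have "\<dots> \<le> 1 * (1 / (t * sqrt t)) * (mc 3 * heatG (2 * t) x)"
   unfolding tt using t by (intro mult_right_mono) (auto simp: less_imp_le)
  finally have 2: "1 / (8 * t ^ 3) * (mc 3 * sqrt t ^ 3 * heatG (2 * t) x) \<le> 1 * (1 / (t * sqrt t)) * (mc 3 * heatG (2 * t) x)" .
  have "2 * (1 / (t * sqrt t)) * (mc 1 * heatG (2 * t) x) + 1 * (1 / (t * sqrt t)) * (mc 3 * heatG (2 * t) x) = (2 * mc 1 + mc 3) / (t * sqrt t) * heatG (2 * t) x"
   by (simp add: divide_inverse algebra_simps)
  with add_mono[OF 1 2] show "3 / (2 * t\<^sup>2) * (mc 1 * sqrt t ^ 1 * heatG (2 * t) x) + 1 / (8 * t ^ 3) * (mc 3 * sqrt t ^ 3 * heatG (2 * t) x) \<le> (2 * mc 1 + mc 3) / (t * sqrt t) * heatG (2 * t) x"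
   by metis
 qed (use p in auto)
 finally show ?thesis by (simp add: w_def p_def mult_ac)
qed

lemma abs_heatP_f_le:
 assumes "0 \<le> s" "s < t"
 shows "\<bar>heatP a (t - s) (f s) x\<bar> \<le> kc * norm a * C\<^sup>2 * (1 / sqrt (t - s))"
proof -
 have "f s y \<le> C\<^sup>2" for y
 proof -
  have "C\<^sup>2 / (1 + s) ^ 4 \<le> C\<^sup>2 / 1" using assms by (intro divide_left_mono one_le_power) auto
  then show ?thesis using f_bounds(2)[OF assms(1), of y] by simp
 qed
 then have "\<bar>heatP a (t - s) (f s) x\<bar> \<le> kc * norm a / sqrt (t - s) * C\<^sup>2"
  by (intro abs_heatP_le) (use assms in auto)
 then show ?thesis by (simp add: mult_ac)
qed

lemma set_integrable_heatP_f:
 assumes "0 < t"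
 shows "set_integrable lborel {0<..<t} (\<lambda>s. heatP a (t - s) (f s) x)"
proof (rule set_integrableI_bounded_by)
 show "(\<lambda>s. heatP a (t - s) (f s) x) \<in> borel_measurable borel" unfolding f_def[abs_def] by measurable
 show "\<bar>heatP a (t - s) (f s) x\<bar> \<le> kc * norm a * C\<^sup>2 * (1 / sqrt (t - s))" if "s \<in> {0<..<t}" for s
  using abs_heatP_f_le that by auto
 show "(nT {0<..<t} (\<lambda>s. kc * norm a * C\<^sup>2 * (1 / sqrt (t - s)))) \<le> ennreal (kc * norm a * C\<^sup>2 * (2 * sqrt (t - 0)))"
  by (rule set_nn_integral_cmult) (use assms nn_integral_inverse_sqrt_reflect[of 0 t] in \<open>auto simp: less_imp_le\<close>)
qed simp

lemma duhamel_halves: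
 assumes "0 < t"
 shows "v t x = heatS t (v 0) x + ((LINT s:{0<..<t/2}|lborel. heatP a (t - s) (f s) x)
  + (LINT s:{0<..<t/2}|lborel. heatP a (t / 2 - s) (f (t / 2 + s)) x))"
proof -
 have "set_integrable lborel {0<..<t/2 + t/2} (\<lambda>s. heatP a (t - s) (f s) x)" using set_integrable_heatP_f[OF assms, of x] by simp
 from interval_split_shift[OF this] assms
 have "(LINT s:{0<..<t}|lborel. heatP a (t - s) (f s) x) = (LINT s:{0<..<t/2}|lborel. heatP a (t - s) (f s) x)
  + (LINT s:{0<..<t/2}|lborel. heatP a (t - (t / 2 + s)) (f (t / 2 + s)) x)" by simp
 moreover have "t - (t / 2 + s) = t / 2 - s" for s by simp
 ultimately show ?thesis using v_eq[OF assms] by simp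
qed

lemma early_part_eq:
 assumes t: "2 \<le> t"
 shows "(LINT s:{0<..<t/2}|lborel. (LI y. R t s y x * f s y))
  = (LINT s:{0<..<t/2}|lborel. heatP a (t - s) (f s) x) - gK a t x * (LINT s:{0<..<t/2}|lborel. F0 s)
   + hG a (LINT s:{0<..<t/2}|lborel. F1 s) t x + lK a t x * (LINT s:{0<..<t/2}|lborel. s * F0 s) - (LINT s:{0<..<t/2}|lborel. TT t x s) / 2"
proof -
 have t0: "0 < t" using t by simp
 let ?S = "{0<..<t/2}"
 have "?S \<subseteq> {0<..<t}" "?S \<subseteq> {0<..}" using t by auto
 note sub = set_integrable_subset[OF _ _ this(1)] set_integrable_subset[OF _ _ this(2)]
 have i1: "set_integrable lborel ?S (\<lambda>s. heatP a (t - s) (f s) x)" by (rule sub(1)[OF set_integrable_heatP_f[OF t0]]) simp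
 have i2: "set_integrable lborel ?S (\<lambda>s. gK a t x * F0 s)"
  by (rule set_integrable_mult_right[OF sub(2)[OF F0_tail(1)[of 1]]]) auto
 have iF1: "set_integrable lborel ?S F1" by (rule sub(2)[OF F1_tail(1)[of 1]]) auto
 note i3 = set_integral_hG_right[OF iF1, of a t x]
 have i4: "set_integrable lborel ?S (\<lambda>s. lK a t x * (s * F0 s))"
  by (rule set_integrable_mult_right[OF log_integral_bound(2)[OF _ D1_nonneg F0_asymptotics t]]) auto
 have i5: "set_integrable lborel ?S (TT t x)"
  by (rule log_integral_bound(2)[OF _ _ TT_asymptotics[OF t0] t]) (use t0 in \<open>auto simp: less_imp_le\<close>)
 have e: "(LI y. R t s y x * f s y) = heatP a (t - s) (f s) x - gK a t x * F0 s + hG a (F1 s) t x + lK a t x * (s * F0 s) - TT t x s / 2"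
  if s: "s \<in> ?S" for s
 proof -
  have s0: "0 \<le> s" "0 < t - s" using s t by auto
  have j1: "integrable lborel (\<lambda>y. gK a (t - s) (x - y) * f s y)"
   by (rule integrable_conv_data[OF integrable_f[OF s0(1)] _ gK_abs_le[OF s0(2)]]) measurable
  note j3 = integral_hG_right[OF f_vector_moment(1)[OF s0(1)], of a t x]
  note j5 = integrable_tG_f[OF t0 s0(1), of x]
  have "(LI y. R t s y x * f s y) = (LI y. gK a (t - s) (x - y) * f s y - gK a t x * f s y + hG a y t x * f s y + s * lK a t x * f s y - tG a y y t x * f s y / 2)"
   by (simp add: R_def algebra_simps)
  also have "\<dots> = heatP a (t - s) (f s) x - gK a t x * F0 s + hG a (F1 s) t x + s * lK a t x * F0 s - TT t x s / 2"
   using j1 j3 j5 s0 by (simp add: conv_def F0_def F1_def TT_def)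
  finally show ?thesis by (simp add: mult_ac)
 qed
 have "(LINT s:?S|lborel. (LI y. R t s y x * f s y))
  = (LINT s:?S|lborel. heatP a (t - s) (f s) x - gK a t x * F0 s + hG a (F1 s) t x + lK a t x * (s * F0 s) - TT t x s / 2)"
  by (rule set_lebesgue_integral_cong) (use e in auto)
 also have "\<dots> = (LINT s:?S|lborel. heatP a (t - s) (f s) x) - (LINT s:?S|lborel. gK a t x * F0 s)
   + (LINT s:?S|lborel. hG a (F1 s) t x) + (LINT s:?S|lborel. lK a t x * (s * F0 s)) - (LINT s:?S|lborel. TT t x s / 2)"
  by (simp add: set_integral_add set_integral_diff i1 i2 i3(1) i4 i5)
 finally show ?thesis using i3(2) by simp
qed

text \<open>The expression inside the norm of the theorem, in kernel notation. The time shift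
  contributes -c0 and half the second moments +c0/2 to the coefficient of lK a ln t; the net -c0/2
  is what is added back, and c0/2 = M^2/(128 pi^2).\<close>

definition W :: "real \<Rightarrow> real^4 \<Rightarrow> real" where
 "W t x = v t x - M * heatG t x - gK (- (LI y. v 0 y *\<^sub>R y) + I0 *\<^sub>R a) t x - (LI y. hG y y t x * v 0 y) / 2
   + hG a V t x + c0 / 2 * lK a t x * ln t"

text \<open>Besides the three Taylor and late-time remainders, four errors arise from completing the
  time integrals: A4 and A5 for the tails of mass and first moment, A6 and A7 for replacing the
  borderline integrals by c0 ln t. Each tail or bounded error meets a kernel whose order brings the
  total to t^(-3/2).\<close>

lemma expansion: "\<exists>A. \<forall>t\<ge>2. heat_small t (A / (t * sqrt t)) (W t)"
proof -
 define A4 where "A4 = 2 * C\<^sup>2 * (kc * norm a)"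
 define A5 where "A5 = kc * norm a * (8 * C\<^sup>2)"
 define A6 where "A6 = (6 * D1 + c0) * (kc * norm a)"
 define A7 where "A7 = 6 * D1 * (norm a * (2 * mc 1 + mc 3)) + c0 * (kc * norm a)"
 define A where "A = 2 * kc * C + 32 * kc * norm a * C\<^sup>2 + 288 * kc * norm a * C\<^sup>2 + A4 + A5 + A6 + 1 / 2 * A7"
 have "heat_small t (A / (t * sqrt t)) (W t)" if t: "2 \<le> t" for t
 proof -
  have t0: "0 < t" and tt: "0 < t * sqrt t" using t by auto
  let ?r = "t * sqrt t"
  let ?I0 = "LINT s:{0<..<t/2}|lborel. F0 s" let ?I1 = "LINT s:{0<..<t/2}|lborel. F1 s"
  let ?J = "LINT s:{0<..<t/2}|lborel. s * F0 s" let ?T = "\<lambda>x. LINT s:{0<..<t/2}|lborel. TT t x s"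
  have 4: "heat_small t (A4 / ?r) (\<lambda>x. (?I0 - I0) * gK a t x)"
  proof -
   have "heat_small t (kc * norm a / sqrt t) (gK a t)"
    by (rule heat_small_kernel[OF _ gK_bound[OF t0] t0]) (use t0 in \<open>auto simp: less_imp_le\<close>)
   moreover have "\<bar>?I0 - I0\<bar> \<le> 2 * C\<^sup>2 / t"
   proof -
    have "\<bar>I0 - ?I0\<bar> \<le> C\<^sup>2 / (1 + t / 2)" using t by (intro F0_tail(2)) auto
    also have "\<dots> \<le> C\<^sup>2 / (t / 2)" using t by (intro divide_left_mono) auto
    finally show ?thesis by (simp add: abs_minus_commute mult.commute)
   qed
   ultimately have "heat_small t (2 * C\<^sup>2 / t * (kc * norm a / sqrt t)) (\<lambda>x. (?I0 - I0) * gK a t x)"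
    by (rule heat_small_cmult) (rule t0)
   then show ?thesis by (simp add: A4_def)
  qed
  have 5: "heat_small t (A5 / ?r) (\<lambda>x. hG a (V - ?I1) t x)"
  proof -
   have n: "norm (V - ?I1) \<le> 8 * C\<^sup>2 / sqrt t"
   proof -
    have "norm (V - ?I1) \<le> 4 * C\<^sup>2 / sqrt (1 + t / 2)" using t by (intro F1_tail(2)) auto
    also have "\<dots> \<le> 4 * C\<^sup>2 / (sqrt t / 2)"
    proof (intro divide_left_mono)
     show "sqrt t / 2 \<le> sqrt (1 + t / 2)" using t by (intro real_le_rsqrt) (auto simp: power_divide)
    qed (use t in auto)
    finally show ?thesis by simp
   qed
   have "heat_small t (kc * (norm a * norm (V - ?I1)) / sqrt t ^ 2) (\<lambda>x. hG a (V - ?I1) t x)"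
    by (rule heat_small_kernel[OF _ hG_bound[OF t0] t0]) (use t0 in \<open>auto simp: less_imp_le\<close>)
   then show ?thesis
   proof (rule heat_small_mono)
    have "kc * (norm a * norm (V - ?I1)) / sqrt t ^ 2 \<le> kc * (norm a * (8 * C\<^sup>2 / sqrt t)) / sqrt t ^ 2"
     using n t0 by (intro divide_right_mono mult_left_mono) (auto simp: less_imp_le)
    also have "\<dots> = A5 / ?r" using t0 by (simp add: A5_def mult_ac)
    finally show "kc * (norm a * norm (V - ?I1)) / sqrt t ^ 2 \<le> A5 / ?r" .
   qed
  qed
  have 6: "heat_small t (A6 / ?r) (\<lambda>x. (c0 * ln t - ?J) * lK a t x)"
  proof -
   have "heat_small t (kc * norm a / sqrt t ^ 3) (lK a t)"
    by (rule heat_small_kernel[OF _ lK_bound[OF t0] t0]) (use t0 in \<open>auto simp: less_imp_le\<close>)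
   moreover have "\<bar>c0 * ln t - ?J\<bar> \<le> 6 * D1 + c0"
    using log_integral_bound(1)[OF _ D1_nonneg F0_asymptotics t] by (simp add: abs_minus_commute)
   ultimately have "heat_small t ((6 * D1 + c0) * (kc * norm a / sqrt t ^ 3)) (\<lambda>x. (c0 * ln t - ?J) * lK a t x)"
    by (rule heat_small_cmult) (rule t0)
   then show ?thesis using t0 by (simp add: A6_def sqrt_powers)
  qed
  have 7: "heat_small t (1 / 2 * (A7 / ?r)) (\<lambda>x. 1 / 2 * (?T x - c0 * lK a t x * ln t))"
  proof (rule heat_small_cmult)
   show "heat_small t (A7 / ?r) (\<lambda>x. ?T x - c0 * lK a t x * ln t)"
   proof (rule heat_small_kernel)
    show "(\<lambda>x. ?T x - c0 * lK a t x * ln t) \<in> borel_measurable borel"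
     unfolding set_lebesgue_integral_def TT_def by measurable
    show "0 \<le> A7 / ?r" using tt by (simp add: A7_def less_imp_le)
    fix x
    let ?D = "D1 * (norm a * (2 * mc 1 + mc 3) / ?r * heatG (2 * t) x)"
    have "\<bar>?T x - c0 * lK a t x * ln t\<bar> \<le> 6 * ?D + \<bar>c0 * lK a t x\<bar>"
     by (rule log_integral_bound(1)[OF _ _ TT_asymptotics[OF t0] t]) (use tt in \<open>auto simp: less_imp_le\<close>)
    also have "\<dots> \<le> 6 * ?D + c0 * (kc * norm a / sqrt t ^ 3 * heatG (2 * t) x)"
     using mult_left_mono[OF lK_bound[OF t0, of a x] c0_nonneg] by (simp add: abs_mult)
    also have "\<dots> = A7 / ?r * heatG (2 * t) x"
     using t0 by (simp add: A7_def sqrt_powers divide_inverse algebra_simps)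
    finally show "\<bar>?T x - c0 * lK a t x * ln t\<bar> \<le> A7 / ?r * heatG (2 * t) x" .
   qed (rule t0)
  qed (use t0 in auto)
  note h = heat_small_add[OF heat_small_add[OF heat_small_add[OF heat_small_add[OF heat_small_add[OF heat_small_add[OF
    linear_part[OF t0] late_part[OF t0] t0] early_part[OF t0] t0] 4 t0] 5 t0] 6 t0] 7 t0]
  have "W t x = heatS t (v 0) x - M * heatG t x + gK (LI y. v 0 y *\<^sub>R y) t x - (LI y. hG y y t x * v 0 y) / 2
   + (LINT s:{0<..<t/2}|lborel. heatP a (t / 2 - s) (f (t / 2 + s)) x) + (LINT s:{0<..<t/2}|lborel. (LI y. R t s y x * f s y))
   + (?I0 - I0) * gK a t x + hG a (V - ?I1) t x + (c0 * ln t - ?J) * lK a t x + 1 / 2 * (?T x - c0 * lK a t x * ln t)" for x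
  proof -
   have g: "gK (- m + I0 *\<^sub>R a) t x = - gK m t x + I0 * gK a t x" for m
    by (simp only: gK_inner inner_add_left inner_minus_left inner_scaleR_left)
   have h: "hG a (V - ?I1) t x = hG a V t x - hG a ?I1 t x" by (simp only: hG_inner inner_diff_left)
   show ?thesis
    unfolding W_def early_part_eq[OF t] duhamel_halves[OF t0] g h by (simp add: algebra_simps)
  qed
  then have "W t = (\<lambda>x. heatS t (v 0) x - M * heatG t x + gK (LI y. v 0 y *\<^sub>R y) t x - (LI y. hG y y t x * v 0 y) / 2
   + (LINT s:{0<..<t/2}|lborel. heatP a (t / 2 - s) (f (t / 2 + s)) x) + (LINT s:{0<..<t/2}|lborel. (LI y. R t s y x * f s y))
   + (?I0 - I0) * gK a t x + hG a (V - ?I1) t x + (c0 * ln t - ?J) * lK a t x + 1 / 2 * (?T x - c0 * lK a t x * ln t))" ..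
  then show ?thesis using h by (simp only: A_def add_divide_distrib times_divide_eq_right)
 qed
 then show ?thesis by blast
qed

end

section \<open>Multi-indices and Lebesgue norms\<close>

lemma partial_gK: "0 < t \<Longrightarrow> partial j (gK b t) = hG b (axis j 1) t"
 using DERIV_imp_deriv[OF DERIV_gK_line[of t b _ "axis j 1" 0]] by (simp add: partial_def fun_eq_iff)

lemma partial_hG: "0 < t \<Longrightarrow> partial j (hG b c t) = tG b c (axis j 1) t"
 using DERIV_imp_deriv[OF DERIV_hG_line[of t b c _ "axis j 1" 0]] by (simp add: partial_def fun_eq_iff)

lemma hG_commute: "hG b c t x = hG c b t x"
 by (simp add: hG_def inner_commute mult.commute)

lemma hG_sum: "hG a c t x = (\<Sum>j\<in>UNIV. hG a (axis j 1) t x * c $ j)"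
 unfolding hG_inner inner_axis' by (simp add: inner_vec_def mult.commute)

text \<open>Summing the third derivatives over j contracts the mixed terms to 2 (a \<bullet> x) and
  adds 4 (a \<bullet> x) from the dimension, which explains the 3/t in \<open>lK\<close>.\<close>

lemma laplace_gK:
 assumes t: "0 < t"
 shows "laplace (gK a t) x = lK a t x"
proof -
 have e: "tG a (axis j 1) (axis j 1) t x = ((2 * (a $ j * x $ j) + (a \<bullet> x)) / (4 * t\<^sup>2) - (a \<bullet> x) / (8 * t ^ 3) * (x $ j * x $ j)) * heatG t x" for j
  by (simp add: tG_def inner_axis inner_axis' norm_axis_1 field_simps)
 have "laplace (gK a t) x = ((2 * (a \<bullet> x) + 4 * (a \<bullet> x)) / (4 * t\<^sup>2) - (a \<bullet> x) / (8 * t ^ 3) * (x \<bullet> x)) * heatG t x"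
  unfolding laplace_def partial_gK[OF t] partial_hG[OF t] e
  by (simp only: sum_distrib_right[symmetric] sum_subtractf sum_divide_distrib[symmetric] sum.distrib sum_distrib_left[symmetric])
    (simp add: inner_vec_def)
 also have "\<dots> = lK a t x"
  using t by (simp add: lK_def field_simps power2_eq_square power3_eq_cube del: dot_square_norm)
 finally show ?thesis .
qed

text \<open>The multi-index e_i + e_j. Sums over multi-indices of order two become sums over ordered
  pairs, where quadratic forms are easy to expand.\<close>

definition two_index :: "4 \<Rightarrow> 4 \<Rightarrow> 4 \<Rightarrow> nat" where
 "two_index i j k = (if k = i then 1 else 0) + (if k = j then 1 else 0)"

lemma two_index_eq_iff: "two_index i j = two_index k l \<longleftrightarrow> (i = k \<and> j = l) \<or> (i = l \<and> j = k)"
proof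
 assume h: "two_index i j = two_index k l"
 have i: "two_index i j i = two_index k l i" and j: "two_index i j j = two_index k l j" using h by simp_all
 have "i = k \<or> i = l"
 proof (rule ccontr)
  assume "\<not> ?thesis"
  then have "two_index k l i = 0" by (simp add: two_index_def)
  then show False using i by (simp add: two_index_def)
 qed
 then show "(i = k \<and> j = l) \<or> (i = l \<and> j = k)"
 proof
  assume "i = k"
  then show ?thesis using j by (cases "j = l") (simp_all add: two_index_def)
 next
  assume "i = l"
  then show ?thesis using j by (cases "j = k") (simp_all add: two_index_def)
 qed
next
 assume "(i = k \<and> j = l) \<or> (i = l \<and> j = k)"
 then show "two_index i j = two_index k l" by (elim disjE conjE) (simp_all add: two_index_def fun_eq_iff)
qed

lemma two_index_exists:
 assumes "mabs \<alpha> = 2"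
 shows "\<exists>i j. \<alpha> = two_index i j"
proof -
 have "\<exists>i. 0 < \<alpha> i"
 proof (rule ccontr)
  assume "\<not> ?thesis"
  then show False using assms by (simp add: mabs_def)
 qed
 then obtain i where i: "0 < \<alpha> i" by blast
 have 1: "\<alpha> i + (\<Sum>k\<in>UNIV - {i}. \<alpha> k) = 2" using assms by (simp add: mabs_def sum.remove[of UNIV i])
 show ?thesis
 proof (cases "\<alpha> i = 2")
  case True
  then have "\<forall>k\<in>UNIV - {i}. \<alpha> k = 0" using 1 by simp
  then have "\<alpha> = two_index i i" using True by (auto simp: two_index_def fun_eq_iff)
  then show ?thesis by blast
 next
  case False
  then have i1: "\<alpha> i = 1" and s1: "(\<Sum>k\<in>UNIV - {i}. \<alpha> k) = 1" using 1 i by auto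
  from s1 obtain j where j: "j \<in> UNIV - {i}" "\<alpha> j = 1" "\<forall>k\<in>UNIV - {i}. k \<noteq> j \<longrightarrow> \<alpha> k = 0"
   using sum_eq_1_iff[of "UNIV - {i}" \<alpha>] by (metis finite)
  then have "\<alpha> = two_index i j" using i1 by (auto simp: two_index_def fun_eq_iff)
  then show ?thesis by blast
 qed
qed

lemma mabs_two_index: "mabs (two_index i j) = 2"
 by (simp add: mabs_def two_index_def sum.distrib)

lemma mfact_two_index: "mfact (two_index i j) = (if i = j then 2 else 1)"
proof -
 have "fact (two_index i j k) = (if k = i then if i = j then 2 else 1 else (1::real))" for k
  by (auto simp: two_index_def)
 then show ?thesis by (simp add: mfact_def)
qed

lemma mpow_two_index: "mpow y (two_index i j) = y $ i * y $ j"
proof -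
 have "y $ k ^ two_index i j k = (if k = i then y $ k else 1) * (if k = j then y $ k else 1)" for k
  by (auto simp: two_index_def)
 then show ?thesis by (simp add: mpow_def prod.distrib)
qed

lemma mpartial_two_index:
 assumes t: "0 < t"
 shows "mpartial (two_index i j) (heatG t) = hG (axis i 1) (axis j 1) t"
proof -
 \<comment> \<open>Case distinction on the index type lists 1, 2, 3, 4, whereas
   \<open>mpartial\<close> iterates over 0, 1, 2, 3; the two agree modulo 4. The order in which
   \<open>mpartial\<close> differentiates is absorbed by the symmetry of \<open>hG\<close>.\<close>
 have four: "(4::4) = 0" by simp
 have ne: "(0::4) \<noteq> 1" "(0::4) \<noteq> 2" "(0::4) \<noteq> 3" "(1::4) \<noteq> 2" "(1::4) \<noteq> 3" "(2::4) \<noteq> 3" by simp_all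
 note ne = ne ne[symmetric]
 have c: "hG (axis k 1) (axis l 1) t = hG (axis l 1) (axis k 1) t" for k l :: 4
  by (simp add: fun_eq_iff hG_commute)
 show ?thesis
  using exhaust_4[of i] exhaust_4[of j] unfolding four
  by (elim disjE; simp add: mpartial_def two_index_def ne partial_heatG[OF t] partial_gK[OF t] numeral_2_eq_2; metis c)
qed

text \<open>The fibre of (i, j) over a multi-index has two elements off the diagonal and one on it,
  while the factorial is 1 and 2 respectively. The fibre size is thus always 2 divided by the
  factorial.\<close>

lemma sum_two_index:
 fixes g :: "(4 \<Rightarrow> nat) \<Rightarrow> real"
 shows "(\<Sum>\<alpha>\<in>{\<alpha>. mabs \<alpha> = 2}. g \<alpha> / mfact \<alpha>) = (\<Sum>i\<in>UNIV. \<Sum>j\<in>UNIV. g (two_index i j)) / 2"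
proof -
 let ?P = "UNIV :: (4 \<times> 4) set" and ?\<iota> = "\<lambda>p. two_index (fst p) (snd p)"
 have im: "{\<alpha>. mabs \<alpha> = 2} = ?\<iota> ` ?P"
 proof (intro set_eqI iffI)
  fix \<alpha> assume "\<alpha> \<in> {\<alpha>. mabs \<alpha> = 2}"
  then obtain i j where "\<alpha> = two_index i j" using two_index_exists by blast
  then show "\<alpha> \<in> ?\<iota> ` ?P" by (intro image_eqI[of _ _ "(i, j)"]) auto
 qed (auto simp: mabs_two_index)
 have "(\<Sum>i\<in>UNIV. \<Sum>j\<in>UNIV. g (two_index i j)) = (\<Sum>p\<in>?P. g (?\<iota> p))"
  by (simp add: sum.cartesian_product UNIV_Times_UNIV[symmetric] case_prod_beta' del: UNIV_Times_UNIV)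
 also have "\<dots> = (\<Sum>\<alpha>\<in>?\<iota> ` ?P. \<Sum>p\<in>{p \<in> ?P. ?\<iota> p = \<alpha>}. g (?\<iota> p))"
  by (rule sum.image_gen) simp
 also have "\<dots> = (\<Sum>\<alpha>\<in>?\<iota> ` ?P. 2 * (g \<alpha> / mfact \<alpha>))"
 proof (rule sum.cong)
  fix \<alpha> assume "\<alpha> \<in> ?\<iota> ` ?P"
  then obtain i j where a: "\<alpha> = two_index i j" by auto
  have fib: "{p \<in> ?P. ?\<iota> p = \<alpha>} = {(i, j), (j, i)}" unfolding a by (auto simp: two_index_eq_iff)
  show "(\<Sum>p\<in>{p \<in> ?P. ?\<iota> p = \<alpha>}. g (?\<iota> p)) = 2 * (g \<alpha> / mfact \<alpha>)"
   unfolding fib using two_index_eq_iff[of i j j i] by (cases "i = j") (auto simp: a mfact_two_index)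
 qed simp
 also have "\<dots> = 2 * (\<Sum>\<alpha>\<in>?\<iota> ` ?P. g \<alpha> / mfact \<alpha>)" by (rule sum_distrib_left[symmetric])
 finally show ?thesis unfolding im by simp
qed

lemma hG_double_sum: "hG y y t x = (\<Sum>i\<in>UNIV. \<Sum>j\<in>UNIV. hG (axis i 1) (axis j 1) t x * (y $ i * y $ j))"
proof -
 have "hG y y t x = (\<Sum>i\<in>UNIV. hG (axis i 1) y t x * y $ i)"
  by (subst hG_sum) (simp add: hG_commute[of y])
 also have "\<dots> = (\<Sum>i\<in>UNIV. (\<Sum>j\<in>UNIV. hG (axis i 1) (axis j 1) t x * y $ j) * y $ i)"
  by (simp only: hG_sum[of "axis _ 1" y])
 finally show ?thesis by (simp only: sum_distrib_left mult_ac)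
qed

text \<open>The sign in (-y) disappears at order two, and summing over ordered pairs reassembles the
  quadratic form \<open>hG y y\<close>, which is the form delivered by the Taylor expansion.\<close>

lemma second_order_term:
 assumes t: "0 < t" and i: "\<And>i j. integrable lborel (\<lambda>y. y $ i * y $ j * g y)"
 shows "(\<Sum>\<alpha>\<in>{\<alpha>. mabs \<alpha> = 2}. mpartial \<alpha> (heatG t) x / mfact \<alpha> * (LI y. mpow (- y) \<alpha> * g y))
  = (LI y. hG y y t x * g y) / 2"
proof -
 have "(\<Sum>\<alpha>\<in>{\<alpha>. mabs \<alpha> = 2}. mpartial \<alpha> (heatG t) x / mfact \<alpha> * (LI y. mpow (- y) \<alpha> * g y))
  = (\<Sum>i\<in>UNIV. \<Sum>j\<in>UNIV. hG (axis i 1) (axis j 1) t x * (LI y. y $ i * y $ j * g y)) / 2"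
  using sum_two_index[of "\<lambda>\<alpha>. mpartial \<alpha> (heatG t) x * (LI y. mpow (- y) \<alpha> * g y)"]
  by (simp add: mpow_two_index mpartial_two_index[OF t])
 also have "(\<Sum>i\<in>UNIV. \<Sum>j\<in>UNIV. hG (axis i 1) (axis j 1) t x * (LI y. y $ i * y $ j * g y))
  = (LI y. (\<Sum>i\<in>UNIV. \<Sum>j\<in>UNIV. hG (axis i 1) (axis j 1) t x * (y $ i * y $ j * g y)))"
  using i by (simp add: Bochner_Integration.integral_sum)
 also have "\<dots> = (LI y. hG y y t x * g y)"
  by (simp add: hG_double_sum[of _ t x] sum_distrib_right mult.assoc)
 finally show ?thesis .
qed

text \<open>For finite q, the q-th power of the norm is at most the supremum to the power q - 1
  times the L^1 norm. With A/t^2 and A the powers of A combine to A and those of t to -2(1 -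
  1/q).\<close>

lemma Lq_norm_le:
 assumes q: "1 \<le> q" and [measurable]: "\<phi> \<in> borel_measurable borel" and A: "0 < A" and t: "0 < t"
  and n: "nL \<phi> \<le> ennreal A" "AE x in lborel. \<bar>\<phi> x\<bar> \<le> A / t\<^sup>2"
 shows "Lq_norm q \<phi> \<le> ereal (A * t powr - gamma_q q)"
proof (cases "q = \<infinity>")
 case True
 have "esssup lborel (\<lambda>x. ereal \<bar>\<phi> x\<bar>) \<le> ereal (A / t\<^sup>2)"
  by (rule esssup_I) (use n(2) in auto)
 then show ?thesis using True t by (simp add: Lq_norm_def gamma_q_def powr_minus_divide)
next
 case False
 then obtain r where r: "q = ereal r" "1 \<le> r" using q by (cases q) auto
 let ?B = "A / t\<^sup>2" and ?I = "NI x. ennreal (\<bar>\<phi> x\<bar> powr r)"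
 have B: "0 < ?B" using A t by simp
 have "?I \<le> (NI x. ennreal (?B powr (r - 1)) * ennreal \<bar>\<phi> x\<bar>)"
 proof (rule nn_integral_mono_AE, rule AE_mp[OF n(2)], intro AE_I2 impI)
  fix x assume x: "\<bar>\<phi> x\<bar> \<le> ?B"
  have "\<bar>\<phi> x\<bar> powr r = \<bar>\<phi> x\<bar> powr (r - 1) * \<bar>\<phi> x\<bar>" by (cases "\<phi> x = 0") (simp_all add: powr_diff)
  also have "\<dots> \<le> ?B powr (r - 1) * \<bar>\<phi> x\<bar>" using x r by (intro mult_right_mono powr_mono2) auto
  finally show "ennreal (\<bar>\<phi> x\<bar> powr r) \<le> ennreal (?B powr (r - 1)) * ennreal \<bar>\<phi> x\<bar>"
   by (simp add: ennreal_mult[symmetric] ennreal_leI)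
 qed
 also have "\<dots> = ennreal (?B powr (r - 1)) * nL \<phi>" by (rule nn_integral_cmult) measurable
 also have "\<dots> \<le> ennreal (?B powr (r - 1)) * ennreal A" by (intro mult_left_mono n) auto
 also have "\<dots> = ennreal (?B powr (r - 1) * A)" using A by (simp add: ennreal_mult)
 finally have I: "?I \<le> ennreal (?B powr (r - 1) * A)" .
 then have fin: "?I \<noteq> \<infinity>" by (auto simp: top_unique)
 have "enn2real ?I \<le> ?B powr (r - 1) * A" using I A by (intro enn2real_leI) auto
 then have "enn2real ?I powr (1 / r) \<le> (?B powr (r - 1) * A) powr (1 / r)"
  using r by (intro powr_mono2) auto
 also have "\<dots> = A * t powr - (2 * (1 - 1 / r))"
 proof -
  \<comment> \<open>Equality of the powers is checked on logarithms, where it is linear; this uses A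
    > 0.\<close>
  have "ln ((?B powr (r - 1) * A) powr (1 / r)) = ln (A * t powr - (2 * (1 - 1 / r)))"
   using A t r by (simp add: ln_mult ln_powr ln_div ln_realpow field_simps)
  then show ?thesis by (rule ln_inj_iff[THEN iffD1, rotated 2]) (use A t in auto)
 qed
 finally have "ereal (enn2real ?I powr (1 / r)) \<le> ereal (A * t powr - (2 * (1 - 1 / r)))" by simp
 then show ?thesis using r(1) fin by (simp add: Lq_norm_def gamma_q_def Let_def)
qed

theorem theorem1p2:
  fixes a :: "real^4" and u0 :: "real^4 \<Rightarrow> real" and u :: "real \<Rightarrow> real^4 \<Rightarrow> real"
    and q :: ereal
  assumes u0_L1: "integrable lborel u0"
    and u0_Linf: "\<exists>C. AE x in lborel. \<bar>u0 x\<bar> \<le> C"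
    and u0_mom3: "integrable lborel (\<lambda>x. (norm x) ^ 3 * u0 x)"
    and sol: "mild_solution a u0 u"
    and q: "1 \<le> q"
  defines "M0 \<equiv> (\<integral>x. u0 x \<partial>lborel)"
    and "M1 \<equiv> - (\<integral>x. u0 x *\<^sub>R x \<partial>lborel)
               + (LINT s:{0<..}|lborel. (\<integral>x. (u s x)^2 \<partial>lborel)) *\<^sub>R a"
    and "V \<equiv> (LINT s:{0<..}|lborel. (\<integral>y. (u s y)^2 *\<^sub>R y \<partial>lborel))"
  shows "\<exists>C T. \<forall>t\<ge>T. Lq_norm q (\<lambda>x.
             u t x - M0 * heatG t x
             - (\<Sum>j\<in>UNIV. M1$j * partial j (heatG t) x)
             - (\<Sum>\<alpha>\<in>{\<alpha>. mabs \<alpha> = 2}. mpartial \<alpha> (heatG t) x / mfact \<alpha>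
                   * (\<integral>y. mpow (- y) \<alpha> * u0 y \<partial>lborel))
             + (\<Sum>j\<in>UNIV. partial j (adot_grad a (heatG t)) x * V$j)
             + M0^2 / (128 * pi^2) * laplace (adot_grad a (heatG t)) x * ln t)
           \<le> ereal (C * t powr (- gamma_q q - 3/2))"
proof -
 obtain C0 where C0: "AE x in lborel. \<bar>u0 x\<bar> \<le> C0" using u0_Linf by blast
 obtain v where mild: "mild a v" and v0: "AE x in lborel. v 0 x = u0 x" and uv: "\<And>t. t > 0 \<Longrightarrow> AE x in lborel. u t x = v t x"
  using mild_solution_representative[OF u0_L1 C0 sol] by blast
 have [measurable]: "u0 \<in> borel_measurable borel" using u0_L1 by auto
 have "(\<lambda>z. u (fst z) (snd z)) \<in> borel_measurable (lborel \<Otimes>\<^sub>M lborel)"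
  using sol unfolding mild_solution_def by (elim conjE)
 from measurable_two_arguments[OF this, of "\<lambda>_. t" borel "\<lambda>x. x" for t]
 have [measurable]: "u t \<in> borel_measurable borel" for t by simp
 interpret m: mild a v by (rule mild)
 have "(NI x. ennreal (norm x ^ 3) * ennreal \<bar>v 0 x\<bar>) = (NI x. ennreal (norm (norm x ^ 3 * u0 x)))"
  by (rule nn_integral_cong_AE, rule AE_mp[OF v0], intro AE_I2 impI) (simp add: ennreal_mult[symmetric] abs_mult)
 also have "\<dots> < \<infinity>" using u0_mom3 by (simp add: integrable_iff_bounded)
 finally obtain C where C: "0 \<le> C" "\<forall>t\<ge>0. nL (v t) \<le> ennreal C \<and> (\<forall>x. \<bar>v t x\<bar> \<le> C / (1 + t)\<^sup>2)
   \<and> (NI x. ennreal (norm x ^ 3) * ennreal \<bar>v t x\<bar>) \<le> ennreal (C * ((1 + t) * sqrt (1 + t)))"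
  using m.global_bounds by blast
 interpret D: mild_decay a v C by unfold_locales (use C in auto)
 obtain A where A: "\<And>t. 2 \<le> t \<Longrightarrow> heat_small t (A / (t * sqrt t)) (D.W t)" using D.expansion by blast
 have M: "M0 = D.M"
  unfolding M0_def D.M_def by (rule integral_cong_AE) (use v0 in auto)
 have m1: "(LI x. u0 x *\<^sub>R x) = (LI y. v 0 y *\<^sub>R y)"
  by (rule integral_cong_AE) (use v0 in auto)
 have sq: "AE y in lborel. (u s y)\<^sup>2 = D.f s y" if "s \<in> {0<..}" for s
  using uv[of s] that by (auto simp: D.f_def)
 have I0: "(LINT s:{0<..}|lborel. (LI x. (u s x)^2)) = D.I0"
  unfolding D.I0_def D.F0_def
  by (rule set_lebesgue_integral_cong) (auto intro!: integral_cong_AE sq)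
 have V: "V = D.V"
  unfolding V_def D.V_def D.F1_def
 proof (rule set_lebesgue_integral_cong)
  show "\<forall>s. s \<in> {0<..} \<longrightarrow> (LI y. (u s y)\<^sup>2 *\<^sub>R y) = (LI y. D.f s y *\<^sub>R y)"
  proof (intro allI impI integral_cong_AE)
   fix s :: real assume "s \<in> {0<..}"
   from sq[OF this] show "AE y in lborel. (u s y)\<^sup>2 *\<^sub>R y = D.f s y *\<^sub>R y" by auto
  qed measurable
 qed simp
 have i2: "integrable lborel (\<lambda>y. y $ i * y $ j * u0 y)" for i j
 proof -
  have "integrable lborel (\<lambda>y. y $ i * y $ j * v 0 y)"
  proof (rule weighted_moment(1)[OF m.v_borel _ _ _ D.nL_v0_moment[of 2]])
   show "\<bar>y $ i * y $ j\<bar> \<le> 1 * norm y ^ 2" for y :: "real^4"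
    unfolding abs_mult power2_eq_square by (simp add: mult_mono component_le_norm_cart)
  qed (use C in auto)
  then show ?thesis
   by (rule integrable_cong_AE_imp) (use v0 in auto)
 qed
 \<comment> \<open>Made strictly positive, as \<open>Lq_norm_le\<close> requires.\<close>
 define B where "B = \<bar>A\<bar> + 1"
 show ?thesis
 proof (rule exI[of _ B], rule exI[of _ 2], intro allI impI)
  fix t :: real assume t: "2 \<le> t"
  then have t0: "0 < t" by simp
  let ?\<phi> = "\<lambda>x. u t x - M0 * heatG t x
       - (\<Sum>j\<in>UNIV. M1$j * partial j (heatG t) x)
       - (\<Sum>\<alpha>\<in>{\<alpha>. mabs \<alpha> = 2}. mpartial \<alpha> (heatG t) x / mfact \<alpha>
          * (LI y. mpow (- y) \<alpha> * u0 y))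
       + (\<Sum>j\<in>UNIV. partial j (adot_grad a (heatG t)) x * V$j)
       + M0^2 / (128 * pi^2) * laplace (adot_grad a (heatG t)) x * ln t"
  have hv: "(LI y. hG y y t x * u0 y) = (LI y. hG y y t x * v 0 y)" for x
   by (rule integral_cong_AE) (use v0 in \<open>auto simp: hG_def\<close>)
  \<comment> \<open>All partial derivatives are replaced by kernels, and all constants agree with
    those formed from \<open>v\<close>. The only discrepancy left is u - v at time t, which vanishes
    off a null set and is invisible to the norm.\<close>
  have \<phi>: "?\<phi> x = u t x - v t x + D.W t x" for x
   unfolding D.W_def second_order_term[OF t0 i2] partial_heatG[OF t0] adot_grad_heatG[OF t0] partial_gK[OF t0] laplace_gK[OF t0]
    gK_sum[of M1, symmetric] hG_sum[symmetric] V M hv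
   by (simp add: M1_def m1 I0 D.c0_def)
  have W: "heat_small t (B / (t * sqrt t)) (D.W t)"
   by (rule heat_small_mono[OF A[OF t]]) (use t0 in \<open>auto simp: B_def intro!: divide_right_mono\<close>)
  note w = heat_smallD[OF W]
  have [measurable]: "D.W t \<in> borel_measurable borel" by (rule w(1))
  have AEe: "AE x in lborel. ?\<phi> x = D.W t x" unfolding \<phi> using uv[OF t0] by auto
  have "Lq_norm q ?\<phi> \<le> ereal (B / (t * sqrt t) * t powr - gamma_q q)"
  proof (rule Lq_norm_le[OF q])
   show "?\<phi> \<in> borel_measurable borel" unfolding \<phi> by measurable
   have "nL ?\<phi> = nL (D.W t)" by (rule nn_integral_cong_AE) (use AEe in auto)
   then show "nL ?\<phi> \<le> ennreal (B / (t * sqrt t))" using w(2) by simp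
   show "AE x in lborel. \<bar>?\<phi> x\<bar> \<le> B / (t * sqrt t) / t\<^sup>2"
    by (rule AE_mp[OF AEe]) (use w(3) in \<open>auto intro!: AE_I2\<close>)
  qed (use t0 in \<open>auto simp: B_def\<close>)
  also have "B / (t * sqrt t) * t powr - gamma_q q = B * t powr (- gamma_q q - 3 / 2)"
  proof -
   have "t powr (3 / 2) = t powr (1 + 1 / 2)" by simp
   also have "\<dots> = t * sqrt t" unfolding powr_add using t0 by (simp add: powr_half_sqrt)
   finally show ?thesis by (simp add: powr_diff)
  qed
  finally show "Lq_norm q ?\<phi> \<le> ereal (B * t powr (- gamma_q q - 3 / 2))" .
 qed
qed

end
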